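(* Let $d\ge 2$, let $\vartheta>\frac{d+1}{2}$, put $\underline{\vartheta}=\min\{\vartheta;d+1\}$, let $a\in L^\infty_\vartheta(\mathbb{R}^d)$ be a divergence-free vector field, and let $u\in \mathcal{C}_w([0,T];L^\infty_{\underline{\vartheta}})$ be the mild solution of the Navier--Stokes system (NS) with initial datum $a$. Set $$\mathcal{E}_{h,k}(t)=\int_{\mathbb{R}^d}(u_hu_k)(y,t)\,dy,\qquad K_{h,k}(t)=\int_0^t\int_{\mathbb{R}^d}(u_hu_k)(y,s)\,dy\,ds .$$ Then, for $t\in[0,T]$ and as $|x|\to+\infty$, $$u(x,t)=e^{t\Delta}a(x)+\nabla\Pi(x,t)+\mathcal{O}_t\left(|x|^{-\min\{2\vartheta;\,d+2\}}\right),$$ where $$\Pi(x,t)=\gamma_d\sum_{h,k=1}^d\left(\frac{\delta_{h,k}}{d\,|x|^d}-\frac{x_hx_k}{|x|^{d+2}}\right)K_{h,k}(t),\qquad \gamma_d=\pi^{-d/2}\,\Gamma\left(\tfrac{d+2}{2}\right),$$ and $\nabla$ is the gradient in $x$. If, moreover, the first and second order derivatives of $a$ belong to $L^\infty_\vartheta$, then there exists a constant $p_0$ such that the pressure satisfies, for $t>0$ and as $|x|\to+\infty$, $$p(x,t)=p_0-\gamma_d\sum_{h,k=1}^d\left(\frac{\delta_{h,k}}{d\,|x|^d}-\frac{x_hx_k}{|x|^{d+2}}\right)\mathcal{E}_{h,k}(t)+\mathcal{O}_t\left(|x|^{-\min\{2\vartheta-1;\,d+1\}}\right).$$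
   Context: (NS) is the system on $\mathbb{R}^d$: $\partial_t u-\Delta u+(u\cdot\nabla)u=-\nabla p$, $\operatorname{div}u=0$, $u(x,0)=a(x)$. The pressure $p$ is determined by $-\nabla p=(\partial_t-\Delta)u+\operatorname{div}(u\otimes u)$ up to an additive function of $t$ alone; the statement on $p$ is understood up to this indeterminacy (i.e. for a suitable choice of that function; equivalently $p_0$ may depend on $t$). For $\vartheta\ge0$, $L^\infty_\vartheta$ is the space of measurable functions (or vector fields) $f$ on $\mathbb{R}^d$ with $\|f\|_{L^\infty_\vartheta}=\operatorname{ess\,sup}_x(1+|x|)^\vartheta|f(x)|<\infty$. $\mathcal{C}_w([0,T];L^\infty_\vartheta)$ is the space of $u(x,t)$ with $u(t)\in L^\infty_\vartheta$ for all $t$, $\|u(t')-u(t)\|_{L^\infty_\vartheta}\to0$ as $t'\to t$ for $t>0$, and $u(t)\to u(0)$ in the distributional sense as $t\to0$; its elements are understood to be bounded in $L^\infty_\vartheta$ on $[0,T]$. $e^{t\Delta}a(x)=(4\pi t)^{-d/2}\int_{\mathbb{R}^d}e^{-|x-y|^2/4t}a(y)\,dy$. A mild solution is one satisfying $u(t)=e^{t\Delta}a-\int_0^te^{(t-s)\Delta}\mathbb{P}\operatorname{div}(u\otimes u)(s)\,ds$, with $\mathbb{P}f=f-\nabla\Delta^{-1}(\operatorname{div}f)$. The solution $u$ is the one given by this known theorem: there is $\gamma>0$ (depending on $d$) such that for every divergence-free $a\in L^\infty(\mathbb{R}^d)$ there are $T\ge\gamma\min\{1;\|a\|_{L^\infty}^{-2}\}$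 and a unique mild solution $u\in\mathcal{C}_w([0,T];L^\infty)$ of (NS), smooth for $t>0$; if $a\in L^\infty_\vartheta$ with $\vartheta\ge0$ then $u\in\mathcal{C}_w([0,T];L^\infty_{\underline{\vartheta}})$ with $\underline{\vartheta}=\min\{\vartheta;d+1\}$. $f(x,t)=\mathcal{O}_t(\phi(x)^{-1})$ (for positive $\phi$) means $|\phi(x)f(x,t)|\le C_t$ (here for all large $|x|$) for some function $t\mapsto C_t$ that is locally bounded on the range of $t$ considered. $\delta_{h,k}$ is the Kronecker symbol. *)

theory Defs
  imports "HOL-Analysis.Analysis" "HOL-Probability.Essential_Supremum"
begin

definition pderiv_at :: "'n::finite \<Rightarrow> (real^'n \<Rightarrow> 'b::real_normed_vector) \<Rightarrow> real^'n \<Rightarrow> 'b" where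
  "pderiv_at i f x = frechet_derivative f (at x) (axis i 1)"

definition grad :: "(real^'n::finite \<Rightarrow> real) \<Rightarrow> real^'n \<Rightarrow> real^'n" where
  "grad f x = (\<chi> i. pderiv_at i f x)"

definition divg :: "(real^'n::finite \<Rightarrow> real^'n) \<Rightarrow> real^'n \<Rightarrow> real" where
  "divg f x = (\<Sum>i\<in>UNIV. pderiv_at i (\<lambda>y. f y $ i) x)"

definition laplacian :: "(real^'n::finite \<Rightarrow> 'b::real_normed_vector) \<Rightarrow> real^'n \<Rightarrow> 'b" where
  "laplacian f x = (\<Sum>i\<in>UNIV. pderiv_at i (pderiv_at i f) x)"

definition tensor :: "(real^'n::finite \<Rightarrow> real^'n) \<Rightarrow> real^'n \<Rightarrow> real^'n^'n" where
  "tensor v x = (\<chi> h k. v x $ h * v x $ k)"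

definition div_tensor :: "(real^'n::finite \<Rightarrow> real^'n^'n) \<Rightarrow> real^'n \<Rightarrow> real^'n" where
  "div_tensor F x = (\<chi> j. \<Sum>k\<in>UNIV. pderiv_at k (\<lambda>y. F y $ k $ j) x)"

text \<open>Derivatives are taken within \<open>S\<close>, which is meant to be convex with nonempty interior
  (so that they are unique), e.g. the whole space or \<open>(0,T] \<times> \<real>\<^sup>d\<close>.\<close>

primrec Ck_on :: "nat \<Rightarrow> 'a::real_normed_vector set \<Rightarrow> ('a \<Rightarrow> 'b::real_normed_vector) \<Rightarrow> bool" where
  "Ck_on 0 S f \<longleftrightarrow> continuous_on S f"
| "Ck_on (Suc k) S f \<longleftrightarrow>
     (\<exists>f'. (\<forall>x\<in>S. (f has_derivative f' x) (at x within S)) \<and> (\<forall>v. Ck_on k S (\<lambda>x. f' x v)))"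

definition smooth_on :: "'a::real_normed_vector set \<Rightarrow> ('a \<Rightarrow> 'b::real_normed_vector) \<Rightarrow> bool" where
  "smooth_on S f \<longleftrightarrow> (\<forall>k. Ck_on k S f)"

definition test_function :: "(real^'n::finite \<Rightarrow> real) \<Rightarrow> bool" where
  "test_function \<phi> \<longleftrightarrow> smooth_on UNIV \<phi> \<and> compact (closure {x. \<phi> x \<noteq> 0})"

definition weak_div_free :: "(real^'n::finite \<Rightarrow> real^'n) \<Rightarrow> bool" where
  "weak_div_free a \<longleftrightarrow> (\<forall>\<phi>. test_function \<phi> \<longrightarrow> (LINT x|lebesgue. a x \<bullet> grad \<phi> x) = 0)"

definition weak_pderiv ::
  "'n::finite \<Rightarrow> (real^'n \<Rightarrow> real^'n) \<Rightarrow> (real^'n \<Rightarrow> real^'n) \<Rightarrow> bool" where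
  "weak_pderiv i f g \<longleftrightarrow> (\<forall>\<phi>. test_function \<phi> \<longrightarrow>
     (LINT x|lebesgue. pderiv_at i \<phi> x *\<^sub>R f x) = - (LINT x|lebesgue. \<phi> x *\<^sub>R g x))"

definition Linf_norm :: "real \<Rightarrow> (real^'n::finite \<Rightarrow> real^'n) \<Rightarrow> ereal" where
  "Linf_norm \<theta> f = esssup lebesgue (\<lambda>x. ereal ((1 + norm x) powr \<theta> * norm (f x)))"

definition Linf :: "real \<Rightarrow> (real^'n::finite \<Rightarrow> real^'n) set" where
  "Linf \<theta> = {f. f \<in> borel_measurable lebesgue \<and> Linf_norm \<theta> f < \<infinity>}"

definition Cw :: "real \<Rightarrow> real \<Rightarrow> (real \<Rightarrow> real^'n::finite \<Rightarrow> real^'n) set" where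
  "Cw T \<theta> = {u.
     (\<forall>t\<in>{0..T}. u t \<in> Linf \<theta>) \<and>
     (\<exists>M::real. \<forall>t\<in>{0..T}. Linf_norm \<theta> (u t) \<le> ereal M) \<and>
     (\<forall>t\<in>{0<..T}. ((\<lambda>t'. Linf_norm \<theta> (\<lambda>x. u t' x - u t x)) \<longlongrightarrow> 0) (at t within {0..T})) \<and>
     (\<forall>\<phi>. test_function \<phi> \<longrightarrow>
        ((\<lambda>t. LINT x|lebesgue. \<phi> x *\<^sub>R u t x) \<longlongrightarrow> (LINT x|lebesgue. \<phi> x *\<^sub>R u 0 x)) (at_right 0))}"

definition weak_derivs_Linf :: "real \<Rightarrow> (real^'n::finite \<Rightarrow> real^'n) \<Rightarrow> bool" where
  "weak_derivs_Linf \<theta> a \<longleftrightarrow>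
     (\<exists>g H. (\<forall>i. weak_pderiv i a (g i) \<and> g i \<in> Linf \<theta>) \<and>
            (\<forall>i j. weak_pderiv j (g i) (H i j) \<and> H i j \<in> Linf \<theta>))"

definition heat ::
  "real \<Rightarrow> (real^'n::finite \<Rightarrow> 'b::{banach, second_countable_topology}) \<Rightarrow> real^'n \<Rightarrow> 'b" where
  "heat t f x = (if t = 0 then f x else
     (4 * pi * t) powr (- real CARD('n) / 2) *\<^sub>R
       (LINT y|lebesgue. exp (- (norm (x - y))\<^sup>2 / (4 * t)) *\<^sub>R f y))"

text \<open>Fundamental solution of the Laplacian for \<open>d \<ge> 2\<close>; the unit sphere of \<open>\<real>\<^sup>d\<close> has area
  \<open>d * unit_ball_vol d\<close>.\<close>

definition newton_kernel :: "real^'n::finite \<Rightarrow> real" where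
  "newton_kernel x = (if CARD('n) = 2 then ln (norm x) / (2 * pi)
     else - 1 / ((real CARD('n) - 2) * (real CARD('n) * unit_ball_vol (real CARD('n)))
                  * norm x ^ (CARD('n) - 2)))"

definition inv_laplacian :: "(real^'n::finite \<Rightarrow> real) \<Rightarrow> real^'n \<Rightarrow> real" where
  "inv_laplacian g x = (LINT y|lebesgue. newton_kernel (x - y) * g y)"

definition leray :: "(real^'n::finite \<Rightarrow> real^'n) \<Rightarrow> real^'n \<Rightarrow> real^'n" where
  "leray f x = f x - grad (inv_laplacian (divg f)) x"

text \<open>The operator \<open>e\<^sup>t\<^sup>\<Delta> \<P> div\<close>. Its factors commute, and the heat semigroup is applied first:
  for \<open>t > 0\<close> and \<open>F = u \<otimes> u\<close> with \<open>u\<close> in \<open>Linf \<theta>\<close>, \<open>2 * \<theta> > d + 1\<close>, the tensor \<open>heat t F\<close> is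
  smooth and decays like \<open>|x|\<close> to the power \<open>- 2 * \<theta>\<close> together with all its derivatives, so that
  \<open>div\<close> is classical and the integral in \<open>inv_laplacian\<close> converges absolutely.\<close>

definition heat_leray_div :: "real \<Rightarrow> (real^'n::finite \<Rightarrow> real^'n^'n) \<Rightarrow> real^'n \<Rightarrow> real^'n" where
  "heat_leray_div t F = leray (div_tensor (heat t F))"

definition mild_solution ::
  "real \<Rightarrow> (real^'n::finite \<Rightarrow> real^'n) \<Rightarrow> (real \<Rightarrow> real^'n \<Rightarrow> real^'n) \<Rightarrow> bool" where
  "mild_solution T a u \<longleftrightarrow> (\<forall>t\<in>{0..T}. \<forall>x.
     u t x = heat t a x - (LINT s:{0..t}|lebesgue. heat_leray_div (t - s) (tensor (u s)) x))"

text \<open>At \<open>t = T\<close> the time derivative is one-sided.\<close>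

definition is_pressure ::
  "real \<Rightarrow> (real \<Rightarrow> real^'n::finite \<Rightarrow> real^'n) \<Rightarrow> (real \<Rightarrow> real^'n \<Rightarrow> real) \<Rightarrow> bool" where
  "is_pressure T u p \<longleftrightarrow> (\<forall>t\<in>{0<..T}. \<forall>x.
     GDERIV (p t) x :> - (vector_derivative (\<lambda>s. u s x) (at t within {0<..T})
                          - laplacian (u t) x + div_tensor (tensor (u t)) x))"

definition energy_matrix :: "(real \<Rightarrow> real^'n::finite \<Rightarrow> real^'n) \<Rightarrow> real \<Rightarrow> 'n \<Rightarrow> 'n \<Rightarrow> real" where
  "energy_matrix u t h k = (LINT y|lebesgue. u t y $ h * u t y $ k)"

definition K_matrix :: "(real \<Rightarrow> real^'n::finite \<Rightarrow> real^'n) \<Rightarrow> real \<Rightarrow> 'n \<Rightarrow> 'n \<Rightarrow> real" where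
  "K_matrix u t h k = (LINT s:{0..t}|lebesgue. (LINT y|lebesgue. u s y $ h * u s y $ k))"

definition gamma_d :: "nat \<Rightarrow> real" where
  "gamma_d d = pi powr (- real d / 2) * Gamma ((real d + 2) / 2)"

definition profile :: "('n::finite \<Rightarrow> 'n \<Rightarrow> real) \<Rightarrow> real^'n \<Rightarrow> real" where
  "profile M x = gamma_d CARD('n) * (\<Sum>h\<in>UNIV. \<Sum>k\<in>UNIV.
     ((if h = k then 1 else 0) / (real CARD('n) * norm x ^ CARD('n))
       - x $ h * x $ k / norm x ^ (CARD('n) + 2)) * M h k)"

definition locally_bounded_on :: "real set \<Rightarrow> (real \<Rightarrow> real) \<Rightarrow> bool" where
  "locally_bounded_on I C \<longleftrightarrow>
     (\<forall>t\<in>I. \<exists>e>0. \<exists>B. \<forall>s\<in>I. \<bar>s - t\<bar> < e \<longrightarrow> \<bar>C s\<bar> \<le> B)"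

text \<open>\<open>f(x,t) = O\<^sub>t(\<phi>(x)\<^sup>-\<^sup>1)\<close> as \<open>|x| \<rightarrow> \<infinity>\<close>, for \<open>t\<close> in \<open>I\<close>; the threshold \<open>R\<close> does not depend
  on \<open>t\<close>.\<close>

definition big_Ot ::
  "real set \<Rightarrow> (real^'n::finite \<Rightarrow> real) \<Rightarrow> (real \<Rightarrow> real^'n \<Rightarrow> 'b::real_normed_vector) \<Rightarrow> bool" where
  "big_Ot I \<phi> f \<longleftrightarrow> (\<exists>C R. locally_bounded_on I C \<and>
     (\<forall>t\<in>I. \<forall>x. norm x \<ge> R \<longrightarrow> norm (\<phi> x *\<^sub>R f t x) \<le> C t))"

end

theory Submission
 imports Defs "HOL-Probability.Distributions"
begin

text \<open>Write G_s for the heat kernel \<open>gk s\<close>, D_k for a partial derivative and d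
  for the dimension. The whole proof rests on the identity that minus the inverse Laplacian is the
  integral over r > 0 of the heat semigroup. It turns component j of e^{t Delta} P div F into the
  sum over k of D_k G_t * F_kj plus the sum over h, k of the integral over r > t of D_h D_k D_j G_r
  * F_hk (\<open>heat_leray_div_eq\<close>). No explicit Oseen kernel and no singular integral is
  needed: everything follows from Gaussian bounds with parabolic scaling, which are axiomatised for
  a kernel and its gradient in \<open>gkernel\<close>.

  Velocity. The stress u(s) tensor u(s) decays with an exponent p > d + 1, so it has finite mass and
  finite first moment. In a convolution at x, the part |y| <= |x|/2 is compared with the value of
  the kernel at x times the mass of the stress, the mean value theorem being paid for by the first
  moment; in the part |y| > |x|/2 the decay of the stress is used (\<open>conv_near_far\<close>).
  The term with D_k G_t then yields only an error (\<open>gk1_conv_decay\<close>). In the term with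
  third derivatives the integral over r > t may be replaced by the one over r > 0, since at the
  point x the kernel is tiny for small times (\<open>gk3_time_conv_decay\<close>). The integral of
  D_h D_k G_r over all r > 0 is minus the Hessian of the Newton kernel
  (\<open>gk2_time_integral\<close>), which is how the explicit profile and the constant
  \<open>gamma_d\<close> arise (\<open>profile_eq\<close>, \<open>profile_grad\<close>). Both errors
  carry the factor (t - s)^{-1/2}, which is integrable in the Duhamel formula
  (\<open>velocity_asymptotics\<close>).

  Pressure. The candidate \<open>prs\<close> is the sum over h, k of the integral over r > 0 of D_h
  D_k G_r * (u_h u_k). Near r = 0 this converges only thanks to cancellation: D_h D_k G_r has
  integral zero, so a Hoelder bound on u is enough. Such a bound, with constant of order t^{-1/4},
  is read off from the mild formulation (\<open>velocity_holder\<close>). For the expansion in x one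
  needs Hoelder continuity and decay at once; interpolating between the two loses at most one power
  of |x| (\<open>stress_holder_decay\<close>). The integral in r is estimated separately for r <= 1,
  for 1 < r <= |x|^2 and for r > |x|^2 (\<open>pressure_component_asymptotics\<close>).

  Identification. An arbitrary pressure q is related to \<open>prs\<close> as follows. The Duhamel
  integrand is the divergence of the heat-regularised momentum flux u tensor u + \<open>prs\<close>
  I (\<open>duh_momentum\<close>). Tested against a compactly supported function this gives the
  momentum equation integrated in time (\<open>weak_momentum\<close>), which can be differentiated
  in t. The classical equation, which defines q, gives the same time derivative with q in place of
  \<open>prs\<close>. Hence q(t) - \<open>prs\<close> t has vanishing distributional gradient
  (\<open>pressure_weak_gradient\<close>) and is a constant in x (\<open>weak_gradient_0\<close>,
  \<open>pressure_eq\<close>); this constant is the function of t that the statement allows.\<close>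

section \<open>Differentiation under the integral and interchange of integrals\<close>

lemma has_derivative_lebesgue_integral:
 fixes f :: "'a::euclidean_space \<Rightarrow> 'b \<Rightarrow> real"
 assumes "convex S" and x0: "x0 \<in> S"
  and der: "!!x y. x \<in> S ==> y \<in> space M ==> ((%x. f x y) has_derivative f' x y) (at x within S)"
  and bnd: "!!x y v. x \<in> S ==> y \<in> space M ==> \<bar>f' x y v\<bar> \<le> norm v * g y"
  and g: "integrable M g"
  and f: "!!x. x \<in> S ==> integrable M (f x)"
  and f'm: "!!v. (%y. f' x0 y v) \<in> borel_measurable M"
 shows "((%x. LINT y|M. f x y) has_derivative (%v. LINT y|M. f' x0 y v)) (at x0 within S)"
proof -
 have f'i: "integrable M (%y. f' x0 y v)" for v
 proof (rule Bochner_Integration.integrable_bound[of M "%y. norm v * g y"])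
  show "AE y in M. norm (f' x0 y v) \<le> norm (norm v * g y)"
   using bnd[OF x0, of _ v] by (intro AE_I2) (smt (verit) real_norm_def)
 qed (use g f'm in auto)
 have lin: "linear (f' x0 y)" if "y \<in> space M" for y
  using der[OF x0 that] has_derivative_linear by blast
 have bl: "bounded_linear (%v. LINT y|M. f' x0 y v)"
 proof (rule linear_conv_bounded_linear[THEN iffD1], rule linearI)
  fix v w :: 'a and c :: real
  have "(LINT y|M. f' x0 y (v + w)) = (LINT y|M. f' x0 y v + f' x0 y w)"
   by (intro Bochner_Integration.integral_cong refl) (simp add: lin linear_add)
  then show "(LINT y|M. f' x0 y (v + w)) = (LINT y|M. f' x0 y v) + (LINT y|M. f' x0 y w)"
   using f'i by simp
  have "(LINT y|M. f' x0 y (c *\<^sub>R v)) = (LINT y|M. c *\<^sub>R f' x0 y v)"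
   by (intro Bochner_Integration.integral_cong refl) (simp add: lin linear_scale)
  then show "(LINT y|M. f' x0 y (c *\<^sub>R v)) = c *\<^sub>R (LINT y|M. f' x0 y v)"
   by simp
 qed
 let ?R = "%x y. (f x y - f x0 y - f' x0 y (x - x0)) / norm (x - x0)"
 have "((%x. LINT y|M. ?R x y) \<longlongrightarrow> 0) (at x0 within S)"
  unfolding tendsto_at_iff_sequentially comp_def
 proof (intro allI impI)
  fix X assume X: "\<forall>i. X i \<in> S - {x0}" "X \<longlonglongrightarrow> x0"
  have "(%i. LINT y|M. ?R (X i) y) \<longlonglongrightarrow> (LINT y|M. 0)"
  proof (rule integral_dominated_convergence[where w="%y. 2 * g y"])
   show "(%x. 0) \<in> borel_measurable M" by simp
   show "(%y. ?R (X i) y) \<in> borel_measurable M" for i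
    by (intro borel_measurable_divide borel_measurable_diff borel_measurable_integrable[OF f] f'm borel_measurable_const)
     (use X x0 in auto)
   show "integrable M (%y. 2 * g y)" using g by simp
   show "AE y in M. (%i. ?R (X i) y) \<longlonglongrightarrow> 0"
   proof (rule AE_I2)
    fix y assume "y \<in> space M"
    from der[OF x0 this] have "((%x. ?R x y) \<longlongrightarrow> 0) (at x0 within S)"
     unfolding has_derivative_within by (simp add: divide_inverse_commute diff_diff_eq)
    then show "(%i. ?R (X i) y) \<longlonglongrightarrow> 0"
     using X unfolding tendsto_at_iff_sequentially comp_def by blast
   qed
   \<comment> \<open>On the convex set \<open>S\<close> the mean value inequality bounds the
     increment of \<open>f\<close> by \<open>g y\<close> times the distance; the linear term costs
     another \<open>g y\<close>. This gives the dominating function.\<close>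
   show "AE y in M. norm (?R (X i) y) \<le> 2 * g y" for i
   proof (rule AE_I2)
    fix y assume y: "y \<in> space M"
    have Xi: "X i \<in> S" "X i \<noteq> x0" using X by auto
    have on: "onorm (f' x y) \<le> g y" if "x \<in> S" for x
     by (rule onorm_le) (use bnd[OF that y] in \<open>simp add: mult.commute\<close>)
    have "norm (f (X i) y - f x0 y) \<le> g y * norm (X i - x0)"
     by (rule differentiable_bound[OF \<open>convex S\<close> _ _ Xi(1) x0, of _ "%x. f' x y"]) (use der y on in auto)
    moreover have "\<bar>f' x0 y (X i - x0)\<bar> \<le> g y * norm (X i - x0)"
     using bnd[OF x0 y, of "X i - x0"] by (simp add: mult.commute)
    ultimately have "\<bar>f (X i) y - f x0 y - f' x0 y (X i - x0)\<bar> \<le> 2 * g y * norm (X i - x0)"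
     by simp
    then show "norm (?R (X i) y) \<le> 2 * g y"
     using Xi by (simp add: divide_le_eq)
   qed
  qed
  then show "(%i. LINT y|M. ?R (X i) y) \<longlonglongrightarrow> 0" by simp
 qed
 moreover have "\<forall>\<^sub>F x in at x0 within S. (LINT y|M. ?R x y) =
  ((LINT y|M. f x y) - (LINT y|M. f x0 y) - (LINT y|M. f' x0 y (x - x0))) / norm (x - x0)"
  using f f'i x0 by (auto simp: eventually_at_filter intro!: always_eventually)
 ultimately have "((%x. ((LINT y|M. f x y) - (LINT y|M. f x0 y) - (LINT y|M. f' x0 y (x - x0))) / norm (x - x0))
   \<longlongrightarrow> 0) (at x0 within S)"
  using tendsto_cong by fast
 with bl show ?thesis
  unfolding has_derivative_within by (simp add: divide_inverse_commute diff_diff_eq)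
qed

text \<open>Tonelli's criterion in the form suited to the estimates below: an integrable bound on
  the inner absolute integrals is what they produce, and measurability of the inner integral is
  supplied here.\<close>

lemma integrable_pair_bound:
 fixes f :: "'a \<Rightarrow> 'b \<Rightarrow> real"
 assumes "sigma_finite_measure M" "sigma_finite_measure N"
  and m: "(%(x, y). f x y) \<in> borel_measurable (M \<Otimes>\<^sub>M N)"
  and "!!x. x \<in> space M ==> integrable N (f x)"
  and b: "!!x. x \<in> space M ==> (LINT y|N. \<bar>f x y\<bar>) \<le> g x"
  and g: "integrable M g"
 shows "integrable (M \<Otimes>\<^sub>M N) (%(x, y). f x y)"
proof -
 interpret pair_sigma_finite M N using assms by (simp add: pair_sigma_finite_def)
 have [measurable]: "(%(x, y). f x y) \<in> borel_measurable (M \<Otimes>\<^sub>M N)" by fact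
 show ?thesis
 proof (rule Fubini_integrable)
  show "(%(x, y). f x y) \<in> borel_measurable (M \<Otimes>\<^sub>M N)" by fact
  show "AE x in M. integrable N (%y. case (x, y) of (x, y) \<Rightarrow> f x y)" using assms by auto
  show "integrable M (%x. LINT y|N. norm (case (x, y) of (x, y) \<Rightarrow> f x y))"
  proof (rule Bochner_Integration.integrable_bound[OF g])
   show "(%x. LINT y|N. norm (case (x, y) of (x, y) \<Rightarrow> f x y)) \<in> borel_measurable M"
    by measurable
   show "AE x in M. norm (LINT y|N. norm (case (x, y) of (x, y) \<Rightarrow> f x y)) \<le> norm (g x)"
    using b by (intro AE_I2) (smt (verit) real_norm_def integral_nonneg_AE AE_I2 prod.case Bochner_Integration.integral_cong)
  qed
 qed
qed

lemma integral_swap_bound: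
 fixes f :: "'a \<Rightarrow> 'b \<Rightarrow> real"
 assumes "sigma_finite_measure M" "sigma_finite_measure N"
  and "(%(x, y). f x y) \<in> borel_measurable (M \<Otimes>\<^sub>M N)"
  and "!!x. x \<in> space M ==> integrable N (f x)"
  and "!!x. x \<in> space M ==> (LINT y|N. \<bar>f x y\<bar>) \<le> g x"
  and "integrable M g"
 shows "(LINT x|M. LINT y|N. f x y) = (LINT y|N. LINT x|M. f x y)"
  and "integrable M (%x. LINT y|N. f x y)"
  and "integrable N (%y. LINT x|M. f x y)"
proof -
 interpret pair_sigma_finite M N using assms by (simp add: pair_sigma_finite_def)
 have *: "integrable (M \<Otimes>\<^sub>M N) (%(x, y). f x y)" by (rule integrable_pair_bound[OF assms])
 show "(LINT x|M. LINT y|N. f x y) = (LINT y|N. LINT x|M. f x y)"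
  using Fubini_integral[OF *] by simp
 show "integrable M (%x. LINT y|N. f x y)" using integrable_fst'[OF *] by simp
 show "integrable N (%y. LINT x|M. f x y)" using integrable_snd[OF *] by simp
qed

text \<open>From y <= e^y with y = c w / q, raised to the power q. The summand 1 covers the case q =
  0, in which \<open>0 powr 0\<close> evaluates to 0.\<close>

lemma powr_mult_exp_le:
 fixes q c w :: real
 assumes "q \<ge> 0" "c > 0" "w \<ge> 0"
 shows "w powr q * exp (- c * w) \<le> (q / c) powr q + 1"
proof (cases "q = 0 \<or> w = 0")
 case True
 with assms show ?thesis by (auto simp: powr_def)
next
 case False
 then have q: "q > 0" "w > 0" using assms by auto
 have "c * w / q \<le> exp (c * w / q)" using exp_ge_add_one_self[of "c*w/q"] by linarith
 then have "(c * w / q) powr q \<le> exp (c * w / q) powr q"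
  using assms q by (intro powr_mono2) auto
 also have "\<dots> = exp (c * w)" using q by (simp add: powr_def)
 finally have "(c * w / q) powr q * exp (- c * w) \<le> 1"
  by (simp add: exp_minus divide_simps)
 then have "(q / c) powr q * ((c * w / q) powr q * exp (- c * w)) \<le> (q / c) powr q * 1"
  by (intro mult_left_mono) auto
 moreover have "(q / c) powr q * (c * w / q) powr q = w powr q"
  using q assms by (simp flip: powr_mult)
 ultimately show ?thesis by (simp flip: mult.assoc)
qed

section \<open>The heat kernel and its derivatives up to order four\<close>

definition gk :: "real \<Rightarrow> 'a::euclidean_space \<Rightarrow> real" where
 "gk s z = (4 * pi * s) powr (- real DIM('a) / 2) * exp (- (norm z)\<^sup>2 / (4 * s))"

text \<open>\<open>gk1\<close> to \<open>gk4\<close> are the iterated directional derivatives of the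
  heat kernel, written as explicit polynomials times the Gaussian: measurability is then immediate,
  and each size estimate is one on a polynomial.\<close>

definition gk1 :: "'a::euclidean_space \<Rightarrow> real \<Rightarrow> 'a \<Rightarrow> real" where
 "gk1 a s z = - (z \<bullet> a) / (2 * s) * gk s z"

definition gk2 :: "'a::euclidean_space \<Rightarrow> 'a \<Rightarrow> real \<Rightarrow> 'a \<Rightarrow> real" where
 "gk2 a b s z = ((z \<bullet> a) * (z \<bullet> b) / (4 * s^2) - (a \<bullet> b) / (2 * s)) * gk s z"

definition gk3 :: "'a::euclidean_space \<Rightarrow> 'a \<Rightarrow> 'a \<Rightarrow> real \<Rightarrow> 'a \<Rightarrow> real" where
 "gk3 a b c s z = (((a \<bullet> b) * (z \<bullet> c) + (a \<bullet> c) * (z \<bullet> b) + (b \<bullet> c) * (z \<bullet> a)) / (4 * s^2)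
  - (z \<bullet> a) * (z \<bullet> b) * (z \<bullet> c) / (8 * s^3)) * gk s z"

definition gk4 :: "'a::euclidean_space \<Rightarrow> 'a \<Rightarrow> 'a \<Rightarrow> 'a \<Rightarrow> real \<Rightarrow> 'a \<Rightarrow> real" where
 "gk4 a b c e s z = ((z \<bullet> a) * (z \<bullet> b) * (z \<bullet> c) * (z \<bullet> e) / (16 * s^4)
  - ((a \<bullet> b) * (z \<bullet> c) * (z \<bullet> e) + (a \<bullet> c) * (z \<bullet> b) * (z \<bullet> e) + (b \<bullet> c) * (z \<bullet> a) * (z \<bullet> e)
    + (a \<bullet> e) * (z \<bullet> b) * (z \<bullet> c) + (b \<bullet> e) * (z \<bullet> a) * (z \<bullet> c) + (c \<bullet> e) * (z \<bullet> a) * (z \<bullet> b)) / (8 * s^3)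
  + ((a \<bullet> b) * (c \<bullet> e) + (a \<bullet> c) * (b \<bullet> e) + (b \<bullet> c) * (a \<bullet> e)) / (4 * s^2)) * gk s z"

lemma gk_nonneg [simp]: "gk s z \<ge> 0" by (simp add: gk_def)

lemma gk_pos: "s > 0 ==> gk s z > 0" by (simp add: gk_def)

lemma gk_minus [simp]: "gk s (- z) = gk s z" by (simp add: gk_def)

lemma gk_measurable [measurable (raw)]:
 assumes [measurable]: "f \<in> borel_measurable M" "g \<in> borel_measurable M"
 shows "(%x. gk (f x) (g x)) \<in> borel_measurable M"
  "(%x. gk1 a (f x) (g x)) \<in> borel_measurable M"
  "(%x. gk2 a b (f x) (g x)) \<in> borel_measurable M"
  "(%x. gk3 a b c (f x) (g x)) \<in> borel_measurable M"
 unfolding gk_def gk1_def gk2_def gk3_def by measurable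

lemma norm_square_has_derivative:
 "((%z::'a::euclidean_space. (norm z)\<^sup>2) has_derivative (%v. 2 * (z \<bullet> v))) (at z within S)"
 unfolding power2_norm_eq_inner by (auto intro!: derivative_eq_intros simp: inner_commute)

lemma gk_has_derivative:
 fixes z :: "'a::euclidean_space"
 assumes "s > 0"
 shows "(gk s has_derivative (%v. gk1 v s z)) (at z)"
proof -
 have "((%z::'a. exp (- (norm z)\<^sup>2 / (4 * s))) has_derivative
   (%v. - (2 * (z \<bullet> v)) / (4 * s) * exp (- (norm z)\<^sup>2 / (4 * s)))) (at z)"
  by (rule derivative_eq_intros norm_square_has_derivative refl | use assms in simp)+
 from has_derivative_mult_right[OF this, of "(4 * pi * s) powr (- real DIM('a) / 2)"] show ?thesis
  using assms by (simp add: gk_def[abs_def] gk1_def[abs_def] field_simps)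
qed

lemma gk1_has_derivative:
 assumes "s > 0"
 shows "(gk1 a s has_derivative (%v. gk2 a v s z)) (at z)"
 unfolding gk1_def[abs_def]
 apply (rule derivative_eq_intros gk_has_derivative refl assms | (use assms in simp; fail))+
 using assms by (auto simp: gk1_def gk2_def fun_eq_iff field_simps power2_eq_square inner_commute)

lemma gk2_has_derivative:
 assumes "s > 0"
 shows "(gk2 a b s has_derivative (%v. gk3 a b v s z)) (at z)"
 unfolding gk2_def[abs_def]
 apply (rule derivative_eq_intros gk_has_derivative refl assms | (use assms in simp; fail))+
 using assms by (auto simp: gk1_def gk3_def fun_eq_iff field_simps power2_eq_square power3_eq_cube inner_commute)

lemma gk3_has_derivative:
 assumes "s > 0"
 shows "(gk3 a b c s has_derivative (%v. gk4 a b c v s z)) (at z)"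
 unfolding gk3_def[abs_def]
 apply (rule derivative_eq_intros gk_has_derivative refl assms | (use assms in simp; fail))+
 using assms by (auto simp: gk1_def gk4_def fun_eq_iff field_simps power2_eq_square power3_eq_cube power4_eq_xxxx inner_commute)

lemma lborel_distr_reflect: "distr lborel borel (%y. x - y) = (lborel :: 'a::euclidean_space measure)"
 by (subst (2) lborel_affine[of "-1" x]) (auto simp: density_1)

lemma lborel_reflect:
 fixes f :: "'a::euclidean_space \<Rightarrow> real"
 assumes [measurable]: "f \<in> borel_measurable borel"
 shows "integrable lborel (%y. f (x - y)) \<longleftrightarrow> integrable lborel f"
  "(LINT y|lborel. f (x - y)) = (LINT y|lborel. f y)"
 by (subst (2) lborel_distr_reflect[of x, symmetric], simp add: integrable_distr_eq)
  (subst (2) lborel_distr_reflect[of x, symmetric], simp add: integral_distr)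

lemma lborel_shift:
 fixes f :: "'a::euclidean_space \<Rightarrow> real"
 assumes [measurable]: "f \<in> borel_measurable borel"
 shows "integrable lborel (%y. f (y + c)) \<longleftrightarrow> integrable lborel f"
  "(LINT y|lborel. f (y + c)) = (LINT y|lborel. f y)"
 by (subst (2) lborel_distr_plus[of c, symmetric], simp add: integrable_distr_eq add.commute)
  (subst (2) lborel_distr_plus[of c, symmetric], simp add: integral_distr add.commute)

text \<open>The heat kernel is the product over the coordinates of normal densities of variance 2
  s.\<close>

lemma gk_nn_integral:
 assumes s: "s > 0"
 shows "(\<integral>\<^sup>+x. ennreal (gk s (x::'a::euclidean_space)) \<partial>lborel) = 1"
proof -
 have nd: "normal_density 0 (sqrt (2 * s)) y = (4 * pi * s) powr (- 1 / 2) * exp (- y\<^sup>2 / (4 * s))" for y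
  using s by (simp add: normal_density_def powr_minus_divide powr_half_sqrt mult_ac)
 have gkp: "gk s x = (\<Prod>b\<in>Basis. normal_density 0 (sqrt (2 * s)) (x \<bullet> b))" for x :: 'a
 proof -
  have "(norm x)\<^sup>2 = (\<Sum>b\<in>Basis. (x \<bullet> b)\<^sup>2)"
   unfolding power2_norm_eq_inner by (subst euclidean_inner) (simp add: power2_eq_square)
  then have e: "exp (- (norm x)\<^sup>2 / (4 * s)) = (\<Prod>b\<in>Basis. exp (- (x \<bullet> b)\<^sup>2 / (4 * s)))"
   by (simp add: exp_sum[symmetric] sum_negf sum_divide_distrib)
  have p: "((4 * pi * s) powr (- 1 / 2)) ^ DIM('a) = (4 * pi * s) powr (- real DIM('a) / 2)"
   using s by (subst powr_power) auto
  show ?thesis unfolding nd prod.distrib gk_def e[symmetric] by (simp only: prod_constant p)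
 qed
 have "(\<integral>\<^sup>+x. ennreal (gk s (x::'a)) \<partial>lborel) =
  (\<integral>\<^sup>+x. (\<Prod>b\<in>Basis. ennreal (normal_density 0 (sqrt (2 * s)) (x \<bullet> b))) \<partial>(lborel :: 'a measure))"
  unfolding gkp by (simp add: prod_ennreal)
 also have "\<dots> = (\<Prod>b\<in>(Basis::'a set). (\<integral>\<^sup>+x. ennreal (normal_density 0 (sqrt (2 * s)) x) \<partial>lborel))"
  by (rule nn_integral_lborel_prod) auto
 also have "\<dots> = 1"
  using s by (intro prod.neutral ballI) (simp add: nn_integral_eq_integral integrable_normal_density)
 finally show ?thesis .
qed

lemma gk_integral:
 assumes "s > 0"
 shows "integrable lborel (gk s :: 'a::euclidean_space \<Rightarrow> real)" "(LINT x|lborel. gk s (x::'a)) = 1"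
proof -
 show "integrable lborel (gk s :: 'a \<Rightarrow> real)"
  by (rule integrableI_bounded) (auto simp: gk_nn_integral[OF assms])
 then show "(LINT x|lborel. gk s (x::'a)) = 1"
  using nn_integral_eq_integral[of lborel "gk s :: 'a \<Rightarrow> real"] gk_nn_integral[OF assms, where 'a='a]
  by simp
qed

text \<open>Half of the exponent is split off. The factor exp(-|z|^2 / (8 s)) absorbs any polynomial
  in |z| / sqrt s, at the price of doubling the time; this is why \<open>gk (2 * s)\<close> appears
  in all later bounds.\<close>

lemma gk_double:
 fixes z :: "'a::euclidean_space"
 assumes "s > 0"
 shows "gk s z = 2 powr (real DIM('a) / 2) * gk (2 * s) z * exp (- (norm z)\<^sup>2 / (8 * s))"
proof -
 have "(4 * pi * (2 * s)) powr (- real DIM('a) / 2) = 2 powr (- real DIM('a) / 2) * (4 * pi * s) powr (- real DIM('a) / 2)"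
  using assms by (simp add: powr_mult[symmetric] mult_ac)
 moreover have "- (norm z)\<^sup>2 / (4 * (2 * s)) + - (norm z)\<^sup>2 / (8 * s) = - (norm z)\<^sup>2 / (4 * s)"
  using assms by (simp add: field_simps)
 then have "exp (- (norm z)\<^sup>2 / (4 * (2 * s))) * exp (- (norm z)\<^sup>2 / (8 * s)) = exp (- (norm z)\<^sup>2 / (4 * s))"
  by (simp flip: exp_add)
 moreover have "2 powr (real DIM('a) / 2) * 2 powr (- real DIM('a) / 2) = (1::real)"
  by (simp flip: powr_add)
 ultimately show ?thesis unfolding gk_def by (simp add: mult_ac)
qed

lemma gk_moment_bound:
 fixes q :: real
 assumes "q \<ge> 0"
 shows "\<exists>C\<ge>0. \<forall>s>0. \<forall>z::'a::euclidean_space. norm z powr q * gk s z \<le> C * s powr (q / 2) * gk (2 * s) z"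
proof -
 let ?C = "((q/2) / (1/8)) powr (q/2) + 1"
 have "norm z powr q * gk s z \<le> (2 powr (real DIM('a) / 2) * ?C) * s powr (q / 2) * gk (2 * s) z"
  if "s > 0" for s and z :: 'a
 proof -
  have "norm z powr q = ((norm z)\<^sup>2 / s * s) powr (q / 2)"
   using that by (simp add: powr_powr flip: powr_numeral)
  then have "norm z powr q * exp (- (norm z)\<^sup>2 / (8 * s))
    = s powr (q / 2) * (((norm z)\<^sup>2 / s) powr (q/2) * exp (- (1/8) * ((norm z)\<^sup>2 / s)))"
   using that by (simp add: powr_mult powr_divide)
  also have "\<dots> \<le> s powr (q / 2) * ?C"
   using assms that by (intro mult_left_mono powr_mult_exp_le) auto
  finally have "(2 powr (real DIM('a) / 2) * gk (2 * s) z) * (norm z powr q * exp (- (norm z)\<^sup>2 / (8 * s)))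
   \<le> (2 powr (real DIM('a) / 2) * gk (2 * s) z) * (s powr (q / 2) * ?C)"
   by (intro mult_left_mono) auto
  then show ?thesis
   using gk_double[OF that, of z] by (simp add: mult_ac)
 qed
 then show ?thesis by (intro exI[of _ "2 powr (real DIM('a) / 2) * ?C"]) (auto simp: powr_def)
qed

lemma one_plus_le: "1 + r \<le> 2 * (1 + r\<^sup>2)" for r :: real
proof -
 have "0 \<le> (r - 1/4)\<^sup>2" by simp
 then show ?thesis by (simp add: power2_eq_square algebra_simps)
qed

lemma gk_poly_bound:
 fixes m :: nat
 assumes "m \<ge> 1"
 shows "\<exists>C\<ge>0. \<forall>s>0. \<forall>z::'a::euclidean_space. (1 + norm z / sqrt s) ^ m * gk s z \<le> C * gk (2 * s) z"
proof -
 have "(1 + norm z / sqrt s) ^ m * gk s z \<le> ((16 * m) ^ m * 2 powr (real DIM('a) / 2)) * gk (2 * s) z"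
  if s: "s > 0" for s and z :: 'a
 proof -
  let ?r = "norm z / sqrt s"
  have r2: "?r\<^sup>2 = (norm z)\<^sup>2 / s" using s by (simp add: power_divide)
  have "1 + ?r \<le> 2 * (1 + ?r\<^sup>2)"
   by (rule one_plus_le)
  \<comment> \<open>The constant is chosen so that the m-th power is controlled by (1 + v / m)^m <=
    e^v with v = r^2 / 8, exactly the exponential that \<open>gk_double\<close> can cancel.\<close>
  also have "\<dots> \<le> 16 * m * (1 + (?r\<^sup>2 / 8) / m)"
   using assms by (simp add: field_simps)
  finally have "(1 + ?r) ^ m \<le> (16 * m * (1 + (?r\<^sup>2 / 8) / m)) ^ m"
   using s by (intro power_mono) auto
  also have "\<dots> = (16 * m) ^ m * (1 + (?r\<^sup>2 / 8) / m) ^ m" by (simp add: power_mult_distrib)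
  also have "\<dots> \<le> (16 * m) ^ m * exp (?r\<^sup>2 / 8)"
   using assms by (intro mult_left_mono exp_ge_one_plus_x_over_n_power_n) (auto simp: order_trans[of _ 0])
  finally have "(1 + ?r) ^ m * exp (- (norm z)\<^sup>2 / (8 * s)) \<le> (16 * m) ^ m"
   unfolding r2 using exp_gt_zero[of "(norm z)\<^sup>2 / s / 8"]
   by (simp add: exp_minus pos_divide_le_eq mult_ac flip: divide_inverse)
  then have "(2 powr (real DIM('a) / 2) * gk (2 * s) z) * ((1 + ?r) ^ m * exp (- (norm z)\<^sup>2 / (8 * s)))
   \<le> (2 powr (real DIM('a) / 2) * gk (2 * s) z) * (16 * m) ^ m"
   by (intro mult_left_mono) auto
  then show ?thesis
   using gk_double[OF s, of z] by (simp add: mult_ac)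
 qed
 then show ?thesis by (intro exI[of _ "(16 * m) ^ m * 2 powr (real DIM('a) / 2)"]) auto
qed

text \<open>The class of kernels that scale like an m-th derivative of the heat kernel, together
  with their space derivative, of order m + 1. All convolution estimates are proved for this class
  and thus serve the heat kernel and its first three derivatives at once.\<close>

definition gkernel :: "nat \<Rightarrow> (real \<Rightarrow> 'a::euclidean_space \<Rightarrow> real) \<Rightarrow> (real \<Rightarrow> 'a \<Rightarrow> 'a \<Rightarrow> real) \<Rightarrow> bool" where
 "gkernel m f f' \<longleftrightarrow>
  (\<forall>s>0. \<forall>z. (f s has_derivative f' s z) (at z)) \<and>
  (%(s, z). f s z) \<in> borel_measurable (borel \<Otimes>\<^sub>M borel) \<and>
  (\<forall>v. (%(s, z). f' s z v) \<in> borel_measurable (borel \<Otimes>\<^sub>M borel)) \<and>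
  (\<exists>C\<ge>0. \<forall>s>0. \<forall>z. \<bar>f s z\<bar> \<le> C * s powr (- (real m / 2)) * gk (2 * s) z) \<and>
  (\<exists>C\<ge>0. \<forall>s>0. \<forall>z v. \<bar>f' s z v\<bar> \<le> C * norm v * s powr (- ((real m + 1) / 2)) * gk (2 * s) z)"

lemma scaled_bound:
 fixes x s K :: real
 assumes "s > 0" "(1 + norm z / sqrt s) ^ m * gk s z \<le> C * gk (2 * s) z"
  and "\<bar>x\<bar> * sqrt s ^ m \<le> K * (1 + norm z / sqrt s) ^ m" "K \<ge> 0"
 shows "\<bar>x * gk s z\<bar> \<le> C * K * s powr (- (real m / 2)) * gk (2 * s) z"
proof -
 have p: "s powr (- (real m / 2)) = 1 / sqrt s ^ m"
  using assms(1) by (simp add: powr_minus_divide powr_half_sqrt[symmetric] powr_power)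
 have "\<bar>x\<bar> * sqrt s ^ m * gk s z \<le> K * ((1 + norm z / sqrt s) ^ m * gk s z)"
  using mult_right_mono[OF assms(3), of "gk s z"] by (simp add: mult_ac)
 also have "\<dots> \<le> K * (C * gk (2 * s) z)"
  using assms by (intro mult_left_mono) auto
 finally show ?thesis
  unfolding p using assms(1) by (simp add: abs_mult field_simps)
qed

lemma abs_mult_le_mult: "\<bar>x\<bar> \<le> X ==> \<bar>y\<bar> \<le> Y ==> \<bar>x * y\<bar> \<le> X * (Y::real)"
 unfolding abs_mult by (intro mult_mono) auto

lemma abs_scale_le: "x * \<sigma> ^ m = y ==> \<bar>y\<bar> \<le> 2 * (K * R ^ m) ==> \<sigma> > 0 ==> \<bar>x\<bar> * \<sigma> ^ m \<le> 2 * K * (R::real) ^ m"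
 by (auto simp: abs_mult)

text \<open>Putting z = sqrt s * w removes s from the polynomial prefactors of the kernels. With R =
  1 + |w|, a factor w . a costs one power of R and a factor a . b costs two, so every monomial in
  the m-th derivative obeys the same bound, the product of the norms times R^m.\<close>

lemma scaling_obtain:
 fixes z :: "'a::euclidean_space"
 assumes "s > 0"
 obtains \<sigma> w R where "\<sigma> > 0" "s = \<sigma>\<^sup>2" "z = \<sigma> *\<^sub>R w" "sqrt s = \<sigma>" "1 + norm z / sqrt s = R"
  "!!a. \<bar>w \<bullet> a\<bar> \<le> norm a * R" "!!a b::'a. \<bar>a \<bullet> b\<bar> \<le> norm a * norm b * R\<^sup>2"
proof
 define \<sigma> where "\<sigma> = sqrt s"
 define w where "w = z /\<^sub>R \<sigma>"
 show \<sigma>: "\<sigma> > 0" "s = \<sigma>\<^sup>2" "z = \<sigma> *\<^sub>R w" "sqrt s = \<sigma>" using assms by (auto simp: \<sigma>_def w_def)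
 show R: "1 + norm z / sqrt s = 1 + norm w"
  using \<sigma> assms unfolding \<open>sqrt s = \<sigma>\<close> by (simp add: field_simps)
 show "\<bar>w \<bullet> a\<bar> \<le> norm a * (1 + norm w)" for a
  using Cauchy_Schwarz_ineq2[of w a] by (smt (verit) mult.commute norm_ge_zero mult_left_mono)
 have "1 \<le> (1 + norm w)\<^sup>2" by simp
 then show "\<bar>a \<bullet> b\<bar> \<le> norm a * norm b * (1 + norm w)\<^sup>2" for a b :: 'a
  using Cauchy_Schwarz_ineq2[of a b] mult_left_mono[of 1 "(1 + norm w)\<^sup>2" "norm a * norm b"] by simp
qed

lemma gk_bound_0:
 "\<exists>C\<ge>0. \<forall>s>0. \<forall>z::'a::euclidean_space. \<bar>gk s z\<bar> \<le> C * gk (2 * s) z"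
proof -
 have "gk s z \<le> 2 powr (real DIM('a) / 2) * gk (2 * s) z" if "s > 0" for s and z :: 'a
  unfolding gk_double[OF that, of z] using that by (simp add: mult_left_le)
 then show ?thesis by (intro exI[of _ "2 powr (real DIM('a) / 2)"]) auto
qed

lemma gk_bound_1:
 "\<exists>C\<ge>0. \<forall>s>0. \<forall>(z::'a::euclidean_space) a. \<bar>gk1 a s z\<bar>
  \<le> C * (norm a) * s powr (- (real 1 / 2)) * gk (2 * s) z"
proof -
 from gk_poly_bound[of 1, where 'a='a] obtain C where C: "C \<ge> 0"
  "!!s z::'a. s > 0 ==> (1 + norm z / sqrt s) ^ 1 * gk s z \<le> C * gk (2 * s) z" by auto
 have "\<bar>gk1 a s z\<bar> \<le> C * (2 * (norm a)) * s powr (- (real 1 / 2)) * gk (2 * s) z"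
  if s: "s > 0" for s and a z :: 'a
  unfolding gk1_def
 proof (rule scaled_bound[OF s C(2)[OF s]])
  obtain \<sigma> w R where \<sigma>: "\<sigma> > 0" "s = \<sigma>\<^sup>2" "z = \<sigma> *\<^sub>R w" "sqrt s = \<sigma>" "1 + norm z / sqrt s = R"
   and W: "!!a. \<bar>w \<bullet> a\<bar> \<le> norm a * R" and I: "!!a b::'a. \<bar>a \<bullet> b\<bar> \<le> norm a * norm b * R\<^sup>2"
   using scaling_obtain[OF s, of z] by blast
  have "(- (z \<bullet> a) / (2 * s)) * \<sigma> ^ 1
    = - (w \<bullet> a) / 2"
   unfolding \<sigma>(2,3) inner_scaleR_left using \<sigma>(1)
   by (simp add: divide_simps) (simp add: algebra_simps power_numeral_reduce)
  moreover have "\<bar>- (w \<bullet> a) / 2\<bar>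
    \<le> 2 * ((norm a) * R ^ 1)"
  proof -
   define K where "K = (norm a) * R ^ 1"
   have p: "p = q ==> \<bar>x\<bar> \<le> p ==> \<bar>x\<bar> \<le> q" for p q x :: real by simp
   have h: "\<bar>w \<bullet> a\<bar> \<le> K"
    using W[of a]
    by (simp_all add: K_def power_numeral_reduce mult_ac)
   from h[THEN abs_le_D1] h[THEN abs_le_D2] show ?thesis
    unfolding K_def[symmetric] by (intro abs_leI) linarith+
  qed
  ultimately show "\<bar>- (z \<bullet> a) / (2 * s)\<bar> * sqrt s ^ 1
    \<le> 2 * (norm a) * (1 + norm z / sqrt s) ^ 1"
   unfolding \<sigma>(5) unfolding \<sigma>(4) using \<sigma>(1) by (intro abs_scale_le)
 qed auto
 with C(1) show ?thesis by (intro exI[of _ "2 * C"]) (auto simp: mult_ac)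
qed

lemma gk_bound_2:
 "\<exists>C\<ge>0. \<forall>s>0. \<forall>(z::'a::euclidean_space) a b. \<bar>gk2 a b s z\<bar>
  \<le> C * (norm a * norm b) * s powr (- (real 2 / 2)) * gk (2 * s) z"
proof -
 from gk_poly_bound[of 2, where 'a='a] obtain C where C: "C \<ge> 0"
  "!!s z::'a. s > 0 ==> (1 + norm z / sqrt s) ^ 2 * gk s z \<le> C * gk (2 * s) z" by auto
 have "\<bar>gk2 a b s z\<bar> \<le> C * (2 * (norm a * norm b)) * s powr (- (real 2 / 2)) * gk (2 * s) z"
  if s: "s > 0" for s and a b z :: 'a
  unfolding gk2_def
 proof (rule scaled_bound[OF s C(2)[OF s]])
  obtain \<sigma> w R where \<sigma>: "\<sigma> > 0" "s = \<sigma>\<^sup>2" "z = \<sigma> *\<^sub>R w" "sqrt s = \<sigma>" "1 + norm z / sqrt s = R"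
   and W: "!!a. \<bar>w \<bullet> a\<bar> \<le> norm a * R" and I: "!!a b::'a. \<bar>a \<bullet> b\<bar> \<le> norm a * norm b * R\<^sup>2"
   using scaling_obtain[OF s, of z] by blast
  have "((z \<bullet> a) * (z \<bullet> b) / (4 * s^2) - (a \<bullet> b) / (2 * s)) * \<sigma> ^ 2
    = (w \<bullet> a) * (w \<bullet> b) / 4 - (a \<bullet> b) / 2"
   unfolding \<sigma>(2,3) inner_scaleR_left using \<sigma>(1)
   by (simp add: divide_simps) (simp add: algebra_simps power_numeral_reduce)
  moreover have "\<bar>(w \<bullet> a) * (w \<bullet> b) / 4 - (a \<bullet> b) / 2\<bar>
    \<le> 2 * ((norm a * norm b) * R ^ 2)"
  proof -
   define K where "K = (norm a * norm b) * R ^ 2"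
   have p: "p = q ==> \<bar>x\<bar> \<le> p ==> \<bar>x\<bar> \<le> q" for p q x :: real by simp
   have h: "\<bar>(w \<bullet> a) * (w \<bullet> b)\<bar> \<le> K" "\<bar>a \<bullet> b\<bar> \<le> K"
    using abs_mult_le_mult[OF W[of a] W[of b]]
    I[of a b]
    by (simp_all add: K_def power_numeral_reduce mult_ac)
   from h[THEN abs_le_D1] h[THEN abs_le_D2] show ?thesis
    unfolding K_def[symmetric] by (intro abs_leI) linarith+
  qed
  ultimately show "\<bar>(z \<bullet> a) * (z \<bullet> b) / (4 * s^2) - (a \<bullet> b) / (2 * s)\<bar> * sqrt s ^ 2
    \<le> 2 * (norm a * norm b) * (1 + norm z / sqrt s) ^ 2"
   unfolding \<sigma>(5) unfolding \<sigma>(4) using \<sigma>(1) by (intro abs_scale_le)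
 qed auto
 with C(1) show ?thesis by (intro exI[of _ "2 * C"]) (auto simp: mult_ac)
qed

lemma gk3_arith:
 fixes K :: real
 assumes "\<bar>t1\<bar> \<le> K" "\<bar>t2\<bar> \<le> K" "\<bar>t3\<bar> \<le> K" "\<bar>t4\<bar> \<le> K"
 shows "\<bar>(t2 + t3 + t4) / 4 - t1 / 8\<bar> \<le> 2 * K"
proof -
 have "\<bar>t1 / 8\<bar> \<le> K / 8" using assms(1) by simp
 moreover have "\<bar>(t2 + t3 + t4) / 4\<bar> \<le> 3 * K / 4" using assms(2-4) by simp
 ultimately show ?thesis using assms(1) by linarith
qed

lemma gk_bound_3:
 "\<exists>C\<ge>0. \<forall>s>0. \<forall>(z::'a::euclidean_space) a b c. \<bar>gk3 a b c s z\<bar>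
  \<le> C * (norm a * norm b * norm c) * s powr (- (real 3 / 2)) * gk (2 * s) z"
proof -
 from gk_poly_bound[of 3, where 'a='a] obtain C where C: "C \<ge> 0"
  "!!s z::'a. s > 0 ==> (1 + norm z / sqrt s) ^ 3 * gk s z \<le> C * gk (2 * s) z" by auto
 have "\<bar>gk3 a b c s z\<bar> \<le> C * (2 * (norm a * norm b * norm c)) * s powr (- (real 3 / 2)) * gk (2 * s) z"
  if s: "s > 0" for s and a b c z :: 'a
  unfolding gk3_def
 proof (rule scaled_bound[OF s C(2)[OF s]])
  obtain \<sigma> w R where \<sigma>: "\<sigma> > 0" "s = \<sigma>\<^sup>2" "z = \<sigma> *\<^sub>R w" "sqrt s = \<sigma>" "1 + norm z / sqrt s = R"
   and W: "!!a. \<bar>w \<bullet> a\<bar> \<le> norm a * R" and I: "!!a b::'a. \<bar>a \<bullet> b\<bar> \<le> norm a * norm b * R\<^sup>2"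
   using scaling_obtain[OF s, of z] by blast
  have "(((a \<bullet> b) * (z \<bullet> c) + (a \<bullet> c) * (z \<bullet> b) + (b \<bullet> c) * (z \<bullet> a)) / (4 * s^2) - (z \<bullet> a) * (z \<bullet> b) * (z \<bullet> c) / (8 * s^3)) * \<sigma> ^ 3
    = ((a \<bullet> b) * (w \<bullet> c) + (a \<bullet> c) * (w \<bullet> b) + (b \<bullet> c) * (w \<bullet> a)) / 4 - (w \<bullet> a) * (w \<bullet> b) * (w \<bullet> c) / 8"
   unfolding \<sigma>(2,3) inner_scaleR_left using \<sigma>(1)
   by (simp add: divide_simps) (simp add: algebra_simps power_numeral_reduce)
  moreover have "\<bar>((a \<bullet> b) * (w \<bullet> c) + (a \<bullet> c) * (w \<bullet> b) + (b \<bullet> c) * (w \<bullet> a)) / 4 - (w \<bullet> a) * (w \<bullet> b) * (w \<bullet> c) / 8\<bar>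
    \<le> 2 * ((norm a * norm b * norm c) * R ^ 3)"
  proof -
   define K where "K = (norm a * norm b * norm c) * R ^ 3"
   have p: "p = q ==> \<bar>x\<bar> \<le> p ==> \<bar>x\<bar> \<le> q" for p q x :: real by simp
   have h: "\<bar>(w \<bullet> a) * (w \<bullet> b) * (w \<bullet> c)\<bar> \<le> K" "\<bar>(a \<bullet> b) * (w \<bullet> c)\<bar> \<le> K" "\<bar>(a \<bullet> c) * (w \<bullet> b)\<bar> \<le> K" "\<bar>(b \<bullet> c) * (w \<bullet> a)\<bar> \<le> K"
    using abs_mult_le_mult[OF abs_mult_le_mult[OF W[of a] W[of b]] W[of c]]
    abs_mult_le_mult[OF I[of a b] W[of c]]
    abs_mult_le_mult[OF I[of a c] W[of b]]
    abs_mult_le_mult[OF I[of b c] W[of a]]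
    by (simp_all add: K_def power_numeral_reduce mult_ac)
   show ?thesis unfolding K_def[symmetric] by (rule gk3_arith; rule h)
  qed
  ultimately show "\<bar>((a \<bullet> b) * (z \<bullet> c) + (a \<bullet> c) * (z \<bullet> b) + (b \<bullet> c) * (z \<bullet> a)) / (4 * s^2) - (z \<bullet> a) * (z \<bullet> b) * (z \<bullet> c) / (8 * s^3)\<bar> * sqrt s ^ 3
    \<le> 2 * (norm a * norm b * norm c) * (1 + norm z / sqrt s) ^ 3"
   unfolding \<sigma>(5) unfolding \<sigma>(4) using \<sigma>(1) by (intro abs_scale_le)
 qed auto
 with C(1) show ?thesis by (intro exI[of _ "2 * C"]) (auto simp: mult_ac)
qed

lemma gk4_arith:
 fixes K :: real
 assumes "\<bar>t1\<bar> \<le> K" "\<bar>t2\<bar> \<le> K" "\<bar>t3\<bar> \<le> K" "\<bar>t4\<bar> \<le> K" "\<bar>t5\<bar> \<le> K" "\<bar>t6\<bar> \<le> K" "\<bar>t7\<bar> \<le> K" "\<bar>t8\<bar> \<le> K" "\<bar>t9\<bar> \<le> K" "\<bar>t10\<bar> \<le> K"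
 shows "\<bar>t1 / 16 - (t2 + t3 + t4 + t5 + t6 + t7) / 8 + (t8 + t9 + t10) / 4\<bar> \<le> 2 * K"
proof -
 have "\<bar>t1 / 16\<bar> \<le> K / 16" using assms(1) by simp
 moreover have "\<bar>(t2 + t3 + t4 + t5 + t6 + t7) / 8\<bar> \<le> 6 * K / 8" using assms(2-7) by simp
 moreover have "\<bar>(t8 + t9 + t10) / 4\<bar> \<le> 3 * K / 4" using assms(8-10) by simp
 ultimately show ?thesis using assms(1) by linarith
qed

lemma gk_bound_4:
 "\<exists>C\<ge>0. \<forall>s>0. \<forall>(z::'a::euclidean_space) a b c e. \<bar>gk4 a b c e s z\<bar>
  \<le> C * (norm a * norm b * norm c * norm e) * s powr (- (real 4 / 2)) * gk (2 * s) z"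
proof -
 from gk_poly_bound[of 4, where 'a='a] obtain C where C: "C \<ge> 0"
  "!!s z::'a. s > 0 ==> (1 + norm z / sqrt s) ^ 4 * gk s z \<le> C * gk (2 * s) z" by auto
 have "\<bar>gk4 a b c e s z\<bar> \<le> C * (2 * (norm a * norm b * norm c * norm e)) * s powr (- (real 4 / 2)) * gk (2 * s) z"
  if s: "s > 0" for s and a b c e z :: 'a
  unfolding gk4_def
 proof (rule scaled_bound[OF s C(2)[OF s]])
  obtain \<sigma> w R where \<sigma>: "\<sigma> > 0" "s = \<sigma>\<^sup>2" "z = \<sigma> *\<^sub>R w" "sqrt s = \<sigma>" "1 + norm z / sqrt s = R"
   and W: "!!a. \<bar>w \<bullet> a\<bar> \<le> norm a * R" and I: "!!a b::'a. \<bar>a \<bullet> b\<bar> \<le> norm a * norm b * R\<^sup>2"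
   using scaling_obtain[OF s, of z] by blast
  have "((z \<bullet> a) * (z \<bullet> b) * (z \<bullet> c) * (z \<bullet> e) / (16 * s^4)
  - ((a \<bullet> b) * (z \<bullet> c) * (z \<bullet> e) + (a \<bullet> c) * (z \<bullet> b) * (z \<bullet> e) + (b \<bullet> c) * (z \<bullet> a) * (z \<bullet> e)
    + (a \<bullet> e) * (z \<bullet> b) * (z \<bullet> c) + (b \<bullet> e) * (z \<bullet> a) * (z \<bullet> c) + (c \<bullet> e) * (z \<bullet> a) * (z \<bullet> b)) / (8 * s^3)
  + ((a \<bullet> b) * (c \<bullet> e) + (a \<bullet> c) * (b \<bullet> e) + (b \<bullet> c) * (a \<bullet> e)) / (4 * s^2)) * \<sigma> ^ 4
    = (w \<bullet> a) * (w \<bullet> b) * (w \<bullet> c) * (w \<bullet> e) / 16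
  - ((a \<bullet> b) * (w \<bullet> c) * (w \<bullet> e) + (a \<bullet> c) * (w \<bullet> b) * (w \<bullet> e) + (b \<bullet> c) * (w \<bullet> a) * (w \<bullet> e)
    + (a \<bullet> e) * (w \<bullet> b) * (w \<bullet> c) + (b \<bullet> e) * (w \<bullet> a) * (w \<bullet> c) + (c \<bullet> e) * (w \<bullet> a) * (w \<bullet> b)) / 8
  + ((a \<bullet> b) * (c \<bullet> e) + (a \<bullet> c) * (b \<bullet> e) + (b \<bullet> c) * (a \<bullet> e)) / 4"
   unfolding \<sigma>(2,3) inner_scaleR_left using \<sigma>(1)
   by (simp add: divide_simps) (simp add: algebra_simps power_numeral_reduce)
  moreover have "\<bar>(w \<bullet> a) * (w \<bullet> b) * (w \<bullet> c) * (w \<bullet> e) / 16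
  - ((a \<bullet> b) * (w \<bullet> c) * (w \<bullet> e) + (a \<bullet> c) * (w \<bullet> b) * (w \<bullet> e) + (b \<bullet> c) * (w \<bullet> a) * (w \<bullet> e)
    + (a \<bullet> e) * (w \<bullet> b) * (w \<bullet> c) + (b \<bullet> e) * (w \<bullet> a) * (w \<bullet> c) + (c \<bullet> e) * (w \<bullet> a) * (w \<bullet> b)) / 8
  + ((a \<bullet> b) * (c \<bullet> e) + (a \<bullet> c) * (b \<bullet> e) + (b \<bullet> c) * (a \<bullet> e)) / 4\<bar>
    \<le> 2 * ((norm a * norm b * norm c * norm e) * R ^ 4)"
  proof -
   define K where "K = (norm a * norm b * norm c * norm e) * R ^ 4"
   have p: "p = q ==> \<bar>x\<bar> \<le> p ==> \<bar>x\<bar> \<le> q" for p q x :: real by simp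
   have h0: "\<bar>(w \<bullet> a) * (w \<bullet> b) * (w \<bullet> c) * (w \<bullet> e)\<bar> \<le> K"
    by (rule p[OF _ abs_mult_le_mult[OF abs_mult_le_mult[OF abs_mult_le_mult[OF W[of a] W[of b]] W[of c]] W[of e]]]) (simp add: K_def power_numeral_reduce mult_ac)
   have h1: "\<bar>(a \<bullet> b) * (w \<bullet> c) * (w \<bullet> e)\<bar> \<le> K"
    by (rule p[OF _ abs_mult_le_mult[OF abs_mult_le_mult[OF I[of a b] W[of c]] W[of e]]]) (simp add: K_def power_numeral_reduce mult_ac)
   have h2: "\<bar>(a \<bullet> c) * (w \<bullet> b) * (w \<bullet> e)\<bar> \<le> K"
    by (rule p[OF _ abs_mult_le_mult[OF abs_mult_le_mult[OF I[of a c] W[of b]] W[of e]]]) (simp add: K_def power_numeral_reduce mult_ac)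
   have h3: "\<bar>(b \<bullet> c) * (w \<bullet> a) * (w \<bullet> e)\<bar> \<le> K"
    by (rule p[OF _ abs_mult_le_mult[OF abs_mult_le_mult[OF I[of b c] W[of a]] W[of e]]]) (simp add: K_def power_numeral_reduce mult_ac)
   have h4: "\<bar>(a \<bullet> e) * (w \<bullet> b) * (w \<bullet> c)\<bar> \<le> K"
    by (rule p[OF _ abs_mult_le_mult[OF abs_mult_le_mult[OF I[of a e] W[of b]] W[of c]]]) (simp add: K_def power_numeral_reduce mult_ac)
   have h5: "\<bar>(b \<bullet> e) * (w \<bullet> a) * (w \<bullet> c)\<bar> \<le> K"
    by (rule p[OF _ abs_mult_le_mult[OF abs_mult_le_mult[OF I[of b e] W[of a]] W[of c]]]) (simp add: K_def power_numeral_reduce mult_ac)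
   have h6: "\<bar>(c \<bullet> e) * (w \<bullet> a) * (w \<bullet> b)\<bar> \<le> K"
    by (rule p[OF _ abs_mult_le_mult[OF abs_mult_le_mult[OF I[of c e] W[of a]] W[of b]]]) (simp add: K_def power_numeral_reduce mult_ac)
   have h7: "\<bar>(a \<bullet> b) * (c \<bullet> e)\<bar> \<le> K"
    by (rule p[OF _ abs_mult_le_mult[OF I[of a b] I[of c e]]]) (simp add: K_def power_numeral_reduce mult_ac)
   have h8: "\<bar>(a \<bullet> c) * (b \<bullet> e)\<bar> \<le> K"
    by (rule p[OF _ abs_mult_le_mult[OF I[of a c] I[of b e]]]) (simp add: K_def power_numeral_reduce mult_ac)
   have h9: "\<bar>(b \<bullet> c) * (a \<bullet> e)\<bar> \<le> K"
    by (rule p[OF _ abs_mult_le_mult[OF I[of b c] I[of a e]]]) (simp add: K_def power_numeral_reduce mult_ac)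
   note h = h0 h1 h2 h3 h4 h5 h6 h7 h8 h9
   show ?thesis unfolding K_def[symmetric] by (rule gk4_arith; rule h)
  qed
  ultimately show "\<bar>(z \<bullet> a) * (z \<bullet> b) * (z \<bullet> c) * (z \<bullet> e) / (16 * s^4)
  - ((a \<bullet> b) * (z \<bullet> c) * (z \<bullet> e) + (a \<bullet> c) * (z \<bullet> b) * (z \<bullet> e) + (b \<bullet> c) * (z \<bullet> a) * (z \<bullet> e)
    + (a \<bullet> e) * (z \<bullet> b) * (z \<bullet> c) + (b \<bullet> e) * (z \<bullet> a) * (z \<bullet> c) + (c \<bullet> e) * (z \<bullet> a) * (z \<bullet> b)) / (8 * s^3)
  + ((a \<bullet> b) * (c \<bullet> e) + (a \<bullet> c) * (b \<bullet> e) + (b \<bullet> c) * (a \<bullet> e)) / (4 * s^2)\<bar> * sqrt s ^ 4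
    \<le> 2 * (norm a * norm b * norm c * norm e) * (1 + norm z / sqrt s) ^ 4"
   unfolding \<sigma>(5) unfolding \<sigma>(4) using \<sigma>(1) by (intro abs_scale_le)
 qed auto
 with C(1) show ?thesis by (intro exI[of _ "2 * C"]) (auto simp: mult_ac)
qed

section \<open>Integrals of the heat kernel over time\<close>

lemma gamma_kernel_integral:
 assumes p: "p > 0" and A: "A > (0::real)"
 shows "set_integrable lborel {0<..} (%s. s powr (- p - 1) * exp (- A / s))"
  and "(LINT s:{0<..}|lborel. s powr (- p - 1) * exp (- A / s)) = Gamma p * A powr (- p)"
proof -
 let ?f = "%t::real. t powr (p - 1) / exp t"
 have Gi: "(?f has_integral Gamma p) {0<..}"
 proof -
  have "((%t. if t \<in> {0<..} then ?f t else 0) has_integral Gamma p) {0..}"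
   by (rule has_integral_spike[of "{0}", OF _ _ Gamma_integral_real[OF p]]) auto
  then show ?thesis by (subst (asm) has_integral_restrict) auto
 qed
 have Ga: "?f absolutely_integrable_on {0<..}"
  using Gi by (intro nonnegative_absolutely_integrable_1) auto
 have img: "(%s. A / s) ` {0<..} = {0<..}"
 proof safe
  fix y :: real assume "y > 0"
  then show "y \<in> (%s. A / s) ` {0<..}" using A by (intro image_eqI[of _ _ "A / y"]) auto
 qed (use A in auto)
 \<comment> \<open>Substitution t = A / s in Euler's integral for \<open>Gamma p\<close>.\<close>
 have cv: "(%s. \<bar>- A / s^2\<bar> * ?f (A / s)) absolutely_integrable_on {0<..} \<and>
     integral {0<..} (%s. \<bar>- A / s^2\<bar> * ?f (A / s)) = Gamma p"
 proof (rule has_absolute_integral_change_of_variables_1'[where g = "%s. A / s" and g' = "%s. - A / s^2" and f = ?f, THEN iffD2])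
  show "{0<..} \<in> sets (lebesgue :: real measure)" by simp
  show "((%s. A / s) has_field_derivative - A / s^2) (at s within {0<..})" if "s \<in> {0<..}" for s
   using that by (auto intro!: derivative_eq_intros simp: power2_eq_square)
  show "inj_on (%s. A / s) {0<..}" using A by (auto simp: inj_on_def field_simps)
  show "?f absolutely_integrable_on (%s. A / s) ` {0<..} \<and> integral ((%s. A / s) ` {0<..}) ?f = Gamma p"
   unfolding img using Ga Gi by (auto dest: integral_unique)
 qed
 have eq: "\<bar>- A / s^2\<bar> * ?f (A / s) = A powr p * (s powr (- p - 1) * exp (- A / s))" if "s \<in> {0<..}" for s
  using that A by (simp add: powr_divide powr_diff powr_minus exp_minus field_simps power2_eq_square)
 let ?h = "%s. s powr (- p - 1) * exp (- A / s)"
 have "(%s. A powr p * ?h s) absolutely_integrable_on {0<..}"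
  using cv by (intro set_integrable_cong[OF refl refl eq, THEN iffD1]) auto
 then have "set_integrable lebesgue {0<..} ?h"
  using A by simp
 then show int: "set_integrable lborel {0<..} ?h"
  unfolding set_integrable_def by (subst (asm) integrable_completion) auto
 have "A powr p * integral {0<..} ?h = integral {0<..} (%s. A powr p * ?h s)" by simp
 also have "\<dots> = Gamma p"
  using cv eq by (metis (no_types, lifting) Henstock_Kurzweil_Integration.integral_cong)
 finally have "integral {0<..} ?h = Gamma p * A powr (- p)"
  using A by (simp add: powr_minus field_simps)
 then show "(LINT s:{0<..}|lborel. ?h s) = Gamma p * A powr (- p)"
  using set_borel_integral_eq_integral(2)[OF int] by simp
qed

text \<open>At s = 0 the Gaussian converges because z is nonzero; at infinity the integrand behaves
  like s^{-q - d/2}, whence the condition on q.\<close>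

lemma gk_time_integral:
 fixes z :: "'a::euclidean_space"
 assumes z: "z \<noteq> 0" and q: "q + real DIM('a) / 2 - 1 > 0"
 shows "set_integrable lborel {0<..} (%s. s powr (- q) * gk s z)"
  and "(LINT s:{0<..}|lborel. s powr (- q) * gk s z)
   = (4 * pi) powr (- real DIM('a) / 2) * Gamma (q + real DIM('a) / 2 - 1) * ((norm z)\<^sup>2 / 4) powr (- (q + real DIM('a) / 2 - 1))"
proof -
 let ?p = "q + real DIM('a) / 2 - 1" and ?A = "(norm z)\<^sup>2 / 4" and ?c = "(4 * pi) powr (- real DIM('a) / 2)"
 have A: "?A > 0" using z by simp
 have eq: "s powr (- q) * gk s z = ?c * (s powr (- ?p - 1) * exp (- ?A / s))" if "s \<in> {0<..}" for s
 proof -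
  have "s powr (- ?p - 1) = s powr (- q) * s powr (- real DIM('a) / 2)"
   by (simp add: algebra_simps flip: powr_add)
  then show ?thesis
   using that by (simp add: gk_def powr_mult field_simps)
 qed
 show "set_integrable lborel {0<..} (%s. s powr (- q) * gk s z)"
  by (subst set_integrable_cong[OF refl refl eq]) (use gamma_kernel_integral(1)[OF q A] in auto)
 have "(LINT s:{0<..}|lborel. s powr (- q) * gk s z) = (LINT s:{0<..}|lborel. ?c * (s powr (- ?p - 1) * exp (- ?A / s)))"
  by (rule set_lebesgue_integral_cong) (use eq in auto)
 then show "(LINT s:{0<..}|lborel. s powr (- q) * gk s z)
   = ?c * Gamma ?p * ?A powr (- ?p)"
  using gamma_kernel_integral(2)[OF q A] by simp
qed

section \<open>Kernels with Gaussian bounds: convolution, semigroup law, moduli of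
  continuity\<close>

lemma gkernel_gk: "gkernel 0 (gk :: real \<Rightarrow> 'a::euclidean_space \<Rightarrow> real) (%s z v. gk1 v s z)"
 unfolding gkernel_def
proof (intro conjI allI impI)
 show "(gk s has_derivative (%v. gk1 v s z)) (at z)" if "s > 0" for s and z :: 'a
  by (rule gk_has_derivative[OF that])
 from gk_bound_0[where 'a='a] obtain C where "C \<ge> 0" "!!s z::'a. s > 0 ==> \<bar>gk s z\<bar> \<le> C * gk (2 * s) z" by blast
 then show "\<exists>C\<ge>0. \<forall>s>0. \<forall>z::'a. \<bar>gk s z\<bar> \<le> C * s powr (- (real 0 / 2)) * gk (2 * s) z"
  by (intro exI[of _ C]) auto
 from gk_bound_1[where 'a='a] obtain C where "C \<ge> 0" "!!s z a::'a. s > 0 ==> \<bar>gk1 a s z\<bar> \<le> C * norm a * s powr (- (real 1 / 2)) * gk (2 * s) z" by blast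
 then show "\<exists>C\<ge>0. \<forall>s>0. \<forall>z v::'a. \<bar>gk1 v s z\<bar> \<le> C * norm v * s powr (- ((real 0 + 1) / 2)) * gk (2 * s) z"
  by (intro exI[of _ C]) auto
qed measurable

lemma gkernel_gk1: "gkernel 1 (gk1 (a::'a::euclidean_space)) (%s z v. gk2 a v s z)"
 unfolding gkernel_def
proof (intro conjI allI impI)
 show "(gk1 a s has_derivative (%v. gk2 a v s z)) (at z)" if "s > 0" for s and z :: 'a
  by (rule gk1_has_derivative[OF that])
 from gk_bound_1[where 'a='a] obtain C where "C \<ge> 0" "!!s z a::'a. s > 0 ==> \<bar>gk1 a s z\<bar> \<le> C * norm a * s powr (- (real 1 / 2)) * gk (2 * s) z" by blast
 then show "\<exists>C\<ge>0. \<forall>s>0. \<forall>z::'a. \<bar>gk1 a s z\<bar> \<le> C * s powr (- (real 1 / 2)) * gk (2 * s) z"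
  by (intro exI[of _ "C * norm a"]) auto
 from gk_bound_2[where 'a='a] obtain C where C: "C \<ge> 0" "!!s z a b::'a. s > 0 ==> \<bar>gk2 a b s z\<bar> \<le> C * (norm a * norm b) * s powr (- (real 2 / 2)) * gk (2 * s) z" by blast
 have "\<bar>gk2 a v s z\<bar> \<le> C * norm a * norm v * s powr (- ((real 1 + 1) / 2)) * gk (2 * s) z" if "s > 0" for s and z v :: 'a
  using C(2)[OF that, of a v z] by (simp add: mult_ac)
 with C(1) show "\<exists>C\<ge>0. \<forall>s>0. \<forall>z v::'a. \<bar>gk2 a v s z\<bar> \<le> C * norm v * s powr (- ((real 1 + 1) / 2)) * gk (2 * s) z"
  by (intro exI[of _ "C * norm a"]) auto
qed measurable

lemma gkernel_gk2: "gkernel 2 (gk2 a (b::'a::euclidean_space)) (%s z v. gk3 a b v s z)"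
 unfolding gkernel_def
proof (intro conjI allI impI)
 show "(gk2 a b s has_derivative (%v. gk3 a b v s z)) (at z)" if "s > 0" for s and z :: 'a
  by (rule gk2_has_derivative[OF that])
 from gk_bound_2[where 'a='a] obtain C where C: "C \<ge> 0" "!!s z a b::'a. s > 0 ==> \<bar>gk2 a b s z\<bar> \<le> C * (norm a * norm b) * s powr (- (real 2 / 2)) * gk (2 * s) z" by blast
 then show "\<exists>C\<ge>0. \<forall>s>0. \<forall>z::'a. \<bar>gk2 a b s z\<bar> \<le> C * s powr (- (real 2 / 2)) * gk (2 * s) z"
  by (intro exI[of _ "C * (norm a * norm b)"]) auto
 from gk_bound_3[where 'a='a] obtain C where C: "C \<ge> 0" "!!s z a b c::'a. s > 0 ==> \<bar>gk3 a b c s z\<bar> \<le> C * (norm a * norm b * norm c) * s powr (- (real 3 / 2)) * gk (2 * s) z" by blast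
 have "\<bar>gk3 a b v s z\<bar> \<le> C * (norm a * norm b) * norm v * s powr (- ((real 2 + 1) / 2)) * gk (2 * s) z" if "s > 0" for s and z v :: 'a
  using C(2)[OF that, of a b v z] by (simp add: mult_ac)
 with C(1) show "\<exists>C\<ge>0. \<forall>s>0. \<forall>z v::'a. \<bar>gk3 a b v s z\<bar> \<le> C * norm v * s powr (- ((real 2 + 1) / 2)) * gk (2 * s) z"
  by (intro exI[of _ "C * (norm a * norm b)"]) auto
qed measurable

lemma gkernel_gk3: "gkernel 3 (gk3 a b (c::'a::euclidean_space)) (%s z v. gk4 a b c v s z)"
 unfolding gkernel_def
proof (intro conjI allI impI)
 show "(gk3 a b c s has_derivative (%v. gk4 a b c v s z)) (at z)" if "s > 0" for s and z :: 'a
  by (rule gk3_has_derivative[OF that])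
 from gk_bound_3[where 'a='a] obtain C where C: "C \<ge> 0" "!!s z a b c::'a. s > 0 ==> \<bar>gk3 a b c s z\<bar> \<le> C * (norm a * norm b * norm c) * s powr (- (real 3 / 2)) * gk (2 * s) z" by blast
 then show "\<exists>C\<ge>0. \<forall>s>0. \<forall>z::'a. \<bar>gk3 a b c s z\<bar> \<le> C * s powr (- (real 3 / 2)) * gk (2 * s) z"
  by (intro exI[of _ "C * (norm a * norm b * norm c)"]) auto
 from gk_bound_4[where 'a='a] obtain C where C: "C \<ge> 0" "!!s z a b c e::'a. s > 0 ==> \<bar>gk4 a b c e s z\<bar> \<le> C * (norm a * norm b * norm c * norm e) * s powr (- (real 4 / 2)) * gk (2 * s) z" by blast
 have "\<bar>gk4 a b c v s z\<bar> \<le> C * (norm a * norm b * norm c) * norm v * s powr (- ((real 3 + 1) / 2)) * gk (2 * s) z" if "s > 0" for s and z v :: 'a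
  using C(2)[OF that, of a b c v z] by (simp add: mult_ac)
 with C(1) show "\<exists>C\<ge>0. \<forall>s>0. \<forall>z v::'a. \<bar>gk4 a b c v s z\<bar> \<le> C * norm v * s powr (- ((real 3 + 1) / 2)) * gk (2 * s) z"
  by (intro exI[of _ "C * (norm a * norm b * norm c)"]) auto
 show "(%(s, z). gk4 a b c v s z) \<in> borel_measurable (borel \<Otimes>\<^sub>M borel)" for v
  unfolding gk4_def by measurable
qed measurable

lemma gkernelE:
 assumes "gkernel m f f'"
 obtains C where "C > 0"
  "!!s z. s > 0 ==> \<bar>f s z\<bar> \<le> C * s powr (- (real m / 2)) * gk (2 * s) z"
  "!!s z v. s > 0 ==> \<bar>f' s z v\<bar> \<le> C * norm v * s powr (- ((real m + 1) / 2)) * gk (2 * s) z"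
proof -
 from assms obtain C D where C: "C \<ge> 0" "!!s z. s > 0 ==> \<bar>f s z\<bar> \<le> C * s powr (- (real m / 2)) * gk (2 * s) z"
  and D: "D \<ge> 0" "!!s z v. s > 0 ==> \<bar>f' s z v\<bar> \<le> D * norm v * s powr (- ((real m + 1) / 2)) * gk (2 * s) z"
  unfolding gkernel_def by blast
 have "\<bar>f s z\<bar> \<le> (C + D + 1) * s powr (- (real m / 2)) * gk (2 * s) z" if "s > 0" for s z
  by (rule order_trans[OF C(2)[OF that]]) (intro mult_right_mono; use C(1) D(1) in simp)
 moreover have "\<bar>f' s z v\<bar> \<le> (C + D + 1) * norm v * s powr (- ((real m + 1) / 2)) * gk (2 * s) z" if "s > 0" for s z v
  by (rule order_trans[OF D(2)[OF that]]) (intro mult_right_mono; use C(1) D(1) in simp)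
 ultimately show ?thesis using that[of "C + D + 1"] C D by auto
qed

lemma gkernel_measurable2:
 assumes "gkernel m f f'" and [measurable]: "g \<in> borel_measurable M" "h \<in> borel_measurable M"
 shows "(%x. f (g x) (h x)) \<in> borel_measurable M" "(%x. f' (g x) (h x) v) \<in> borel_measurable M"
proof -
 from assms have *[measurable]: "(%(s, z). f s z) \<in> borel_measurable (borel \<Otimes>\<^sub>M borel)"
  "(%(s, z). f' s z v) \<in> borel_measurable (borel \<Otimes>\<^sub>M borel)"
  by (auto simp: gkernel_def)
 have "(%x. (%(s, z). f s z) (g x, h x)) \<in> borel_measurable M"
  "(%x. (%(s, z). f' s z v) (g x, h x)) \<in> borel_measurable M" by measurable
 then show "(%x. f (g x) (h x)) \<in> borel_measurable M" "(%x. f' (g x) (h x) v) \<in> borel_measurable M" by simp_all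
qed

lemma gkernel_derivative:
 "gkernel m f f' ==> s > 0 ==> (f s has_derivative f' s z) (at z)"
 by (simp add: gkernel_def)

lemma gk_le_at_0: "s > 0 ==> gk s (z::'a::euclidean_space) \<le> gk s (0::'a)"
 unfolding gk_def by (intro mult_left_mono) auto

lemma gk_antimono: "norm (w::'a::euclidean_space) \<le> norm (z::'a) ==> s > 0 ==> gk s z \<le> gk s w"
 unfolding gk_def by (intro mult_left_mono) (auto simp: divide_right_mono power_mono)

lemma gkernel_integrable:
 fixes f :: "real \<Rightarrow> 'a::euclidean_space \<Rightarrow> real"
 assumes g: "gkernel m f f'" and "s > 0"
 shows "integrable lborel (f s)" "integrable lborel (%z. f' s z v)"
proof -
 note [measurable] = gkernel_measurable2[OF g]
 from g obtain C where C: "C > 0"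
  "!!s z. s > 0 ==> \<bar>f s z\<bar> \<le> C * s powr (- (real m / 2)) * gk (2 * s) z"
  "!!s z v. s > 0 ==> \<bar>f' s z v\<bar> \<le> C * norm v * s powr (- ((real m + 1) / 2)) * gk (2 * s) z"
  by (rule gkernelE) auto
 show "integrable lborel (f s)"
  by (rule Bochner_Integration.integrable_bound[of _ "%z. C * s powr (- (real m / 2)) * gk (2 * s) z"])
   (use C(2)[OF assms(2)] gk_integral[of "2 * s"] assms(2) C(1) in \<open>auto simp: abs_mult\<close>)
 show "integrable lborel (%z. f' s z v)"
  by (rule Bochner_Integration.integrable_bound[of _ "%z. C * norm v * s powr (- ((real m + 1) / 2)) * gk (2 * s) z"])
   (use C(3)[OF assms(2)] gk_integral[of "2 * s"] assms(2) C(1) in \<open>auto simp: abs_mult\<close>)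
qed

lemma gkernel_L1:
 fixes f :: "real \<Rightarrow> 'a::euclidean_space \<Rightarrow> real"
 assumes "gkernel m f f'"
 obtains C where "C > 0" "!!s. s > 0 ==> (LINT z|lborel. \<bar>f s z\<bar>) \<le> C * s powr (- (real m / 2))"
proof -
 from assms obtain C where C: "C > 0"
  "!!s z. s > 0 ==> \<bar>f s z\<bar> \<le> C * s powr (- (real m / 2)) * gk (2 * s) z"
  by (rule gkernelE) auto
 have "(LINT z|lborel. \<bar>f s z\<bar>) \<le> C * s powr (- (real m / 2))" if s: "s > 0" for s
 proof -
  have "(LINT z|lborel. \<bar>f s z\<bar>) \<le> (LINT z|lborel. C * s powr (- (real m / 2)) * gk (2 * s) (z::'a))"
   using C(2)[OF s] gkernel_integrable(1)[OF assms s] gk_integral[of "2 * s"] s by (intro integral_mono) auto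
  then show ?thesis using gk_integral(2)[of "2 * s", where 'a='a] s by simp
 qed
 with C(1) that show ?thesis by blast
qed

lemma conv_integrable:
 fixes k g :: "'a::euclidean_space \<Rightarrow> real"
 assumes [measurable]: "k \<in> borel_measurable borel"
  and "!!z. \<bar>k z\<bar> \<le> B" and g: "integrable lborel g"
 shows "integrable lborel (%y. k (x - y) * g y)"
proof -
 have [measurable]: "g \<in> borel_measurable borel" using borel_measurable_integrable[OF g] by simp
 show ?thesis
 proof (rule Bochner_Integration.integrable_bound[of _ "%y. B * g y"])
  have "0 \<le> B" using assms(2)[of 0] by linarith
  then show "AE y in lborel. norm (k (x - y) * g y) \<le> norm (B * g y)"
   using assms(2) by (intro AE_I2) (auto simp: abs_mult intro!: mult_right_mono)
 qed (use g in auto)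
qed

lemma conv_integrable':
 fixes k g :: "'a::euclidean_space \<Rightarrow> real"
 assumes [measurable]: "g \<in> borel_measurable borel"
  and "!!z. \<bar>g z\<bar> \<le> B" and k: "integrable lborel k"
 shows "integrable lborel (%y. k (x - y) * g y)"
proof -
 have [measurable]: "k \<in> borel_measurable borel" using borel_measurable_integrable[OF k] by simp
 have "integrable lborel (%y. g (x - y) * k y)"
  by (rule conv_integrable[OF _ assms(2) k]) simp
 then show ?thesis
  using lborel_reflect(1)[of "%y. g (x - y) * k y" x] by (simp add: mult.commute)
qed

lemma gkernel_bounded:
 fixes f :: "real \<Rightarrow> 'a::euclidean_space \<Rightarrow> real"
 assumes "gkernel m f f'" "s > 0"
 obtains B where "!!z. \<bar>f s z\<bar> \<le> B" "!!z v. \<bar>f' s z v\<bar> \<le> B * norm v" "B > 0"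
proof -
 from assms(1) obtain C where C: "C > 0"
  "!!s z. s > 0 ==> \<bar>f s z\<bar> \<le> C * s powr (- (real m / 2)) * gk (2 * s) z"
  "!!s z v. s > 0 ==> \<bar>f' s z v\<bar> \<le> C * norm v * s powr (- ((real m + 1) / 2)) * gk (2 * s) z"
  by (rule gkernelE) auto
 let ?A = "C * s powr (- (real m / 2)) * gk (2 * s) (0::'a)" and ?B = "C * s powr (- ((real m + 1) / 2)) * gk (2 * s) (0::'a)"
 have A: "?A > 0" "?B > 0" using C(1) assms(2) by (auto intro!: mult_pos_pos gk_pos)
 have "\<bar>f s z\<bar> \<le> ?A + ?B" for z
 proof -
  have "\<bar>f s z\<bar> \<le> ?A"
   by (rule order_trans[OF C(2)[OF assms(2)]]) (use C(1) assms(2) in \<open>auto intro!: mult_left_mono gk_le_at_0\<close>)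
  then show ?thesis using A by linarith
 qed
 moreover have "\<bar>f' s z v\<bar> \<le> (?A + ?B) * norm v" for z v
 proof -
  have "\<bar>f' s z v\<bar> \<le> C * norm v * s powr (- ((real m + 1) / 2)) * gk (2 * s) (0::'a)"
   by (rule order_trans[OF C(3)[OF assms(2)]]) (use C(1) assms(2) in \<open>auto intro!: mult_left_mono gk_le_at_0\<close>)
  also have "\<dots> = ?B * norm v" by simp
  also have "\<dots> \<le> (?A + ?B) * norm v" using A by (intro mult_right_mono) auto
  finally show ?thesis .
 qed
 ultimately show ?thesis using that[of "?A + ?B"] A by simp
qed

lemma gkernel_conv_has_derivative:
 fixes g :: "'a::euclidean_space \<Rightarrow> real"
 assumes k: "gkernel m f f'" and s: "s > 0" and g: "integrable lborel g"
 shows "((%x. LINT y|lborel. f s (x - y) * g y) has_derivative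
  (%v. LINT y|lborel. f' s (x - y) v * g y)) (at x)"
proof -
 note [measurable] = gkernel_measurable2[OF k]
 have [measurable]: "g \<in> borel_measurable borel" using borel_measurable_integrable[OF g] by simp
 from gkernel_bounded[OF k s] obtain B where B: "!!z. \<bar>f s z\<bar> \<le> B" "!!z v. \<bar>f' s z v\<bar> \<le> B * norm v" "B > 0" by metis
 show ?thesis
 proof (rule has_derivative_lebesgue_integral[of UNIV x _ _ _ "%y. B * \<bar>g y\<bar>"])
  fix x y :: 'a
  have "((%x. f s (x - y)) has_derivative f' s (x - y)) (at x)"
  proof -
   have "((%x. x - y) has_derivative (%v. v)) (at x)" by (auto intro!: derivative_eq_intros)
   from has_derivative_compose[OF this gkernel_derivative[OF k s]] show ?thesis by simp
  qed
  from has_derivative_mult_left[OF this, of "g y"]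
  show "((%x. f s (x - y) * g y) has_derivative (%v. f' s (x - y) v * g y)) (at x)" .
  show "\<bar>f' s (x - y) v * g y\<bar> \<le> norm v * (B * \<bar>g y\<bar>)" for v
   using mult_right_mono[OF B(2)[of "x - y" v], of "\<bar>g y\<bar>"] by (simp add: abs_mult mult_ac)
  show "integrable lborel (%y. f s (x - y) * g y)"
   by (rule conv_integrable[OF _ B(1) g]) measurable
 qed (use g in auto)
qed

lemma gkernel_conv_derivative_eq:
 fixes g :: "'a::euclidean_space \<Rightarrow> real"
 assumes "gkernel m f f'" "s > 0" "integrable lborel g"
  and "!!x. (LINT y|lborel. f s (x - y) * g y) = h x" "(h has_derivative h') (at x)"
 shows "(LINT y|lborel. f' s (x - y) v * g y) = h' v"
 using has_derivative_unique[OF gkernel_conv_has_derivative[OF assms(1-3), of x, unfolded assms(4)] assms(5)]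
 by metis

text \<open>Completing the square: as a function of y the product of the two Gaussians is
  \<open>gk (s + t) x\<close> times a heat kernel of time s t / (s + t) centred at t x / (s + t),
  which has mass one.\<close>

lemma gk_conv_gk:
 fixes x :: "'a::euclidean_space"
 assumes s: "s > 0" and t: "t > 0"
 shows "(LINT y|lborel. gk s (x - y) * gk t y) = gk (s + t) x"
proof -
 let ?r = "s * t / (s + t)" and ?c = "- (t / (s + t)) *\<^sub>R x"
 have e: "gk s (x - y) * gk t y = gk (s + t) x * gk ?r (y + ?c)" for y
 proof -
  have 1: "(4 * pi * s) powr (- real DIM('a) / 2) * (4 * pi * t) powr (- real DIM('a) / 2)
   = (4 * pi * (s + t)) powr (- real DIM('a) / 2) * (4 * pi * ?r) powr (- real DIM('a) / 2)"
  proof -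
   have "(4 * pi * s) * (4 * pi * t) = (4 * pi * (s + t)) * (4 * pi * ?r)" using s t by simp
   then show ?thesis by (simp only: powr_mult[symmetric])
  qed
  have n: "(norm (x - y))\<^sup>2 = x \<bullet> x - 2 * (x \<bullet> y) + y \<bullet> y"
   "(norm (y + ?c))\<^sup>2 = y \<bullet> y - 2 * (t / (s + t)) * (x \<bullet> y) + (t / (s + t))\<^sup>2 * (x \<bullet> x)"
   unfolding power2_norm_eq_inner by (simp_all add: inner_simps inner_commute algebra_simps power2_eq_square)
  have "- (norm (x - y))\<^sup>2 / (4 * s) + - (norm y)\<^sup>2 / (4 * t) =
   - (norm x)\<^sup>2 / (4 * (s + t)) + - (norm (y + ?c))\<^sup>2 / (4 * ?r)"
   unfolding n unfolding power2_norm_eq_inner using s t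
   by (simp add: divide_simps) (simp add: algebra_simps power2_eq_square)
  then have 2: "exp (- (norm (x - y))\<^sup>2 / (4 * s)) * exp (- (norm y)\<^sup>2 / (4 * t)) =
   exp (- (norm x)\<^sup>2 / (4 * (s + t))) * exp (- (norm (y + ?c))\<^sup>2 / (4 * ?r))"
   by (simp only: exp_add[symmetric])
  show ?thesis unfolding gk_def using arg_cong2[OF 1 2, of "(*)"] by (simp only: mult_ac)
 qed
 have "(LINT y|lborel. gk ?r (y + ?c)) = 1"
  using gk_integral(2)[of ?r, where 'a='a] s t by (subst lborel_shift(2)) auto
 then show ?thesis unfolding e by simp
qed

lemma conv_commute:
 fixes f g :: "'a::euclidean_space \<Rightarrow> real"
 assumes [measurable]: "f \<in> borel_measurable borel" "g \<in> borel_measurable borel"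
 shows "(LINT y|lborel. f (x - y) * g y) = (LINT y|lborel. g (x - y) * f y)"
 by (subst lborel_reflect(2)[of "%y. f (x - y) * g y" x, symmetric]) (auto simp: mult.commute)

text \<open>All five follow from the semigroup law by differentiating in x, the value being
  identified by uniqueness of the derivative. When the derivative should fall on the other factor,
  the convolution is commuted first.\<close>

lemma gk_conv:
 fixes x :: "'a::euclidean_space"
 assumes s: "s > 0" and t: "t > 0"
 shows gk1_conv_gk: "(LINT y|lborel. gk1 a s (x - y) * gk t y) = gk1 a (s + t) x"
  and gk2_conv_gk: "(LINT y|lborel. gk2 a b s (x - y) * gk t y) = gk2 a b (s + t) x"
  and gk_conv_gk2: "(LINT y|lborel. gk s (x - y) * gk2 a b t y) = gk2 a b (s + t) x"
  and gk2_conv_gk1: "(LINT y|lborel. gk2 a b s (x - y) * gk1 c t y) = gk3 a b c (s + t) x"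
  and gk1_conv_gk2: "(LINT y|lborel. gk1 c s (x - y) * gk2 a b t y) = gk3 a b c (s + t) x"
proof -
 have st: "s + t > 0" if "s > 0" "t > 0" for s t :: real using that by simp
 have 1: "(LINT y|lborel. gk1 a s (x - y) * gk t y) = gk1 a (s + t) x" if "s > 0" "t > 0" for s t a and x :: 'a
  by (rule gkernel_conv_derivative_eq[OF gkernel_gk \<open>s > 0\<close> gk_integral(1)[OF \<open>t > 0\<close>]])
   (rule gk_conv_gk[OF that], rule gk_has_derivative[OF st[OF that]])
 have 2: "(LINT y|lborel. gk2 a b s (x - y) * gk t y) = gk2 a b (s + t) x" if "s > 0" "t > 0" for s t a b and x :: 'a
  by (rule gkernel_conv_derivative_eq[OF gkernel_gk1 \<open>s > 0\<close> gk_integral(1)[OF \<open>t > 0\<close>]])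
   (rule 1[OF that], rule gk1_has_derivative[OF st[OF that]])
 have 3: "(LINT y|lborel. gk s (x - y) * gk1 a t y) = gk1 a (s + t) x" if "s > 0" "t > 0" for s t a and x :: 'a
  using 1[OF that(2,1), of a x] by (subst conv_commute) (auto simp: add.commute)
 have 4: "(LINT y|lborel. gk1 b s (x - y) * gk1 a t y) = gk2 a b (s + t) x" if "s > 0" "t > 0" for s t a b and x :: 'a
  by (rule gkernel_conv_derivative_eq[OF gkernel_gk \<open>s > 0\<close> gkernel_integrable(1)[OF gkernel_gk1 \<open>t > 0\<close>]])
   (rule 3[OF that], rule gk1_has_derivative[OF st[OF that]])
 have sym: "gk2 a b = gk2 b a" "gk3 c a b = gk3 a b c" for a b c :: 'a
  unfolding gk2_def gk3_def by (auto simp: fun_eq_iff inner_commute algebra_simps)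
 have 5: "(LINT y|lborel. gk2 a b s (x - y) * gk1 c t y) = gk3 a b c (s + t) x" if "s > 0" "t > 0" for s t a b c and x :: 'a
  by (subst sym(2)[symmetric], rule gkernel_conv_derivative_eq[OF gkernel_gk1 \<open>s > 0\<close> gkernel_integrable(1)[OF gkernel_gk1 \<open>t > 0\<close>]])
   (rule 4[OF that], rule gk2_has_derivative[OF st[OF that]])
 show "(LINT y|lborel. gk1 a s (x - y) * gk t y) = gk1 a (s + t) x" by (rule 1[OF s t])
 show "(LINT y|lborel. gk2 a b s (x - y) * gk t y) = gk2 a b (s + t) x" by (rule 2[OF s t])
 show "(LINT y|lborel. gk s (x - y) * gk2 a b t y) = gk2 a b (s + t) x"
  using 2[OF t s, of a b x] by (subst conv_commute) (auto simp: add.commute)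
 show "(LINT y|lborel. gk2 a b s (x - y) * gk1 c t y) = gk3 a b c (s + t) x" by (rule 5[OF s t])
 show "(LINT y|lborel. gk1 c s (x - y) * gk2 a b t y) = gk3 a b c (s + t) x"
  using 5[OF t s, of a b x c] by (subst conv_commute) (auto simp: add.commute)
qed

lemma gkernel_mean_value:
 fixes f :: "real \<Rightarrow> 'a::euclidean_space \<Rightarrow> real"
 assumes "gkernel m f f'" "s > 0"
  and "!!z. z \<in> closed_segment x y ==> (!!v. \<bar>f' s z v\<bar> \<le> B * norm v)"
 shows "\<bar>f s y - f s x\<bar> \<le> B * norm (y - x)"
proof -
 have "norm (f s y - f s x) \<le> B * norm (y - x)"
 proof (rule differentiable_bound[of "closed_segment x y" _ "f' s"])
  show "(f s has_derivative f' s z) (at z within closed_segment x y)" if "z \<in> closed_segment x y" for z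
   by (rule has_derivative_at_withinI, rule gkernel_derivative[OF assms(1,2)])
  show "onorm (f' s z) \<le> B" if "z \<in> closed_segment x y" for z
   by (rule onorm_le) (use assms(3)[OF that] in simp)
 qed auto
 then show ?thesis by simp
qed

text \<open>The segment from x to x - y stays outside the ball of radius |x|/2, so along it the
  Gaussian in the derivative bound is at most its value at x/2.\<close>

lemma gkernel_near:
 fixes f :: "real \<Rightarrow> 'a::euclidean_space \<Rightarrow> real"
 assumes k: "gkernel m f f'"
  and C: "!!s z v. s > 0 ==> \<bar>f' s z v\<bar> \<le> C * norm v * s powr (- ((real m + 1) / 2)) * gk (2 * s) z" "C > 0"
  and s: "s > 0" and y: "norm y \<le> norm x / 2"
 shows "\<bar>f s (x - y) - f s x\<bar> \<le> C * s powr (- ((real m + 1) / 2)) * gk (2 * s) (x /\<^sub>R 2) * norm y"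
proof -
 have "\<bar>f s (x - y) - f s x\<bar> \<le> C * s powr (- ((real m + 1) / 2)) * gk (2 * s) (x /\<^sub>R 2) * norm (x - y - x)"
 proof (rule gkernel_mean_value[OF k s])
  fix z v :: 'a assume z: "z \<in> closed_segment x (x - y)"
  then obtain u where u: "0 \<le> u" "u \<le> 1" "z = x - u *\<^sub>R y"
   by (auto simp: closed_segment_def algebra_simps)
  have "u * norm y \<le> 1 * norm y" using u by (intro mult_right_mono) auto
  then have "norm (x /\<^sub>R 2) \<le> norm z"
   using y u norm_triangle_ineq2[of x "u *\<^sub>R y"] by simp
  then have "gk (2 * s) z \<le> gk (2 * s) (x /\<^sub>R 2)"
   using s by (intro gk_antimono) auto
  then have "C * norm v * s powr (- ((real m + 1) / 2)) * gk (2 * s) z \<le> C * norm v * s powr (- ((real m + 1) / 2)) * gk (2 * s) (x /\<^sub>R 2)"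
   using C by (intro mult_left_mono) auto
  with C(1)[OF s, of z v] show "\<bar>f' s z v\<bar> \<le> C * s powr (- ((real m + 1) / 2)) * gk (2 * s) (x /\<^sub>R 2) * norm v"
   by (simp add: mult_ac)
 qed
 then show ?thesis by simp
qed

text \<open>A shift by at most sqrt s costs only a constant and one more doubling of the time,
  because |z|^2 <= 2 |w|^2 + 2 s.\<close>

lemma gk_shift_le:
 fixes z w :: "'a::euclidean_space"
 assumes s: "s > 0" and h: "(norm (z - w))\<^sup>2 \<le> s"
 shows "gk (2 * s) w \<le> 2 powr (real DIM('a) / 2) * exp (1 / 8) * gk (4 * s) z"
proof -
 have "(norm z)\<^sup>2 \<le> (norm w + norm (z - w))\<^sup>2"
  using norm_triangle_sub[of z w] by (intro power_mono) auto
 also have "\<dots> \<le> 2 * (norm w)\<^sup>2 + 2 * (norm (z - w))\<^sup>2"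
  using zero_le_power2[of "norm w - norm (z - w)"] by (simp add: power2_eq_square algebra_simps)
 also have "\<dots> \<le> 2 * (norm w)\<^sup>2 + 2 * s" using h by simp
 finally have "- (norm w)\<^sup>2 / (4 * (2 * s)) \<le> 1 / 8 + - (norm z)\<^sup>2 / (4 * (4 * s))"
  using s by (simp add: field_simps)
 then have "exp (- (norm w)\<^sup>2 / (4 * (2 * s))) \<le> exp (1 / 8) * exp (- (norm z)\<^sup>2 / (4 * (4 * s)))"
  by (simp flip: exp_add)
 moreover have "(4 * pi * (2 * s)) powr (- real DIM('a) / 2) = 2 powr (real DIM('a) / 2) * (4 * pi * (4 * s)) powr (- real DIM('a) / 2)"
 proof -
  have "4 * pi * (4 * s) = 2 * (4 * pi * (2 * s))" by simp
  then show ?thesis using s by (simp only: powr_mult powr_minus) (simp add: powr_minus field_simps)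
 qed
 ultimately have "gk (2 * s) w \<le> (2 powr (real DIM('a) / 2) * (4 * pi * (4 * s)) powr (- real DIM('a) / 2))
  * (exp (1 / 8) * exp (- (norm z)\<^sup>2 / (4 * (4 * s))))"
  unfolding gk_def by (simp add: mult_left_mono)
 then show ?thesis by (simp add: gk_def mult_ac)
qed

text \<open>The L1 norm of the difference is at most twice that of the kernel, of order s^{-m/2},
  and by the mean value theorem at most of order |h| s^{-(m+1)/2}. The first bound is used for |h|^2
  > s and the second otherwise; both are dominated by their geometric mean. For m = 1 the result
  s^{-3/4} is integrable at s = 0, whereas the s^{-1} of a full derivative would not be.\<close>

lemma gkernel_holder:
 fixes f :: "real \<Rightarrow> 'a::euclidean_space \<Rightarrow> real"
 assumes k: "gkernel m f f'"
 obtains C where "C > 0" "!!s h. s > 0 ==>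
  (LINT z|lborel. \<bar>f s (z + h) - f s z\<bar>) \<le> C * sqrt (norm h) * s powr (- (real m / 2) - 1/4)"
proof -
 note [measurable] = gkernel_measurable2[OF k]
 from k obtain C where C: "C > 0"
  "!!s z. s > 0 ==> \<bar>f s z\<bar> \<le> C * s powr (- (real m / 2)) * gk (2 * s) z"
  "!!s z v. s > 0 ==> \<bar>f' s z v\<bar> \<le> C * norm v * s powr (- ((real m + 1) / 2)) * gk (2 * s) z"
  by (rule gkernelE) auto
 from gkernel_L1[OF k] obtain D where D: "D > 0" "!!s. s > 0 ==> (LINT z|lborel. \<bar>f s z\<bar>) \<le> D * s powr (- (real m / 2))" by auto
 let ?K = "2 powr (real DIM('a) / 2) * exp (1 / 8) :: real"
 have int: "integrable lborel (%z. f s (z + h))" if "s > 0" for s h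
  using gkernel_integrable(1)[OF k that] by (subst lborel_shift(1)) measurable
 have "(LINT z|lborel. \<bar>f s (z + h) - f s z\<bar>) \<le> (2 * D + C * ?K) * sqrt (norm h) * s powr (- (real m / 2) - 1/4)"
  if s: "s > 0" for s h
 proof (cases "(norm h)\<^sup>2 \<le> s")
  case False
  have "(LINT z|lborel. \<bar>f s (z + h) - f s z\<bar>) \<le> (LINT z|lborel. \<bar>f s (z + h)\<bar> + \<bar>f s z\<bar>)"
   using int[OF s] gkernel_integrable(1)[OF k s] by (intro integral_mono) auto
  also have "\<dots> = (LINT z|lborel. \<bar>f s z\<bar>) + (LINT z|lborel. \<bar>f s z\<bar>)"
   using int[OF s] gkernel_integrable(1)[OF k s] lborel_shift(2)[of "%z. \<bar>f s z\<bar>" h] by simp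
  also have "\<dots> \<le> 2 * D * s powr (- (real m / 2))" using D(2)[OF s] by simp
  also have "\<dots> \<le> 2 * D * (s powr (- (real m / 2)) * (sqrt (norm h) * s powr (- 1/4)))"
  proof -
   have "s powr (1/4) \<le> (norm h)\<^sup>2 powr (1/4)" using False s by (intro powr_mono2) auto
   also have "\<dots> = sqrt (norm h)" by (cases "h = 0") (simp_all add: powr_powr powr_half_sqrt[symmetric] flip: powr_numeral)
   finally have "1 \<le> sqrt (norm h) * s powr (- 1/4)" using s by (simp add: powr_minus field_simps)
   then show ?thesis using D(1) by (intro mult_left_mono) (auto simp: mult_le_cancel_left1)
  qed
  also have "\<dots> = 2 * D * (sqrt (norm h) * s powr (- (real m / 2) - 1/4))"
   using powr_add[of s "- (real m / 2)" "- 1/4"] by simp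
  also have "\<dots> \<le> (2 * D + C * ?K) * (sqrt (norm h) * s powr (- (real m / 2) - 1/4))"
   using C(1) by (intro mult_right_mono) auto
  finally show ?thesis by (simp add: mult_ac)
 next
  case True
  have pw: "\<bar>f s (z + h) - f s z\<bar> \<le> C * s powr (- ((real m + 1) / 2)) * (?K * gk (4 * s) z) * norm h" for z
  proof -
   have "\<bar>f s (z + h) - f s z\<bar> \<le> C * s powr (- ((real m + 1) / 2)) * (?K * gk (4 * s) z) * norm (z + h - z)"
   proof (rule gkernel_mean_value[OF k s])
    fix w v :: 'a assume "w \<in> closed_segment z (z + h)"
    then obtain u where u: "0 \<le> u" "u \<le> 1" "w = z + u *\<^sub>R h"
     by (auto simp: closed_segment_def algebra_simps)
    have "norm (z - w) \<le> norm h" using u by (simp add: mult_left_le_one_le)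
    then have "(norm (z - w))\<^sup>2 \<le> (norm h)\<^sup>2" by (intro power_mono) auto
    with True have "(norm (z - w))\<^sup>2 \<le> s" by linarith
    then have "gk (2 * s) w \<le> ?K * gk (4 * s) z"
     by (rule gk_shift_le[OF s])
    then have "C * norm v * s powr (- ((real m + 1) / 2)) * gk (2 * s) w
     \<le> C * norm v * s powr (- ((real m + 1) / 2)) * (?K * gk (4 * s) z)"
     using C(1) by (intro mult_left_mono) auto
    with C(3)[OF s, of w v] show "\<bar>f' s w v\<bar> \<le> C * s powr (- ((real m + 1) / 2)) * (?K * gk (4 * s) z) * norm v"
     by (simp add: mult_ac)
   qed
   then show ?thesis by simp
  qed
  have "(LINT z|lborel. \<bar>f s (z + h) - f s z\<bar>) \<le> (LINT z|lborel. C * s powr (- ((real m + 1) / 2)) * (?K * gk (4 * s) (z::'a)) * norm h)"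
   using pw int[OF s] gkernel_integrable(1)[OF k s] gk_integral(1)[of "4 * s", where 'a='a] s
   by (intro integral_mono) auto
  also have "\<dots> = C * ?K * (s powr (- ((real m + 1) / 2)) * norm h)"
   using gk_integral(2)[of "4 * s", where 'a='a] s by simp
  also have "\<dots> \<le> C * ?K * (sqrt (norm h) * s powr (- (real m / 2) - 1/4))"
  proof (intro mult_left_mono)
   have "sqrt (norm h) = (norm h)\<^sup>2 powr (1/4)"
    by (cases "h = 0") (simp_all add: powr_powr powr_half_sqrt[symmetric] flip: powr_numeral)
   also have "\<dots> \<le> s powr (1/4)" using True by (intro powr_mono2) auto
   finally have "sqrt (norm h) * sqrt (norm h) \<le> s powr (1/4) * sqrt (norm h)" by (intro mult_right_mono) auto
   then have "s powr (- ((real m + 1) / 2)) * norm h \<le> s powr (- ((real m + 1) / 2)) * (s powr (1/4) * sqrt (norm h))"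
    by (intro mult_left_mono) auto
   also have "\<dots> = sqrt (norm h) * s powr (- (real m / 2) - 1/4)"
   proof -
    have "- ((real m + 1) / 2) + 1 / 4 = - (real m / 2) - 1 / 4" by (simp add: field_simps)
    then have "s powr (- ((real m + 1) / 2)) * s powr (1/4) = s powr (- (real m / 2) - 1/4)"
     by (simp only: powr_add[symmetric])
    then show ?thesis by (metis mult.assoc mult.commute)
   qed
   finally show "s powr (- ((real m + 1) / 2)) * norm h \<le> sqrt (norm h) * s powr (- (real m / 2) - 1/4)" .
  qed (use C(1) in auto)
  also have "\<dots> \<le> (2 * D + C * ?K) * (sqrt (norm h) * s powr (- (real m / 2) - 1/4))"
   using D(1) by (intro mult_right_mono) auto
  finally show ?thesis by (simp add: mult_ac)
 qed
 moreover have "2 * D + C * ?K > 0" using C(1) D(1) by (auto intro: add_pos_pos)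
 ultimately show ?thesis using that by blast
qed

section \<open>Integration over intervals and half lines\<close>

text \<open>Integrals over a set are taken with respect to the restricted measure, so that
  \<open>integral_swap_bound\<close> and \<open>has_derivative_lebesgue_integral\<close> apply to
  them as they stand.\<close>

abbreviation lon :: "'a::euclidean_space set \<Rightarrow> 'a measure" where
 "lon A \<equiv> restrict_space lborel A"

lemma sigma_finite_lon: "A \<in> sets borel ==> sigma_finite_measure (lon A)"
 by (rule sigma_finite_measure_restrict_space) (auto intro: sigma_finite_lborel)

lemma lon_integrable: "A \<in> sets borel ==> integrable (lon A) (f::_\<Rightarrow>real) \<longleftrightarrow> set_integrable lborel A f"
 by (subst integrable_restrict_space) (auto simp: set_integrable_def)

lemma lon_integral: "A \<in> sets borel ==> (LINT s|lon A. (f s::real)) = (LINT s:A|lborel. f s)"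
 by (subst integral_restrict_space) (auto simp: set_lebesgue_integral_def)

lemma lon_measurable: "f \<in> borel_measurable borel ==> f \<in> borel_measurable (lon A)"
 by (rule measurable_restrict_space1) simp

lemma lon_measurable_pair:
 assumes [measurable]: "(%(s, y). f s y) \<in> borel_measurable (borel \<Otimes>\<^sub>M borel)"
 shows "(%(s, y). f s y) \<in> borel_measurable (lon A \<Otimes>\<^sub>M lborel)"
  "(%(y, s). f s y) \<in> borel_measurable (lborel \<Otimes>\<^sub>M lon A)"
  "(%(s, y). f s y) \<in> borel_measurable (lon A \<Otimes>\<^sub>M lon B)"
proof -
 have i: "(%x. x) \<in> measurable (lon A) borel" for A :: "'z::euclidean_space set"
  by (rule lon_measurable) simp
 have [measurable]: "fst \<in> measurable (lon A \<Otimes>\<^sub>M N) borel" "snd \<in> measurable (N \<Otimes>\<^sub>M lon A) borel"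
  for A :: "'z::euclidean_space set" and N :: "'y measure"
  using measurable_compose[OF measurable_fst i] measurable_compose[OF measurable_snd i] by auto
 have "(%x. (%(s, y). f s y) (fst x, snd x)) \<in> borel_measurable (lon A \<Otimes>\<^sub>M lborel)"
  "(%x. (%(s, y). f s y) (snd x, fst x)) \<in> borel_measurable (lborel \<Otimes>\<^sub>M lon A)"
  "(%x. (%(s, y). f s y) (fst x, snd x)) \<in> borel_measurable (lon A \<Otimes>\<^sub>M lon B)"
  by measurable
 then show "(%(s, y). f s y) \<in> borel_measurable (lon A \<Otimes>\<^sub>M lborel)"
  "(%(y, s). f s y) \<in> borel_measurable (lborel \<Otimes>\<^sub>M lon A)"
  "(%(s, y). f s y) \<in> borel_measurable (lon A \<Otimes>\<^sub>M lon B)"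
  by (simp_all add: case_prod_beta')
qed

lemma set_integrable_nonneg_has_integral:
 fixes f :: "'a::euclidean_space \<Rightarrow> real"
 assumes "(f has_integral I) A" "!!x. x \<in> A ==> 0 \<le> f x" "A \<in> sets borel" "f \<in> borel_measurable borel"
 shows "integrable (lon A) f" "(LINT x|lon A. f x) = I"
proof -
 note [measurable] = assms(3,4)
 have "f absolutely_integrable_on A"
  using assms by (intro nonnegative_absolutely_integrable_1) auto
 then have s: "set_integrable lborel A f"
  unfolding set_integrable_def by (subst (asm) integrable_completion) auto
 then show "integrable (lon A) f" by (simp add: lon_integrable assms)
 show "(LINT x|lon A. f x) = I"
  using set_borel_integral_eq_integral(2)[OF s] assms by (simp add: lon_integral integral_unique)
qed

lemma powr_integral_0:
 fixes a t :: real
 assumes "a < 1" "t \<ge> 0"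
 shows "integrable (lon {0<..t}) (%s. s powr (- a))" "(LINT s|lon {0<..t}. s powr (- a)) = t powr (1 - a) / (1 - a)"
proof -
 have "((%s. s powr (- a)) has_integral t powr (1 - a) / (1 - a)) {0..t}"
  using has_integral_powr_from_0[of "-a" t] assms by (simp add: add.commute)
 then have "((%s. s powr (- a)) has_integral t powr (1 - a) / (1 - a)) {0<..t}"
  by (subst (asm) has_integral_spike_set_eq[of _ "{0<..t}"]) (auto intro: negligible_subset[of "{0}"])
 from set_integrable_nonneg_has_integral[OF this]
 show "integrable (lon {0<..t}) (%s. s powr (- a))" "(LINT s|lon {0<..t}. s powr (- a)) = t powr (1 - a) / (1 - a)"
  by auto
qed

lemma powr_integral_inf:
 fixes a t :: real
 assumes "a > 1" "t > 0"
 shows "integrable (lon {t<..}) (%s. s powr (- a))" "(LINT s|lon {t<..}. s powr (- a)) = t powr (1 - a) / (a - 1)"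
proof -
 have eq: "- (t powr (1 - a) / (1 - a)) = t powr (1 - a) / (a - 1)"
  using assms by (simp add: field_simps)
 have "((%s. s powr (- a)) has_integral t powr (1 - a) / (a - 1)) {t..}"
  using has_integral_powr_to_inf[of "-a" t] assms by (simp add: add.commute eq)
 then have "((%s. s powr (- a)) has_integral t powr (1 - a) / (a - 1)) {t<..}"
  by (subst (asm) has_integral_spike_set_eq[of _ "{t<..}"]) (auto intro: negligible_subset[of "{t}"])
 from set_integrable_nonneg_has_integral[OF this]
 show "integrable (lon {t<..}) (%s. s powr (- a))" "(LINT s|lon {t<..}. s powr (- a)) = t powr (1 - a) / (a - 1)"
  by auto
qed

text \<open>The integral of f (x + h) over x is independent of h; differentiating under the integral
  at h = 0 gives the claim. The bound on shifts shorter than \<open>\<delta>\<close> is the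
  domination that this requires.\<close>

lemma integral_derivative_eq_0:
 fixes f :: "'a::euclidean_space \<Rightarrow> real"
 assumes d: "!!x. (f has_derivative f' x) (at x)" and f: "integrable lborel f"
  and m: "!!v. (%x. f' x v) \<in> borel_measurable borel"
  and \<delta>: "\<delta> > 0" and b: "!!x h v. norm h < \<delta> ==> \<bar>f' (x + h) v\<bar> \<le> norm v * g x" and g: "integrable lborel g"
 shows "(LINT x|lborel. f' x v) = 0"
proof -
 have fm: "f \<in> borel_measurable borel" using borel_measurable_integrable[OF f] by simp
 have "((%h. LINT x|lborel. f (x + h)) has_derivative (%v. LINT x|lborel. f' (x + 0) v)) (at 0 within ball 0 \<delta>)"
 proof (rule has_derivative_lebesgue_integral[of "ball 0 \<delta>" 0 lborel "%h x. f (x + h)" "%h x. f' (x + h)", OF _ _ _ _ g])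
  fix h x :: 'a
  have "((%h. x + h) has_derivative (%v. v)) (at h within ball 0 \<delta>)" by (auto intro!: derivative_eq_intros)
  from has_derivative_compose[OF this d]
  show "((%h. f (x + h)) has_derivative f' (x + h)) (at h within ball 0 \<delta>)" .
 next
  fix h x v :: 'a assume "h \<in> ball 0 \<delta>"
  then show "\<bar>f' (x + h) v\<bar> \<le> norm v * g x" using b[of h x v] by simp
 next
  fix h :: 'a show "integrable lborel (%x. f (x + h))" using f lborel_shift(1)[OF fm] by simp
 qed (use \<delta> m in auto)
 then have "((%h::'a. LINT x|lborel. f x) has_derivative (%v. LINT x|lborel. f' x v)) (at 0 within ball 0 \<delta>)"
  using lborel_shift(2)[OF fm] by simp
 then have "((%h::'a. LINT x|lborel. f x) has_derivative (%v. LINT x|lborel. f' x v)) (at 0)"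
  by (subst (asm) at_within_open) (use \<delta> in auto)
 from has_derivative_unique[OF this has_derivative_const] show ?thesis by metis
qed

lemma gkernel_derivative_integral_0:
 fixes f :: "real \<Rightarrow> 'a::euclidean_space \<Rightarrow> real"
 assumes k: "gkernel m f f'" and s: "s > 0"
 shows "(LINT z|lborel. f' s z v) = 0"
proof -
 from k obtain C where C: "C > 0"
  "!!s z v. s > 0 ==> \<bar>f' s z v\<bar> \<le> C * norm v * s powr (- ((real m + 1) / 2)) * gk (2 * s) z"
  by (rule gkernelE) auto
 let ?K = "2 powr (real DIM('a) / 2) * exp (1 / 8) :: real"
 show ?thesis
 proof (rule integral_derivative_eq_0[where f = "f s" and f' = "f' s" and \<delta> = "sqrt s"
   and g = "%z. C * s powr (- ((real m + 1) / 2)) * (?K * gk (4 * s) z)"])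
  show "\<bar>f' s (x + h) v\<bar> \<le> norm v * (C * s powr (- ((real m + 1) / 2)) * (?K * gk (4 * s) x))"
   if "norm h < sqrt s" for x h v :: 'a
  proof -
   have "(norm h)\<^sup>2 \<le> (sqrt s)\<^sup>2" using that by (intro power_mono) auto
   then have "gk (2 * s) (x + h) \<le> ?K * gk (4 * s) x"
    using s by (intro gk_shift_le[OF s]) auto
   then have "C * norm v * s powr (- ((real m + 1) / 2)) * gk (2 * s) (x + h)
     \<le> C * norm v * s powr (- ((real m + 1) / 2)) * (?K * gk (4 * s) x)"
    using C(1) by (intro mult_left_mono) auto
   with C(2)[OF s, of "x + h" v] show ?thesis by (simp add: mult_ac)
  qed
  show "integrable lborel (%z::'a. C * s powr (- ((real m + 1) / 2)) * (?K * gk (4 * s) z))"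
   using gk_integral(1)[of "4 * s", where 'a='a] s by simp
 qed (use gkernel_derivative[OF k s] gkernel_integrable[OF k s] s in \<open>auto intro!: gkernel_measurable2(2)[OF k]\<close>)
qed

section \<open>The Newton kernel as a time integral of the heat kernel\<close>

lemma lon_nn_integral_eq:
 fixes f :: "'a::euclidean_space \<Rightarrow> real"
 assumes "A \<in> sets borel" "integrable (lon A) f" "!!x. x \<in> A ==> 0 \<le> f x"
 shows "(\<integral>\<^sup>+x. ennreal (f x) \<partial>lon A) = ennreal (LINT x|lon A. f x)"
 using assms by (intro nn_integral_eq_integral AE_I2) auto

text \<open>The integrand is minus the radial derivative of the heat kernel at radius
  \<open>\<rho>\<close>; its time integral is the reciprocal of the area of the sphere of that
  radius, which is the radial derivative of the Newton kernel. The constants match through Gamma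
  (d/2 + 1) = (d/2) Gamma (d/2).\<close>

lemma radial_kernel_integral:
 fixes e :: "'a::euclidean_space"
 assumes \<rho>: "\<rho> > 0" and e: "norm e = 1"
 shows "integrable (lon {0<..}) (%s. \<rho> / (2 * s) * gk s (\<rho> *\<^sub>R e))"
  and "(LINT s|lon {0<..}. \<rho> / (2 * s) * gk s (\<rho> *\<^sub>R e))
   = \<rho> powr (1 - real DIM('a)) / (real DIM('a) * unit_ball_vol (real DIM('a)))"
proof -
 let ?d = "real DIM('a)"
 have z: "\<rho> *\<^sub>R e \<noteq> 0" using assms by auto
 have q: "1 + ?d / 2 - 1 > 0" by simp
 have eq: "\<rho> / (2 * s) * gk s (\<rho> *\<^sub>R e) = (\<rho> / 2) * (s powr (- 1) * gk s (\<rho> *\<^sub>R e))" if "s > 0" for s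
  using that by (simp add: powr_minus divide_simps)
 have i: "integrable (lon {0<..}) (%s. (\<rho> / 2) * (s powr (- 1) * gk s (\<rho> *\<^sub>R e)))"
 proof (rule Bochner_Integration.integrable_mult_right)
  show "integrable (lon {0<..}) (%s. s powr (- 1) * gk s (\<rho> *\<^sub>R e))"
   using gk_time_integral(1)[OF z q] by (subst lon_integrable) auto
 qed
 show "integrable (lon {0<..}) (%s. \<rho> / (2 * s) * gk s (\<rho> *\<^sub>R e))"
  by (subst Bochner_Integration.integrable_cong[OF refl eq, OF _ ]) (use i in auto)
 have "(LINT s|lon {0<..}. \<rho> / (2 * s) * gk s (\<rho> *\<^sub>R e)) = (LINT s|lon {0<..}. (\<rho> / 2) * (s powr (- 1) * gk s (\<rho> *\<^sub>R e)))"
  by (intro Bochner_Integration.integral_cong refl) (use eq in auto)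
 also have "\<dots> = (\<rho> / 2) * ((4 * pi) powr (- ?d / 2) * Gamma (?d / 2) * (\<rho>\<^sup>2 / 4) powr (- (?d / 2)))"
 proof -
  have n: "norm (\<rho> *\<^sub>R e) = \<rho>" "1 + ?d / 2 - 1 = ?d / 2" using e \<rho> by auto
  have "(LINT s|lon {0<..}. s powr (- 1) * gk s (\<rho> *\<^sub>R e)) =
   (4 * pi) powr (- ?d / 2) * Gamma (?d / 2) * (\<rho>\<^sup>2 / 4) powr (- (?d / 2))"
   using gk_time_integral(2)[OF z q] unfolding n by (subst lon_integral) (simp, simp only:)
  then show ?thesis by (simp only: Bochner_Integration.integral_mult_right_zero)
 qed
 also have "(4 * pi) powr (- ?d / 2) * Gamma (?d / 2) * (\<rho>\<^sup>2 / 4) powr (- (?d / 2))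
   = Gamma (?d / 2) * (pi powr (- (?d / 2)) * \<rho> powr (- ?d))"
 proof -
  have "(4 * pi) * (\<rho>\<^sup>2 / 4) = pi * \<rho>\<^sup>2" by simp
  moreover have "(\<rho>\<^sup>2) powr (- (?d / 2)) = \<rho> powr (- ?d)"
   using \<rho> by (simp add: powr_powr flip: powr_numeral)
  ultimately have "(4 * pi) powr (- (?d / 2)) * (\<rho>\<^sup>2 / 4) powr (- (?d / 2)) = pi powr (- (?d / 2)) * \<rho> powr (- ?d)"
   by (simp only: powr_mult[symmetric]) (simp add: powr_mult)
  then show ?thesis by (simp add: mult_ac)
 qed
 also have "(\<rho> / 2) * (Gamma (?d / 2) * (pi powr (- (?d / 2)) * \<rho> powr (- ?d)))
  = \<rho> powr (1 - ?d) / (?d * unit_ball_vol ?d)"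
 proof -
  have G: "Gamma (?d / 2 + 1) = ?d / 2 * Gamma (?d / 2)"
   by (rule Gamma_plus1) (auto dest: nonpos_Ints_nonpos)
  have "Gamma (?d / 2) > 0" by simp
  moreover have "\<rho> powr (1 - ?d) = \<rho> * \<rho> powr (- ?d)" using \<rho> by (simp add: powr_diff powr_minus field_simps)
  ultimately show ?thesis
   unfolding unit_ball_vol_def G by (simp add: powr_minus field_simps)
 qed
 finally show "(LINT s|lon {0<..}. \<rho> / (2 * s) * gk s (\<rho> *\<^sub>R e)) = \<rho> powr (1 - ?d) / (?d * unit_ball_vol ?d)" .
qed

definition newton_radial :: "nat \<Rightarrow> real \<Rightarrow> real" where
 "newton_radial d r = (if d = 2 then ln r / (2 * pi)
  else - 1 / ((real d - 2) * (real d * unit_ball_vol (real d)) * r ^ (d - 2)))"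

lemma newton_kernel_radial: "newton_kernel (x::real^'n) = newton_radial CARD('n) (norm x)"
 by (simp add: newton_kernel_def newton_radial_def)

lemma newton_radial_derivative:
 assumes "d \<ge> 2" "r > 0"
 shows "DERIV (newton_radial d) r :> r powr (1 - real d) / (real d * unit_ball_vol (real d))"
proof (cases "d = 2")
 case True
 have "DERIV (%r. ln r / (2 * pi)) r :> (1 / r) / (2 * pi)"
  using assms by (auto intro!: derivative_eq_intros)
 moreover have "r powr (- 1) = 1 / r" using assms by (simp add: powr_minus divide_simps)
 moreover have "unit_ball_vol 2 = pi" using unit_ball_vol_numeral(1)[of Num.One] by simp
 ultimately show ?thesis using True by (simp add: newton_radial_def[abs_def])
next
 case False
 define k where "k = d - 3"
 then have k: "d = Suc (Suc (Suc k))" using False assms by simp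
 let ?c = "(real d - 2) * (real d * unit_ball_vol (real d))"
 have "unit_ball_vol (real d) > 0" by simp
 then have c: "?c \<noteq> 0" "real d - 2 \<noteq> 0" using k by (simp_all del: unit_ball_vol_pos)
 have "DERIV (%r. r ^ (d - 2)) r :> real (d - 2) * r ^ k"
  using DERIV_pow[of "d - 2" r] k by simp
 from DERIV_cmult[OF DERIV_inverse'[OF this], of "- 1 / ?c"] assms
 have "DERIV (%r. - 1 / ?c * inverse (r ^ (d - 2))) r :>
   - 1 / ?c * - (inverse (r ^ (d - 2)) * (real (d - 2) * r ^ k) * inverse (r ^ (d - 2)))" by simp
 moreover have "- 1 / ?c * - (inverse (r ^ (d - 2)) * (real (d - 2) * r ^ k) * inverse (r ^ (d - 2)))
   = r powr (1 - real d) / (real d * unit_ball_vol (real d))"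
 proof -
  have "1 - real d = - real (k + 2)" using k by simp
  then have p: "r powr (1 - real d) = inverse (r * r * r ^ k)"
   using assms by (simp only: powr_minus powr_realpow) (simp add: power_add power2_eq_square mult_ac)
  have d: "real (d - 2) = real d - 2" "r ^ (d - 2) = r * r ^ k" using k by auto
  define U D where "U = real d * unit_ball_vol (real d)" and "D = real d - 2"
  have nz: "U \<noteq> 0" "D \<noteq> 0" "r ^ k \<noteq> 0" "r \<noteq> 0" using c assms by (auto simp: U_def D_def)
  show ?thesis
   unfolding p d U_def[symmetric] D_def[symmetric] using nz by (simp add: field_simps)
 qed
 moreover have "newton_radial d = (%r. - 1 / ?c * inverse (r ^ (d - 2)))"
  using False by (simp add: newton_radial_def[abs_def] divide_inverse inverse_mult_distrib mult_ac)
 ultimately show ?thesis by simp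
qed

text \<open>Both sides are the integral over [r1, r2] of the same radial derivative: the fundamental
  theorem of calculus is applied for each s, Tonelli exchanges the integrals, and
  \<open>radial_kernel_integral\<close> evaluates the inner one. Nonnegative integrals are used
  because the finiteness of the left-hand side is a conclusion here.\<close>

lemma newton_radial_diff:
 fixes e :: "'a::euclidean_space"
 assumes d: "DIM('a) \<ge> 2" and r: "0 < r1" "r1 \<le> r2" and e: "norm e = 1"
 shows "(\<integral>\<^sup>+s. ennreal (gk s (r1 *\<^sub>R e) - gk s (r2 *\<^sub>R e)) \<partial>lon {0<..})
  = ennreal (newton_radial DIM('a) r2 - newton_radial DIM('a) r1)"
proof -
 let ?f = "%\<rho> s. \<rho> / (2 * s) * gk s (\<rho> *\<^sub>R e)"
 have 1: "(\<integral>\<^sup>+\<rho>. ennreal (?f \<rho> s) * indicator {r1..r2} \<rho> \<partial>lborel) = ennreal (gk s (r1 *\<^sub>R e) - gk s (r2 *\<^sub>R e))"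
  if s: "s > 0" for s
 proof -
  have "(\<integral>\<^sup>+\<rho>. ennreal (?f \<rho> s) * indicator {r1..r2} \<rho> \<partial>lborel) = ennreal (- gk s (r2 *\<^sub>R e) - (- gk s (r1 *\<^sub>R e)))"
  proof (rule nn_integral_FTC_Icc)
   fix \<rho> assume \<rho>: "\<rho> \<in> {r1..r2}"
   have "((%\<rho>. \<rho> *\<^sub>R e) has_derivative (%h. h *\<^sub>R e)) (at \<rho>)" by (auto intro!: derivative_eq_intros)
   from has_derivative_compose[OF this gk_has_derivative[OF s]]
   have "((%\<rho>. gk s (\<rho> *\<^sub>R e)) has_derivative (%h. h * gk1 e s (\<rho> *\<^sub>R e))) (at \<rho>)"
    by (simp add: gk1_def mult_ac)
   then have "DERIV (%\<rho>. gk s (\<rho> *\<^sub>R e)) \<rho> :> gk1 e s (\<rho> *\<^sub>R e)"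
    by (rule has_derivative_imp_has_field_derivative) simp
   moreover have "gk1 e s (\<rho> *\<^sub>R e) = - ?f \<rho> s"
    using e by (simp add: gk1_def power2_norm_eq_inner[symmetric] dot_square_norm)
   ultimately show "DERIV (%\<rho>. - gk s (\<rho> *\<^sub>R e)) \<rho> :> ?f \<rho> s"
    by (auto intro!: derivative_eq_intros)
   show "0 \<le> ?f \<rho> s" using \<rho> r s by auto
  qed (use r in auto)
  then show ?thesis by simp
 qed
 interpret L: sigma_finite_measure "lon {0<..} :: real measure" by (rule sigma_finite_lon) simp
 interpret P: pair_sigma_finite "lborel :: real measure" "lon {0<..} :: real measure"
  by unfold_locales
 have m: "(%(\<rho>, s). ennreal (?f \<rho> s) * indicator {r1..r2} \<rho>) \<in> borel_measurable (lborel \<Otimes>\<^sub>M lon {0<..})"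
 proof -
  have "(%(s, \<rho>). ?f \<rho> s * indicator {r1..r2} \<rho>) \<in> borel_measurable (borel \<Otimes>\<^sub>M borel)" by measurable
  from lon_measurable_pair(2)[OF this] have "(%x. ennreal ((%(\<rho>, s). ?f \<rho> s * indicator {r1..r2} \<rho>) x)) \<in> borel_measurable (lborel \<Otimes>\<^sub>M lon {0<..})"
   by measurable
  then show ?thesis
   by (rule measurable_cong[THEN iffD1, rotated]) (auto split: split_indicator)
 qed
 have "(\<integral>\<^sup>+s. ennreal (gk s (r1 *\<^sub>R e) - gk s (r2 *\<^sub>R e)) \<partial>lon {0<..})
  = (\<integral>\<^sup>+s. \<integral>\<^sup>+\<rho>. ennreal (?f \<rho> s) * indicator {r1..r2} \<rho> \<partial>lborel \<partial>lon {0<..})"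
  by (intro nn_integral_cong) (use 1 in \<open>simp only: space_restrict_space\<close>, auto)
 also have "\<dots> = (\<integral>\<^sup>+\<rho>. \<integral>\<^sup>+s. ennreal (?f \<rho> s) * indicator {r1..r2} \<rho> \<partial>lon {0<..} \<partial>lborel)"
  using P.Fubini'[OF m] by simp
 also have "\<dots> = (\<integral>\<^sup>+\<rho>. ennreal (\<rho> powr (1 - real DIM('a)) / (real DIM('a) * unit_ball_vol (real DIM('a)))) * indicator {r1..r2} \<rho> \<partial>lborel)"
 proof (intro nn_integral_cong)
  fix \<rho> :: real
  show "(\<integral>\<^sup>+s. ennreal (?f \<rho> s) * indicator {r1..r2} \<rho> \<partial>lon {0<..}) =
   ennreal (\<rho> powr (1 - real DIM('a)) / (real DIM('a) * unit_ball_vol (real DIM('a)))) * indicator {r1..r2} \<rho>"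
  proof (cases "\<rho> \<in> {r1..r2}")
   case True
   then have "\<rho> > 0" using r by auto
   then have "(\<integral>\<^sup>+s. ennreal (?f \<rho> s) \<partial>lon {0<..}) = ennreal (LINT s|lon {0<..}. ?f \<rho> s)"
    by (intro lon_nn_integral_eq radial_kernel_integral e) auto
   then show ?thesis using True radial_kernel_integral(2)[OF \<open>\<rho> > 0\<close> e] by simp
  qed simp
 qed
 also have "\<dots> = ennreal (newton_radial DIM('a) r2 - newton_radial DIM('a) r1)"
  by (rule nn_integral_FTC_Icc) (use r d in \<open>auto intro!: newton_radial_derivative\<close>)
 finally show ?thesis .
qed

lemma newton_radial_mono:
 assumes "d \<ge> 2" "0 < r1" "r1 \<le> r2"
 shows "newton_radial d r1 \<le> newton_radial d r2"
proof (rule DERIV_nonneg_imp_nondecreasing[OF assms(3)])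
 fix x assume "r1 \<le> x"
 then show "\<exists>y. DERIV (newton_radial d) x :> y \<and> 0 \<le> y"
  using assms
  by (intro exI[of _ "x powr (1 - real d) / (real d * unit_ball_vol (real d))"] conjI newton_radial_derivative) auto
qed

lemma gk_norm_cong: "norm (z::'a::euclidean_space) = norm (w::'a) ==> gk s z = gk s (w::'a)"
 by (simp add: gk_def)

text \<open>The Newton kernel is minus the time integral of the heat kernel. In dimension two this
 integral diverges, hence the normalization at a unit vector.\<close>

lemma newton_kernel_integral:
 fixes z e :: "real^'n"
 assumes d: "CARD('n) \<ge> 2" and z: "z \<noteq> 0" and e: "norm e = 1"
 shows "integrable (lon {0<..}) (%s. gk s z - gk s e)"
  and "(LINT s|lon {0<..}. gk s z - gk s e) = newton_kernel e - newton_kernel z"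
  and "(LINT s|lon {0<..}. \<bar>gk s z - gk s e\<bar>) = \<bar>newton_kernel e - newton_kernel z\<bar>"
proof -
 let ?N = "newton_radial CARD('n)"
 \<comment> \<open>Ordering the two points by norm gives the integrand a sign. By radial symmetry
   both may be moved to the ray through \<open>e\<close>, where \<open>newton_radial_diff\<close>
   applies; the general case takes \<open>v\<close> and \<open>w\<close> to be \<open>z\<close> and
   \<open>e\<close> in the right order.\<close>
 have key: "integrable (lon {0<..}) (%s. gk s v - gk s w) \<and> (LINT s|lon {0<..}. gk s v - gk s w) = ?N (norm w) - ?N (norm v)
  \<and> (\<forall>s>0. gk s v - gk s w \<ge> 0)"
  if vw: "v \<noteq> 0" "norm v \<le> norm w" for v w :: "real^'n"
 proof (intro conjI)
  have g: "gk s v - gk s w = gk s (norm v *\<^sub>R e) - gk s (norm w *\<^sub>R e)" for s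
   by (intro arg_cong2[where f = "(-)"] gk_norm_cong) (auto simp: e)
  show pos: "\<forall>s>0. gk s v - gk s w \<ge> 0" using vw by (auto intro: gk_antimono)
  have nn: "(\<integral>\<^sup>+s. ennreal (gk s v - gk s w) \<partial>lon {0<..}) = ennreal (?N (norm w) - ?N (norm v))"
   unfolding g using newton_radial_diff[of "norm v" "norm w" e] d vw e by simp
  show "integrable (lon {0<..}) (%s. gk s v - gk s w)"
   by (rule integrableI_nonneg) (use pos in \<open>auto simp: nn intro!: lon_measurable AE_I2\<close>)
  have "(LINT s|lon {0<..}. gk s v - gk s w) = enn2real (\<integral>\<^sup>+s. ennreal (gk s v - gk s w) \<partial>lon {0<..})"
   by (rule integral_eq_nn_integral) (use pos in \<open>auto intro!: lon_measurable AE_I2\<close>)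
  then show "(LINT s|lon {0<..}. gk s v - gk s w) = ?N (norm w) - ?N (norm v)"
   using newton_radial_mono[OF d, of "norm v" "norm w"] vw by (simp add: nn)
 qed
 have e0: "e \<noteq> 0" using e by auto
 have abs_int: "(LINT s|lon {0<..}. \<bar>f s\<bar>) = (LINT s|lon {0<..}. f s)" if "!!s. s > 0 ==> f s \<ge> 0" for f :: "real \<Rightarrow> real"
  by (intro Bochner_Integration.integral_cong) (use that in auto)
 show "integrable (lon {0<..}) (%s. gk s z - gk s e)"
  and "(LINT s|lon {0<..}. gk s z - gk s e) = newton_kernel e - newton_kernel z"
  and "(LINT s|lon {0<..}. \<bar>gk s z - gk s e\<bar>) = \<bar>newton_kernel e - newton_kernel z\<bar>"
 proof (atomize (full), cases "norm z \<le> norm e")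
  case True
  then show "integrable (lon {0<..}) (%s. gk s z - gk s e) \<and>
   (LINT s|lon {0<..}. gk s z - gk s e) = newton_kernel e - newton_kernel z \<and>
   (LINT s|lon {0<..}. \<bar>gk s z - gk s e\<bar>) = \<bar>newton_kernel e - newton_kernel z\<bar>"
   using key[OF z True] abs_int[of "%s. gk s z - gk s e"] newton_radial_mono[OF d, of "norm z" "norm e"] z
   by (simp add: newton_kernel_radial)
 next
  case False
  then have le: "norm e \<le> norm z" by simp
  have eq: "gk s z - gk s e = - (gk s e - gk s z)" for s by simp
  note k = key[OF e0 le]
  have "integrable (lon {0<..}) (%s. gk s z - gk s e)"
   unfolding eq using k by (intro Bochner_Integration.integrable_minus) auto
  moreover have "(LINT s|lon {0<..}. gk s z - gk s e) = newton_kernel e - newton_kernel z"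
  proof -
   have "(LINT s|lon {0<..}. gk s z - gk s e) = - (LINT s|lon {0<..}. gk s e - gk s z)"
    by (subst Bochner_Integration.integral_minus[symmetric]) simp
   then show ?thesis using k by (simp add: newton_kernel_radial)
  qed
  moreover have "(LINT s|lon {0<..}. \<bar>gk s z - gk s e\<bar>) = \<bar>newton_kernel e - newton_kernel z\<bar>"
   unfolding eq abs_minus_cancel using k abs_int[of "%s. gk s e - gk s z"] newton_radial_mono[OF d, of "norm e" "norm z"] le e
   by (simp add: newton_kernel_radial)
  ultimately show "integrable (lon {0<..}) (%s. gk s z - gk s e) \<and>
   (LINT s|lon {0<..}. gk s z - gk s e) = newton_kernel e - newton_kernel z \<and>
   (LINT s|lon {0<..}. \<bar>gk s z - gk s e\<bar>) = \<bar>newton_kernel e - newton_kernel z\<bar>" by blast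
 qed
qed

lemma lon_Un:
 fixes f :: "'a::euclidean_space \<Rightarrow> real"
 assumes "A \<in> sets borel" "B \<in> sets borel" "A \<inter> B = {}" "integrable (lon A) f" "integrable (lon B) f"
 shows "integrable (lon (A \<union> B)) f" "(LINT x|lon (A \<union> B). f x) = (LINT x|lon A. f x) + (LINT x|lon B. f x)"
 using assms by (auto simp: lon_integrable lon_integral set_integral_Un intro: set_integrable_Un)

lemma lon_subset:
 fixes f :: "'a::euclidean_space \<Rightarrow> real"
 assumes "integrable (lon A) f" "A \<in> sets borel" "B \<in> sets borel" "B \<subseteq> A"
 shows "integrable (lon B) f"
 using assms set_integrable_subset[of lborel A f B] by (simp add: lon_integrable)

lemma lon_shift:
 fixes f :: "real \<Rightarrow> real"
 assumes [measurable]: "f \<in> borel_measurable borel"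
 shows "integrable (lon {0<..}) (%s. f (s + t)) \<longleftrightarrow> integrable (lon {t<..}) f"
  "(LINT s|lon {0<..}. f (s + t)) = (LINT s|lon {t<..}. f s)"
proof -
 have e: "indicator {0<..} s *\<^sub>R f (s + t) = (%r. indicator {t<..} r *\<^sub>R f r) (s + t)" for s
  by (auto split: split_indicator)
 show "integrable (lon {0<..}) (%s. f (s + t)) \<longleftrightarrow> integrable (lon {t<..}) f"
  unfolding lon_integrable[OF borel_open[OF open_greaterThan]] set_integrable_def e
  by (rule lborel_shift(1)) measurable
 show "(LINT s|lon {0<..}. f (s + t)) = (LINT s|lon {t<..}. f s)"
  unfolding lon_integral[OF borel_open[OF open_greaterThan]] set_lebesgue_integral_def e
  by (rule lborel_shift(2)) measurable
qed

lemma gk_double_at_0: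
 "s > 0 ==> gk (2 * s) (0::'a::euclidean_space) = (8 * pi) powr (- real DIM('a) / 2) * s powr (- real DIM('a) / 2)"
proof -
 have "4 * pi * (2 * s) = (8 * pi) * s" by simp
 then show ?thesis unfolding gk_def by (simp only: powr_mult) simp
qed

lemma gkernel_moment:
 fixes f :: "real \<Rightarrow> 'a::euclidean_space \<Rightarrow> real"
 assumes k: "gkernel m f f'" and q: "q \<ge> 0"
 obtains C where "C > 0" "!!s. s > 0 ==> integrable lborel (%z. norm z powr q * \<bar>f s z\<bar>)"
  "!!s. s > 0 ==> (LINT z|lborel. norm z powr q * \<bar>f s z\<bar>) \<le> C * s powr (q / 2 - real m / 2)"
proof -
 note [measurable] = gkernel_measurable2[OF k]
 from k obtain C where C: "C > 0"
  "!!s z. s > 0 ==> \<bar>f s z\<bar> \<le> C * s powr (- (real m / 2)) * gk (2 * s) z"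
  by (rule gkernelE) auto
 from gk_moment_bound[OF q, where 'a='a] obtain D where D: "D \<ge> 0"
  "!!s z::'a. s > 0 ==> norm z powr q * gk s z \<le> D * s powr (q / 2) * gk (2 * s) z" by blast
 define E where "E = C * (D * 2 powr (q / 2)) + 1"
 have E: "E > 0" using C(1) D(1) by (auto simp: E_def intro!: add_nonneg_pos)
 have b: "norm z powr q * \<bar>f s z\<bar> \<le> E * s powr (q / 2 - real m / 2) * gk (2 * (2 * s)) z" if s: "s > 0" for s and z :: 'a
 proof -
  have "norm z powr q * \<bar>f s z\<bar> \<le> norm z powr q * (C * s powr (- (real m / 2)) * gk (2 * s) z)"
   using C(2)[OF s] by (intro mult_left_mono) auto
  also have "\<dots> = C * s powr (- (real m / 2)) * (norm z powr q * gk (2 * s) z)" by simp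
  also have "\<dots> \<le> C * s powr (- (real m / 2)) * (D * (2 * s) powr (q / 2) * gk (2 * (2 * s)) z)"
   using C(1) s by (intro mult_left_mono D(2)) auto
  also have "\<dots> = (C * (D * 2 powr (q / 2))) * (s powr (- (real m / 2)) * s powr (q / 2)) * gk (2 * (2 * s)) z"
   using s by (simp add: powr_mult)
  also have "\<dots> = (C * (D * 2 powr (q / 2))) * s powr (q / 2 - real m / 2) * gk (2 * (2 * s)) z"
   by (simp flip: powr_add)
  also have "\<dots> \<le> E * s powr (q / 2 - real m / 2) * gk (2 * (2 * s)) z"
   by (intro mult_right_mono) (auto simp: E_def)
  finally show ?thesis .
 qed
 have gi: "integrable lborel (%z::'a. E * s powr (q / 2 - real m / 2) * gk (2 * (2 * s)) z)" if "s > 0" for s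
  using gk_integral(1)[of "2 * (2 * s)", where 'a='a] that by simp
 have i: "integrable lborel (%z. norm z powr q * \<bar>f s z\<bar>)" if s: "s > 0" for s
  by (rule Bochner_Integration.integrable_bound[OF gi[OF s]])
   (use b[OF s] E in \<open>auto simp: abs_mult intro!: AE_I2\<close>)
 have "(LINT z|lborel. norm z powr q * \<bar>f s z\<bar>) \<le> E * s powr (q / 2 - real m / 2)" if s: "s > 0" for s
  using integral_mono[OF i[OF s] gi[OF s] b[OF s]] gk_integral(2)[of "2 * (2 * s)", where 'a='a] s by simp
 with E i that show ?thesis by blast
qed

lemma newton_kernel_measurable [measurable]: "newton_kernel \<in> borel_measurable borel"
 unfolding newton_kernel_def[abs_def] by measurable

text \<open>The time integral is cut at s = 1. The part of \<open>gk s z\<close> with s <= 1 is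
  integrable in z and becomes \<open>\<phi>\<close>. For s > 1 the mean value theorem between z and
  e yields the factor 1 + |z| times s^{-1/2} s^{-d/2}, which is at most s^{-3/2} because d >=
  2.\<close>

lemma newton_kernel_bound:
 fixes e :: "real^'n"
 assumes d: "CARD('n) \<ge> 2" and e: "norm e = 1"
 obtains \<phi> C where "integrable lborel \<phi>" "!!z. \<phi> z \<ge> 0" "C > 0"
  "!!z. z \<noteq> 0 ==> \<bar>newton_kernel z - newton_kernel e\<bar> \<le> \<phi> z + C * (1 + norm (z::real^'n))"
proof -
 from gkernel_gk[where 'a="real^'n"] obtain C where C: "C > 0"
  "!!s z v. s > 0 ==> \<bar>gk1 v s z\<bar> \<le> C * norm v * s powr (- ((real 0 + 1) / 2)) * gk (2 * s) (z::real^'n)"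
  by (rule gkernelE) auto
 let ?\<phi> = "%z::real^'n. LINT s|lon {0<..1}. gk s z"
 have \<phi>i: "integrable lborel ?\<phi>"
 proof (rule integral_swap_bound(3)[where g = "%_. 1"])
  show "(%(s, z::real^'n). gk s z) \<in> borel_measurable (lon {0<..1} \<Otimes>\<^sub>M lborel)"
   by (rule lon_measurable_pair(1)) measurable
  show "integrable (lon {0<..1}) (%s::real. 1::real)"
   using powr_integral_0(1)[of 0 1] by (subst Bochner_Integration.integrable_cong[OF refl, of _ _ "%s. s powr (- 0)"]) auto
 qed (auto intro!: sigma_finite_lon sigma_finite_lborel gk_integral simp: gk_integral)
 have low: "integrable (lon {0<..1}) (%s. gk s z)" if z: "z \<noteq> 0" for z :: "real^'n"
 proof (rule Bochner_Integration.integrable_bound)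
  have "integrable (lon {0<..}) (%s. s powr (- 1) * gk s z)"
   using gk_time_integral(1)[OF z, of 1] by (subst lon_integrable) auto
  then show "integrable (lon {0<..1}) (%s. s powr (- 1) * gk s z)"
   by (rule lon_subset) auto
  show "(%s. gk s z) \<in> borel_measurable (lon {0<..1})" by (rule lon_measurable) measurable
  show "AE s in lon {0<..1}. norm (gk s z) \<le> norm (s powr (- 1) * gk s z)"
   by (intro AE_I2) (auto simp: powr_minus_divide field_simps intro: mult_left_le_one_le)
 qed
 have e0: "e \<noteq> 0" using e by auto
 define K where "K = C * (8 * pi) powr (- real CARD('n) / 2)"
 have K: "K > 0" using C(1) by (simp add: K_def)
 define L where "L = (LINT s|lon {0<..1}. gk s e) + K * 2"
 have L0: "(LINT s|lon {0<..1}. gk s e) \<ge> 0" by (rule integral_nonneg_AE) auto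
 then have L: "L > 0" using K unfolding L_def by linarith
 have hi: "\<bar>gk s z - gk s e\<bar> \<le> K * (1 + norm z) * s powr (- (3/2))" if s: "s > 1" for s and z :: "real^'n"
 proof -
  have "\<bar>gk s z - gk s e\<bar> \<le> (K * s powr (- (3/2))) * norm (z - e)"
  proof (rule gkernel_mean_value[OF gkernel_gk])
   fix w v :: "real^'n"
   have "\<bar>gk1 v s w\<bar> \<le> C * norm v * s powr (- ((real 0 + 1) / 2)) * gk (2 * s) (0::real^'n)"
    by (rule order_trans[OF C(2)]) (use s C(1) in \<open>auto intro!: mult_left_mono gk_le_at_0\<close>)
   also have "gk (2 * s) (0::real^'n) = (8 * pi) powr (- real CARD('n) / 2) * s powr (- real CARD('n) / 2)"
    using s by (subst gk_double_at_0) auto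
   also have "\<dots> \<le> (8 * pi) powr (- real CARD('n) / 2) * s powr (- 1)"
    using s d by (intro mult_left_mono powr_mono) auto
   finally have "\<bar>gk1 v s w\<bar> \<le> C * norm v * s powr (- ((real 0 + 1) / 2)) * ((8 * pi) powr (- real CARD('n) / 2) * s powr (- 1))"
    using s C(1) by (simp add: mult_left_mono)
   also have "\<dots> = K * (s powr (- (1 / 2)) * s powr (- 1)) * norm v" by (simp add: K_def)
   also have "s powr (- (1 / 2)) * s powr (- 1) = s powr (- (3/2))" unfolding powr_add[symmetric] by simp
   finally show "\<bar>gk1 v s w\<bar> \<le> K * s powr (- (3/2)) * norm v" .
  qed (use s in auto)
  also have "\<dots> \<le> (K * s powr (- (3/2))) * (1 + norm z)"
   using K e norm_triangle_ineq4[of z e] by (intro mult_left_mono) auto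
  finally show ?thesis by (simp add: mult_ac)
 qed
 have "\<bar>newton_kernel z - newton_kernel e\<bar> \<le> ?\<phi> z + L * (1 + norm z)" if z: "z \<noteq> 0" for z :: "real^'n"
 proof -
  have i: "integrable (lon {0<..}) (%s. \<bar>gk s z - gk s e\<bar>)"
   using newton_kernel_integral(1)[OF d z e] by simp
  have U: "{0::real<..} = {0<..1} \<union> {1<..}" by auto
  have i1: "integrable (lon {0<..1}) (%s. \<bar>gk s z - gk s e\<bar>)" by (rule lon_subset[OF i]) auto
  have i2: "integrable (lon {1<..}) (%s. \<bar>gk s z - gk s e\<bar>)" by (rule lon_subset[OF i]) auto
  have "\<bar>newton_kernel z - newton_kernel e\<bar> = (LINT s|lon {0<..}. \<bar>gk s z - gk s e\<bar>)"
   using newton_kernel_integral(3)[OF d z e] by simp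
  also have "\<dots> = (LINT s|lon {0<..1}. \<bar>gk s z - gk s e\<bar>) + (LINT s|lon {1<..}. \<bar>gk s z - gk s e\<bar>)"
   unfolding U by (rule lon_Un(2)[OF _ _ _ i1 i2]) auto
  also have "(LINT s|lon {0<..1}. \<bar>gk s z - gk s e\<bar>) \<le> (LINT s|lon {0<..1}. gk s z + gk s e)"
   using i1 low[OF z] low[OF e0] by (intro integral_mono) (auto intro: order_trans[OF abs_triangle_ineq4])
  also have "\<dots> = ?\<phi> z + (LINT s|lon {0<..1}. gk s e)" using low[OF z] low[OF e0] by simp
  also have "(LINT s|lon {1<..}. \<bar>gk s z - gk s e\<bar>) \<le> (LINT s|lon {1<..}. K * (1 + norm z) * s powr (- (3/2)))"
   using i2 powr_integral_inf(1)[of "3/2" 1] hi by (intro integral_mono) auto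
  also have "\<dots> = K * (1 + norm z) * 2" using powr_integral_inf(2)[of "3/2" 1] by simp
  finally have "\<bar>newton_kernel z - newton_kernel e\<bar> \<le> ?\<phi> z + ((LINT s|lon {0<..1}. gk s e) + K * 2 * (1 + norm z))" by simp
  also have "\<dots> \<le> ?\<phi> z + L * (1 + norm z)"
   using L0 by (simp add: L_def algebra_simps)
  finally show ?thesis .
 qed
 moreover have "?\<phi> z \<ge> 0" for z by (rule integral_nonneg_AE) auto
 ultimately show ?thesis using that[of ?\<phi> L] \<phi>i L by blast
qed

text \<open>The time integral for the Newton kernel is inserted and the integrals exchanged: by the
  semigroup law the heat kernel at s turns \<open>gk2\<close> at time t into \<open>gk2\<close> at
  time s + t. The normalising constants \<open>gk s e\<close> and \<open>newton_kernel e\<close>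
  drop out because \<open>gk2 a b t\<close> has integral zero. The third claim is the domination
  needed to superpose translates in \<open>newton_conv\<close>.\<close>

lemma newton_kernel_gk2:
 fixes a b :: "real^'n"
 assumes d: "CARD('n) \<ge> 2" and t: "t > 0"
 shows "integrable lborel (%y. newton_kernel (x - y) * gk2 a b t y)" (is ?A)
  and "(LINT y|lborel. newton_kernel (x - y) * gk2 a b t y) = - (LINT r|lon {t<..}. gk2 a b r x)" (is ?B)
  and "\<exists>C\<ge>0. \<forall>x. (LINT y|lborel. \<bar>newton_kernel (x - y) * gk2 a b t y\<bar>) \<le> C * (1 + norm x)" (is ?C)
proof -
 obtain e :: "real^'n" where e: "norm e = 1" using vector_choose_size[of 1] by auto
 from newton_kernel_bound[OF d e] obtain \<phi> C where \<phi>: "integrable lborel \<phi>" "!!z. \<phi> z \<ge> 0" "C > 0"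
  "!!z::real^'n. z \<noteq> 0 ==> \<bar>newton_kernel z - newton_kernel e\<bar> \<le> \<phi> z + C * (1 + norm z)" by metis
 have \<phi>m[measurable]: "\<phi> \<in> borel_measurable borel" using borel_measurable_integrable[OF \<phi>(1)] by simp
 let ?k = "gk2 a b t" and ?N = "%z::real^'n. newton_kernel z - newton_kernel e"
 note k = gkernel_gk2[of a b]
 note ki = gkernel_integrable(1)[OF k t]
 from gkernel_bounded[OF k t] obtain B where B: "B > 0" "!!z. \<bar>?k z\<bar> \<le> B" by metis
 from gkernel_moment[OF k, of 1] have mi: "integrable lborel (%z. norm z powr 1 * \<bar>?k z\<bar>)" using t by auto
 have k1i: "integrable lborel (%y. (1 + norm y) * \<bar>?k y\<bar>)"
  using ki mi by (simp add: distrib_right)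
 have k0: "(LINT y|lborel. ?k y) = 0" using gkernel_derivative_integral_0[OF gkernel_gk1[of a] t] by simp
 define g where "g x y = B * \<phi> (x - y) + C * (1 + norm x) * ((1 + norm y) * \<bar>?k y\<bar>)" for x y
 have gi: "integrable lborel (g x)" for x
  unfolding g_def using \<phi>(1) lborel_reflect(1)[of \<phi> x] k1i by simp
 have gb: "\<bar>?N (x - y) * ?k y\<bar> \<le> g x y" if "y \<noteq> x" for x y
 proof -
  have "\<bar>?N (x - y) * ?k y\<bar> \<le> (\<phi> (x - y) + C * (1 + norm (x - y))) * \<bar>?k y\<bar>"
   unfolding abs_mult using \<phi>(4)[of "x - y"] that by (intro mult_right_mono) auto
  also have "\<dots> = \<phi> (x - y) * \<bar>?k y\<bar> + C * (1 + norm (x - y)) * \<bar>?k y\<bar>" by (simp add: algebra_simps)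
  also have "\<dots> \<le> \<phi> (x - y) * B + C * ((1 + norm x) * (1 + norm y)) * \<bar>?k y\<bar>"
  proof (intro add_mono mult_mono mult_left_mono mult_right_mono)
   have "norm (x - y) \<le> norm x + norm y" by (rule norm_triangle_ineq4)
   then show "1 + norm (x - y) \<le> (1 + norm x) * (1 + norm y)"
    by (simp add: algebra_simps) (smt (verit) mult_nonneg_nonneg norm_ge_zero)
  qed (use \<phi> B in auto)
  finally show ?thesis by (simp add: g_def mult_ac)
 qed
 have ae: "AE y in lborel. y \<noteq> x" for x :: "real^'n" by (rule AE_lborel_singleton)
 have Ni: "integrable lborel (%y. ?N (x - y) * ?k y)" for x
 proof (rule Bochner_Integration.integrable_bound[OF gi[of x]])
  show "AE y in lborel. norm (?N (x - y) * ?k y) \<le> norm (g x y)"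
   using ae[of x] by eventually_elim (use gb in \<open>force intro: order_trans\<close>)
 qed measurable
 have split: "newton_kernel (x - y) * ?k y = ?N (x - y) * ?k y + newton_kernel e * ?k y" for x y by (simp add: algebra_simps)
 show ?A unfolding split using Ni ki by (intro Bochner_Integration.integrable_add) auto
 have eq: "(LINT y|lborel. newton_kernel (x - y) * ?k y) = (LINT y|lborel. ?N (x - y) * ?k y)" for x
  unfolding split using Ni[of x] ki k0 by (subst Bochner_Integration.integral_add) auto
 show ?C
 proof (intro exI conjI allI)
  let ?I = "LINT y|lborel. \<phi> y" and ?J = "LINT y|lborel. (1 + norm y) * \<bar>?k y\<bar>" and ?L = "LINT y|lborel. \<bar>?k y\<bar>"
  let ?D = "B * ?I + C * ?J + \<bar>newton_kernel e\<bar> * ?L"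
  have nn: "?I \<ge> 0" "?J \<ge> 0" "?L \<ge> 0" using \<phi>(2) by (auto intro!: integral_nonneg_AE)
  then show "?D \<ge> 0" using B \<phi>(3) by simp
  fix x
  have "(LINT y|lborel. \<bar>newton_kernel (x - y) * ?k y\<bar>) \<le> (LINT y|lborel. g x y + \<bar>newton_kernel e\<bar> * \<bar>?k y\<bar>)"
  proof (rule integral_mono_AE)
   show "integrable lborel (%y. \<bar>newton_kernel (x - y) * ?k y\<bar>)"
    unfolding split using Ni[of x] ki by (intro integrable_abs Bochner_Integration.integrable_add) auto
   show "integrable lborel (%y. g x y + \<bar>newton_kernel e\<bar> * \<bar>?k y\<bar>)" using gi[of x] ki by simp
   show "AE y in lborel. \<bar>newton_kernel (x - y) * ?k y\<bar> \<le> g x y + \<bar>newton_kernel e\<bar> * \<bar>?k y\<bar>"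
    using ae[of x]
   proof eventually_elim
    fix y assume "y \<noteq> x"
    from gb[OF this] show "\<bar>newton_kernel (x - y) * ?k y\<bar> \<le> g x y + \<bar>newton_kernel e\<bar> * \<bar>?k y\<bar>"
     unfolding split by (intro order_trans[OF abs_triangle_ineq] add_mono) (auto simp: abs_mult)
   qed
  qed
  also have "\<dots> = B * ?I + C * (1 + norm x) * ?J + \<bar>newton_kernel e\<bar> * ?L"
   unfolding g_def using \<phi>(1) lborel_reflect[of \<phi> x] k1i ki by simp
  also have "\<dots> \<le> ?D * (1 + norm x)"
   using nn B \<phi>(3) by (simp add: algebra_simps)
  finally show "(LINT y|lborel. \<bar>newton_kernel (x - y) * ?k y\<bar>) \<le> ?D * (1 + norm x)" .
 qed
 show ?B
 proof -
  \<comment> \<open>The singular point y = x is a null set; assigning 0 there makes the hypotheses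
    of the interchange true for every y.\<close>
  let ?f = "%y s. if y = x then 0 else (gk s (x - y) - gk s e) * ?k y"
  have N: "integrable (lon {0<..}) (%s. gk s z - gk s e)"
   "(LINT s|lon {0<..}. gk s z - gk s e) = - ?N z"
   "(LINT s|lon {0<..}. \<bar>gk s z - gk s e\<bar>) = \<bar>?N z\<bar>" if "z \<noteq> 0" for z :: "real^'n"
   using newton_kernel_integral[OF d that e] by auto
  have fm: "(%(y, s). ?f y s) \<in> borel_measurable (lborel \<Otimes>\<^sub>M lon {0<..})"
   by (rule lon_measurable_pair(2)) measurable
  have "(LINT y|lborel. LINT s|lon {0<..}. ?f y s) = (LINT s|lon {0<..}. LINT y|lborel. ?f y s)"
  proof (rule integral_swap_bound(1)[OF _ _ fm])
   show "integrable lborel (%y. \<bar>?N (x - y) * ?k y\<bar>)" using Ni by simp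
   show "integrable (lon {0<..}) (?f y)" for y
    using N(1)[of "x - y"] by (cases "y = x") auto
   show "(LINT s|lon {0<..}. \<bar>?f y s\<bar>) \<le> \<bar>?N (x - y) * ?k y\<bar>" for y
    using N(3)[of "x - y"] by (cases "y = x") (auto simp: abs_mult)
  qed (auto intro: sigma_finite_lon sigma_finite_lborel)
  also have "(LINT y|lborel. LINT s|lon {0<..}. ?f y s) = (LINT y|lborel. - (?N (x - y) * ?k y))"
  proof (rule integral_cong_AE)
   interpret L: sigma_finite_measure "lon {0<..} :: real measure" by (rule sigma_finite_lon) simp
   show "(%y. LINT s|lon {0<..}. ?f y s) \<in> borel_measurable lborel"
    by (rule L.borel_measurable_lebesgue_integral[OF fm])
   show "AE y in lborel. (LINT s|lon {0<..}. ?f y s) = - (?N (x - y) * ?k y)"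
    using ae[of x]
   proof eventually_elim
    fix y assume y: "y \<noteq> x"
    have "(LINT s|lon {0<..}. ?f y s) = (LINT s|lon {0<..}. gk s (x - y) - gk s e) * ?k y"
     using y by simp
    also have "\<dots> = - ?N (x - y) * ?k y" using N(2)[of "x - y"] y by simp
    finally show "(LINT s|lon {0<..}. ?f y s) = - (?N (x - y) * ?k y)" by (simp add: algebra_simps)
   qed
  qed measurable
  also have "(LINT y|lborel. - (?N (x - y) * ?k y)) = - (LINT y|lborel. newton_kernel (x - y) * ?k y)"
   unfolding eq by (rule Bochner_Integration.integral_minus)
  also have "(LINT s|lon {0<..}. LINT y|lborel. ?f y s) = (LINT s|lon {0<..}. gk2 a b (s + t) x)"
  proof (rule Bochner_Integration.integral_cong[OF refl])
   fix s :: real assume "s \<in> space (lon {0<..})"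
   then have s: "s > 0" by simp
   have ci: "integrable lborel (%y. gk s (x - y) * ?k y)"
   proof -
    from gkernel_bounded[OF gkernel_gk s] obtain B' where "!!z::real^'n. \<bar>gk s z\<bar> \<le> B'" by metis
    then show ?thesis by (intro conv_integrable[OF _ _ ki]) auto
   qed
   have "(LINT y|lborel. ?f y s) = (LINT y|lborel. gk s (x - y) * ?k y - gk s e * ?k y)"
   proof (rule integral_cong_AE)
    show "AE y in lborel. ?f y s = gk s (x - y) * ?k y - gk s e * ?k y"
     using ae[of x] by eventually_elim (simp add: algebra_simps)
   qed measurable
   also have "\<dots> = gk2 a b (s + t) x"
    using ci ki k0 gk_conv_gk2[OF s t] by simp
   finally show "(LINT y|lborel. ?f y s) = gk2 a b (s + t) x" .
  qed
  also have "\<dots> = (LINT r|lon {t<..}. gk2 a b r x)"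
   by (rule lon_shift(2)) measurable
  finally show ?thesis by simp
 qed
qed

section \<open>The projected heat semigroup as a time integral\<close>

abbreviation conv :: "('a::euclidean_space \<Rightarrow> real) \<Rightarrow> ('a \<Rightarrow> real) \<Rightarrow> 'a \<Rightarrow> real" where
 "conv f g x \<equiv> LINT y|lborel. f (x - y) * g y"

lemma gk_le_gk_at_0:
 assumes "0 < t" "t \<le> s"
 shows "gk s (z::'a::euclidean_space) \<le> gk t (0::'a)"
proof -
 have "gk s z \<le> gk s (0::'a)" using assms by (intro gk_le_at_0) auto
 also have "\<dots> \<le> gk t (0::'a)" using assms by (auto simp: gk_def intro!: powr_mono2')
 finally show ?thesis .
qed

lemma gkernel_conv_bound:
 fixes f :: "real \<Rightarrow> 'a::euclidean_space \<Rightarrow> real"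
 assumes k: "gkernel m f f'" and t: "t > 0"
 obtains C where "C > 0" "!!s z. t \<le> s ==> \<bar>f s z\<bar> \<le> C * s powr (- (real m / 2))"
  "!!s z v. t \<le> s ==> \<bar>f' s z v\<bar> \<le> C * norm v * s powr (- ((real m + 1) / 2))"
proof -
 from k obtain C where C: "C > 0"
  "!!s z. s > 0 ==> \<bar>f s z\<bar> \<le> C * s powr (- (real m / 2)) * gk (2 * s) z"
  "!!s z v. s > 0 ==> \<bar>f' s z v\<bar> \<le> C * norm v * s powr (- ((real m + 1) / 2)) * gk (2 * s) z"
  by (rule gkernelE) auto
 let ?D = "C * gk (2 * t) (0::'a)"
 have "?D > 0" using C(1) t by (auto intro!: mult_pos_pos gk_pos)
 moreover have "\<bar>f s z\<bar> \<le> ?D * s powr (- (real m / 2))" if "t \<le> s" for s z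
 proof -
  have "\<bar>f s z\<bar> \<le> C * s powr (- (real m / 2)) * gk (2 * s) z" using C(2)[of s z] t that by auto
  also have "\<dots> \<le> C * s powr (- (real m / 2)) * gk (2 * t) (0::'a)"
   using C(1) t that by (intro mult_left_mono gk_le_gk_at_0) auto
  finally show ?thesis by (simp add: mult_ac)
 qed
 moreover have "\<bar>f' s z v\<bar> \<le> ?D * norm v * s powr (- ((real m + 1) / 2))" if "t \<le> s" for s z v
 proof -
  have "\<bar>f' s z v\<bar> \<le> C * norm v * s powr (- ((real m + 1) / 2)) * gk (2 * s) z" using C(3)[of s z v] t that by auto
  also have "\<dots> \<le> C * norm v * s powr (- ((real m + 1) / 2)) * gk (2 * t) (0::'a)"
   using C(1) t that by (intro mult_left_mono gk_le_gk_at_0) auto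
  finally show ?thesis by (simp add: mult_ac)
 qed
 ultimately show ?thesis using that by blast
qed

lemma gkernel_conv_le:
 fixes f :: "'a::euclidean_space \<Rightarrow> real"
 assumes "!!z. \<bar>f z\<bar> \<le> B" "f \<in> borel_measurable borel" "integrable lborel g"
 shows "\<bar>conv f g x\<bar> \<le> B * (LINT y|lborel. \<bar>g y\<bar>)"
proof -
 have "\<bar>conv f g x\<bar> \<le> (LINT y|lborel. \<bar>f (x - y) * g y\<bar>)"
  using integral_norm_bound[of lborel "%y. f (x - y) * g y"] by simp
 also have "\<dots> \<le> (LINT y|lborel. B * \<bar>g y\<bar>)"
 proof (rule integral_mono)
  show "integrable lborel (%y. \<bar>f (x - y) * g y\<bar>)"
   by (rule integrable_abs, rule conv_integrable[OF assms(2,1,3)])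
  show "\<bar>f (x - y) * g y\<bar> \<le> B * \<bar>g y\<bar>" for y
   using assms(1) by (auto simp: abs_mult intro!: mult_right_mono)
 qed (use assms in auto)
 finally show ?thesis by simp
qed

lemma gkernel_measurable1: "gkernel m f f' ==> f s \<in> borel_measurable borel"
 using gkernel_measurable2(1)[of m f f' "%_. s" borel "%z. z"] by simp

text \<open>The maximum of the Gaussian contributes r^{-d/2} on top of r^{-1}. For d >= 2 and r
  bounded away from 0 this makes r^{-2}, which is integrable at infinity uniformly in z.\<close>

lemma gkernel2_time_bound:
 fixes f :: "real \<Rightarrow> 'a::euclidean_space \<Rightarrow> real"
 assumes d: "DIM('a) \<ge> 2" and k: "gkernel 2 f f'" and t: "t > 0"
 obtains D where "D > 0" "!!r z. t < r ==> \<bar>f r z\<bar> \<le> D * r powr (- 2)"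
proof -
 from k obtain C where C: "C > 0"
  "!!s z. s > 0 ==> \<bar>f s z\<bar> \<le> C * s powr (- (real 2 / 2)) * gk (2 * s) z"
  by (rule gkernelE) auto
 define c where "c = (8 * pi) powr (- real DIM('a) / 2) * t powr (- real DIM('a) / 2 + 1)"
 have c: "c > 0" using t by (simp add: c_def)
 have "\<bar>f r z\<bar> \<le> (C * c) * r powr (- 2)" if r: "t < r" for r z
 proof -
  have "gk (2 * r) (0::'a) = (8 * pi) powr (- real DIM('a) / 2) * r powr (- real DIM('a) / 2)"
   using t r by (subst gk_double_at_0) auto
  also have "r powr (- real DIM('a) / 2) = r powr (- real DIM('a) / 2 + 1) * r powr (- 1)"
   unfolding powr_add[symmetric] by simp
  also have "(8 * pi) powr (- real DIM('a) / 2) * (r powr (- real DIM('a) / 2 + 1) * r powr (- 1))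
    \<le> (8 * pi) powr (- real DIM('a) / 2) * (t powr (- real DIM('a) / 2 + 1) * r powr (- 1))"
   using t r d by (intro mult_left_mono mult_right_mono powr_mono2') auto
  finally have g: "gk (2 * r) (0::'a) \<le> c * r powr (- 1)" by (simp only: c_def mult.assoc)
  have "\<bar>f r z\<bar> \<le> C * r powr (- (real 2 / 2)) * gk (2 * r) (0::'a)"
   using r t C(1) by (intro order_trans[OF C(2)] mult_left_mono gk_le_at_0) auto
  also have "\<dots> \<le> C * r powr (- (real 2 / 2)) * (c * r powr (- 1))"
   using C(1) g by (intro mult_left_mono) auto
  also have "\<dots> = (C * c) * (r powr (- 1) * r powr (- 1))" by (simp add: mult_ac)
  also have "r powr (- 1) * r powr (- 1) = r powr (- 2)" unfolding powr_add[symmetric] by simp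
  finally show ?thesis .
 qed
 with that[of "C * c"] C(1) c show ?thesis by simp
qed

lemma conv_measurable_time:
 fixes f :: "real \<Rightarrow> 'a::euclidean_space \<Rightarrow> real"
 assumes [measurable]: "(%(s, z). f s z) \<in> borel_measurable (borel \<Otimes>\<^sub>M borel)" "g \<in> borel_measurable borel"
 shows "(%s. conv (f s) g x) \<in> borel_measurable borel"
proof -
 have "(%p. (%(s, z). f s z) (fst p, x - snd p) * g (snd p)) \<in> borel_measurable (borel \<Otimes>\<^sub>M lborel)"
  by measurable
 then have "(%(s, y). f s (x - y) * g y) \<in> borel_measurable (borel \<Otimes>\<^sub>M lborel)"
  by (simp add: case_prod_beta')
 then show ?thesis by (rule lborel.borel_measurable_lebesgue_integral)
qed

lemma gkernel_pair_measurable: "gkernel m f f' ==> (%(s, z). f s z) \<in> borel_measurable (borel \<Otimes>\<^sub>M borel)"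
 "gkernel m f f' ==> (%(s, z). f' s z v) \<in> borel_measurable (borel \<Otimes>\<^sub>M borel)"
 by (auto simp: gkernel_def)

lemma gkernel_time_conv_integrable:
 fixes f :: "real \<Rightarrow> 'a::euclidean_space \<Rightarrow> real"
 assumes k: "gkernel m f f'" and m: "m \<ge> 3" and t: "t > 0" and g: "integrable lborel g"
 shows "integrable (lon {t<..}) (%r. conv (f r) g x)"
proof -
 have [measurable]: "g \<in> borel_measurable borel" using borel_measurable_integrable[OF g] by simp
 from gkernel_conv_bound[OF k t] obtain C where C: "C > 0" "!!s z. t \<le> s ==> \<bar>f s z\<bar> \<le> C * s powr (- (real m / 2))" by metis
 show ?thesis
 proof (rule Bochner_Integration.integrable_bound)
  show "integrable (lon {t<..}) (%r. C * r powr (- (real m / 2)) * (LINT y|lborel. \<bar>g y\<bar>))"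
   using powr_integral_inf(1)[of "real m / 2" t] m t by simp
  show "(%r. conv (f r) g x) \<in> borel_measurable (lon {t<..})"
   by (intro lon_measurable conv_measurable_time gkernel_pair_measurable[OF k]) simp
  show "AE r in lon {t<..}. norm (conv (f r) g x) \<le> norm (C * r powr (- (real m / 2)) * (LINT y|lborel. \<bar>g y\<bar>))"
  proof (rule AE_I2)
   fix r assume "r \<in> space (lon {t<..})"
   then have "t \<le> r" by simp
   then have "\<bar>conv (f r) g x\<bar> \<le> C * r powr (- (real m / 2)) * (LINT y|lborel. \<bar>g y\<bar>)"
    using C g by (intro gkernel_conv_le gkernel_measurable1[OF k]) auto
   then show "norm (conv (f r) g x) \<le> norm (C * r powr (- (real m / 2)) * (LINT y|lborel. \<bar>g y\<bar>))"
    by simp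
  qed
 qed
qed

text \<open>Superposition of \<open>newton_kernel_gk2\<close> over translates weighted by g. The
  absolute bound there grows linearly in the shift, which is what the first moment of g
  compensates.\<close>

lemma newton_conv:
 fixes a b :: "real^'n"
 assumes d: "CARD('n) \<ge> 2" and t: "t > 0"
  and g: "integrable lborel g" and g1: "integrable lborel (%y. norm y * g y)"
 shows "integrable lborel (%y. newton_kernel (x - y) * conv (gk2 a b t) g y)" (is ?A)
  and "conv newton_kernel (conv (gk2 a b t) g) x = - (LINT r|lon {t<..}. conv (gk2 a b r) g x)" (is ?B)
proof -
 have [measurable]: "g \<in> borel_measurable borel" using borel_measurable_integrable[OF g] by simp
 obtain C where C: "C \<ge> 0" "!!x. (LINT y|lborel. \<bar>newton_kernel (x - y) * gk2 a b t y\<bar>) \<le> C * (1 + norm x)"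
  using newton_kernel_gk2(3)[OF d t] by blast
 have "DIM(real^'n) \<ge> 2" using d by simp
 from gkernel2_time_bound[OF this gkernel_gk2[of a b] t] obtain D where D: "D > 0"
  and bd: "!!r z. r > t ==> \<bar>gk2 a b r z\<bar> \<le> D * r powr (- 2)" by metis
 let ?f = "%z y. newton_kernel (x - y) * gk2 a b t (y - z) * g z"
 have sh: "(%y. newton_kernel (x - y) * gk2 a b t (y - z)) = (%y. (%w. newton_kernel (x - z - w) * gk2 a b t w) (y + - z))" for z
  by simp
 have shi: "integrable lborel (%y. newton_kernel (x - y) * gk2 a b t (y - z))" for z
  unfolding sh by (subst lborel_shift(1)) (use newton_kernel_gk2(1)[OF d t] in auto)
 have sh1: "(LINT y|lborel. newton_kernel (x - y) * gk2 a b t (y - z)) = - (LINT r|lon {t<..}. gk2 a b r (x - z))" for z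
  unfolding sh by (subst lborel_shift(2)) (use newton_kernel_gk2(2)[OF d t] in auto)
 have sh2: "(LINT y|lborel. \<bar>newton_kernel (x - y) * gk2 a b t (y - z)\<bar>) \<le> C * (1 + norm (x - z))" for z
 proof -
  have "(LINT y|lborel. \<bar>newton_kernel (x - y) * gk2 a b t (y - z)\<bar>) = (LINT w|lborel. \<bar>newton_kernel (x - z - w) * gk2 a b t w\<bar>)"
   using lborel_shift(2)[of "%w. \<bar>newton_kernel (x - z - w) * gk2 a b t w\<bar>" "- z"] by simp
  then show ?thesis using C(2) by simp
 qed
 have fm: "(%(z, y). ?f z y) \<in> borel_measurable (lborel \<Otimes>\<^sub>M lborel)" by measurable
 have Gi: "integrable lborel (%z. C * (1 + norm x) * \<bar>g z\<bar> + C * \<bar>norm z * g z\<bar>)" using g g1 by simp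
 have b: "(LINT y|lborel. \<bar>?f z y\<bar>) \<le> C * (1 + norm x) * \<bar>g z\<bar> + C * \<bar>norm z * g z\<bar>" for z
 proof -
  have "(LINT y|lborel. \<bar>?f z y\<bar>) = (LINT y|lborel. \<bar>newton_kernel (x - y) * gk2 a b t (y - z)\<bar>) * \<bar>g z\<bar>"
   by (simp add: abs_mult)
  also have "\<dots> \<le> (C * (1 + norm (x - z))) * \<bar>g z\<bar>" by (intro mult_right_mono sh2) auto
  also have "\<dots> \<le> (C * (1 + norm x + norm z)) * \<bar>g z\<bar>"
   using C(1) norm_triangle_ineq4[of x z] by (intro mult_right_mono mult_left_mono) auto
  finally show ?thesis by (simp add: algebra_simps abs_mult)
 qed
 have fi: "integrable lborel (?f z)" for z using shi by simp
 note sw = integral_swap_bound[OF sigma_finite_lborel sigma_finite_lborel fm fi b Gi]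
 have in2: "(LINT z|lborel. ?f z y) = newton_kernel (x - y) * conv (gk2 a b t) g y" for y
  by (simp only: mult.assoc Bochner_Integration.integral_mult_right_zero)
 show ?A using sw(3) unfolding in2 by simp
 have "conv newton_kernel (conv (gk2 a b t) g) x = (LINT z|lborel. LINT y|lborel. ?f z y)"
  using sw(1) unfolding in2 by simp
 also have "\<dots> = (LINT z|lborel. - (LINT r|lon {t<..}. gk2 a b r (x - z) * g z))"
  by (intro Bochner_Integration.integral_cong refl) (simp add: sh1)
 also have "\<dots> = - (LINT z|lborel. LINT r|lon {t<..}. gk2 a b r (x - z) * g z)"
  by (rule Bochner_Integration.integral_minus)
 also have "(LINT z|lborel. LINT r|lon {t<..}. gk2 a b r (x - z) * g z) = (LINT r|lon {t<..}. conv (gk2 a b r) g x)"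
 proof (rule integral_swap_bound(1))
  have i2: "integrable (lon {t<..}) (%r. D * r powr (- 2))" "(LINT r|lon {t<..}. D * r powr (- 2)) = D * (1 / t)"
  proof -
   have "t powr (- 1) = 1 / t" using t by (simp add: powr_minus_divide)
   then show "integrable (lon {t<..}) (%r. D * r powr (- 2))" "(LINT r|lon {t<..}. D * r powr (- 2)) = D * (1 / t)"
    using powr_integral_inf[of 2 t] t by simp_all
  qed
  show "(%(z, r). gk2 a b r (x - z) * g z) \<in> borel_measurable (lborel \<Otimes>\<^sub>M lon {t<..})"
   by (rule lon_measurable_pair(2)) measurable
  show ii: "integrable (lon {t<..}) (%r. gk2 a b r (x - z) * g z)" for z
  proof (rule Bochner_Integration.integrable_mult_left, rule Bochner_Integration.integrable_bound[OF i2(1)])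
   show "(%r. gk2 a b r (x - z)) \<in> borel_measurable (lon {t<..})" by (rule lon_measurable) measurable
   show "AE r in lon {t<..}. norm (gk2 a b r (x - z)) \<le> norm (D * r powr - 2)"
    by (intro AE_I2) (auto intro!: order_trans[OF bd abs_ge_self])
  qed
  show "(LINT r|lon {t<..}. \<bar>gk2 a b r (x - z) * g z\<bar>) \<le> D * (1 / t) * \<bar>g z\<bar>" for z
  proof -
   have "(LINT r|lon {t<..}. \<bar>gk2 a b r (x - z) * g z\<bar>) \<le> (LINT r|lon {t<..}. D * r powr (- 2) * \<bar>g z\<bar>)"
   proof (rule integral_mono)
    show "integrable (lon {t<..}) (%r. \<bar>gk2 a b r (x - z) * g z\<bar>)" by (rule integrable_abs[OF ii])
    show "integrable (lon {t<..}) (%r. D * r powr (- 2) * \<bar>g z\<bar>)"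
     by (rule Bochner_Integration.integrable_mult_left[OF i2(1)])
   qed (auto simp: abs_mult intro!: mult_right_mono bd)
   then show ?thesis using i2(2) by simp
  qed
  show "integrable lborel (%z. D * (1 / t) * \<bar>g z\<bar>)" using g by simp
 qed (auto intro!: sigma_finite_lon sigma_finite_lborel)
 finally show ?B .
qed

lemma time_conv_has_derivative:
 fixes g :: "real^'n \<Rightarrow> real"
 assumes d: "CARD('n) \<ge> 2" and t: "t > 0" and g: "integrable lborel g"
 shows "((%x. LINT r|lon {t<..}. conv (gk2 a b r) g x) has_derivative
  (%v. LINT r|lon {t<..}. conv (gk3 a b v r) g x)) (at x)"
proof -
 have gm[measurable]: "g \<in> borel_measurable borel" using borel_measurable_integrable[OF g] by simp
 note k = gkernel_gk2[of a b]
 from gkernel_conv_bound[OF k t] obtain C where C: "C > 0"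
  "!!s z v. t \<le> s ==> \<bar>gk3 a b v s z\<bar> \<le> C * norm v * s powr (- ((real 2 + 1) / 2))" by metis
 have "DIM(real^'n) \<ge> 2" using d by simp
 from gkernel2_time_bound[OF this k t] obtain D where D: "D > 0"
  "!!r z. r > t ==> \<bar>gk2 a b r z\<bar> \<le> D * r powr (- 2)" by metis
 let ?G = "LINT y|lborel. \<bar>g y\<bar>"
 have bd: "\<bar>conv (gk2 a b r) g x\<bar> \<le> D * ?G * r powr (- 2)" if r: "r > t" for r x
  using gkernel_conv_le[where f = "gk2 a b r", OF D(2)[OF r] _ g, of x] by (simp add: mult_ac)
 show ?thesis
 proof (rule has_derivative_lebesgue_integral[of UNIV x _ _ _ "%r. C * r powr (- (3/2)) * ?G"])
  fix x r assume r: "r \<in> space (lon {t<..})"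
  then have r0: "r > 0" "r \<ge> t" using t by auto
  show "((%x. conv (gk2 a b r) g x) has_derivative (%v. conv (gk3 a b v r) g x)) (at x)"
   by (rule gkernel_conv_has_derivative[OF k r0(1) g])
  fix v
  have "\<bar>conv (gk3 a b v r) g x\<bar> \<le> C * norm v * r powr (- ((real 2 + 1) / 2)) * ?G"
   using C(2)[OF r0(2)] g by (intro gkernel_conv_le) auto
  then show "\<bar>conv (gk3 a b v r) g x\<bar> \<le> norm v * (C * r powr (- (3/2)) * ?G)" by (simp add: mult_ac)
 next
  show "integrable (lon {t<..}) (%r. C * r powr (- (3/2)) * ?G)"
   using powr_integral_inf(1)[of "3/2" t] t by simp
  fix x
  show "integrable (lon {t<..}) (%r. conv (gk2 a b r) g x)"
  proof (rule Bochner_Integration.integrable_bound)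
   show "integrable (lon {t<..}) (%r. D * ?G * r powr (- 2))" using powr_integral_inf(1)[of 2 t] t by simp
   show "(%r. conv (gk2 a b r) g x) \<in> borel_measurable (lon {t<..})"
    by (intro lon_measurable conv_measurable_time gkernel_pair_measurable(1)[OF k] gm)
   show "AE r in lon {t<..}. norm (conv (gk2 a b r) g x) \<le> norm (D * ?G * r powr - 2)"
    by (intro AE_I2) (auto intro!: order_trans[OF bd abs_ge_self])
  qed
 next
  fix v show "(%r. conv (gk3 a b v r) g x) \<in> borel_measurable (lon {t<..})"
   by (intro lon_measurable conv_measurable_time gkernel_pair_measurable(2)[OF k] gm)
 qed auto
qed

lemma pderiv_at_eq:
 "(f has_derivative f') (at x) ==> pderiv_at i f x = f' (axis i 1)"
 unfolding pderiv_at_def by (metis frechet_derivative_at)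

lemma heat_component:
 fixes F :: "real^'n \<Rightarrow> real^'n^'n"
 assumes F: "integrable lborel F" and t: "t > 0"
 shows "heat t F x $ h $ k = conv (gk t) (%y. F y $ h $ k) x"
proof -
 have Fm[measurable]: "F \<in> borel_measurable borel" using borel_measurable_integrable[OF F] by simp
 have m: "(%y. exp (- (norm (x - y))\<^sup>2 / (4 * t)) *\<^sub>R F y) \<in> borel_measurable lborel" by measurable
 have i: "integrable lborel (%y. exp (- (norm (x - y))\<^sup>2 / (4 * t)) *\<^sub>R F y)"
 proof (rule Bochner_Integration.integrable_bound[OF F m], rule AE_I2)
  fix y
  have "exp (- (norm (x - y))\<^sup>2 / (4 * t)) * norm (F y) \<le> 1 * norm (F y)"
   using t by (intro mult_right_mono) auto
  then show "norm (exp (- (norm (x - y))\<^sup>2 / (4 * t)) *\<^sub>R F y) \<le> norm (F y)" by simp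
 qed
 have bl: "bounded_linear (%M::real^'n^'n. M $ h $ k)"
  by (rule bounded_linear_compose[OF bounded_linear_vec_nth bounded_linear_vec_nth])
 have "heat t F x $ h $ k = (4 * pi * t) powr (- real CARD('n) / 2) * ((LINT y|lborel. exp (- (norm (x - y))\<^sup>2 / (4 * t)) *\<^sub>R F y) $ h $ k)"
  using t integral_completion[OF m] by (simp add: heat_def)
 also have "(LINT y|lborel. exp (- (norm (x - y))\<^sup>2 / (4 * t)) *\<^sub>R F y) $ h $ k
  = (LINT y|lborel. (exp (- (norm (x - y))\<^sup>2 / (4 * t)) *\<^sub>R F y) $ h $ k)"
  by (rule integral_bounded_linear[OF bl i, symmetric])
 finally show ?thesis
  by (simp add: gk_def mult.assoc)
qed

text \<open>The operator is followed through its factors, each acting on the kernel of a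
  convolution: div gives first derivatives at time t, a second divergence gives second derivatives,
  the Newton potential converts these into minus an integral over r > t, and the gradient adds the
  third derivative. As r stays above t > 0, no singular kernel ever occurs.\<close>

theorem heat_leray_div_eq:
 fixes F :: "real^'n \<Rightarrow> real^'n^'n"
 assumes d: "CARD('n) \<ge> 2" and t: "t > 0" and F: "integrable lborel F"
  and Fhk: "!!h k. integrable lborel (%y. F y $ h $ k)"
  and F1: "!!h k. integrable lborel (%y. norm y * F y $ h $ k)"
 shows "heat_leray_div t F x $ j = (\<Sum>k\<in>UNIV. conv (gk1 (axis k 1) t) (%y. F y $ k $ j) x)
  + (\<Sum>h\<in>UNIV. \<Sum>k\<in>UNIV. LINT r|lon {t<..}. conv (gk3 (axis h 1) (axis k 1) (axis j 1) r) (%y. F y $ h $ k) x)"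
proof -
 let ?e = "%i. axis i 1 :: real^'n"
 have 1: "div_tensor (heat t F) x $ j = (\<Sum>k\<in>UNIV. conv (gk1 (?e k) t) (%y. F y $ k $ j) x)" for x j
 proof -
  have "pderiv_at k (%y. heat t F y $ k $ j) x = conv (gk1 (?e k) t) (%y. F y $ k $ j) x" for k
   unfolding heat_component[OF F t] by (rule pderiv_at_eq[OF gkernel_conv_has_derivative[OF gkernel_gk t Fhk]])
  then show ?thesis by (simp add: div_tensor_def)
 qed
 have 2: "divg (div_tensor (heat t F)) x = (\<Sum>j\<in>UNIV. \<Sum>k\<in>UNIV. conv (gk2 (?e k) (?e j) t) (%y. F y $ k $ j) x)" for x
 proof -
  have "pderiv_at j (%y. div_tensor (heat t F) y $ j) x = (\<Sum>k\<in>UNIV. conv (gk2 (?e k) (?e j) t) (%y. F y $ k $ j) x)" for j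
   unfolding 1 by (rule pderiv_at_eq[OF has_derivative_sum[OF gkernel_conv_has_derivative[OF gkernel_gk1 t Fhk]]])
  then show ?thesis by (simp add: divg_def)
 qed
 have 3: "inv_laplacian (divg (div_tensor (heat t F))) x
  = - (\<Sum>j\<in>UNIV. \<Sum>k\<in>UNIV. LINT r|lon {t<..}. conv (gk2 (?e k) (?e j) r) (%y. F y $ k $ j) x)" for x
 proof -
  note nc = newton_conv[OF d t Fhk F1]
  have "inv_laplacian (divg (div_tensor (heat t F))) x
   = (LINT y|lebesgue. (\<Sum>j\<in>UNIV. \<Sum>k\<in>UNIV. newton_kernel (x - y) * conv (gk2 (?e k) (?e j) t) (%y. F y $ k $ j) y))"
   unfolding inv_laplacian_def 2 by (simp add: sum_distrib_left)
  also have "\<dots> = (LINT y|lborel. (\<Sum>j\<in>UNIV. \<Sum>k\<in>UNIV. newton_kernel (x - y) * conv (gk2 (?e k) (?e j) t) (%y. F y $ k $ j) y))"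
   by (rule integral_completion) (intro borel_measurable_sum borel_measurable_integrable[OF nc(1)])
  also have "\<dots> = (\<Sum>j\<in>UNIV. \<Sum>k\<in>UNIV. conv newton_kernel (conv (gk2 (?e k) (?e j) t) (%y. F y $ k $ j)) x)"
   using nc(1) by (subst Bochner_Integration.integral_sum) (auto intro!: sum.cong Bochner_Integration.integral_sum)
  finally show ?thesis unfolding nc(2) by (simp add: sum_negf)
 qed
 have 4: "grad (inv_laplacian (divg (div_tensor (heat t F)))) x $ j
  = - (\<Sum>i\<in>UNIV. \<Sum>k\<in>UNIV. LINT r|lon {t<..}. conv (gk3 (?e k) (?e i) (?e j) r) (%y. F y $ k $ i) x)"
  unfolding grad_def vec_lambda_beta
  unfolding 3[abs_def]
  by (rule pderiv_at_eq[OF has_derivative_minus[OF has_derivative_sum[OF has_derivative_sum[OF time_conv_has_derivative[OF d t Fhk]]]]])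
 have "(\<Sum>i\<in>UNIV. \<Sum>k\<in>UNIV. LINT r|lon {t<..}. conv (gk3 (?e k) (?e i) (?e j) r) (%y. F y $ k $ i) x)
  = (\<Sum>h\<in>UNIV. \<Sum>k\<in>UNIV. LINT r|lon {t<..}. conv (gk3 (?e h) (?e k) (?e j) r) (%y. F y $ h $ k) x)"
  by (rule sum.swap)
 then show ?thesis
  unfolding heat_leray_div_def leray_def vector_minus_component 1 4 by simp
qed

section \<open>The profile as a time integral of second derivatives of the heat kernel\<close>

lemma norm_div_sqrt2: "(norm (z /\<^sub>R sqrt 2))\<^sup>2 = (norm z)\<^sup>2 / 2"
proof -
 have "norm (z /\<^sub>R sqrt 2) = norm z / sqrt 2" by (simp add: divide_inverse mult.commute)
 then show ?thesis by (simp add: power_divide)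
qed

lemma gk_double_scale:
 assumes s: "s > 0"
 shows "gk (2 * s) (z::'a::euclidean_space) = 2 powr (- real DIM('a) / 2) * gk s (z /\<^sub>R sqrt 2)"
proof -
 have 1: "4 * pi * (2 * s) = 2 * (4 * pi * s)" by simp
 have 2: "- ((norm z)\<^sup>2 / 2) / (4 * s) = - (norm z)\<^sup>2 / (4 * (2 * s))" using s by (simp add: field_simps)
 show ?thesis unfolding gk_def norm_div_sqrt2 2 1 powr_mult by (simp only: mult.assoc)
qed

lemma gk_double_time_integrable:
 fixes z :: "'a::euclidean_space"
 assumes "m \<ge> 2" "z \<noteq> 0"
 shows "integrable (lon {0<..}) (%s. s powr (- (real m / 2)) * gk (2 * s) z)"
proof -
 have "DIM('a) > 0" by simp
 then have p: "real m / 2 + real DIM('a) / 2 - 1 > 0" using assms by linarith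
 have "integrable (lon {0<..}) (%s. s powr (- (real m / 2)) * gk s (z /\<^sub>R sqrt 2))"
  using gk_time_integral(1)[OF _ p, of "z /\<^sub>R sqrt 2"] assms by (subst lon_integrable) auto
 then have "integrable (lon {0<..}) (%s. 2 powr (- real DIM('a) / 2) * (s powr (- (real m / 2)) * gk s (z /\<^sub>R sqrt 2)))"
  by (rule Bochner_Integration.integrable_mult_right)
 then show ?thesis
  by (rule Bochner_Integration.integrable_cong[OF refl, THEN iffD1, rotated]) (use gk_double_scale[of _ z] in auto)
qed

text \<open>The power of |z| is dictated by parabolic scaling. Up to a constant the kernel at time 2
  s is the one at time s evaluated at z / sqrt 2, which reduces the claim to
  \<open>gk_time_integral\<close>.\<close>

lemma gk_double_time_integral:
 assumes "m \<ge> 2"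
 obtains C where "C > 0"
  "!!z::'a::euclidean_space. z \<noteq> 0 ==> (LINT s|lon {0<..}. s powr (- (real m / 2)) * gk (2 * s) z) = C * norm z powr (2 - real DIM('a) - real m)"
proof -
 let ?d = "real DIM('a)"
 let ?p = "real m / 2 + ?d / 2 - 1"
 have "DIM('a) > 0" by simp
 then have p: "?p > 0" using assms by linarith
 define C where "C = 2 powr (- ?d / 2) * ((4 * pi) powr (- ?d / 2) * Gamma ?p * (1 / 8) powr (- ?p))"
 have C: "C > 0" using p by (simp add: C_def)
 have eq: "s powr (- (real m / 2)) * gk (2 * s) z = 2 powr (- ?d / 2) * (s powr (- (real m / 2)) * gk s (z /\<^sub>R sqrt 2))"
  if "s > 0" for s and z :: 'a using gk_double_scale[OF that, of z] by simp
 have 2: "(LINT s|lon {0<..}. s powr (- (real m / 2)) * gk (2 * s) z) = C * norm z powr (2 - ?d - real m)" if z: "z \<noteq> 0" for z :: 'a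
 proof -
  have "(LINT s|lon {0<..}. s powr (- (real m / 2)) * gk (2 * s) z)
   = (LINT s|lon {0<..}. 2 powr (- ?d / 2) * (s powr (- (real m / 2)) * gk s (z /\<^sub>R sqrt 2)))"
   by (rule Bochner_Integration.integral_cong) (use eq in auto)
  also have "\<dots> = 2 powr (- ?d / 2) * (LINT s|lon {0<..}. (s powr (- (real m / 2)) * gk s (z /\<^sub>R sqrt 2)))"
   by (rule Bochner_Integration.integral_mult_right_zero)
  also have "(LINT s|lon {0<..}. (s powr (- (real m / 2)) * gk s (z /\<^sub>R sqrt 2)))
   = (4 * pi) powr (- ?d / 2) * Gamma ?p * ((norm (z /\<^sub>R sqrt 2))\<^sup>2 / 4) powr (- ?p)"
   using gk_time_integral(2)[OF _ p, of "z /\<^sub>R sqrt 2"] z by (subst lon_integral) auto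
  also have "(norm (z /\<^sub>R sqrt 2))\<^sup>2 / 4 = (1 / 8) * (norm z)\<^sup>2"
   unfolding norm_div_sqrt2 by simp
  also have "\<dots> powr (- ?p) = (1 / 8) powr (- ?p) * norm z powr (2 - ?d - real m)"
  proof -
   have "(norm z)\<^sup>2 powr (- ?p) = norm z powr (2 * (- ?p))"
    using z by (simp add: powr_powr flip: powr_numeral)
   also have "2 * (- ?p) = 2 - ?d - real m" by (simp add: field_simps)
   finally have F: "(norm z)\<^sup>2 powr (- ?p) = norm z powr (2 - ?d - real m)" .
   show ?thesis by (simp only: powr_mult F)
  qed
  finally show ?thesis by (simp add: C_def mult_ac)
 qed
 show ?thesis by (rule that[OF C 2])
qed

text \<open>Formally the heat kernel integrates over time to minus the Newton kernel, so the value
  is minus the Hessian of the latter; \<open>gamma_d\<close> is the reciprocal of the volume of the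
  unit ball. The computation uses the time integrals of s^{-1} G_s and s^{-2} G_s, whose constants
  are related by Gamma (d/2 + 1) = (d/2) Gamma (d/2).\<close>

lemma gk2_time_integral:
 fixes z :: "'a::euclidean_space"
 assumes z: "z \<noteq> 0"
 shows "integrable (lon {0<..}) (%s. gk2 a b s z)"
  and "(LINT s|lon {0<..}. gk2 a b s z) = - (gamma_d DIM('a) *
   ((a \<bullet> b) / (real DIM('a) * norm z ^ DIM('a)) - (z \<bullet> a) * (z \<bullet> b) / norm z ^ (DIM('a) + 2)))"
proof -
 let ?d = "real DIM('a)" and ?n = "norm z"
 define q1 where "q1 = 1 + ?d / 2 - 1"
 define q2 where "q2 = 2 + ?d / 2 - 1"
 have q: "q1 > 0" "q2 > 0" by (auto simp: q1_def q2_def add_pos_pos)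
 have n: "?n > 0" using z by simp
 have i1: "integrable (lon {0<..}) (%s. s powr (- 1) * gk s z)"
  using gk_time_integral(1)[OF z, of 1] by (subst lon_integrable) auto
 have i2: "integrable (lon {0<..}) (%s. s powr (- 2) * gk s z)"
  using gk_time_integral(1)[OF z, of 2] by (subst lon_integrable) (auto simp: add_pos_pos)
 have G2: "Gamma (?d / 2 + 1) = ?d / 2 * Gamma (?d / 2)"
  by (rule Gamma_plus1) (auto dest: nonpos_Ints_nonpos)
 have base: "(4 * pi) powr (- ?d / 2) * (?n\<^sup>2 / 4) powr (- (?d / 2)) = pi powr (- ?d / 2) * ?n powr (- ?d)"
 proof -
  have "(4 * pi) * (?n\<^sup>2 / 4) = pi * ?n\<^sup>2" by simp
  moreover have "(?n\<^sup>2) powr (- (?d / 2)) = ?n powr (- ?d)"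
   using n by (simp add: powr_powr flip: powr_numeral)
  ultimately have "(4 * pi) powr (- (?d / 2)) * (?n\<^sup>2 / 4) powr (- (?d / 2)) = pi powr (- (?d / 2)) * ?n powr (- ?d)"
   by (simp only: powr_mult[symmetric]) (simp add: powr_mult)
  then show ?thesis by simp
 qed
 define P where "P = pi powr (- ?d / 2) * Gamma (?d / 2)"
 have I1: "(LINT s|lon {0<..}. s powr (- 1) * gk s z) = P * ?n powr (- ?d)"
 proof -
  have "(LINT s|lon {0<..}. s powr (- 1) * gk s z) = ((4 * pi) powr (- ?d / 2) * (?n\<^sup>2 / 4) powr (- (?d / 2))) * Gamma (?d / 2)"
   using gk_time_integral(2)[OF z, of 1] by (subst lon_integral) (auto simp: mult_ac)
  then show ?thesis unfolding base by (simp add: P_def)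
 qed
 have I2: "(LINT s|lon {0<..}. s powr (- 2) * gk s z) = P * (?d / 2) * (4 / ?n\<^sup>2) * ?n powr (- ?d)"
 proof -
  have e: "2 + ?d / 2 - 1 = ?d / 2 + 1" by simp
  have "?d / 2 + 1 > 0" by (simp add: add_pos_pos)
  then have "(LINT s|lon {0<..}. s powr (- 2) * gk s z) = (4 * pi) powr (- ?d / 2) * Gamma (?d / 2 + 1) * (?n\<^sup>2 / 4) powr (- (?d / 2 + 1))"
   using gk_time_integral(2)[OF z, of 2, unfolded e] by (subst lon_integral) auto
  also have "(?n\<^sup>2 / 4) powr (- (?d / 2 + 1)) = (?n\<^sup>2 / 4) powr (- (?d / 2)) * (4 / ?n\<^sup>2)"
  proof -
   have "(?n\<^sup>2 / 4) powr (- (?d / 2 + 1)) = (?n\<^sup>2 / 4) powr (- (?d / 2)) * (?n\<^sup>2 / 4) powr (- 1)"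
    unfolding powr_add[symmetric] by simp
   also have "(?n\<^sup>2 / 4) powr (- 1) = 4 / ?n\<^sup>2" using n by (simp add: powr_minus_divide)
   finally show ?thesis .
  qed
  finally have "(LINT s|lon {0<..}. s powr (- 2) * gk s z)
   = ((4 * pi) powr (- ?d / 2) * (?n\<^sup>2 / 4) powr (- (?d / 2))) * Gamma (?d / 2 + 1) * (4 / ?n\<^sup>2)" by (simp add: mult_ac)
  then show ?thesis unfolding base G2 by (simp add: P_def)
 qed
 have eq: "gk2 a b s z = (z \<bullet> a) * (z \<bullet> b) / 4 * (s powr (- 2) * gk s z) - (a \<bullet> b) / 2 * (s powr (- 1) * gk s z)" if "s > 0" for s
 proof -
  have "s powr (- 2) = 1 / s^2" "s powr (- 1) = 1 / s" using that by (simp_all add: powr_minus_divide)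
  then show ?thesis by (simp add: gk2_def algebra_simps)
 qed
 have J: "integrable (lon {0<..}) (%s. (z \<bullet> a) * (z \<bullet> b) / 4 * (s powr (- 2) * gk s z) - (a \<bullet> b) / 2 * (s powr (- 1) * gk s z))"
  by (intro Bochner_Integration.integrable_diff Bochner_Integration.integrable_mult_right i1 i2)
 then show "integrable (lon {0<..}) (%s. gk2 a b s z)"
  by (rule Bochner_Integration.integrable_cong[OF refl, THEN iffD1, rotated]) (use eq in auto)
 have "(LINT s|lon {0<..}. gk2 a b s z) = (LINT s|lon {0<..}. (z \<bullet> a) * (z \<bullet> b) / 4 * (s powr (- 2) * gk s z) - (a \<bullet> b) / 2 * (s powr (- 1) * gk s z))"
  by (rule Bochner_Integration.integral_cong) (use eq in auto)
 also have "\<dots> = (z \<bullet> a) * (z \<bullet> b) / 4 * (LINT s|lon {0<..}. s powr (- 2) * gk s z) - (a \<bullet> b) / 2 * (LINT s|lon {0<..}. s powr (- 1) * gk s z)"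
  by (subst Bochner_Integration.integral_diff[OF Bochner_Integration.integrable_mult_right[OF i2] Bochner_Integration.integrable_mult_right[OF i1]])
   (simp only: Bochner_Integration.integral_mult_right_zero)
 also have "\<dots> = - (gamma_d DIM('a) *
   ((a \<bullet> b) / (?d * ?n ^ DIM('a)) - (z \<bullet> a) * (z \<bullet> b) / ?n ^ (DIM('a) + 2)))"
 proof -
  have g: "gamma_d DIM('a) = P * (?d / 2)"
  proof -
   have "(?d + 2) / 2 = ?d / 2 + 1" by simp
   then show ?thesis unfolding gamma_d_def P_def by (simp only: G2) simp
  qed
  have np: "?n powr (- ?d) = 1 / ?n ^ DIM('a)" "?n ^ (DIM('a) + 2) = ?n ^ DIM('a) * ?n\<^sup>2"
   using n by (simp_all add: powr_minus_divide powr_realpow power_add power2_eq_square)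
  define N D where "N = ?n ^ DIM('a)" and "D = ?d"
  have nz: "N \<noteq> 0" "D \<noteq> 0" "?n\<^sup>2 \<noteq> 0" using n by (auto simp: N_def D_def)
  show ?thesis
   unfolding I1 I2 g np unfolding N_def[symmetric] D_def[symmetric] using nz by (simp add: field_simps power2_eq_square)
 qed
 finally show "(LINT s|lon {0<..}. gk2 a b s z) = - (gamma_d DIM('a) *
   ((a \<bullet> b) / (?d * ?n ^ DIM('a)) - (z \<bullet> a) * (z \<bullet> b) / ?n ^ (DIM('a) + 2)))" .
qed

lemma gk3_time_integrable:
 fixes z :: "'a::euclidean_space"
 assumes "z \<noteq> 0"
 shows "integrable (lon {0<..}) (%s. gk3 a b c s z)"
proof -
 have D: "integrable (lon {0<..}) (%s. s powr (- (real 3 / 2)) * gk (2 * s) z)"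
  by (rule gk_double_time_integrable) (use assms in auto)
 obtain C where C: "C > 0" "!!s z. s > 0 ==> \<bar>gk3 a b c s z\<bar> \<le> C * s powr (- (real 3 / 2)) * gk (2 * s) z"
  using gkernelE[OF gkernel_gk3[of a b c]] by metis
 show ?thesis
 proof (rule Bochner_Integration.integrable_bound[OF Bochner_Integration.integrable_mult_right[OF D, of C]])
  show "(%s. gk3 a b c s z) \<in> borel_measurable (lon {0<..})" by (rule lon_measurable) measurable
  show "AE s in lon {0<..}. norm (gk3 a b c s z) \<le> norm (C * (s powr - (real 3 / 2) * gk (2 * s) z))"
   by (intro AE_I2) (use C(2) in \<open>auto intro!: order_trans[OF _ abs_ge_self] simp: mult.assoc\<close>)
 qed
qed

text \<open>On the ball of radius |x|/2 around x every point has norm at least |x|/2, so the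
  Gaussian at x/2 dominates all derivatives there, and its time integral is finite since x/2 is
  nonzero.\<close>

lemma gk2_time_has_derivative:
 fixes x :: "'a::euclidean_space"
 assumes x: "x \<noteq> 0"
 shows "((%x. LINT s|lon {0<..}. gk2 a b s x) has_derivative (%v. LINT s|lon {0<..}. gk3 a b v s x)) (at x)"
proof -
 let ?S = "ball x (norm x / 2)"
 have half: "x /\<^sub>R 2 \<noteq> 0" using x by simp
 have D: "integrable (lon {0<..}) (%s. s powr (- (real 3 / 2)) * gk (2 * s) (x /\<^sub>R 2))"
  by (rule gk_double_time_integrable) (use half in auto)
 obtain C where C: "C > 0" "!!s z v. s > 0 ==> \<bar>gk3 a b v s z\<bar> \<le> C * norm v * s powr (- ((real 2 + 1) / 2)) * gk (2 * s) z"
  using gkernelE[OF gkernel_gk2[of a b]] by metis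
 have "((%x. LINT s|lon {0<..}. gk2 a b s x) has_derivative (%v. LINT s|lon {0<..}. gk3 a b v s x)) (at x within ?S)"
 proof (rule has_derivative_lebesgue_integral[where g = "%s. C * (s powr (- (real 3 / 2)) * gk (2 * s) (x /\<^sub>R 2))"])
  show "x \<in> ?S" using x by simp
  show "integrable (lon {0<..}) (%s. C * (s powr (- (real 3 / 2)) * gk (2 * s) (x /\<^sub>R 2)))"
   by (rule Bochner_Integration.integrable_mult_right[OF D])
  fix w assume w: "w \<in> ?S"
  then have w2: "norm (x /\<^sub>R 2) \<le> norm w"
   using norm_triangle_ineq2[of x w] by (simp add: dist_norm)
  then have "w \<noteq> 0" using x by auto
  then show "integrable (lon {0<..}) (%s. gk2 a b s w)" by (rule gk2_time_integral(1))
  fix s :: real assume "s \<in> space (lon {0<..})"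
  then have s: "s > 0" by simp
  show "((%x. gk2 a b s x) has_derivative (%v. gk3 a b v s w)) (at w within ?S)"
   by (rule has_derivative_at_withinI, rule gk2_has_derivative[OF s])
  fix v
  have "\<bar>gk3 a b v s w\<bar> \<le> C * norm v * s powr (- ((real 2 + 1) / 2)) * gk (2 * s) w" by (rule C(2)[OF s])
  also have "\<dots> \<le> C * norm v * s powr (- ((real 2 + 1) / 2)) * gk (2 * s) (x /\<^sub>R 2)"
   using C(1) s w2 by (intro mult_left_mono gk_antimono) auto
  finally show "\<bar>gk3 a b v s w\<bar> \<le> norm v * (C * (s powr (- (real 3 / 2)) * gk (2 * s) (x /\<^sub>R 2)))"
   by (simp add: mult_ac)
 next
  fix v show "(%s. gk3 a b v s x) \<in> borel_measurable (lon {0<..})" by (rule lon_measurable) measurable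
 qed auto
 then show ?thesis by (subst (asm) at_within_open) (use x in auto)
qed

lemma axis_nth_if: "axis h (1::real) $ k = (if h = k then 1 else 0)"
 by (simp add: axis_def)

text \<open>Brings the explicit profile into the form in which it is compared with
  \<open>heat_leray_div_eq\<close>: the contraction of M with the Hessian of the Newton
  kernel.\<close>

lemma profile_eq:
 fixes x :: "real^'n"
 assumes "x \<noteq> 0"
 shows "profile M x = - (\<Sum>h\<in>UNIV. \<Sum>k\<in>UNIV. (LINT s|lon {0<..}. gk2 (axis h 1) (axis k 1) s x) * M h k)"
proof -
 have "gamma_d CARD('n) * (((if h = k then 1 else 0) / (real CARD('n) * norm x ^ CARD('n))
   - x $ h * x $ k / norm x ^ (CARD('n) + 2)) * M h k) = - (LINT s|lon {0<..}. gk2 (axis h 1) (axis k 1) s x) * M h k" for h k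
  by (subst gk2_time_integral(2)[OF assms]) (simp add: inner_axis inner_axis_axis axis_nth_if)
 then show ?thesis unfolding profile_def sum_distrib_left by (simp add: sum_negf)
qed

lemma profile_grad:
 fixes x :: "real^'n"
 assumes x: "x \<noteq> 0"
 shows "grad (profile M) x $ j = - (\<Sum>h\<in>UNIV. \<Sum>k\<in>UNIV. (LINT s|lon {0<..}. gk3 (axis h 1) (axis k 1) (axis j 1) s x) * M h k)"
proof -
 have "((%x. - (\<Sum>h\<in>UNIV. \<Sum>k\<in>UNIV. (LINT s|lon {0<..}. gk2 (axis h 1) (axis k 1) s x) * M h k)) has_derivative
   (%v. - (\<Sum>h\<in>UNIV. \<Sum>k\<in>UNIV. (LINT s|lon {0<..}. gk3 (axis h 1) (axis k 1) v s x) * M h k))) (at x)"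
  by (intro has_derivative_minus has_derivative_sum has_derivative_mult_left gk2_time_has_derivative x)
 then have "(profile M has_derivative
   (%v. - (\<Sum>h\<in>UNIV. \<Sum>k\<in>UNIV. (LINT s|lon {0<..}. gk3 (axis h 1) (axis k 1) v s x) * M h k))) (at x)"
  by (rule has_derivative_transform_within_open[of _ _ _ _ "- {0}"]) (use x in \<open>auto simp: profile_eq\<close>)
 then show ?thesis unfolding grad_def vec_lambda_beta by (rule pderiv_at_eq)
qed

section \<open>Convolution of heat kernels with decaying functions\<close>

text \<open>Subordination takes the place of polar coordinates. The mixture of heat kernels over s >
  1 with weight s^{-q} has finite mass because q > 1. Already the times between R and 2 R with R =
  (1 + |y|)^2 contribute a multiple of R^{-q - d/2 + 1}, and q = (p - d)/2 + 1 is chosen so that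
  this equals (1 + |y|)^{-p}.\<close>

lemma integrable_weight:
 fixes p :: real
 assumes "p > real DIM('a)"
 shows "integrable lborel (%y::'a::euclidean_space. (1 + norm y) powr (- p))"
proof -
 let ?d = "real DIM('a)"
 define q where "q = (p - ?d) / 2 + 1"
 have q: "q > 1" using assms by (simp add: q_def)
 let ?\<psi> = "%y::'a. LINT s|lon {1<..}. s powr (- q) * gk s y"
 have pi': "integrable (lon {1<..}) (%s. s powr (- q))" by (rule powr_integral_inf(1)) (use q in auto)
 have \<psi>: "integrable lborel ?\<psi>"
 proof (rule integral_swap_bound(3)[where g = "%s. s powr (- q)"])
  show "(%(s, y::'a). s powr (- q) * gk s y) \<in> borel_measurable (lon {1<..} \<Otimes>\<^sub>M lborel)"
   by (rule lon_measurable_pair(1)) measurable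
  show "integrable lborel (%y::'a. s powr (- q) * gk s y)" if "s \<in> space (lon {1<..})" for s
   using gk_integral(1)[of s] that by simp
  show "(LINT y|lborel. \<bar>s powr (- q) * gk s (y::'a)\<bar>) \<le> s powr (- q)" if "s \<in> space (lon {1<..})" for s
   using gk_integral(2)[of s, where 'a='a] that by (simp add: abs_mult)
 qed (auto intro!: sigma_finite_lon sigma_finite_lborel pi')
 define c where "c = 2 powr (- q) * (8 * pi) powr (- ?d / 2) * exp (- 1 / 4)"
 have c: "c > 0" by (simp add: c_def)
 have low: "c * (1 + norm y) powr (- p) \<le> ?\<psi> y" for y :: 'a
 proof -
  define R where "R = (1 + norm y)\<^sup>2"
  have R: "R \<ge> 1" "(norm y)\<^sup>2 \<le> R" by (auto simp: R_def intro!: power_mono)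
  have si: "integrable (lon {1<..}) (%s. s powr (- q) * gk s y)"
  proof (rule Bochner_Integration.integrable_bound)
   show "integrable (lon {1<..}) (%s. s powr (- q) * gk 1 (0::'a))" using pi' by simp
   show "(%s. s powr (- q) * gk s y) \<in> borel_measurable (lon {1<..})" by (rule lon_measurable) measurable
   show "AE s in lon {1<..}. norm (s powr - q * gk s y) \<le> norm (s powr - q * gk 1 (0::'a))"
    by (intro AE_I2) (auto simp: abs_mult intro!: mult_left_mono gk_le_gk_at_0)
  qed
  let ?K = "(2 * R) powr (- q) * ((8 * pi * R) powr (- ?d / 2) * exp (- 1 / 4))"
  have "?K * R = (LINT s|lon {R<..2*R}. ?K)"
   using R by (simp add: measure_restrict_space)
  also have "\<dots> \<le> (LINT s|lon {R<..2*R}. s powr (- q) * gk s y)"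
  proof (rule integral_mono)
   show "integrable (lon {R<..2*R}) (%s. ?K)" using R by (simp add: lon_integrable set_integrable_def integrable_indicator_iff)
   show "integrable (lon {R<..2*R}) (%s. s powr (- q) * gk s y)" by (rule lon_subset[OF si]) (use R in auto)
   fix s assume "s \<in> space (lon {R<..2*R})"
   then have s: "R < s" "s \<le> 2 * R" by auto
   have "(2 * R) powr (- q) \<le> s powr (- q)" using s R q by (intro powr_mono2') auto
   moreover have "(8 * pi * R) powr (- ?d / 2) \<le> (4 * pi * s) powr (- ?d / 2)"
    using s R by (intro powr_mono2') auto
   moreover have "exp (- 1 / 4) \<le> exp (- (norm y)\<^sup>2 / (4 * s))"
    using s R by (simp add: field_simps)
   ultimately show "?K \<le> s powr (- q) * gk s y"
    unfolding gk_def by (intro mult_mono) auto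
  qed
  also have "\<dots> \<le> ?\<psi> y"
  proof -
   have U: "{1<..} = {R<..2*R} \<union> ({1<..R} \<union> {2*R<..})" using R by auto
   have i: "integrable (lon A) (%s. s powr (- q) * gk s y)" if "A \<in> sets borel" "A \<subseteq> {1<..}" for A
    by (rule lon_subset[OF si]) (use that in auto)
   have "?\<psi> y = (LINT s|lon {R<..2*R}. s powr (- q) * gk s y) + (LINT s|lon ({1<..R} \<union> {2*R<..}). s powr (- q) * gk s y)"
    unfolding U by (rule lon_Un(2)) (use R in \<open>auto intro!: i\<close>)
   moreover have "(LINT s|lon ({1<..R} \<union> {2*R<..}). s powr (- q) * gk s y) \<ge> 0"
    by (rule integral_nonneg_AE) auto
   ultimately show ?thesis by linarith
  qed
  also have "?K * R = c * (1 + norm y) powr (- p)"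
  proof -
   have "R powr (- q) * R powr (- ?d / 2) * R powr 1 = R powr (- p / 2)"
    unfolding powr_add[symmetric] by (simp add: q_def field_simps)
   moreover have "R powr (- p / 2) = (1 + norm y) powr (- p)"
    using powr_powr[of "1 + norm y" 2 "- p / 2"] unfolding R_def by (simp add: add_pos_nonneg)
   ultimately show ?thesis using R by (simp add: c_def powr_mult mult_ac)
  qed
  finally show ?thesis .
 qed
 show ?thesis
 proof (rule Bochner_Integration.integrable_bound)
  show "integrable lborel (%y. ?\<psi> y / c)" using \<psi> by simp
  show "AE y in lborel. norm ((1 + norm y) powr (- p)) \<le> norm (?\<psi> (y::'a) / c)"
   using low c by (intro AE_I2) (auto simp: field_simps intro!: order_trans[OF _ abs_ge_self])
 qed measurable
qed

text \<open>The constant \<open>M\<close> is a parameter so that the estimates below are explicit in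
  it and hence uniform over all time slices of a solution.\<close>

definition decays :: "real \<Rightarrow> real \<Rightarrow> ('a::euclidean_space \<Rightarrow> real) \<Rightarrow> bool" where
 "decays p M g \<longleftrightarrow> g \<in> borel_measurable borel \<and> 0 \<le> M \<and> (\<forall>y. \<bar>g y\<bar> \<le> M * (1 + norm y) powr (- p))"

definition weight_integral :: "'a::euclidean_space itself \<Rightarrow> real \<Rightarrow> real" where
 "weight_integral _ p = (LINT y|lborel. (1 + norm (y::'a)) powr (- p))"

lemma weight_integral_nonneg: "weight_integral a p \<ge> 0"
 unfolding weight_integral_def by (rule integral_nonneg_AE) auto

lemma decays_measurable: "decays p M g ==> g \<in> borel_measurable borel"
 by (simp add: decays_def)

lemma decays_bound: "decays p M g ==> \<bar>g y\<bar> \<le> M * (1 + norm y) powr (- p)" "decays p M g ==> 0 \<le> M"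
 by (auto simp: decays_def)

lemma decays_abs_le: "decays p M g ==> p \<ge> 0 ==> \<bar>g y\<bar> \<le> M"
proof -
 assume g: "decays p M g" and p: "p \<ge> 0"
 have "(1 + norm y) powr (- p) \<le> (1 + norm y) powr 0"
  using p by (intro powr_mono) auto
 then have "M * (1 + norm y) powr (- p) \<le> M * 1"
  using decays_bound(2)[OF g] by (intro mult_left_mono) (auto simp: add_nonneg_eq_0_iff split: if_splits)
 with decays_bound(1)[OF g, of y] show ?thesis by simp
qed

lemma decays_far:
 assumes g: "decays p M g" and p: "p \<ge> 0" and y: "norm y \<ge> norm x / 2" and x: "x \<noteq> 0"
 shows "\<bar>g y\<bar> \<le> M * (2 powr p * norm x powr (- p))"
proof -
 have "\<bar>g y\<bar> \<le> M * (1 + norm y) powr (- p)" by (rule decays_bound[OF g])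
 also have "\<dots> \<le> M * (norm x / 2) powr (- p)"
  using decays_bound(2)[OF g] p y x by (intro mult_left_mono powr_mono2') auto
 also have "(norm x / 2) powr (- p) = 2 powr p * norm x powr (- p)"
  by (simp add: powr_divide powr_minus field_simps)
 finally show ?thesis .
qed

lemma decays_weight:
 assumes g: "decays p M (g :: 'a::euclidean_space \<Rightarrow> real)"
 shows "norm y * \<bar>g y\<bar> \<le> M * (1 + norm y) powr (- (p - 1))" "\<bar>g y\<bar> \<le> M * (1 + norm y) powr (- (p - 1))"
proof -
 have e: "(1 + norm y) * (1 + norm y) powr (- p) = (1 + norm y) powr (- (p - 1))"
  using powr_add[of "1 + norm y" 1 "- p"] by (simp add: add_pos_nonneg)
 have "(1 + norm y) * \<bar>g y\<bar> \<le> (1 + norm y) * (M * (1 + norm y) powr (- p))"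
  by (intro mult_left_mono decays_bound(1)[OF g]) auto
 also have "\<dots> = M * (1 + norm y) powr (- (p - 1))" by (simp only: e[symmetric] mult_ac)
 finally have *: "(1 + norm y) * \<bar>g y\<bar> \<le> M * (1 + norm y) powr (- (p - 1))" .
 have "norm y * \<bar>g y\<bar> \<le> (1 + norm y) * \<bar>g y\<bar>" by (intro mult_right_mono) auto
 with * show "norm y * \<bar>g y\<bar> \<le> M * (1 + norm y) powr (- (p - 1))" by linarith
 have "1 * \<bar>g y\<bar> \<le> (1 + norm y) * \<bar>g y\<bar>" by (intro mult_right_mono) auto
 with * show "\<bar>g y\<bar> \<le> M * (1 + norm y) powr (- (p - 1))" by linarith
qed

lemma decays_integrable:
 fixes g :: "'a::euclidean_space \<Rightarrow> real"
 assumes g: "decays p M g" and p: "p > real DIM('a) + 1"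
 shows "integrable lborel g" "integrable lborel (%y. norm y * g y)"
  "(LINT y|lborel. \<bar>g y\<bar>) \<le> M * weight_integral TYPE('a) (p - 1)"
  "(LINT y|lborel. norm y * \<bar>g y\<bar>) \<le> M * weight_integral TYPE('a) (p - 1)"
proof -
 note [measurable] = decays_measurable[OF g]
 have w: "integrable lborel (%y::'a. M * (1 + norm y) powr (- (p - 1)))"
  using integrable_weight[where 'a='a, of "p - 1"] p by simp
 show g1: "integrable lborel g"
  by (rule Bochner_Integration.integrable_bound[OF w])
   (auto intro!: AE_I2 order_trans[OF decays_weight(2)[OF g] abs_ge_self] simp del: minus_diff_eq)
 show g2: "integrable lborel (%y. norm y * g y)"
  by (rule Bochner_Integration.integrable_bound[OF w])
   (auto simp: abs_mult[of "norm _"] intro!: AE_I2 order_trans[OF decays_weight(1)[OF g] abs_ge_self] simp del: minus_diff_eq)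
 have "(LINT y|lborel. \<bar>g y\<bar>) \<le> (LINT y|lborel. M * (1 + norm (y::'a)) powr (- (p - 1)))"
  by (rule integral_mono[OF integrable_abs[OF g1] w decays_weight(2)[OF g]])
 then show "(LINT y|lborel. \<bar>g y\<bar>) \<le> M * weight_integral TYPE('a) (p - 1)" by (simp add: weight_integral_def)
 have g2': "integrable lborel (%y. norm y * \<bar>g y\<bar>)" using integrable_abs[OF g2] by (simp add: abs_mult)
 have "(LINT y|lborel. norm y * \<bar>g y\<bar>) \<le> (LINT y|lborel. M * (1 + norm (y::'a)) powr (- (p - 1)))"
  by (rule integral_mono[OF g2' w decays_weight(1)[OF g]])
 then show "(LINT y|lborel. norm y * \<bar>g y\<bar>) \<le> M * weight_integral TYPE('a) (p - 1)" by (simp add: weight_integral_def)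
qed

lemma gkernel_reflect_integrable:
 fixes f :: "real \<Rightarrow> 'a::euclidean_space \<Rightarrow> real"
 assumes k: "gkernel m f f'" and s: "s > 0"
  and C: "!!s z. s > 0 ==> \<bar>f s z\<bar> \<le> C * s powr (- (real m / 2)) * gk (2 * s) z"
 shows "integrable lborel (%y. \<bar>f s (x - y)\<bar>)" "(LINT y|lborel. \<bar>f s (x - y)\<bar>) \<le> C * s powr (- (real m / 2))"
proof -
 have fm: "(%z. \<bar>f s z\<bar>) \<in> borel_measurable borel" using gkernel_measurable1[OF k] by simp
 show "integrable lborel (%y. \<bar>f s (x - y)\<bar>)"
  using lborel_reflect(1)[OF fm] gkernel_integrable(1)[OF k s] by simp
 have "(LINT y|lborel. \<bar>f s (x - y)\<bar>) = (LINT y|lborel. \<bar>f s y\<bar>)" by (rule lborel_reflect(2)[OF fm])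
 also have "\<dots> \<le> (LINT y|lborel. C * s powr (- (real m / 2)) * gk (2 * s) (y::'a))"
  using gkernel_integrable(1)[OF k s] gk_integral(1)[of "2 * s", where 'a='a] s C[OF s] by (intro integral_mono) auto
 also have "\<dots> = C * s powr (- (real m / 2))" using gk_integral(2)[of "2 * s", where 'a='a] s by simp
 finally show "(LINT y|lborel. \<bar>f s (x - y)\<bar>) \<le> C * s powr (- (real m / 2))" .
qed

text \<open>The first estimate replaces the kernel at x - y by its value at x. For |y| <= |x|/2 the
  mean value theorem costs a factor |y|, paid for by the first moment of g. For |y| > |x|/2 the
  convolution term is bounded by |x|^{-p} times the L1 norm of the kernel, while in the subtracted
  term the factor 1 <= 2 |y| / |x| again brings in the first moment. The second estimate uses the
  same split without subtraction, the third only the maximum of the Gaussian.\<close>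

lemma conv_near_far:
 fixes f :: "real \<Rightarrow> 'a::euclidean_space \<Rightarrow> real"
 assumes k: "gkernel m f f'" and s: "s > 0" and x: "x \<noteq> 0" and g: "decays p M g" and p: "p > real DIM('a) + 1"
  and C: "C > 0" "!!s z. s > 0 ==> \<bar>f s z\<bar> \<le> C * s powr (- (real m / 2)) * gk (2 * s) z"
  "!!s z v. s > 0 ==> \<bar>f' s z v\<bar> \<le> C * norm v * s powr (- ((real m + 1) / 2)) * gk (2 * s) z"
 defines "w \<equiv> weight_integral TYPE('a) (p - 1)"
 shows "\<bar>conv (f s) g x - f s x * (LINT y|lborel. g y)\<bar> \<le> C * M * (w * (s powr (- ((real m + 1) / 2)) * gk (2 * s) (x /\<^sub>R 2))
  + 2 powr p * norm x powr (- p) * s powr (- (real m / 2)) + 2 / norm x * w * (s powr (- (real m / 2)) * gk (2 * s) x))" (is ?A)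
  and "\<bar>conv (f s) g x\<bar> \<le> C * M * (w * (s powr (- (real m / 2)) * gk (2 * s) (x /\<^sub>R 2))
  + 2 powr p * norm x powr (- p) * s powr (- (real m / 2)))" (is ?B)
  and "\<bar>conv (f s) g x\<bar> \<le> C * M * (w * (s powr (- (real m / 2)) * gk (2 * s) (0::'a)))" (is ?D)
proof -
 have p0: "p \<ge> 0" using p by simp
 note M = decays_bound(2)[OF g]
 note gi = decays_integrable[OF g p, folded w_def]
 note fi = gkernel_reflect_integrable[OF k s C(2)]
 from gkernel_bounded[OF k s] obtain B where B: "!!z. \<bar>f s z\<bar> \<le> B" by metis
 have ci: "integrable lborel (%y. f s (x - y) * g y)"
  by (rule conv_integrable[OF gkernel_measurable1[OF k] B gi(1)])
 have g2: "integrable lborel (%y. norm y * \<bar>g y\<bar>)" using integrable_abs[OF gi(2)] by (simp add: abs_mult)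
 have w: "w \<ge> 0" by (simp add: w_def weight_integral_nonneg)
 let ?S = "M * (2 powr p * norm x powr (- p))"
 let ?a = "C * s powr (- ((real m + 1) / 2)) * gk (2 * s) (x /\<^sub>R 2)"
 let ?b = "C * s powr (- (real m / 2)) * gk (2 * s) (x /\<^sub>R 2)"
 let ?c = "C * s powr (- (real m / 2))"
 have nn: "?S \<ge> 0" "?a \<ge> 0" "?b \<ge> 0" "?c \<ge> 0" using M C(1) by auto
 show ?A
 proof -
  let ?h = "%y. ?a * (norm y * \<bar>g y\<bar>) + ?S * \<bar>f s (x - y)\<bar> + 2 / norm x * \<bar>f s x\<bar> * (norm y * \<bar>g y\<bar>)"
  have "conv (f s) g x - f s x * (LINT y|lborel. g y) = (LINT y|lborel. f s (x - y) * g y - f s x * g y)"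
   using ci gi(1) by simp
  also have "\<bar>\<dots>\<bar> \<le> (LINT y|lborel. \<bar>f s (x - y) * g y - f s x * g y\<bar>)"
   using integral_norm_bound[of lborel "%y. f s (x - y) * g y - f s x * g y"] by simp
  also have "\<dots> \<le> (LINT y|lborel. ?h y)"
  proof (rule integral_mono)
   show "integrable lborel (%y. \<bar>f s (x - y) * g y - f s x * g y\<bar>)" using ci gi(1) by simp
   show "integrable lborel ?h" using g2 fi(1) by simp
   fix y
   have e: "f s (x - y) * g y - f s x * g y = (f s (x - y) - f s x) * g y" by (simp add: algebra_simps)
   show "\<bar>f s (x - y) * g y - f s x * g y\<bar> \<le> ?h y"
   proof (cases "norm y \<le> norm x / 2")
    case True
    have "\<bar>f s (x - y) - f s x\<bar> \<le> ?a * norm y"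
     by (rule gkernel_near[OF k C(3) C(1) s True])
    then have "\<bar>f s (x - y) - f s x\<bar> * \<bar>g y\<bar> \<le> ?a * norm y * \<bar>g y\<bar>" by (rule mult_right_mono) auto
    moreover have "0 \<le> ?S * \<bar>f s (x - y)\<bar>" "0 \<le> 2 / norm x * \<bar>f s x\<bar> * (norm y * \<bar>g y\<bar>)" using nn by auto
    ultimately show ?thesis unfolding e abs_mult[of "f s (x - y) - f s x"] by (simp only: mult.assoc)
   next
    case False
    then have y: "norm y \<ge> norm x / 2" by simp
    have "\<bar>f s (x - y)\<bar> * \<bar>g y\<bar> \<le> \<bar>f s (x - y)\<bar> * ?S"
     by (intro mult_left_mono decays_far[OF g p0 y x]) auto
    moreover have "1 \<le> 2 / norm x * norm y" using y x by (simp add: field_simps)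
    then have "1 * (\<bar>f s x\<bar> * \<bar>g y\<bar>) \<le> 2 / norm x * norm y * (\<bar>f s x\<bar> * \<bar>g y\<bar>)" by (intro mult_right_mono) auto
    moreover have "0 \<le> ?a * (norm y * \<bar>g y\<bar>)" using nn by auto
    moreover have "\<bar>f s (x - y) * g y - f s x * g y\<bar> \<le> \<bar>f s (x - y)\<bar> * \<bar>g y\<bar> + \<bar>f s x\<bar> * \<bar>g y\<bar>"
     using abs_triangle_ineq4[of "f s (x - y) * g y" "f s x * g y"] by (simp add: abs_mult)
    ultimately show ?thesis by (simp add: mult_ac)
   qed
  qed
  also have "(LINT y|lborel. ?h y) = ?a * (LINT y|lborel. norm y * \<bar>g y\<bar>) + ?S * (LINT y|lborel. \<bar>f s (x - y)\<bar>)
   + 2 / norm x * \<bar>f s x\<bar> * (LINT y|lborel. norm y * \<bar>g y\<bar>)"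
   using g2 fi(1) by simp
  also have "\<dots> \<le> ?a * (M * w) + ?S * ?c + 2 / norm x * (?c * gk (2 * s) x) * (M * w)"
  proof (intro add_mono mult_mono mult_left_mono)
   show "\<bar>f s x\<bar> \<le> ?c * gk (2 * s) x" using C(2)[OF s, of x] by simp
  qed (use nn gi(4) fi(2) M w C(1) in \<open>auto intro!: integral_nonneg_AE\<close>)
  also have "\<dots> = C * M * (w * (s powr (- ((real m + 1) / 2)) * gk (2 * s) (x /\<^sub>R 2))
  + 2 powr p * norm x powr (- p) * s powr (- (real m / 2)) + 2 / norm x * w * (s powr (- (real m / 2)) * gk (2 * s) x))"
   by (simp add: algebra_simps)
  finally show ?thesis .
 qed
 have ab: "\<bar>conv (f s) g x\<bar> \<le> (LINT y|lborel. \<bar>f s (x - y) * g y\<bar>)"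
  using integral_norm_bound[of lborel "%y. f s (x - y) * g y"] by simp
 show ?B
 proof -
  let ?h = "%y. ?b * \<bar>g y\<bar> + ?S * \<bar>f s (x - y)\<bar>"
  note ab
  also have "(LINT y|lborel. \<bar>f s (x - y) * g y\<bar>) \<le> (LINT y|lborel. ?h y)"
  proof (rule integral_mono)
   show "integrable lborel (%y. \<bar>f s (x - y) * g y\<bar>)" using ci by simp
   show "integrable lborel ?h" using gi(1) fi(1) by simp
   fix y
   show "\<bar>f s (x - y) * g y\<bar> \<le> ?h y"
   proof (cases "norm y \<le> norm x / 2")
    case True
    have "norm (x /\<^sub>R 2) \<le> norm (x - y)" using True norm_triangle_ineq2[of x y] by simp
    then have "gk (2 * s) (x - y) \<le> gk (2 * s) (x /\<^sub>R 2)" using s by (intro gk_antimono) auto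
    then have "C * s powr (- (real m / 2)) * gk (2 * s) (x - y) \<le> ?b" using C(1) by (intro mult_left_mono) auto
    then have "\<bar>f s (x - y)\<bar> \<le> ?b" using C(2)[OF s, of "x - y"] by linarith
    then have "\<bar>f s (x - y)\<bar> * \<bar>g y\<bar> \<le> ?b * \<bar>g y\<bar>" by (rule mult_right_mono) auto
    moreover have "0 \<le> ?S * \<bar>f s (x - y)\<bar>" using nn by auto
    ultimately show ?thesis unfolding abs_mult by linarith
   next
    case False
    then have y: "norm y \<ge> norm x / 2" by simp
    have "\<bar>f s (x - y)\<bar> * \<bar>g y\<bar> \<le> \<bar>f s (x - y)\<bar> * ?S"
     by (intro mult_left_mono decays_far[OF g p0 y x]) auto
    moreover have "0 \<le> ?b * \<bar>g y\<bar>" using nn by auto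
    ultimately show ?thesis unfolding abs_mult by (simp add: mult_ac)
   qed
  qed
  also have "\<dots> = ?b * (LINT y|lborel. \<bar>g y\<bar>) + ?S * (LINT y|lborel. \<bar>f s (x - y)\<bar>)"
   using gi(1) fi(1) by simp
  also have "\<dots> \<le> ?b * (M * w) + ?S * ?c"
   using nn gi(3) fi(2) by (intro add_mono mult_left_mono) auto
  finally show ?thesis by (simp add: algebra_simps)
 qed
 show ?D
 proof -
  have "\<bar>f s z\<bar> \<le> ?c * gk (2 * s) (0::'a)" for z
   using s C(1) by (intro order_trans[OF C(2)] mult_left_mono gk_le_at_0) auto
  then have "\<bar>conv (f s) g x\<bar> \<le> ?c * gk (2 * s) (0::'a) * (LINT y|lborel. \<bar>g y\<bar>)"
   by (rule gkernel_conv_le[OF _ gkernel_measurable1[OF k] gi(1)])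
  also have "\<dots> \<le> ?c * gk (2 * s) (0::'a) * (M * w)"
   using gi(3) C(1) by (intro mult_left_mono) auto
  finally show ?thesis by (simp add: mult_ac)
 qed
qed

text \<open>At a fixed nonzero point the Gaussian beats every power of s as s tends to 0: a factor
  s^q is obtained for 2 q further powers of 1/|z|, by \<open>powr_mult_exp_le\<close> with w = |z|^2
  / s.\<close>

lemma gk_decay:
 assumes q: "q \<ge> 0"
 obtains C where "C > 0" "!!s z. s > 0 ==> z \<noteq> 0 ==>
  gk (2 * s) (z::'a::euclidean_space) \<le> C * s powr q * norm z powr (- (real DIM('a) + 2 * q))"
proof -
 let ?d = "real DIM('a)"
 let ?K = "((?d / 2 + q) / (1 / 8)) powr (?d / 2 + q) + 1"
 have "gk (2 * s) z \<le> ((8 * pi) powr (- ?d / 2) * ?K) * s powr q * norm z powr (- (?d + 2 * q))"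
  if s: "s > 0" and z: "z \<noteq> 0" for s and z :: 'a
 proof -
  let ?w = "(norm z)\<^sup>2 / s"
  have n: "norm z > 0" using z by simp
  have k: "?w powr (?d / 2 + q) * exp (- (1 / 8) * ?w) \<le> ?K"
   using s q by (intro powr_mult_exp_le) auto
  have w: "?w powr (?d / 2 + q) = norm z powr (?d + 2 * q) * (s powr (- ?d / 2) * s powr (- q))"
  proof -
   have "(norm z)\<^sup>2 powr (?d / 2 + q) = norm z powr (2 * (?d / 2 + q))"
    using n by (simp add: powr_powr flip: powr_numeral)
   also have "2 * (?d / 2 + q) = ?d + 2 * q" by simp
   finally have A: "(norm z)\<^sup>2 powr (?d / 2 + q) = norm z powr (?d + 2 * q)" .
   have B: "s powr (- ?d / 2) * s powr (- q) = inverse (s powr (?d / 2 + q))"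
    unfolding powr_add[symmetric] powr_minus[symmetric] by simp
   have "?w powr (?d / 2 + q) = (norm z)\<^sup>2 powr (?d / 2 + q) / s powr (?d / 2 + q)"
    by (rule powr_divide)
   then show ?thesis unfolding A B by (simp only: divide_inverse)
  qed
  have 4: "4 * pi * (2 * s) = (8 * pi) * s" by simp
  have e: "- (norm z)\<^sup>2 / (4 * (2 * s)) = - (1 / 8) * ?w" using s by (simp add: field_simps)
  have g: "gk (2 * s) z = (8 * pi) powr (- ?d / 2) * (s powr (- ?d / 2) * exp (- (1 / 8) * ?w))"
   unfolding gk_def 4 e powr_mult by (rule mult.assoc)
  have "norm z powr (?d + 2 * q) * (s powr (- ?d / 2) * s powr (- q)) * exp (- (1 / 8) * ?w) \<le> ?K"
   using k unfolding w .
  then have L: "(s powr q * norm z powr (- (?d + 2 * q))) * (norm z powr (?d + 2 * q) * (s powr (- ?d / 2) * s powr (- q)) * exp (- (1 / 8) * ?w))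
   \<le> (s powr q * norm z powr (- (?d + 2 * q))) * ?K"
   by (intro mult_left_mono) auto
  have E: "(s powr q * norm z powr (- (?d + 2 * q))) * (norm z powr (?d + 2 * q) * (s powr (- ?d / 2) * s powr (- q)) * exp (- (1 / 8) * ?w))
   = (s powr q * s powr (- q)) * (norm z powr (- (?d + 2 * q)) * norm z powr (?d + 2 * q)) * (s powr (- ?d / 2) * exp (- (1 / 8) * ?w))"
   by (simp only: mult_ac)
  have 1: "s powr q * s powr (- q) = 1" "norm z powr (- (?d + 2 * q)) * norm z powr (?d + 2 * q) = 1"
   using s n unfolding powr_add[symmetric] by simp_all
  have "s powr (- ?d / 2) * exp (- (1 / 8) * ?w) \<le> (s powr q * norm z powr (- (?d + 2 * q))) * ?K"
   using L unfolding E 1 by (simp only: mult_1)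
  then have "gk (2 * s) z \<le> (8 * pi) powr (- ?d / 2) * ((s powr q * norm z powr (- (?d + 2 * q))) * ?K)"
   unfolding g by (intro mult_left_mono) auto
  then show ?thesis by (simp only: mult_ac)
 qed
 moreover have "(8 * pi) powr (- ?d / 2) * ?K > 0" by (intro mult_pos_pos add_nonneg_pos) auto
 ultimately show ?thesis using that by blast
qed

lemma norm_powr_le:
 fixes x :: "'a::real_normed_vector"
 assumes "norm x \<ge> 1" "e \<ge> k"
 shows "norm x powr (- e) \<le> norm x powr (- k)"
 using assms by (intro powr_mono) auto

lemma norm_half_powr: "norm (x /\<^sub>R 2) powr (- e) = 2 powr e * norm x powr (- e)" for x :: "'a::real_normed_vector"
proof -
 have "norm (x /\<^sub>R 2) = norm x / 2" by simp
 then show ?thesis by (simp add: powr_divide powr_minus field_simps)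
qed

lemma sqrt_weight: "0 < \<tau> ==> \<tau> \<le> T ==> 1 \<le> sqrt T * \<tau> powr (- (1/2))"
 by (simp add: powr_minus_divide powr_half_sqrt)

text \<open>The first derivative contributes no leading term: on a bounded time range its value near
  x is O(|x|^{-d-2}) by \<open>gk_decay\<close> with q = 1, and what is left is the decay of g. The
  singularity at \<open>\<tau>\<close> = 0 is that of the L1 norm of the kernel.\<close>

lemma gk1_conv_decay:
 fixes a :: "'a::euclidean_space"
 assumes p: "p > real DIM('a) + 1" and \<kappa>: "\<kappa> \<le> p" "\<kappa> \<le> real DIM('a) + 2" and T: "T > 0"
 shows "\<exists>K>0. \<forall>M g \<tau> x. decays p M g \<longrightarrow> 0 < \<tau> \<longrightarrow> \<tau> \<le> T \<longrightarrow> norm x \<ge> 1 \<longrightarrow>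
  \<bar>conv (gk1 a \<tau>) g x\<bar> \<le> K * M * \<tau> powr (- (1/2)) * norm x powr (- \<kappa>)"
proof -
 let ?d = "real DIM('a)"
 from gkernel_gk1[of a] obtain C where C: "C > 0"
  "!!s z. s > 0 ==> \<bar>gk1 a s z\<bar> \<le> C * s powr (- (real 1 / 2)) * gk (2 * s) z"
  "!!s z v. s > 0 ==> \<bar>gk2 a v s z\<bar> \<le> C * norm v * s powr (- ((real 1 + 1) / 2)) * gk (2 * s) z"
  by (rule gkernelE) auto
 from gk_decay[of 1, where 'a='a] obtain D where D: "D > 0"
  "!!s z. s > 0 ==> z \<noteq> 0 ==> gk (2 * s) (z::'a) \<le> D * s powr 1 * norm z powr (- (?d + 2 * 1))" by auto
 define w where "w = weight_integral TYPE('a) (p - 1)"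
 have w: "w \<ge> 0" by (simp add: w_def weight_integral_nonneg)
 define K where "K = C * (w * (D * T * 2 powr (?d + 2)) + 2 powr p)"
 have K: "K > 0" using C(1) D(1) w T by (auto simp: K_def intro!: mult_pos_pos add_nonneg_pos)
 have "\<bar>conv (gk1 a \<tau>) g x\<bar> \<le> K * M * \<tau> powr (- (1/2)) * norm x powr (- \<kappa>)"
  if g: "decays p M g" and \<tau>: "0 < \<tau>" "\<tau> \<le> T" and x: "norm x \<ge> 1" for M g \<tau> and x :: 'a
 proof -
  have x0: "x \<noteq> 0" using x by auto
  let ?X = "norm x powr (- \<kappa>)" and ?t = "\<tau> powr (- (1/2))"
  have M: "M \<ge> 0" by (rule decays_bound(2)[OF g])
  have "gk (2 * \<tau>) (x /\<^sub>R 2) \<le> D * \<tau> powr 1 * norm (x /\<^sub>R 2) powr (- (?d + 2))"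
   using D(2)[OF \<tau>(1), of "x /\<^sub>R 2"] x0 by simp
  also have "\<dots> = D * \<tau> * (2 powr (?d + 2) * norm x powr (- (?d + 2)))"
   unfolding norm_half_powr using \<tau> by simp
  also have "\<dots> \<le> D * T * (2 powr (?d + 2) * ?X)"
   using D(1) \<tau> T norm_powr_le[OF x \<kappa>(2)] by (intro mult_mono) auto
  finally have 1: "gk (2 * \<tau>) (x /\<^sub>R 2) \<le> D * T * 2 powr (?d + 2) * ?X" by simp
  have "\<bar>conv (gk1 a \<tau>) g x\<bar> \<le> C * M * (w * (\<tau> powr (- (real 1 / 2)) * gk (2 * \<tau>) (x /\<^sub>R 2))
   + 2 powr p * norm x powr (- p) * \<tau> powr (- (real 1 / 2)))"
   unfolding w_def by (rule conv_near_far(2)[OF gkernel_gk1 \<tau>(1) x0 g p C])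
  also have "\<dots> \<le> C * M * (w * (?t * (D * T * 2 powr (?d + 2) * ?X)) + 2 powr p * ?X * ?t)"
   using C(1) M w 1 norm_powr_le[OF x \<kappa>(1)]
   by (intro mult_left_mono add_mono mult_mono) auto
  also have "\<dots> = K * M * ?t * ?X" by (simp add: K_def algebra_simps)
  finally show ?thesis .
 qed
 with K show ?thesis by blast
qed

text \<open>Only times beyond \<open>\<tau>\<close> are present, yet the leading term has the full
  integral over r > 0: at the point x the missing part over (0, \<open>\<tau>\<close>] is
  O(|x|^{-d-3}) by \<open>gk_decay\<close>. For r > \<open>\<tau>\<close> the error of
  \<open>conv_near_far\<close> is integrated in r. Its two Gaussian terms, extended to all r > 0,
  are homogeneous in x; the remaining term |x|^{-p} r^{-3/2} integrates to |x|^{-p} times 2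
  \<open>\<tau>\<close>^{-1/2}.\<close>

lemma gk3_time_conv_decay:
 fixes a b c :: "'a::euclidean_space"
 assumes p: "p > real DIM('a) + 1" and \<kappa>: "\<kappa> \<le> p" "\<kappa> \<le> real DIM('a) + 2" and T: "T > 0"
 shows "\<exists>K>0. \<forall>M g \<tau> x. decays p M g \<longrightarrow> 0 < \<tau> \<longrightarrow> \<tau> \<le> T \<longrightarrow> norm x \<ge> 1 \<longrightarrow>
  \<bar>(LINT r|lon {\<tau><..}. conv (gk3 a b c r) g x) - (LINT r|lon {0<..}. gk3 a b c r x) * (LINT y|lborel. g y)\<bar>
  \<le> K * M * \<tau> powr (- (1/2)) * norm x powr (- \<kappa>)"
proof -
 let ?d = "real DIM('a)"
 note k = gkernel_gk3[of a b c]
 from k obtain C where C: "C > 0"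
  "!!s z. s > 0 ==> \<bar>gk3 a b c s z\<bar> \<le> C * s powr (- (real 3 / 2)) * gk (2 * s) z"
  "!!s z v. s > 0 ==> \<bar>gk4 a b c v s z\<bar> \<le> C * norm v * s powr (- ((real 3 + 1) / 2)) * gk (2 * s) z"
  by (rule gkernelE) auto
 from gk_decay[of "3/2", where 'a='a] obtain D where D: "D > 0"
  "!!s z. s > 0 ==> z \<noteq> 0 ==> gk (2 * s) (z::'a) \<le> D * s powr (3/2) * norm z powr (- (?d + 2 * (3/2)))" by auto
 from gk_double_time_integral[of 3, where 'a='a] obtain I3 where I3: "I3 > 0"
  "!!z::'a. z \<noteq> 0 ==> (LINT s|lon {0<..}. s powr (- (real 3 / 2)) * gk (2 * s) z) = I3 * norm z powr (2 - ?d - real 3)" by auto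
 from gk_double_time_integral[of 4, where 'a='a] obtain I4 where I4: "I4 > 0"
  "!!z::'a. z \<noteq> 0 ==> (LINT s|lon {0<..}. s powr (- (real 4 / 2)) * gk (2 * s) z) = I4 * norm z powr (2 - ?d - real 4)" by auto
 define w where "w = weight_integral TYPE('a) (p - 1)"
 have w: "w \<ge> 0" by (simp add: w_def weight_integral_nonneg)
 define K0 where "K0 = w * (I4 * 2 powr (?d + 2)) + 2 * w * I3 + w * D * T"
 have K0: "K0 \<ge> 0" using I4(1) I3(1) w D(1) T by (simp add: K0_def)
 define K where "K = C * (K0 * sqrt T + 2 powr p * 2)"
 have K: "K > 0" using C(1) K0 T by (auto simp: K_def intro!: mult_pos_pos add_nonneg_pos)
 have "\<bar>(LINT r|lon {\<tau><..}. conv (gk3 a b c r) g x) - (LINT r|lon {0<..}. gk3 a b c r x) * (LINT y|lborel. g y)\<bar>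
  \<le> K * M * \<tau> powr (- (1/2)) * norm x powr (- \<kappa>)"
  if g: "decays p M g" and \<tau>: "0 < \<tau>" "\<tau> \<le> T" and x: "norm x \<ge> 1" for M g \<tau> and x :: 'a
 proof -
  have x0: "x \<noteq> 0" "x /\<^sub>R 2 \<noteq> 0" using x by auto
  let ?X = "norm x powr (- \<kappa>)" and ?t = "\<tau> powr (- (1/2))" and ?E = "LINT y|lborel. g y"
  let ?f = "gk3 a b c"
  have M: "M \<ge> 0" by (rule decays_bound(2)[OF g])
  note gi = decays_integrable[OF g p, folded w_def]
  have E: "\<bar>?E\<bar> \<le> M * w" by (rule order_trans[OF integral_norm_bound[of lborel g, unfolded real_norm_def] gi(3)])
  have U: "{0<..} = {0<..\<tau>} \<union> {\<tau><..}" using \<tau> by auto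
  have i0: "integrable (lon {0<..}) (%r. ?f r x)" by (rule gk3_time_integrable[OF x0(1)])
  have iA: "integrable (lon {0<..\<tau>}) (%r. ?f r x)" by (rule lon_subset[OF i0]) auto
  have iB: "integrable (lon {\<tau><..}) (%r. ?f r x)" by (rule lon_subset[OF i0]) (use \<tau> in auto)
  have ic: "integrable (lon {\<tau><..}) (%r. conv (?f r) g x)"
   by (rule gkernel_time_conv_integrable[OF k _ \<tau>(1) gi(1)]) simp
  have "(LINT r|lon {0<..}. ?f r x) = (LINT r|lon {0<..\<tau>}. ?f r x) + (LINT r|lon {\<tau><..}. ?f r x)"
   unfolding U by (rule lon_Un(2)[OF _ _ _ iA iB]) auto
  then have eq: "(LINT r|lon {\<tau><..}. conv (?f r) g x) - (LINT r|lon {0<..}. ?f r x) * ?E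
   = (LINT r|lon {\<tau><..}. conv (?f r) g x - ?f r x * ?E) - (LINT r|lon {0<..\<tau>}. ?f r x) * ?E"
   using ic iB by (simp add: algebra_simps)
  have b1: "\<bar>LINT r|lon {0<..\<tau>}. ?f r x\<bar> \<le> C * (D * T * ?X)"
  proof -
   have pw: "\<bar>?f r x\<bar> \<le> C * D * ?X" if r: "r > 0" for r
   proof -
    have "\<bar>?f r x\<bar> \<le> C * r powr (- (real 3 / 2)) * gk (2 * r) x" by (rule C(2)[OF r])
    also have "\<dots> \<le> C * r powr (- (real 3 / 2)) * (D * r powr (3/2) * norm x powr (- (?d + 2 * (3/2))))"
     using C(1) by (intro mult_left_mono D(2)[OF r x0(1)]) auto
    also have "\<dots> = C * D * (r powr (- (3 / 2)) * r powr (3/2)) * norm x powr (- (?d + 3))" by simp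
    also have "r powr (- (3 / 2)) * r powr (3/2) = 1" unfolding powr_add[symmetric] using r by simp
    also have "C * D * 1 * norm x powr (- (?d + 3)) \<le> C * D * 1 * ?X"
     using C(1) D(1) \<kappa> by (intro mult_left_mono norm_powr_le[OF x]) auto
    finally show ?thesis by simp
   qed
   have ti: "integrable (lon {0<..\<tau>}) (%_. C * D * ?X)" "(LINT r|lon {0<..\<tau>}. C * D * ?X) = \<tau> * (C * D * ?X)"
    using \<tau> by (simp_all add: lon_integrable set_integrable_def integrable_indicator_iff measure_restrict_space)
   have "\<bar>LINT r|lon {0<..\<tau>}. ?f r x\<bar> \<le> (LINT r|lon {0<..\<tau>}. \<bar>?f r x\<bar>)"
    using integral_norm_bound[of "lon {0<..\<tau>}" "%r. ?f r x"] by simp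
   also have "\<dots> \<le> (LINT r|lon {0<..\<tau>}. C * D * ?X)"
    by (rule integral_mono[OF integrable_abs[OF iA] ti(1)]) (use pw in auto)
   also have "\<dots> \<le> T * (C * D * ?X)" unfolding ti(2) using \<tau> C(1) D(1) by (intro mult_right_mono) auto
   finally show ?thesis by (simp add: mult_ac)
  qed
  have b2: "\<bar>LINT r|lon {\<tau><..}. conv (?f r) g x - ?f r x * ?E\<bar>
   \<le> C * M * (w * (I4 * 2 powr (?d + 2) * ?X) + 2 powr p * ?X * (2 * ?t) + 2 * w * I3 * ?X)"
  proof -
   let ?h4 = "%r. r powr (- (real 4 / 2)) * gk (2 * r) (x /\<^sub>R 2)" and ?h3 = "%r. r powr (- (real 3 / 2)) * gk (2 * r) x"
   let ?h = "%r. C * M * (w * ?h4 r + 2 powr p * norm x powr (- p) * r powr (- (3 / 2)) + 2 / norm x * w * ?h3 r)"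
   have j4: "integrable (lon {0<..}) ?h4" by (rule gk_double_time_integrable) (use x0 in auto)
   have j3: "integrable (lon {0<..}) ?h3" by (rule gk_double_time_integrable) (use x0 in auto)
   have jr: "integrable (lon {\<tau><..}) (%r. r powr (- (3 / 2)))" "(LINT r|lon {\<tau><..}. r powr (- (3 / 2))) = 2 * ?t"
    using powr_integral_inf[of "3/2" \<tau>] \<tau> by auto
   have j4': "integrable (lon {\<tau><..}) ?h4" by (rule lon_subset[OF j4]) (use \<tau> in auto)
   have j3': "integrable (lon {\<tau><..}) ?h3" by (rule lon_subset[OF j3]) (use \<tau> in auto)
   have mono: "(LINT r|lon {\<tau><..}. h r) \<le> (LINT r|lon {0<..}. h r)"
    if h: "integrable (lon {0<..}) h" "!!r. r > 0 ==> h r \<ge> 0" for h :: "real \<Rightarrow> real"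
   proof -
    have "(LINT r|lon {0<..}. h r) = (LINT r|lon {0<..\<tau>}. h r) + (LINT r|lon {\<tau><..}. h r)"
     unfolding U by (rule lon_Un(2)) (use \<tau> in \<open>auto intro: lon_subset[OF h(1)]\<close>)
    moreover have "(LINT r|lon {0<..\<tau>}. h r) \<ge> 0" by (rule integral_nonneg_AE) (use h in auto)
    ultimately show ?thesis by simp
   qed
   have v4: "(LINT r|lon {\<tau><..}. ?h4 r) \<le> I4 * 2 powr (?d + 2) * ?X"
   proof -
    have "(LINT r|lon {\<tau><..}. ?h4 r) \<le> (LINT r|lon {0<..}. ?h4 r)" by (rule mono[OF j4]) auto
    also have "\<dots> = I4 * norm (x /\<^sub>R 2) powr (- (?d + 2))" using I4(2)[OF x0(2)] by (simp add: algebra_simps)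
    also have "\<dots> = I4 * (2 powr (?d + 2) * norm x powr (- (?d + 2)))" unfolding norm_half_powr ..
    also have "\<dots> \<le> I4 * (2 powr (?d + 2) * ?X)"
     using I4(1) \<kappa> by (intro mult_left_mono norm_powr_le[OF x]) auto
    finally show ?thesis by simp
   qed
   have v3: "2 / norm x * w * (LINT r|lon {\<tau><..}. ?h3 r) \<le> 2 * w * I3 * ?X"
   proof -
    have "(LINT r|lon {\<tau><..}. ?h3 r) \<le> (LINT r|lon {0<..}. ?h3 r)" by (rule mono[OF j3]) auto
    also have "\<dots> = I3 * norm x powr (- (?d + 1))" using I3(2)[OF x0(1)] by (simp add: algebra_simps)
    finally have "2 / norm x * w * (LINT r|lon {\<tau><..}. ?h3 r) \<le> 2 / norm x * w * (I3 * norm x powr (- (?d + 1)))"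
     using w by (intro mult_left_mono) auto
    also have "\<dots> = 2 * w * I3 * (norm x powr (- (?d + 1)) * norm x powr (- 1))"
     using x0 by (simp add: powr_minus_divide)
    also have "norm x powr (- (?d + 1)) * norm x powr (- 1) = norm x powr (- (?d + 2))"
     unfolding powr_add[symmetric] by (rule arg_cong[where f = "(powr) (norm x)"]) simp
    also have "2 * w * I3 * norm x powr (- (?d + 2)) \<le> 2 * w * I3 * ?X"
     using w I3(1) \<kappa> by (intro mult_left_mono norm_powr_le[OF x]) auto
    finally show ?thesis .
   qed
   have "\<bar>LINT r|lon {\<tau><..}. conv (?f r) g x - ?f r x * ?E\<bar> \<le> (LINT r|lon {\<tau><..}. \<bar>conv (?f r) g x - ?f r x * ?E\<bar>)"
    using integral_norm_bound[of "lon {\<tau><..}" "%r. conv (?f r) g x - ?f r x * ?E"] by simp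
   also have "\<dots> \<le> (LINT r|lon {\<tau><..}. ?h r)"
   proof (rule integral_mono)
    show "integrable (lon {\<tau><..}) (%r. \<bar>conv (?f r) g x - ?f r x * ?E\<bar>)" using ic iB by simp
    show "integrable (lon {\<tau><..}) ?h"
     using j4' j3' jr(1) by (intro Bochner_Integration.integrable_mult_right Bochner_Integration.integrable_add)
    fix r assume "r \<in> space (lon {\<tau><..})"
    then have r: "r > 0" using \<tau> by simp
    show "\<bar>conv (?f r) g x - ?f r x * ?E\<bar> \<le> ?h r"
     using conv_near_far(1)[OF k r x0(1) g p C] by (simp add: w_def)
   qed
   also have "\<dots> = C * M * (w * (LINT r|lon {\<tau><..}. ?h4 r) + 2 powr p * norm x powr (- p) * (2 * ?t) + 2 / norm x * w * (LINT r|lon {\<tau><..}. ?h3 r))"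
   proof -
    have "(LINT r|lon {\<tau><..}. w * ?h4 r + 2 powr p * norm x powr (- p) * r powr (- (3 / 2)) + 2 / norm x * w * ?h3 r)
     = (LINT r|lon {\<tau><..}. w * ?h4 r + 2 powr p * norm x powr (- p) * r powr (- (3 / 2))) + (LINT r|lon {\<tau><..}. 2 / norm x * w * ?h3 r)"
     by (intro Bochner_Integration.integral_add Bochner_Integration.integrable_add Bochner_Integration.integrable_mult_right j4' j3' jr)
    also have "(LINT r|lon {\<tau><..}. w * ?h4 r + 2 powr p * norm x powr (- p) * r powr (- (3 / 2)))
     = (LINT r|lon {\<tau><..}. w * ?h4 r) + (LINT r|lon {\<tau><..}. 2 powr p * norm x powr (- p) * r powr (- (3 / 2)))"
     by (intro Bochner_Integration.integral_add Bochner_Integration.integrable_mult_right j4' jr)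
    finally show ?thesis
     unfolding jr(2)[symmetric] by (simp only: Bochner_Integration.integral_mult_right_zero)
   qed
   also have "\<dots> \<le> C * M * (w * (I4 * 2 powr (?d + 2) * ?X) + 2 powr p * ?X * (2 * ?t) + 2 * w * I3 * ?X)"
    using C(1) M w \<kappa> norm_powr_le[OF x \<kappa>(1)] by (intro mult_left_mono add_mono mult_mono v4 v3) auto
   finally show ?thesis .
  qed
  have "\<bar>(LINT r|lon {\<tau><..}. conv (?f r) g x) - (LINT r|lon {0<..}. ?f r x) * ?E\<bar>
   \<le> \<bar>LINT r|lon {\<tau><..}. conv (?f r) g x - ?f r x * ?E\<bar> + \<bar>LINT r|lon {0<..\<tau>}. ?f r x\<bar> * \<bar>?E\<bar>"
   unfolding eq by (rule order_trans[OF abs_triangle_ineq4]) (simp add: abs_mult)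
  also have "\<dots> \<le> C * M * (w * (I4 * 2 powr (?d + 2) * ?X) + 2 powr p * ?X * (2 * ?t) + 2 * w * I3 * ?X) + (C * (D * T * ?X)) * (M * w)"
   using b1 b2 E C(1) D(1) T by (intro add_mono mult_mono) auto
  also have "\<dots> = C * M * ?X * (K0 * 1 + 2 powr p * 2 * ?t)" by (simp add: K0_def algebra_simps)
  \<comment> \<open>The terms without a singular factor are multiplied by sqrt T *
    \<open>\<tau>\<close>^{-1/2}, which is at least 1, so that all of them carry the same
    weight.\<close>
  also have "\<dots> \<le> C * M * ?X * (K0 * (sqrt T * ?t) + 2 powr p * 2 * ?t)"
   using C(1) M K0 sqrt_weight[OF \<tau>] by (intro mult_left_mono add_mono) auto
  also have "\<dots> = K * M * ?t * ?X" by (simp add: K_def algebra_simps)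
  finally show ?thesis .
 qed
 with K show ?thesis by blast
qed

section \<open>Mild solutions: the Duhamel integral and the expansion of the velocity\<close>

lemma vec_integral:
 fixes V :: "'a \<Rightarrow> 'b::euclidean_space^'n"
 assumes "!!j. integrable M (%s. V s $ j)"
 shows "integrable M V" "integral\<^sup>L M V $ j = (LINT s|M. V s $ j)"
proof -
 have e: "V = (%s. \<Sum>j\<in>UNIV. axis j (V s $ j))"
  by (auto simp: fun_eq_iff vec_eq_iff axis_def sum.delta)
 have bl: "bounded_linear (axis j :: 'b \<Rightarrow> 'b^'n)" for j
  by (intro linear_conv_bounded_linear[THEN iffD1] linearI) (auto simp: vec_eq_iff axis_def)
 show "integrable M V"
  by (subst e) (intro Bochner_Integration.integrable_sum integrable_bounded_linear[OF bl] assms)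
 then show "integral\<^sup>L M V $ j = (LINT s|M. V s $ j)"
  by (rule integral_bounded_linear[OF bounded_linear_vec_nth, symmetric])
qed

lemma lon_reflect:
 fixes f :: "real \<Rightarrow> real"
 assumes [measurable]: "f \<in> borel_measurable borel"
 shows "integrable (lon {0<..<t}) (%s. f (t - s)) \<longleftrightarrow> integrable (lon {0<..<t}) f"
  "(LINT s|lon {0<..<t}. f (t - s)) = (LINT s|lon {0<..<t}. f s)"
proof -
 have e: "indicator {0<..<t} s *\<^sub>R f (t - s) = (%r. indicator {0<..<t} r *\<^sub>R f r) (t - s)" for s
  by (auto split: split_indicator)
 show "integrable (lon {0<..<t}) (%s. f (t - s)) \<longleftrightarrow> integrable (lon {0<..<t}) f"
  unfolding lon_integrable[OF borel_open[OF open_greaterThanLessThan]] set_integrable_def e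
  by (rule lborel_reflect(1)) measurable
 show "(LINT s|lon {0<..<t}. f (t - s)) = (LINT s|lon {0<..<t}. f s)"
  unfolding lon_integral[OF borel_open[OF open_greaterThanLessThan]] set_lebesgue_integral_def e
  by (rule lborel_reflect(2)) measurable
qed

lemma powr_integral_open:
 fixes a t :: real
 assumes "a < 1" "t > 0"
 shows "integrable (lon {0<..<t}) (%s. s powr (- a))" "(LINT s|lon {0<..<t}. s powr (- a)) \<le> t powr (1 - a) / (1 - a)"
  "integrable (lon {0<..<t}) (%s. (t - s) powr (- a))" "(LINT s|lon {0<..<t}. (t - s) powr (- a)) \<le> t powr (1 - a) / (1 - a)"
proof -
 have i: "integrable (lon {0<..t}) (%s. s powr (- a))" using powr_integral_0(1)[of a t] assms by simp
 show i1: "integrable (lon {0<..<t}) (%s. s powr (- a))" by (rule lon_subset[OF i]) auto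
 have i2: "integrable (lon {t}) (%s. s powr (- a))" by (rule lon_subset[OF i]) (use assms in auto)
 have U: "{0<..t} = {0<..<t} \<union> {t}" using assms by auto
 have "(LINT s|lon {0<..t}. s powr (- a)) = (LINT s|lon {0<..<t}. s powr (- a)) + (LINT s|lon {t}. s powr (- a))"
  unfolding U by (rule lon_Un(2)[OF _ _ _ i1 i2]) auto
 moreover have "(LINT s|lon {t}. s powr (- a)) \<ge> 0" by (rule integral_nonneg_AE) auto
 ultimately show v: "(LINT s|lon {0<..<t}. s powr (- a)) \<le> t powr (1 - a) / (1 - a)"
  using powr_integral_0(2)[of a t] assms by simp
 show "integrable (lon {0<..<t}) (%s. (t - s) powr (- a))"
  using lon_reflect(1)[of "%s. s powr (- a)" t] i1 by simp
 show "(LINT s|lon {0<..<t}. (t - s) powr (- a)) \<le> t powr (1 - a) / (1 - a)"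
  using lon_reflect(2)[of "%s. s powr (- a)" t] v by simp
qed

lemma conv_L1_bound:
 fixes f :: "real \<Rightarrow> 'a::euclidean_space \<Rightarrow> real"
 assumes k: "gkernel m f f'" and s: "s > 0" and g: "!!y. \<bar>g y\<bar> \<le> B" "g \<in> borel_measurable borel"
  and C: "!!s z. s > 0 ==> \<bar>f s z\<bar> \<le> C * s powr (- (real m / 2)) * gk (2 * s) z"
 shows "\<bar>conv (f s) g x\<bar> \<le> C * B * s powr (- (real m / 2))"
proof -
 note fi = gkernel_reflect_integrable[OF k s C]
 have B: "B \<ge> 0" using g(1)[of 0] by linarith
 have ci: "integrable lborel (%y. f s (x - y) * g y)"
  by (rule conv_integrable'[OF g(2,1) gkernel_integrable(1)[OF k s]])
 have "\<bar>conv (f s) g x\<bar> \<le> (LINT y|lborel. \<bar>f s (x - y) * g y\<bar>)"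
  using integral_norm_bound[of lborel "%y. f s (x - y) * g y"] by simp
 also have "\<dots> \<le> (LINT y|lborel. \<bar>f s (x - y)\<bar> * B)"
 proof (rule integral_mono)
  show "integrable lborel (%y. \<bar>f s (x - y)\<bar> * B)" using fi(1) by (rule Bochner_Integration.integrable_mult_left)
  show "\<bar>f s (x - y) * g y\<bar> \<le> \<bar>f s (x - y)\<bar> * B" for y unfolding abs_mult by (intro mult_left_mono g) auto
 qed (rule integrable_abs[OF ci])
 also have "\<dots> = (LINT y|lborel. \<bar>f s (x - y)\<bar>) * B" by (rule Bochner_Integration.integral_mult_left_zero)
 also have "\<dots> \<le> C * s powr (- (real m / 2)) * B" using fi(2) B by (rule mult_right_mono)
 finally show ?thesis by (simp add: mult_ac)
qed

text \<open>A mild solution with the hypotheses of the theorem, in which \<open>p\<close> stands for twice the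
 decay exponent of the velocity.\<close>

locale mild_ns =
 fixes a :: "real^'n \<Rightarrow> real^'n" and u :: "real \<Rightarrow> real^'n \<Rightarrow> real^'n" and T p M :: real
 assumes d: "CARD('n) \<ge> 2" and T: "T > 0" and p: "p > real CARD('n) + 1"
  and a_meas: "a \<in> borel_measurable lebesgue" and a_bound: "AE y in lebesgue. norm (a y) \<le> M"
  and cont: "continuous_on ({0<..T} \<times> UNIV) (%(t, x). u t x)"
  and bound: "!!t x. t \<in> {0<..T} ==> norm (u t x) \<le> M * (1 + norm x) powr (- (p / 2))"
  and mild: "mild_solution T a u"
begin

lemma M_nonneg: "M \<ge> 0"
proof -
 have "0 \<le> norm (u T 0)" by simp
 also have "\<dots> \<le> M" using bound[of T 0] T by simp
 finally show ?thesis .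
qed

text \<open>Extended by 0 outside (0, T], so that it is Borel jointly in time and space; at time 0
  the solution coincides with the datum, which is only Lebesgue measurable.\<close>

definition stress :: "'n \<Rightarrow> 'n \<Rightarrow> real \<Rightarrow> real^'n \<Rightarrow> real" where
 "stress h k s y = (if s \<in> {0<..T} then u s y $ h * u s y $ k else 0)"

lemma velocity_measurable: "(%(s, y). if s \<in> {0<..T} then u s y else 0) \<in> borel_measurable (borel \<Otimes>\<^sub>M borel)"
proof -
 have "(%z. if z \<in> {0<..T} \<times> UNIV then (%(t, x). u t x) z else 0) \<in> borel_measurable borel"
 proof (rule borel_measurable_continuous_on_if)
  show "{0<..T} \<times> (UNIV :: (real^'n) set) \<in> sets borel"
   unfolding borel_prod[symmetric] by (rule pair_measureI) auto
 qed (use cont in auto)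
 moreover have "(%(s, y). if s \<in> {0<..T} then u s y else 0) = (%z. if z \<in> {0<..T} \<times> UNIV then (%(t, x). u t x) z else 0)"
  by (auto simp: fun_eq_iff)
 ultimately show ?thesis unfolding borel_prod by simp
qed

lemma stress_measurable: "(%(s, y). stress h k s y) \<in> borel_measurable (borel \<Otimes>\<^sub>M borel)"
proof -
 have [measurable]: "(%z. (if fst z \<in> {0<..T} then u (fst z) (snd z) else 0) $ h) \<in> borel_measurable (borel \<Otimes>\<^sub>M borel)" for h
  using borel_measurable_continuous_onI[of "%v::real^'n. v $ h"] velocity_measurable
  by (intro measurable_compose[OF velocity_measurable[unfolded case_prod_beta']]) (auto intro: continuous_intros)
 have "(%z. (if fst z \<in> {0<..T} then u (fst z) (snd z) else 0) $ h * (if fst z \<in> {0<..T} then u (fst z) (snd z) else 0) $ k)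
   \<in> borel_measurable (borel \<Otimes>\<^sub>M borel)" by measurable
 moreover have "(%(s, y). stress h k s y) = (%z. (if fst z \<in> {0<..T} then u (fst z) (snd z) else 0) $ h * (if fst z \<in> {0<..T} then u (fst z) (snd z) else 0) $ k)"
  by (auto simp: stress_def fun_eq_iff)
 ultimately show ?thesis by simp
qed

lemma stress_compose [measurable (raw)]:
 assumes [measurable]: "f \<in> borel_measurable N" "g \<in> borel_measurable N"
 shows "(%z. stress h k (f z) (g z)) \<in> borel_measurable N"
proof -
 have "(%z. (%(s, y). stress h k s y) (f z, g z)) \<in> borel_measurable N"
  by (rule measurable_compose[OF _ stress_measurable]) measurable
 then show ?thesis by simp
qed

lemma stress_decays: "decays p (M\<^sup>2) (stress h k s)"
 unfolding decays_def
proof (intro conjI allI)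
 show "stress h k s \<in> borel_measurable borel" by measurable
 fix y
 show "\<bar>stress h k s y\<bar> \<le> M\<^sup>2 * (1 + norm y) powr (- p)"
 proof (cases "s \<in> {0<..T}")
  case True
  have "\<bar>u s y $ h\<bar> * \<bar>u s y $ k\<bar> \<le> (M * (1 + norm y) powr (- (p / 2))) * (M * (1 + norm y) powr (- (p / 2)))"
   using bound[OF True, of y] component_le_norm_cart[of "u s y"] M_nonneg
   by (intro mult_mono) (auto intro: order_trans)
  also have "\<dots> = M\<^sup>2 * ((1 + norm y) powr (- (p / 2)) * (1 + norm y) powr (- (p / 2)))"
   by (simp add: power2_eq_square)
  also have "(1 + norm y) powr (- (p / 2)) * (1 + norm y) powr (- (p / 2)) = (1 + norm y) powr (- p)"
   unfolding powr_add[symmetric] by simp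
  finally show ?thesis using True by (simp add: stress_def abs_mult)
 qed (auto simp: stress_def)
qed simp

lemma stress_bound: "\<bar>stress h k s y\<bar> \<le> M\<^sup>2"
 using decays_abs_le[OF stress_decays] p by simp

lemma stress_integrable: "integrable lborel (stress h k s)" "integrable lborel (%y. norm y * stress h k s y)"
 using decays_integrable(1,2)[OF stress_decays] p by auto

text \<open>Component j of e^{\<open>\<tau>\<close> Delta} P div applied to u(s) tensor u(s), in the
  form provided by \<open>heat_leray_div_eq\<close>.\<close>

definition duh :: "'n \<Rightarrow> real \<Rightarrow> real \<Rightarrow> real^'n \<Rightarrow> real" where
 "duh j \<tau> s x = (\<Sum>k\<in>UNIV. conv (gk1 (axis k 1) \<tau>) (stress k j s) x)
  + (\<Sum>h\<in>UNIV. \<Sum>k\<in>UNIV. LINT r|lon {\<tau><..}. conv (gk3 (axis h 1) (axis k 1) (axis j 1) r) (stress h k s) x)"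

lemma tensor_component: "s \<in> {0<..T} ==> tensor (u s) y $ h $ k = stress h k s y"
 by (simp add: tensor_def stress_def)

lemma heat_leray_div_duh:
 assumes s: "s \<in> {0<..T}" and \<tau>: "\<tau> > 0"
 shows "heat_leray_div \<tau> (tensor (u s)) x $ j = duh j \<tau> s x"
proof -
 note tc = tensor_component[OF s]
 have c: "integrable lborel (%y. tensor (u s) y $ h $ k)" "integrable lborel (%y. norm y * tensor (u s) y $ h $ k)" for h k
  unfolding tc by (rule stress_integrable)+
 from c(1) have "integrable lborel (%y. tensor (u s) y $ h)" for h by (rule vec_integral(1))
 then have i: "integrable lborel (tensor (u s))" by (rule vec_integral(1))
 show ?thesis
  unfolding duh_def heat_leray_div_eq[OF d \<tau> i c] tc ..
qed

text \<open>The usual smoothing bound on bounded data. The local term has the L1 norm of a first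
  derivative; in the nonlocal one the L1 norm r^{-3/2} of a third derivative is integrated over r >
  \<open>\<tau>\<close>.\<close>

lemma duh_bound:
 obtains C where "C > 0" "!!j \<tau> s x. \<tau> > 0 ==> \<bar>duh j \<tau> s x\<bar> \<le> C * \<tau> powr (- (1/2))"
proof -
 define Q1 where "Q1 k C \<longleftrightarrow> (\<forall>s z. s > 0 \<longrightarrow> \<bar>gk1 (axis k 1 :: real^'n) s z\<bar> \<le> C * s powr (- (real 1 / 2)) * gk (2 * s) z)" for k C
 have "\<exists>C>0. Q1 k C" for k
  unfolding Q1_def by (rule gkernelE[OF gkernel_gk1[of "axis k 1 :: real^'n"]]) blast
 then obtain C1 where C1: "!!k. C1 k > 0" "!!k. Q1 k (C1 k)" by metis
 define Q3 where "Q3 h k j C \<longleftrightarrow> (\<forall>s z. s > 0 \<longrightarrow> \<bar>gk3 (axis h 1) (axis k 1) (axis j 1 :: real^'n) s z\<bar>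
  \<le> C * s powr (- (real 3 / 2)) * gk (2 * s) z)" for h k j C
 have "\<exists>C>0. Q3 h k j C" for h k j
  unfolding Q3_def by (rule gkernelE[OF gkernel_gk3[of "axis h 1" "axis k 1" "axis j 1 :: real^'n"]]) blast
 then obtain C3 where C3: "!!h k j. C3 h k j > 0" "!!h k j. Q3 h k j (C3 h k j)" by metis
 note C1' = C1(2)[unfolded Q1_def, rule_format]
 note C3' = C3(2)[unfolded Q3_def, rule_format]
 define C where "C = (\<Sum>j\<in>UNIV. (\<Sum>k\<in>UNIV. C1 k * M\<^sup>2) + (\<Sum>h\<in>UNIV. \<Sum>k\<in>UNIV. C3 h k j * M\<^sup>2 * 2)) + 1"
 have nn: "(\<Sum>k\<in>UNIV. C1 k * M\<^sup>2) + (\<Sum>h\<in>UNIV. \<Sum>k\<in>UNIV. C3 h k j * M\<^sup>2 * 2) \<ge> 0" for j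
  using C1(1) C3(1) by (intro add_nonneg_nonneg sum_nonneg mult_nonneg_nonneg) (auto intro: less_imp_le)
 have Cj: "(\<Sum>k\<in>UNIV. C1 k * M\<^sup>2) + (\<Sum>h\<in>UNIV. \<Sum>k\<in>UNIV. C3 h k j * M\<^sup>2 * 2) \<le> C" for j
  using member_le_sum[of j UNIV "%j. (\<Sum>k\<in>UNIV. C1 k * M\<^sup>2) + (\<Sum>h\<in>UNIV. \<Sum>k\<in>UNIV. C3 h k j * M\<^sup>2 * 2)"] nn
  unfolding C_def by (smt (verit) UNIV_I finite)
 have "C > 0" unfolding C_def using nn by (intro add_nonneg_pos sum_nonneg) auto
 moreover have "\<bar>duh j \<tau> s x\<bar> \<le> C * \<tau> powr (- (1/2))" if \<tau>: "\<tau> > 0" for j \<tau> s x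
 proof -
  let ?t = "\<tau> powr (- (1/2))"
  have 1: "\<bar>conv (gk1 (axis k 1) \<tau>) (stress k j s) x\<bar> \<le> C1 k * M\<^sup>2 * ?t" for k
   using conv_L1_bound[OF gkernel_gk1 \<tau> stress_bound _ C1'] by simp
  have 3: "\<bar>LINT r|lon {\<tau><..}. conv (gk3 (axis h 1) (axis k 1) (axis j 1) r) (stress h k s) x\<bar> \<le> C3 h k j * M\<^sup>2 * 2 * ?t" for h k
  proof -
   let ?f = "%r. conv (gk3 (axis h 1) (axis k 1) (axis j 1) r) (stress h k s) x"
   have i: "integrable (lon {\<tau><..}) ?f"
    by (rule gkernel_time_conv_integrable[OF gkernel_gk3 _ \<tau> stress_integrable(1)]) simp
   have "\<bar>LINT r|lon {\<tau><..}. ?f r\<bar> \<le> (LINT r|lon {\<tau><..}. \<bar>?f r\<bar>)"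
    using integral_norm_bound[of "lon {\<tau><..}" ?f] by simp
   also have "\<dots> \<le> (LINT r|lon {\<tau><..}. C3 h k j * M\<^sup>2 * r powr (- (3/2)))"
   proof (rule integral_mono[OF integrable_abs[OF i]])
    show "integrable (lon {\<tau><..}) (%r. C3 h k j * M\<^sup>2 * r powr (- (3/2)))"
     using powr_integral_inf(1)[of "3/2" \<tau>] \<tau> by simp
    fix r assume "r \<in> space (lon {\<tau><..})"
    then have r: "r > 0" using \<tau> by simp
    show "\<bar>?f r\<bar> \<le> C3 h k j * M\<^sup>2 * r powr (- (3/2))"
     using conv_L1_bound[OF gkernel_gk3 r stress_bound _ C3'] by simp
   qed
   also have "\<dots> = C3 h k j * M\<^sup>2 * 2 * ?t" using powr_integral_inf(2)[of "3/2" \<tau>] \<tau> by simp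
   finally show ?thesis .
  qed
  have "\<bar>duh j \<tau> s x\<bar> \<le> (\<Sum>k\<in>UNIV. C1 k * M\<^sup>2 * ?t) + (\<Sum>h\<in>UNIV. \<Sum>k\<in>UNIV. C3 h k j * M\<^sup>2 * 2 * ?t)"
   unfolding duh_def
   by (intro order_trans[OF abs_triangle_ineq] add_mono order_trans[OF sum_abs] sum_mono 1 3)
  also have "\<dots> = ((\<Sum>k\<in>UNIV. C1 k * M\<^sup>2) + (\<Sum>h\<in>UNIV. \<Sum>k\<in>UNIV. C3 h k j * M\<^sup>2 * 2)) * ?t"
   by (simp add: sum_distrib_right distrib_right)
  also have "\<dots> \<le> C * ?t" by (intro mult_right_mono Cj) auto
  finally show ?thesis .
 qed
 ultimately show ?thesis using that by blast
qed

lemma conv_stress_measurable: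
 fixes f :: "real \<Rightarrow> real^'n \<Rightarrow> real"
 assumes [measurable]: "(%(s, z). f s z) \<in> borel_measurable (borel \<Otimes>\<^sub>M borel)"
  "g1 \<in> borel_measurable N" "g2 \<in> borel_measurable N"
 shows "(%w. conv (f (g1 w)) (stress h k (g2 w)) x) \<in> borel_measurable N"
proof -
 have "(%q. (%(s, z). f s z) (g1 (fst q), x - snd q) * stress h k (g2 (fst q)) (snd q)) \<in> borel_measurable (N \<Otimes>\<^sub>M lborel)"
  by measurable
 then have "(%(w, y). f (g1 w) (x - y) * stress h k (g2 w) y) \<in> borel_measurable (N \<Otimes>\<^sub>M lborel)"
  by (simp add: case_prod_beta')
 then show ?thesis by (rule lborel.borel_measurable_lebesgue_integral)
qed

lemma duh_measurable: "(%s. duh j (t - s) s x) \<in> borel_measurable borel"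
proof -
 have 1: "(%s. conv (gk1 (axis k 1) (t - s)) (stress k j s) x) \<in> borel_measurable borel" for k
  by (rule conv_stress_measurable[OF gkernel_pair_measurable(1)[OF gkernel_gk1]]) measurable
 have 3: "(%s. LINT r|lon {t - s<..}. conv (gk3 (axis h 1) (axis k 1) (axis j 1) r) (stress h k s) x) \<in> borel_measurable borel" for h k
 proof -
  have [measurable]: "(%q. conv (gk3 (axis h 1) (axis k 1) (axis j 1) (snd q)) (stress h k (fst q)) x) \<in> borel_measurable (borel \<Otimes>\<^sub>M lborel)"
   by (rule conv_stress_measurable[OF gkernel_pair_measurable(1)[OF gkernel_gk3]]) measurable
  have "(%q. indicator {w. fst w + snd w > t} q * conv (gk3 (axis h 1) (axis k 1) (axis j 1) (snd q)) (stress h k (fst q)) x) \<in> borel_measurable (borel \<Otimes>\<^sub>M lborel)"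
   by measurable
  then have "(%(s, r). indicator {t - s<..} r *\<^sub>R conv (gk3 (axis h 1) (axis k 1) (axis j 1) r) (stress h k s) x) \<in> borel_measurable (borel \<Otimes>\<^sub>M lborel)"
   by (rule measurable_cong[THEN iffD1, rotated]) (auto split: split_indicator simp: algebra_simps)
  from lborel.borel_measurable_lebesgue_integral[OF this]
  show ?thesis unfolding lon_integral[OF borel_open[OF open_greaterThan]] set_lebesgue_integral_def .
 qed
 show ?thesis unfolding duh_def by (intro borel_measurable_add borel_measurable_sum 1 3)
qed

lemma duh_integrable:
 assumes t: "t > 0"
 shows "integrable (lon {0<..<t}) (%s. duh j (t - s) s x)"
proof -
 from duh_bound obtain C where C: "C > 0" "!!j \<tau> s x. \<tau> > 0 ==> \<bar>duh j \<tau> s x\<bar> \<le> C * \<tau> powr (- (1/2))" by metis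
 show ?thesis
 proof (rule Bochner_Integration.integrable_bound)
  show "integrable (lon {0<..<t}) (%s. C * (t - s) powr (- (1/2)))"
   using powr_integral_open(3)[of "1/2" t] t by simp
  show "(%s. duh j (t - s) s x) \<in> borel_measurable (lon {0<..<t})"
   by (rule lon_measurable[OF duh_measurable])
  show "AE s in lon {0<..<t}. norm (duh j (t - s) s x) \<le> norm (C * (t - s) powr (- (1/2)))"
   by (intro AE_I2) (auto intro!: order_trans[OF C(2) abs_ge_self])
 qed
qed

text \<open>At the endpoints the Duhamel integrand takes whatever value the total operators assign
  to it. They form a null set, and \<open>H'\<close> keeps these two values while being Borel, which
  allows the passage from Lebesgue to Borel measure.\<close>

lemma integral_Icc_lebesgue:
 fixes H :: "real \<Rightarrow> 'b::euclidean_space"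
 assumes t: "t > 0" and eq: "!!s. s \<in> {0<..<t} ==> H s = V s" and V: "V \<in> borel_measurable borel"
 shows "(LINT s:{0..t}|lebesgue. H s) = (LINT s|lborel. indicator {0<..<t} s *\<^sub>R V s)"
proof -
 note [measurable] = V
 define H' where "H' s = (if s = 0 then H 0 else if s = t then H t else V s)" for s
 have [measurable]: "H' \<in> borel_measurable borel" unfolding H'_def[abs_def] by measurable
 have "(LINT s:{0..t}|lebesgue. H s) = (LINT s|lebesgue. indicator {0..t} s *\<^sub>R H' s)"
  unfolding set_lebesgue_integral_def
  by (intro Bochner_Integration.integral_cong refl) (auto simp: H'_def eq split: split_indicator)
 also have "\<dots> = (LINT s|lborel. indicator {0..t} s *\<^sub>R H' s)" by (rule integral_completion) measurable
 also have "\<dots> = (LINT s|lborel. indicator {0<..<t} s *\<^sub>R V s)"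
 proof (rule integral_cong_AE)
  have "AE s in lborel. s \<noteq> 0" "AE s in lborel. s \<noteq> t" by (rule AE_lborel_singleton)+
  then show "AE s in lborel. indicator {0..t} s *\<^sub>R H' s = indicator {0<..<t} s *\<^sub>R V s"
   by eventually_elim (auto simp: H'_def split: split_indicator)
 qed measurable
 finally show ?thesis .
qed

lemma mild_component:
 assumes t: "t \<in> {0<..T}"
 shows "u t x $ j = heat t a x $ j - (LINT s|lon {0<..<t}. duh j (t - s) s x)"
proof -
 have t0: "t > 0" using t by simp
 let ?V = "%s. \<chi> j. duh j (t - s) s x"
 have V: "?V \<in> borel_measurable borel"
 proof -
  have "?V = (%s. \<Sum>j\<in>UNIV. duh j (t - s) s x *\<^sub>R axis j 1)"
   by (auto simp: fun_eq_iff vec_eq_iff axis_def sum.delta if_distrib cong: if_cong)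
  then show ?thesis by (simp only:) (intro borel_measurable_sum borel_measurable_scaleR duh_measurable borel_measurable_const)
 qed
 have H: "heat_leray_div (t - s) (tensor (u s)) x = ?V s" if "s \<in> {0<..<t}" for s
  using heat_leray_div_duh[of s "t - s" x] that t by (auto simp: vec_eq_iff)
 have vi: "integrable lborel (%s. (indicator {0<..<t} s *\<^sub>R ?V s) $ j)" for j
  using duh_integrable[OF t0, of j x] by (simp add: lon_integrable set_integrable_def)
 have "u t x = heat t a x - (LINT s:{0..t}|lebesgue. heat_leray_div (t - s) (tensor (u s)) x)"
  using mild t unfolding mild_solution_def by auto
 also have "(LINT s:{0..t}|lebesgue. heat_leray_div (t - s) (tensor (u s)) x) = (LINT s|lborel. indicator {0<..<t} s *\<^sub>R ?V s)"
  by (rule integral_Icc_lebesgue[OF t0 H V])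
 finally have "u t x $ j = heat t a x $ j - (LINT s|lborel. indicator {0<..<t} s *\<^sub>R ?V s) $ j" by simp
 also have "(LINT s|lborel. indicator {0<..<t} s *\<^sub>R ?V s) $ j = (LINT s|lon {0<..<t}. duh j (t - s) s x)"
  by (subst vec_integral(2)[OF vi]) (simp add: lon_integral set_lebesgue_integral_def)
 finally show ?thesis .
qed

lemma energy_matrix_eq: "s \<in> {0<..T} ==> energy_matrix u s h k = (LINT y|lborel. stress h k s y)"
proof -
 assume s: "s \<in> {0<..T}"
 have "energy_matrix u s h k = (LINT y|lebesgue. stress h k s y)"
  using s by (simp add: energy_matrix_def stress_def)
 also have "\<dots> = (LINT y|lborel. stress h k s y)" by (rule integral_completion) measurable
 finally show ?thesis .
qed

lemma stress_integral_measurable: "(%s. LINT y|lborel. stress h k s y) \<in> borel_measurable borel"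
 by (rule lborel.borel_measurable_lebesgue_integral) measurable

lemma stress_integral_bound: "\<bar>LINT y|lborel. stress h k s y\<bar> \<le> M\<^sup>2 * weight_integral TYPE(real^'n) (p - 1)"
 using order_trans[OF integral_norm_bound[of lborel "stress h k s", unfolded real_norm_def]] decays_integrable(3)[OF stress_decays] p
 by simp

lemma stress_integral_integrable: "integrable (lon {0<..<t}) (%s. LINT y|lborel. stress h k s y)"
proof (rule Bochner_Integration.integrable_bound)
 show "integrable (lon {0<..<t}) (%s. M\<^sup>2 * weight_integral TYPE(real^'n) (p - 1))"
  by (cases "t > 0") (simp_all add: lon_integrable set_integrable_def integrable_indicator_iff)
 show "(%s. LINT y|lborel. stress h k s y) \<in> borel_measurable (lon {0<..<t})"
  by (rule lon_measurable[OF stress_integral_measurable])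
 show "AE s in lon {0<..<t}. norm (LINT y|lborel. stress h k s y) \<le> norm (M\<^sup>2 * weight_integral TYPE(real^'n) (p - 1))"
  by (intro AE_I2) (auto intro!: order_trans[OF stress_integral_bound abs_ge_self])
qed

lemma K_matrix_eq:
 assumes t: "t \<in> {0<..T}"
 shows "K_matrix u t h k = (LINT s|lon {0<..<t}. LINT y|lborel. stress h k s y)"
proof -
 have "K_matrix u t h k = (LINT s:{0..t}|lebesgue. energy_matrix u s h k)"
  by (simp add: K_matrix_def energy_matrix_def)
 also have "\<dots> = (LINT s|lborel. indicator {0<..<t} s *\<^sub>R (LINT y|lborel. stress h k s y))"
  by (rule integral_Icc_lebesgue) (use t in \<open>auto simp: energy_matrix_eq intro!: stress_integral_measurable\<close>)
 finally show ?thesis by (simp add: lon_integral set_lebesgue_integral_def)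
qed

text \<open>The gradient of the profile of K is, like the Duhamel term, an integral over s: K
  integrates in time the masses of the stresses at time s. Under the common integral the difference
  is estimated by \<open>gk1_conv_decay\<close> and \<open>gk3_time_conv_decay\<close> with
  \<open>\<tau>\<close> = t - s, and the weight (t - s)^{-1/2} integrates to at most 2 sqrt
  T.\<close>

lemma velocity_asymptotics:
 assumes \<kappa>: "\<kappa> \<le> p" "\<kappa> \<le> real CARD('n) + 2"
 obtains C where "!!t x. t \<in> {0<..T} ==> norm x \<ge> 1 ==>
  norm (u t x - (heat t a x + grad (profile (K_matrix u t)) x)) \<le> C * norm x powr (- \<kappa>)"
proof -
 have dd: "real DIM(real^'n) = real CARD('n)" by simp
 have p': "p > real DIM(real^'n) + 1" "\<kappa> \<le> real DIM(real^'n) + 2" using p \<kappa> by simp_all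
 define Q1 where "Q1 k K \<longleftrightarrow> (\<forall>M g \<tau> x. decays p M g \<longrightarrow> 0 < \<tau> \<longrightarrow> \<tau> \<le> T \<longrightarrow> norm x \<ge> 1 \<longrightarrow>
  \<bar>conv (gk1 (axis k 1 :: real^'n) \<tau>) g x\<bar> \<le> K * M * \<tau> powr (- (1/2)) * norm x powr (- \<kappa>))" for k K
 have "\<exists>K>0. Q1 k K" for k
  unfolding Q1_def by (rule gk1_conv_decay[OF p'(1) \<kappa>(1) p'(2) T])
 then obtain K1 where K1: "!!k. K1 k > 0" "!!k. Q1 k (K1 k)" by metis
 define Q3 where "Q3 h k j K \<longleftrightarrow> (\<forall>M g \<tau> x. decays p M g \<longrightarrow> 0 < \<tau> \<longrightarrow> \<tau> \<le> T \<longrightarrow> norm x \<ge> 1 \<longrightarrow>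
  \<bar>(LINT r|lon {\<tau><..}. conv (gk3 (axis h 1) (axis k 1) (axis j 1 :: real^'n) r) g x)
   - (LINT r|lon {0<..}. gk3 (axis h 1) (axis k 1) (axis j 1) r x) * (LINT y|lborel. g y)\<bar>
  \<le> K * M * \<tau> powr (- (1/2)) * norm x powr (- \<kappa>))" for h k j K
 have "\<exists>K>0. Q3 h k j K" for h k j
  unfolding Q3_def by (rule gk3_time_conv_decay[OF p'(1) \<kappa>(1) p'(2) T])
 then obtain K3 where K3: "!!h k j. K3 h k j > 0" "!!h k j. Q3 h k j (K3 h k j)" by metis
 note K1' = K1(2)[unfolded Q1_def, rule_format]
 note K3' = K3(2)[unfolded Q3_def, rule_format]
 define C where "C j = (\<Sum>k\<in>UNIV. K1 k * M\<^sup>2) + (\<Sum>h\<in>UNIV. \<Sum>k\<in>UNIV. K3 h k j * M\<^sup>2)" for j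
 have C: "C j \<ge> 0" for j unfolding C_def
  using K1(1) K3(1) by (intro add_nonneg_nonneg sum_nonneg mult_nonneg_nonneg) (auto intro: less_imp_le)
 have main: "\<bar>(u t x - (heat t a x + grad (profile (K_matrix u t)) x)) $ j\<bar> \<le> C j * (2 * sqrt T) * norm x powr (- \<kappa>)"
  if t: "t \<in> {0<..T}" and x: "norm x \<ge> 1" for t x j
 proof -
  have t0: "t > 0" "t \<le> T" using t by auto
  have x0: "x \<noteq> 0" using x by auto
  let ?L = "%h k. LINT r|lon {0<..}. gk3 (axis h 1) (axis k 1) (axis j 1) r x"
  let ?E = "%s h k. LINT y|lborel. stress h k s y"
  let ?X = "norm x powr (- \<kappa>)"
  have "(u t x - (heat t a x + grad (profile (K_matrix u t)) x)) $ j
   = - (LINT s|lon {0<..<t}. duh j (t - s) s x) + (\<Sum>h\<in>UNIV. \<Sum>k\<in>UNIV. ?L h k * (LINT s|lon {0<..<t}. ?E s h k))"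
   by (simp add: profile_grad[OF x0] mild_component[OF t] K_matrix_eq[OF t])
  also have "(\<Sum>h\<in>UNIV. \<Sum>k\<in>UNIV. ?L h k * (LINT s|lon {0<..<t}. ?E s h k)) = (LINT s|lon {0<..<t}. (\<Sum>h\<in>UNIV. \<Sum>k\<in>UNIV. ?L h k * ?E s h k))"
   by (subst Bochner_Integration.integral_sum) (auto intro!: sum.cong simp: stress_integral_integrable)
  also have "- (LINT s|lon {0<..<t}. duh j (t - s) s x) + (LINT s|lon {0<..<t}. (\<Sum>h\<in>UNIV. \<Sum>k\<in>UNIV. ?L h k * ?E s h k))
   = - (LINT s|lon {0<..<t}. duh j (t - s) s x - (\<Sum>h\<in>UNIV. \<Sum>k\<in>UNIV. ?L h k * ?E s h k))"
   using duh_integrable[OF t0(1)]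
   by (subst Bochner_Integration.integral_diff) (auto intro!: Bochner_Integration.integrable_sum Bochner_Integration.integrable_mult_right stress_integral_integrable)
  finally have eq: "(u t x - (heat t a x + grad (profile (K_matrix u t)) x)) $ j = - (LINT s|lon {0<..<t}. duh j (t - s) s x - (\<Sum>h\<in>UNIV. \<Sum>k\<in>UNIV. ?L h k * ?E s h k))" .
  have "\<bar>(u t x - (heat t a x + grad (profile (K_matrix u t)) x)) $ j\<bar> \<le> (LINT s|lon {0<..<t}. \<bar>duh j (t - s) s x - (\<Sum>h\<in>UNIV. \<Sum>k\<in>UNIV. ?L h k * ?E s h k)\<bar>)"
   unfolding eq abs_minus_cancel
   using integral_norm_bound[of "lon {0<..<t}" "%s. duh j (t - s) s x - (\<Sum>h\<in>UNIV. \<Sum>k\<in>UNIV. ?L h k * ?E s h k)"] by simp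
  also have "\<dots> \<le> (LINT s|lon {0<..<t}. C j * ?X * (t - s) powr (- (1/2)))"
  proof (rule integral_mono)
   show "integrable (lon {0<..<t}) (%s. \<bar>duh j (t - s) s x - (\<Sum>h\<in>UNIV. \<Sum>k\<in>UNIV. ?L h k * ?E s h k)\<bar>)"
    by (intro integrable_abs Bochner_Integration.integrable_diff duh_integrable t0 Bochner_Integration.integrable_sum
     Bochner_Integration.integrable_mult_right stress_integral_integrable)
   show "integrable (lon {0<..<t}) (%s. C j * ?X * (t - s) powr (- (1/2)))"
    using powr_integral_open(3)[of "1/2" t] t0 by simp
   fix s assume "s \<in> space (lon {0<..<t})"
   then have s: "0 < t - s" "t - s \<le> T" using t by auto
   let ?t = "(t - s) powr (- (1/2))"
   have "duh j (t - s) s x - (\<Sum>h\<in>UNIV. \<Sum>k\<in>UNIV. ?L h k * ?E s h k)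
    = (\<Sum>k\<in>UNIV. conv (gk1 (axis k 1) (t - s)) (stress k j s) x)
    + (\<Sum>h\<in>UNIV. \<Sum>k\<in>UNIV. (LINT r|lon {t - s<..}. conv (gk3 (axis h 1) (axis k 1) (axis j 1) r) (stress h k s) x) - ?L h k * ?E s h k)"
    by (simp add: duh_def sum_subtractf)
   then have "\<bar>duh j (t - s) s x - (\<Sum>h\<in>UNIV. \<Sum>k\<in>UNIV. ?L h k * ?E s h k)\<bar> \<le> (\<Sum>k\<in>UNIV. K1 k * M\<^sup>2 * ?t * ?X) + (\<Sum>h\<in>UNIV. \<Sum>k\<in>UNIV. K3 h k j * M\<^sup>2 * ?t * ?X)"
    by (simp only:) (intro order_trans[OF abs_triangle_ineq] add_mono order_trans[OF sum_abs] sum_mono K1' K3' stress_decays s x)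
   also have "\<dots> = C j * ?X * ?t" by (simp only: C_def sum_distrib_right distrib_right mult.assoc mult.commute[of ?t ?X])
   finally show "\<bar>duh j (t - s) s x - (\<Sum>h\<in>UNIV. \<Sum>k\<in>UNIV. ?L h k * ?E s h k)\<bar> \<le> C j * ?X * ?t" .
  qed
  also have "\<dots> = C j * ?X * (LINT s|lon {0<..<t}. (t - s) powr (- (1/2)))" by simp
  also have "\<dots> \<le> C j * ?X * (2 * sqrt T)"
  proof (intro mult_left_mono)
   have "(LINT s|lon {0<..<t}. (t - s) powr (- (1/2))) \<le> 2 * sqrt t"
    using powr_integral_open(4)[of "1/2" t] t0 by (simp add: powr_half_sqrt)
   also have "\<dots> \<le> 2 * sqrt T" using t0 by simp
   finally show "(LINT s|lon {0<..<t}. (t - s) powr (- (1/2))) \<le> 2 * sqrt T" .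
  qed (use C in auto)
  finally show ?thesis by (simp add: mult_ac)
 qed
 have "norm (u t x - (heat t a x + grad (profile (K_matrix u t)) x)) \<le> (\<Sum>j\<in>UNIV. C j * (2 * sqrt T)) * norm x powr (- \<kappa>)"
  if t: "t \<in> {0<..T}" and x: "norm x \<ge> 1" for t x
  using order_trans[OF norm_le_l1_cart sum_mono[OF main[OF t x]]] by (simp add: sum_distrib_right)
 with that show ?thesis by blast
qed

end

section \<open>Hoelder continuity of the velocity\<close>

lemma finite_uniform_bound:
 fixes P :: "'i::finite \<Rightarrow> real \<Rightarrow> bool"
 assumes "!!i. \<exists>C>0. P i C" and mono: "!!i C C'. P i C ==> C \<le> C' ==> P i C'"
 shows "\<exists>C>0. \<forall>i. P i C"
proof -
 from assms(1) obtain c where c: "!!i. c i > 0" "!!i. P i (c i)" by metis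
 have "c i \<le> (\<Sum>i\<in>UNIV. c i)" for i
  by (rule member_le_sum) (auto intro: less_imp_le c)
 moreover have "(\<Sum>i\<in>UNIV. c i) > 0" by (intro sum_pos) (auto intro: c)
 ultimately show ?thesis using mono c by blast
qed

lemma conv_holder:
 fixes f :: "real \<Rightarrow> 'a::euclidean_space \<Rightarrow> real"
 assumes k: "gkernel m f f'" and s: "s > 0" and g: "!!y. \<bar>g y\<bar> \<le> B" "g \<in> borel_measurable borel"
  and C: "(LINT z|lborel. \<bar>f s (z + h) - f s z\<bar>) \<le> c"
 shows "\<bar>conv (f s) g (x + h) - conv (f s) g x\<bar> \<le> B * c"
proof -
 note [measurable] = gkernel_measurable1[OF k] g(2)
 have B: "B \<ge> 0" using g(1)[of 0] by linarith
 note fi = gkernel_integrable(1)[OF k s]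
 have ci: "integrable lborel (%y. f s (x - y) * g y)" for x
  by (rule conv_integrable'[OF g(2,1) fi])
 let ?k = "%z. \<bar>f s (z + h) - f s z\<bar>"
 have ki: "integrable lborel ?k" using fi lborel_shift(1)[of "f s" h] by simp
 have km: "?k \<in> borel_measurable borel" by measurable
 have e: "f s (x + h - y) = f s (x - y + h)" for y by (simp add: algebra_simps)
 have "conv (f s) g (x + h) - conv (f s) g x = (LINT y|lborel. (f s (x - y + h) - f s (x - y)) * g y)"
  using ci[of "x + h"] ci[of x] unfolding e by (subst Bochner_Integration.integral_diff[symmetric]) (auto simp: algebra_simps)
 also have "\<bar>\<dots>\<bar> \<le> (LINT y|lborel. \<bar>(f s (x - y + h) - f s (x - y)) * g y\<bar>)"
  using integral_norm_bound[of lborel "%y. (f s (x - y + h) - f s (x - y)) * g y"] by simp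
 also have "\<dots> \<le> (LINT y|lborel. ?k (x - y) * B)"
 proof (rule integral_mono)
  show "integrable lborel (%y. \<bar>(f s (x - y + h) - f s (x - y)) * g y\<bar>)"
   using ci[of "x + h"] ci[of x] unfolding e by (intro integrable_abs) (simp add: algebra_simps)
  show "integrable lborel (%y. ?k (x - y) * B)"
   using lborel_reflect(1)[OF km, of x] ki by (intro Bochner_Integration.integrable_mult_left) simp
  show "\<bar>(f s (x - y + h) - f s (x - y)) * g y\<bar> \<le> ?k (x - y) * B" for y
   unfolding abs_mult by (intro mult_left_mono g) auto
 qed
 also have "\<dots> = (LINT z|lborel. ?k z) * B"
  using lborel_reflect(2)[OF km, of x] by simp
 also have "\<dots> \<le> c * B" using C B by (intro mult_right_mono) auto
 finally show ?thesis by (simp add: mult.commute)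
qed

context mild_ns
begin

text \<open>The datum is Lebesgue measurable and bounded almost everywhere. Each component is
  changed on a null set into a Borel function truncated at M, which leaves its heat extension for t
  > 0 unchanged.\<close>

lemma initial_borel:
 obtains b where "b \<in> borel_measurable borel" "!!y. \<bar>b y\<bar> \<le> M" "!!t x. t > 0 ==> heat t a x $ j = conv (gk t) b x"
proof -
 have aj: "(%y. a y $ j) \<in> borel_measurable lebesgue" for j
 proof (rule measurable_compose[OF a_meas borel_measurable_continuous_onI])
  show "continuous_on UNIV (%v::real^'n. v $ j)" by (intro continuous_intros)
 qed
 have "\<exists>b. b \<in> borel_measurable borel \<and> (\<forall>y. \<bar>b y\<bar> \<le> M) \<and> (AE y in lebesgue. a y $ j = b y)" for j
 proof -
  from completion_ex_borel_measurable_real[OF aj[of j]] obtain b' where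
   b': "b' \<in> borel_measurable lborel" "AE y in lborel. a y $ j = b' y" by auto
  then have [measurable]: "b' \<in> borel_measurable borel" by simp
  let ?b = "%y. max (- M) (min M (b' y))"
  have "AE y in lebesgue. a y $ j = b' y" by (rule AE_completion[OF b'(2)])
  with a_bound have "AE y in lebesgue. a y $ j = ?b y"
  proof eventually_elim
   fix y assume "norm (a y) \<le> M" "a y $ j = b' y"
   with component_le_norm_cart[of "a y" j] show "a y $ j = ?b y" by auto
  qed
  moreover have "\<bar>?b y\<bar> \<le> M" for y using M_nonneg by auto
  moreover have "?b \<in> borel_measurable borel" by measurable
  ultimately show ?thesis by blast
 qed
 then obtain b where b: "!!j. b j \<in> borel_measurable borel" "!!j y. \<bar>b j y\<bar> \<le> M" "!!j. AE y in lebesgue. a y $ j = b j y"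
  by metis
 have "heat t a x $ j = conv (gk t) (b j) x" if t: "t > 0" for t x j
 proof -
  let ?c = "(4 * pi * t) powr (- real CARD('n) / 2)"
  let ?w = "%y. exp (- (norm (x - y))\<^sup>2 / (4 * t))"
  have wm[measurable]: "?w \<in> borel_measurable borel" by measurable
  have c: "?c > 0" using t by simp
  have wl: "?w \<in> borel_measurable lebesgue" by (rule measurable_completion) simp
  have bl: "b j \<in> borel_measurable lebesgue" for j by (rule measurable_completion) (use b in simp)
  have ci: "integrable lborel (%y. gk t (x - y) * b j y)" for j
   by (rule conv_integrable'[OF b(1,2) gk_integral(1)[OF t]])
  have gw: "gk t (x - y) = ?c * ?w y" for y by (simp add: gk_def)
  have wb: "integrable lborel (%y. ?w y * b j y)" for j
   using ci[of j] c unfolding gw by (simp add: mult.assoc)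
  have ae: "AE y in lebesgue. (?w y *\<^sub>R a y) $ j = ?w y * b j y" for j
   using b(3)[of j] by eventually_elim simp
  have m1: "(%y. (?w y *\<^sub>R a y) $ j) \<in> borel_measurable lebesgue" for j
   using borel_measurable_times[OF wl aj[of j]] by simp
  have m2: "(%y. ?w y * b j y) \<in> borel_measurable lebesgue" for j
   by (rule borel_measurable_times[OF wl bl])
  have "integrable lebesgue (%y. ?w y * b j y)" for j
   using wb[of j] b(1)[of j] by (subst integrable_completion) auto
  then have vi: "integrable lebesgue (%y. (?w y *\<^sub>R a y) $ j)" for j
   using integrable_cong_AE[OF m1 m2 ae] by simp
  have "heat t a x $ j = ?c * ((LINT y|lebesgue. ?w y *\<^sub>R a y) $ j)"
   using t by (simp add: heat_def)
  also have "(LINT y|lebesgue. ?w y *\<^sub>R a y) $ j = (LINT y|lebesgue. (?w y *\<^sub>R a y) $ j)"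
   by (rule vec_integral(2)[OF vi])
  also have "\<dots> = (LINT y|lebesgue. ?w y * b j y)" by (rule integral_cong_AE[OF m1 m2 ae])
  also have "\<dots> = (LINT y|lborel. ?w y * b j y)" by (rule integral_completion) (use b in measurable)
  also have "?c * \<dots> = conv (gk t) (b j) x" unfolding gw by (simp add: mult.assoc)
  finally show ?thesis .
 qed
 with b that show ?thesis by blast
qed

text \<open>The analogue of \<open>duh_bound\<close> for increments: \<open>gkernel_holder\<close>
  gives \<open>\<tau>\<close>^{-3/4} for the first derivative and r^{-7/4} for the third, and the
  latter integrates over r > \<open>\<tau>\<close> to 4/3 of \<open>\<tau>\<close>^{-3/4}.\<close>

lemma duh_holder:
 obtains C where "C > 0" "!!j \<tau> s x h. \<tau> > 0 ==> \<bar>duh j \<tau> s (x + h) - duh j \<tau> s x\<bar> \<le> C * sqrt (norm h) * \<tau> powr (- (3/4))"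
proof -
 define P1 where "P1 k C \<longleftrightarrow> (\<forall>s h. s > 0 \<longrightarrow> (LINT z|lborel. \<bar>gk1 (axis k 1 :: real^'n) s (z + h) - gk1 (axis k 1) s z\<bar>)
   \<le> C * sqrt (norm h) * s powr (- (real 1 / 2) - 1/4))" for k C
 have "\<exists>C>0. \<forall>k. P1 k C"
 proof (rule finite_uniform_bound)
  show "\<exists>C>0. P1 k C" for k unfolding P1_def by (rule gkernel_holder[OF gkernel_gk1[of "axis k 1 :: real^'n"]]) blast
  show "P1 k C'" if "P1 k C" "C \<le> C'" for k C C'
   using that unfolding P1_def by (meson mult_right_mono order_trans powr_ge_zero real_sqrt_ge_zero norm_ge_zero)
 qed
 then obtain C1 where C1: "C1 > 0" "!!k. P1 k C1" by blast
 note C1' = C1(2)[unfolded P1_def, rule_format]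
 define P3 where "P3 w C \<longleftrightarrow> (\<forall>s v. s > 0 \<longrightarrow> (case w of (h, k, j) \<Rightarrow> LINT z|lborel. \<bar>gk3 (axis h 1) (axis k 1) (axis j 1 :: real^'n) s (z + v)
   - gk3 (axis h 1) (axis k 1) (axis j 1) s z\<bar>) \<le> C * sqrt (norm v) * s powr (- (real 3 / 2) - 1/4))" for w C
 have "\<exists>C>0. \<forall>w. P3 w C"
 proof (rule finite_uniform_bound)
  fix w :: "'n \<times> 'n \<times> 'n"
  obtain h k j where w: "w = (h, k, j)" by (metis prod_cases3)
  show "\<exists>C>0. P3 w C" unfolding P3_def w prod.case
   by (rule gkernel_holder[OF gkernel_gk3[of "axis h 1" "axis k 1" "axis j 1 :: real^'n"]]) blast
 next
  show "P3 k C'" if "P3 k C" "C \<le> C'" for k C C'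
   using that unfolding P3_def by (meson mult_right_mono order_trans powr_ge_zero real_sqrt_ge_zero norm_ge_zero)
 qed
 then obtain C3 where C3: "C3 > 0" "!!w. P3 w C3" by blast
 have C3': "(LINT z|lborel. \<bar>gk3 (axis h 1) (axis k 1) (axis j 1 :: real^'n) s (z + v) - gk3 (axis h 1) (axis k 1) (axis j 1) s z\<bar>)
   \<le> C3 * sqrt (norm v) * s powr (- (real 3 / 2) - 1/4)" if "s > 0" for h k j s v
  using C3(2)[of "(h, k, j)"] that unfolding P3_def prod.case by blast
 let ?N = "real CARD('n)"
 define C where "C = ?N * (M\<^sup>2 * C1) + ?N * (?N * (M\<^sup>2 * C3 * (4/3))) + 1"
 have "C > 0" unfolding C_def using C1(1) C3(1) by (intro add_nonneg_pos add_nonneg_nonneg mult_nonneg_nonneg) auto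
 moreover have "\<bar>duh j \<tau> s (x + v) - duh j \<tau> s x\<bar> \<le> C * sqrt (norm v) * \<tau> powr (- (3/4))" if \<tau>: "\<tau> > 0" for j \<tau> s x v
 proof -
  let ?t = "\<tau> powr (- (3/4))" and ?v = "sqrt (norm v)"
  have 1: "\<bar>conv (gk1 (axis k 1) \<tau>) (stress k j s) (x + v) - conv (gk1 (axis k 1) \<tau>) (stress k j s) x\<bar> \<le> M\<^sup>2 * C1 * (?v * ?t)" for k
   using conv_holder[OF gkernel_gk1 \<tau> stress_bound _ C1'[OF \<tau>]] by (simp add: mult.assoc)
  have 3: "\<bar>(LINT r|lon {\<tau><..}. conv (gk3 (axis h 1) (axis k 1) (axis j 1) r) (stress h k s) (x + v))
   - (LINT r|lon {\<tau><..}. conv (gk3 (axis h 1) (axis k 1) (axis j 1) r) (stress h k s) x)\<bar> \<le> M\<^sup>2 * C3 * (4/3) * (?v * ?t)" for h k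
  proof -
   let ?f = "%x r. conv (gk3 (axis h 1) (axis k 1) (axis j 1) r) (stress h k s) x"
   have i: "integrable (lon {\<tau><..}) (?f x)" for x
    by (rule gkernel_time_conv_integrable[OF gkernel_gk3 _ \<tau> stress_integrable(1)]) simp
   have "(LINT r|lon {\<tau><..}. ?f (x + v) r) - (LINT r|lon {\<tau><..}. ?f x r) = (LINT r|lon {\<tau><..}. ?f (x + v) r - ?f x r)"
    using i by simp
   then have "\<bar>(LINT r|lon {\<tau><..}. ?f (x + v) r) - (LINT r|lon {\<tau><..}. ?f x r)\<bar> \<le> (LINT r|lon {\<tau><..}. \<bar>?f (x + v) r - ?f x r\<bar>)"
    using integral_norm_bound[of "lon {\<tau><..}" "%r. ?f (x + v) r - ?f x r"] by simp
   also have "\<dots> \<le> (LINT r|lon {\<tau><..}. M\<^sup>2 * C3 * ?v * r powr (- (7/4)))"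
   proof (rule integral_mono)
    show "integrable (lon {\<tau><..}) (%r. \<bar>?f (x + v) r - ?f x r\<bar>)" using i by simp
    show "integrable (lon {\<tau><..}) (%r. M\<^sup>2 * C3 * ?v * r powr (- (7/4)))"
     using powr_integral_inf(1)[of "7/4" \<tau>] \<tau> by simp
    fix r assume "r \<in> space (lon {\<tau><..})"
    then have r: "r > 0" using \<tau> by simp
    show "\<bar>?f (x + v) r - ?f x r\<bar> \<le> M\<^sup>2 * C3 * ?v * r powr (- (7/4))"
     using conv_holder[OF gkernel_gk3 r stress_bound _ C3'[OF r]] by (simp add: mult.assoc)
   qed
   also have "\<dots> = M\<^sup>2 * C3 * (4/3) * (?v * ?t)" using powr_integral_inf(2)[of "7/4" \<tau>] \<tau> by simp
   finally show ?thesis .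
  qed
  have "duh j \<tau> s (x + v) - duh j \<tau> s x =
   (\<Sum>k\<in>UNIV. conv (gk1 (axis k 1) \<tau>) (stress k j s) (x + v) - conv (gk1 (axis k 1) \<tau>) (stress k j s) x)
   + (\<Sum>h\<in>UNIV. \<Sum>k\<in>UNIV. (LINT r|lon {\<tau><..}. conv (gk3 (axis h 1) (axis k 1) (axis j 1) r) (stress h k s) (x + v))
   - (LINT r|lon {\<tau><..}. conv (gk3 (axis h 1) (axis k 1) (axis j 1) r) (stress h k s) x))"
   by (simp add: duh_def sum_subtractf)
  then have "\<bar>duh j \<tau> s (x + v) - duh j \<tau> s x\<bar>
   \<le> (\<Sum>k::'n\<in>UNIV. M\<^sup>2 * C1 * (?v * ?t)) + (\<Sum>h::'n\<in>UNIV. \<Sum>k::'n\<in>UNIV. M\<^sup>2 * C3 * (4/3) * (?v * ?t))"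
   by (simp only:) (intro order_trans[OF abs_triangle_ineq] add_mono order_trans[OF sum_abs] sum_mono 1 3)
  also have "\<dots> = (?N * (M\<^sup>2 * C1) + ?N * (?N * (M\<^sup>2 * C3 * (4/3)))) * (?v * ?t)"
   by (simp add: algebra_simps)
  also have "\<dots> \<le> C * (?v * ?t)" unfolding C_def by (intro mult_right_mono) auto
  finally show ?thesis by (simp add: mult.assoc)
 qed
 ultimately show ?thesis using that by blast
qed

text \<open>Regularity is read off from the mild formulation. The heat extension of a merely bounded
  datum costs t^{-1/4}; the Duhamel part contributes the integral of (t - s)^{-3/4}, at most 4
  t^{1/4}, which is absorbed by t^{1/4} <= sqrt T * t^{-1/4}.\<close>

lemma velocity_holder:
 obtains H where "H > 0" "!!t x v. t \<in> {0<..T} ==> norm (u t (x + v) - u t x) \<le> H * t powr (- (1/4)) * sqrt (norm v)"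
proof -
 obtain C0 where C0: "C0 > 0"
  "!!s v. s > 0 ==> (LINT z|lborel. \<bar>gk s (z + v) - gk s (z::real^'n)\<bar>) \<le> C0 * sqrt (norm v) * s powr (- (real 0 / 2) - 1/4)"
  by (rule gkernel_holder[OF gkernel_gk[where 'a="real^'n"]]) blast
 from duh_holder obtain C where C: "C > 0"
  "!!j \<tau> s x h. \<tau> > 0 ==> \<bar>duh j \<tau> s (x + h) - duh j \<tau> s x\<bar> \<le> C * sqrt (norm h) * \<tau> powr (- (3/4))" by metis
 define K where "K = M * C0 + C * (4 * sqrt T)"
 have K: "K > 0" using C(1) T M_nonneg C0(1) by (auto simp: K_def intro!: add_nonneg_pos mult_pos_pos)
 have main: "\<bar>(u t (x + v) - u t x) $ j\<bar> \<le> K * t powr (- (1/4)) * sqrt (norm v)" if t: "t \<in> {0<..T}" for t x v j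
 proof -
  have t0: "t > 0" "t \<le> T" using t by auto
  obtain b where b: "b \<in> borel_measurable borel" "!!y. \<bar>b y\<bar> \<le> M" "!!t x. t > 0 ==> heat t a x $ j = conv (gk t) b x"
   using initial_borel by metis
  let ?v = "sqrt (norm v)"
  have "\<bar>heat t a (x + v) $ j - heat t a x $ j\<bar> \<le> M * (C0 * ?v * t powr (- (real 0 / 2) - 1/4))"
   unfolding b(3)[OF t0(1)] by (rule conv_holder[OF gkernel_gk t0(1) b(2,1) C0(2)[OF t0(1)]])
  then have 1: "\<bar>heat t a (x + v) $ j - heat t a x $ j\<bar> \<le> M * C0 * t powr (- (1/4)) * ?v" by (simp add: mult_ac)
  have "\<bar>(LINT s|lon {0<..<t}. duh j (t - s) s (x + v)) - (LINT s|lon {0<..<t}. duh j (t - s) s x)\<bar>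
   = \<bar>LINT s|lon {0<..<t}. duh j (t - s) s (x + v) - duh j (t - s) s x\<bar>"
   using duh_integrable[OF t0(1)] by simp
  also have "\<dots> \<le> (LINT s|lon {0<..<t}. \<bar>duh j (t - s) s (x + v) - duh j (t - s) s x\<bar>)"
   using integral_norm_bound[of "lon {0<..<t}" "%s. duh j (t - s) s (x + v) - duh j (t - s) s x"] by simp
  also have "\<dots> \<le> (LINT s|lon {0<..<t}. C * ?v * (t - s) powr (- (3/4)))"
   using duh_integrable[OF t0(1)] powr_integral_open(3)[of "3/4" t] t0 C(2) by (intro integral_mono) auto
  also have "\<dots> = C * ?v * (LINT s|lon {0<..<t}. (t - s) powr (- (3/4)))" by simp
  also have "\<dots> \<le> C * ?v * (4 * t powr (1/4))"
   using powr_integral_open(4)[of "3/4" t] t0 C(1) by (intro mult_left_mono) auto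
  also have "\<dots> \<le> C * ?v * (4 * (sqrt T * t powr (- (1/4))))"
  proof -
   have "t powr (1/4) = t powr (1/2) * t powr (- (1/4))" unfolding powr_add[symmetric] by simp
   also have "\<dots> \<le> sqrt T * t powr (- (1/4))" using t0 by (intro mult_right_mono) (auto simp: powr_half_sqrt)
   finally show ?thesis using C(1) by (intro mult_left_mono) auto
  qed
  finally have 2: "\<bar>(LINT s|lon {0<..<t}. duh j (t - s) s (x + v)) - (LINT s|lon {0<..<t}. duh j (t - s) s x)\<bar>
   \<le> C * (4 * sqrt T) * t powr (- (1/4)) * ?v" by (simp add: mult_ac)
  have "(u t (x + v) - u t x) $ j = (heat t a (x + v) $ j - heat t a x $ j)
   - ((LINT s|lon {0<..<t}. duh j (t - s) s (x + v)) - (LINT s|lon {0<..<t}. duh j (t - s) s x))"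
   by (simp add: mild_component[OF t])
  then have "\<bar>(u t (x + v) - u t x) $ j\<bar> \<le> M * C0 * t powr (- (1/4)) * ?v + C * (4 * sqrt T) * t powr (- (1/4)) * ?v"
   using 1 2 by linarith
  then show ?thesis by (simp add: K_def algebra_simps)
 qed
 have "norm (u t (x + v) - u t x) \<le> (real CARD('n) * K) * t powr (- (1/4)) * sqrt (norm v)" if t: "t \<in> {0<..T}" for t x v
 proof -
  have "norm (u t (x + v) - u t x) \<le> (\<Sum>j::'n\<in>UNIV. K * t powr (- (1/4)) * sqrt (norm v))"
   by (rule order_trans[OF norm_le_l1_cart sum_mono[OF main[OF t]]])
  then show ?thesis by simp
 qed
 moreover have "real CARD('n) * K > 0" using K by simp
 ultimately show ?thesis using that by blast
qed

lemma stress_holder: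
 obtains G where "G > 0" "!!h k t x y. t \<in> {0<..T} ==> \<bar>stress h k t y - stress h k t x\<bar> \<le> G * t powr (- (1/4)) * norm (y - x) powr (1/2)"
proof -
 from velocity_holder obtain H where H: "H > 0" "!!t x v. t \<in> {0<..T} ==> norm (u t (x + v) - u t x) \<le> H * t powr (- (1/4)) * sqrt (norm v)" by metis
 have "\<bar>stress h k t y - stress h k t x\<bar> \<le> (2 * M * H + 1) * t powr (- (1/4)) * norm (y - x) powr (1/2)" if t: "t \<in> {0<..T}" for h k t x y
 proof -
  let ?D = "H * t powr (- (1/4)) * norm (y - x) powr (1/2)"
  have un: "norm (u t x) \<le> M" for x
  proof -
   have "(1 + norm x) powr (- (p / 2)) \<le> (1 + norm x) powr 0" using p by (intro powr_mono) auto
   then have "M * (1 + norm x) powr (- (p / 2)) \<le> M * 1"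
    using M_nonneg by (intro mult_left_mono) (auto simp: add_nonneg_eq_0_iff split: if_splits)
   with bound[OF t, of x] show ?thesis by simp
  qed
  have dn: "norm (u t y - u t x) \<le> ?D" using H(2)[OF t, of x "y - x"] by (simp add: powr_half_sqrt)
  have c: "\<bar>u t y $ h - u t x $ h\<bar> \<le> ?D" for h
   using component_le_norm_cart[of "u t y - u t x" h] dn by simp
  have b: "\<bar>u t x $ h\<bar> \<le> M" for x h using component_le_norm_cart[of "u t x" h] un[of x] by linarith
  have "stress h k t y - stress h k t x = u t y $ h * (u t y $ k - u t x $ k) + (u t y $ h - u t x $ h) * u t x $ k"
   using t by (simp add: stress_def algebra_simps)
  then have "\<bar>stress h k t y - stress h k t x\<bar> \<le> M * ?D + ?D * M"
   by (simp only:) (intro order_trans[OF abs_triangle_ineq] add_mono abs_mult_le_mult b c)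
  also have "\<dots> \<le> (2 * M * H + 1) * (t powr (- (1/4)) * norm (y - x) powr (1/2))" by (simp add: algebra_simps)
  finally show ?thesis by (simp add: mult.assoc)
 qed
 moreover have "2 * M * H + 1 > 0" using H(1) M_nonneg by (intro add_nonneg_pos) auto
 ultimately show ?thesis using that by blast
qed

text \<open>The increment of u is bounded both by its decay, of order (1 + |x|)^{-p/2}, and by the
  Hoelder estimate; their geometric mean with weights 1 - \<open>\<beta>\<close> and
  \<open>\<beta>\<close> retains most of the decay. Multiplied by one more factor u it decays with
  exponent p - \<open>\<beta>\<close> p / 2, and \<open>\<beta>\<close> = 1 / (d + 1) together with
  p <= 2 (d + 1) makes the loss at most one. The condition |y| >= |x|/2 makes the decay at y
  comparable with that at x.\<close>

lemma stress_holder_decay: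
 assumes p2: "p \<le> 2 * (real CARD('n) + 1)"
 defines "\<beta> \<equiv> 1 / (real CARD('n) + 1)"
 obtains G where "G > 0" "!!h k t x y. t \<in> {0<..T} ==> norm y \<ge> norm x / 2 ==>
  \<bar>stress h k t y - stress h k t x\<bar> \<le> G * t powr (- (\<beta>/4)) * (1 + norm x) powr (- (p - 1)) * norm (y - x) powr (\<beta>/2)"
proof -
 from velocity_holder obtain H where H: "H > 0" "!!t x v. t \<in> {0<..T} ==> norm (u t (x + v) - u t x) \<le> H * t powr (- (1/4)) * sqrt (norm v)" by metis
 have \<beta>: "\<beta> > 0" "\<beta> \<le> 1" "\<beta> * (p / 2) \<le> 1" using p2 by (auto simp: \<beta>_def field_simps)
 define A where "A = M * 2 powr (p / 2)"
 have A: "A \<ge> 0" using M_nonneg by (simp add: A_def)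
 define G where "G = 2 * A * ((2 * A) powr (1 - \<beta>) * H powr \<beta>) + 1"
 have "G > 0" unfolding G_def using A by (intro add_nonneg_pos) auto
 moreover have "\<bar>stress h k t y - stress h k t x\<bar> \<le> G * t powr (- (\<beta>/4)) * (1 + norm x) powr (- (p - 1)) * norm (y - x) powr (\<beta>/2)"
  if t: "t \<in> {0<..T}" and y: "norm y \<ge> norm x / 2" for h k t x y
 proof -
  define X where "X = (1 + norm x) powr (- (p / 2))"
  have X: "X > 0" by (simp add: X_def add_nonneg_eq_0_iff)
  let ?L = "H * t powr (- (1/4)) * norm (y - x) powr (1/2)"
  have "X * 1 \<le> X * 2 powr (p / 2)" using p X by (intro mult_left_mono ge_one_powr_ge_zero) auto
  then have ux: "norm (u t x) \<le> A * X" using bound[OF t, of x] M_nonneg mult_left_mono[of "X * 1" "X * 2 powr (p / 2)" M]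
   by (simp add: A_def X_def mult_ac)
  have uy: "norm (u t y) \<le> A * X"
  proof -
   have "(1 + norm y) powr (- (p / 2)) \<le> ((1 + norm x) / 2) powr (- (p / 2))"
    using y p by (intro powr_mono2') (auto simp: add_pos_nonneg)
   also have "\<dots> = 2 powr (p / 2) * X" by (simp add: X_def powr_divide powr_minus field_simps)
   finally have "M * (1 + norm y) powr (- (p / 2)) \<le> M * (2 powr (p / 2) * X)" using M_nonneg by (rule mult_left_mono)
   with bound[OF t, of y] show ?thesis by (simp add: A_def mult.assoc)
  qed
  let ?n = "norm (u t y - u t x)"
  have dn: "?n \<le> ?L" using H(2)[OF t, of x "y - x"] by (simp add: powr_half_sqrt)
  have dn2: "?n \<le> 2 * A * X" using norm_triangle_ineq4[of "u t y" "u t x"] ux uy by simp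
  have interp: "?n \<le> (2 * A * X) powr (1 - \<beta>) * ?L powr \<beta>"
  proof (cases "?n = 0")
   case False
   then have "?n = ?n powr (1 - \<beta>) * ?n powr \<beta>" unfolding powr_add[symmetric] by simp
   also have "\<dots> \<le> (2 * A * X) powr (1 - \<beta>) * ?L powr \<beta>"
    using \<beta> dn dn2 by (intro mult_mono powr_mono2) auto
   finally show ?thesis .
  qed simp
  define D where "D = (2 * A * X) powr (1 - \<beta>) * ?L powr \<beta>"
  have c: "\<bar>u t y $ h - u t x $ h\<bar> \<le> D" for h
   using component_le_norm_cart[of "u t y - u t x" h] interp by (simp add: D_def)
  have bx: "\<bar>u t x $ h\<bar> \<le> A * X" for h using component_le_norm_cart[of "u t x" h] ux by linarith
  have by': "\<bar>u t y $ h\<bar> \<le> A * X" for h using component_le_norm_cart[of "u t y" h] uy by linarith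
  have "stress h k t y - stress h k t x = u t y $ h * (u t y $ k - u t x $ k) + (u t y $ h - u t x $ h) * u t x $ k"
   using t by (simp add: stress_def algebra_simps)
  then have "\<bar>stress h k t y - stress h k t x\<bar> \<le> (A * X) * D + D * (A * X)"
   by (simp only:) (intro order_trans[OF abs_triangle_ineq] add_mono abs_mult_le_mult bx by' c)
  also have "\<dots> = 2 * A * ((2 * A) powr (1 - \<beta>) * H powr \<beta>) * (X * X powr (1 - \<beta>)) * (t powr (- (\<beta>/4)) * norm (y - x) powr (\<beta>/2))"
  proof -
   have "?L powr \<beta> = H powr \<beta> * (t powr (- (\<beta>/4)) * norm (y - x) powr (\<beta>/2))"
    by (simp add: powr_mult powr_powr)
   moreover have "(2 * A * X) powr (1 - \<beta>) = (2 * A) powr (1 - \<beta>) * X powr (1 - \<beta>)"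
    by (rule powr_mult)
   ultimately show ?thesis unfolding D_def by (simp add: algebra_simps)
  qed
  also have "\<dots> \<le> G * (1 + norm x) powr (- (p - 1)) * (t powr (- (\<beta>/4)) * norm (y - x) powr (\<beta>/2))"
  proof (intro mult_right_mono mult_mono)
   have "X * X powr (1 - \<beta>) = (1 + norm x) powr (- (p / 2) + - (p / 2) * (1 - \<beta>))"
    unfolding X_def powr_powr powr_add[symmetric] ..
   also have "\<dots> \<le> (1 + norm x) powr (- (p - 1))"
    using \<beta> by (intro powr_mono) (auto simp: field_simps)
   finally show "X * X powr (1 - \<beta>) \<le> (1 + norm x) powr (- (p - 1))" .
  qed (use A X G_def \<open>G > 0\<close> in auto)
  finally show ?thesis by (simp add: mult_ac)
 qed
 ultimately show ?thesis using that by blast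
qed

end

section \<open>The pressure as a time integral, and the momentum flux\<close>

lemma continuous_on_lebesgue_integral:
 fixes f :: "'a::metric_space \<Rightarrow> 'b \<Rightarrow> real"
 assumes "!!y. y \<in> space M ==> continuous_on S (%x. f x y)"
  and "!!x. x \<in> S ==> f x \<in> borel_measurable M"
  and "!!x y. x \<in> S ==> y \<in> space M ==> \<bar>f x y\<bar> \<le> g y"
  and "integrable M g"
 shows "continuous_on S (%x. LINT y|M. f x y)"
 unfolding continuous_on_sequentially comp_def
proof (intro allI ballI impI, elim conjE)
 fix X x assume x: "x \<in> S" and X: "\<forall>n. X n \<in> S" "X \<longlonglongrightarrow> x"
 show "(%n. LINT y|M. f (X n) y) \<longlonglongrightarrow> (LINT y|M. f x y)"
 proof (rule integral_dominated_convergence[where w = g])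
  show "AE y in M. (%n. f (X n) y) \<longlonglongrightarrow> f x y"
  proof (rule AE_I2)
   fix y assume "y \<in> space M"
   from assms(1)[OF this] show "(%n. f (X n) y) \<longlonglongrightarrow> f x y"
    using x X unfolding continuous_on_sequentially comp_def by blast
  qed
  show "AE y in M. norm (f (X n) y) \<le> g y" for n
   using assms(3)[of "X n"] X by (intro AE_I2) auto
 qed (use assms x X in auto)
qed

lemma conv_assoc:
 fixes f g F :: "'a::euclidean_space \<Rightarrow> real"
 assumes f: "integrable lborel f" and g: "g \<in> borel_measurable borel" "!!z. \<bar>g z\<bar> \<le> B" and F: "integrable lborel F"
 shows "conv f (conv g F) x = conv (conv f g) F x"
proof -
 have [measurable]: "f \<in> borel_measurable borel" "F \<in> borel_measurable borel"
  using borel_measurable_integrable[OF f] borel_measurable_integrable[OF F] by auto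
 note [measurable] = g(1)
 let ?f = "%z y. f (x - y) * g (y - z) * F z"
 let ?I = "LINT y|lborel. \<bar>f y\<bar>"
 have B: "B \<ge> 0" using g(2)[of 0] by linarith
 have fr: "integrable lborel (%y. f (x - y))" using lborel_reflect(1)[of f x] f by simp
 have fr': "integrable lborel (%y. B * \<bar>f (x - y)\<bar>)" "(LINT y|lborel. B * \<bar>f (x - y)\<bar>) = B * ?I"
  using fr lborel_reflect(2)[of "%y. \<bar>f y\<bar>" x] by auto
 have i0: "integrable lborel (%y. f (x - y) * g (y - z))" for z
 proof (rule Bochner_Integration.integrable_bound[OF fr'(1)])
  show "AE y in lborel. norm (f (x - y) * g (y - z)) \<le> norm (B * \<bar>f (x - y)\<bar>)"
   using g(2) B by (intro AE_I2) (auto simp: abs_mult mult.commute[of B] intro!: mult_left_mono)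
 qed measurable
 have b0: "(LINT y|lborel. \<bar>f (x - y) * g (y - z)\<bar>) \<le> B * ?I" for z
 proof -
  have "(LINT y|lborel. \<bar>f (x - y) * g (y - z)\<bar>) \<le> (LINT y|lborel. B * \<bar>f (x - y)\<bar>)"
   using i0[of z] fr'(1) g(2) by (intro integral_mono integrable_abs) (auto simp: abs_mult mult.commute[of B] intro!: mult_left_mono)
  then show ?thesis unfolding fr'(2) .
 qed
 have "(LINT z|lborel. LINT y|lborel. ?f z y) = (LINT y|lborel. LINT z|lborel. ?f z y)"
 proof (rule integral_swap_bound(1)[OF sigma_finite_lborel sigma_finite_lborel])
  show "(%(z, y). ?f z y) \<in> borel_measurable (lborel \<Otimes>\<^sub>M lborel)" by measurable
  show "integrable lborel (?f z)" for z using i0[of z] by (rule Bochner_Integration.integrable_mult_left)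
  show "(LINT y|lborel. \<bar>?f z y\<bar>) \<le> B * ?I * \<bar>F z\<bar>" for z
  proof -
   have "(LINT y|lborel. \<bar>?f z y\<bar>) = (LINT y|lborel. \<bar>f (x - y) * g (y - z)\<bar>) * \<bar>F z\<bar>"
    unfolding abs_mult[of _ "F z"] by (rule Bochner_Integration.integral_mult_left_zero)
   also have "\<dots> \<le> B * ?I * \<bar>F z\<bar>" by (intro mult_right_mono b0) auto
   finally show ?thesis .
  qed
  show "integrable lborel (%z. B * ?I * \<bar>F z\<bar>)" using F by simp
 qed
 also have "(LINT y|lborel. LINT z|lborel. ?f z y) = conv f (conv g F) x"
  by (simp only: mult.assoc Bochner_Integration.integral_mult_right_zero)
 also have "(LINT z|lborel. LINT y|lborel. ?f z y) = conv (conv f g) F x"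
 proof (intro Bochner_Integration.integral_cong refl)
  fix z
  have "(LINT y|lborel. ?f z y) = (LINT y|lborel. f (x - y) * g (y - z)) * F z"
   by (rule Bochner_Integration.integral_mult_left_zero)
  also have "(LINT y|lborel. f (x - y) * g (y - z)) = conv f g (x - z)"
   using lborel_shift(2)[of "%w. f (x - z - w) * g w" "- z"] by simp
  finally show "(LINT y|lborel. ?f z y) = conv f g (x - z) * F z" .
 qed
 finally show ?thesis by simp
qed

lemma gk2_integral_0: "s > 0 ==> (LINT z|lborel. gk2 a b s (z::'a::euclidean_space)) = 0"
 using gkernel_derivative_integral_0[OF gkernel_gk1[of a]] by simp

text \<open>Second derivatives of the heat kernel have integral zero, so F may be replaced by its
  increment from x. This is what lets Hoelder continuity act against the s^{-1} singularity.\<close>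

lemma gk2_conv_cancel:
 fixes F :: "'a::euclidean_space \<Rightarrow> real"
 assumes s: "s > 0" and F: "F \<in> borel_measurable borel" "!!y. \<bar>F y\<bar> \<le> B"
 shows "conv (gk2 a b s) F x = (LINT y|lborel. gk2 a b s (x - y) * (F y - F x))"
  and "integrable lborel (%y. gk2 a b s (x - y) * (F y - F x))"
proof -
 note [measurable] = F(1)
 note ki = gkernel_integrable(1)[OF gkernel_gk2[of a b] s]
 have kr: "integrable lborel (%y. gk2 a b s (x - y))" "(LINT y|lborel. gk2 a b s (x - y)) = 0"
  using lborel_reflect[of "gk2 a b s" x] ki gk2_integral_0[OF s, of a b] by auto
 have ci: "integrable lborel (%y. gk2 a b s (x - y) * F y)" by (rule conv_integrable'[OF F ki])
 show "integrable lborel (%y. gk2 a b s (x - y) * (F y - F x))"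
  using ci kr(1) by (simp add: right_diff_distrib)
 show "conv (gk2 a b s) F x = (LINT y|lborel. gk2 a b s (x - y) * (F y - F x))"
  using ci kr by (simp add: right_diff_distrib)
qed

lemma gk2_conv_holder:
 fixes F :: "'a::euclidean_space \<Rightarrow> real"
 assumes s: "s > 0" and F: "F \<in> borel_measurable borel" "!!y. \<bar>F y\<bar> \<le> B"
  and H: "!!y. \<bar>F y - F x\<bar> \<le> G * norm (y - x) powr q" and G: "G \<ge> 0" and q: "q \<ge> 0"
  and i: "integrable lborel (%z. norm z powr q * \<bar>gk2 a b s z\<bar>)"
  and C: "(LINT z|lborel. norm z powr q * \<bar>gk2 a b s z\<bar>) \<le> c"
 shows "\<bar>conv (gk2 a b s) F x\<bar> \<le> G * c"
proof -
 note cc = gk2_conv_cancel[OF s F, where a=a and b=b and x=x]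
 let ?k = "%z. norm z powr q * \<bar>gk2 a b s z\<bar>"
 have km: "?k \<in> borel_measurable borel" by measurable
 have "\<bar>conv (gk2 a b s) F x\<bar> \<le> (LINT y|lborel. \<bar>gk2 a b s (x - y) * (F y - F x)\<bar>)"
  unfolding cc(1) using integral_norm_bound[of lborel "%y. gk2 a b s (x - y) * (F y - F x)"] by simp
 also have "\<dots> \<le> (LINT y|lborel. G * ?k (x - y))"
 proof (rule integral_mono[OF integrable_abs[OF cc(2)]])
  show "integrable lborel (%y. G * ?k (x - y))" using lborel_reflect(1)[OF km, of x] i by simp
  fix y
  have "\<bar>gk2 a b s (x - y)\<bar> * \<bar>F y - F x\<bar> \<le> \<bar>gk2 a b s (x - y)\<bar> * (G * norm (y - x) powr q)"
   by (intro mult_left_mono H) auto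
  then show "\<bar>gk2 a b s (x - y) * (F y - F x)\<bar> \<le> G * ?k (x - y)"
   by (simp add: abs_mult norm_minus_commute mult_ac)
 qed
 also have "\<dots> = G * (LINT z|lborel. ?k z)" using lborel_reflect(2)[OF km, of x] by simp
 also have "\<dots> \<le> G * c" using C G by (rule mult_left_mono)
 finally show ?thesis .
qed

text \<open>The domination in r for D_h D_k G_r * (u_h u_k): near 0 the Hoelder exponent 1/2
  improves r^{-1} to r^{-3/4}, and beyond 1 \<open>gkernel2_time_bound\<close> gives r^{-2}.\<close>

definition time_profile :: "real \<Rightarrow> real" where
 "time_profile r = (if r \<le> 1 then r powr (- (3/4)) else r powr (- 2))"

lemma time_profile_nonneg: "time_profile r \<ge> 0" by (simp add: time_profile_def)

lemma time_profile_integrable: "integrable (lon {0<..}) time_profile"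
proof -
 have U: "{0::real<..} = {0<..1} \<union> {1<..}" by auto
 have 1: "integrable (lon {0<..1}) time_profile"
  by (rule Bochner_Integration.integrable_cong[OF refl, THEN iffD1, OF _ powr_integral_0(1)[of "3/4" 1]])
   (auto simp: time_profile_def)
 have 2: "integrable (lon {1<..}) time_profile"
  by (rule Bochner_Integration.integrable_cong[OF refl, THEN iffD1, OF _ powr_integral_inf(1)[of 2 1]])
   (auto simp: time_profile_def)
 show ?thesis unfolding U by (rule lon_Un(1)[OF _ _ _ 1 2]) auto
qed

context mild_ns
begin

definition pconv :: "'n \<Rightarrow> 'n \<Rightarrow> real \<Rightarrow> real \<Rightarrow> real^'n \<Rightarrow> real" where
 "pconv h k r t x = conv (gk2 (axis h 1) (axis k 1) r) (stress h k t) x"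

text \<open>The decaying pressure -Delta^{-1} D_h D_k (u_h u_k), with -Delta^{-1} expressed as the
  time integral of the heat semigroup. That every pressure differs from it by a function of t alone
  is \<open>pressure_eq\<close>.\<close>

definition prs :: "real \<Rightarrow> real^'n \<Rightarrow> real" where
 "prs t x = (\<Sum>h\<in>UNIV. \<Sum>k\<in>UNIV. LINT r|lon {0<..}. pconv h k r t x)"

lemma pconv_measurable [measurable (raw)]:
 assumes [measurable]: "g1 \<in> borel_measurable N" "g2 \<in> borel_measurable N" "g3 \<in> borel_measurable N"
 shows "(%w. pconv h k (g1 w) (g2 w) (g3 w)) \<in> borel_measurable N"
proof -
 have "(%q. gk2 (axis h 1) (axis k 1) (g1 (fst q)) (g3 (fst q) - snd q) * stress h k (g2 (fst q)) (snd q)) \<in> borel_measurable (N \<Otimes>\<^sub>M lborel)"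
  by measurable
 then have "(%(w, y). gk2 (axis h 1) (axis k 1) (g1 w) (g3 w - y) * stress h k (g2 w) y) \<in> borel_measurable (N \<Otimes>\<^sub>M lborel)"
  by (simp add: case_prod_beta')
 then show ?thesis unfolding pconv_def by (rule lborel.borel_measurable_lebesgue_integral)
qed

lemma prs_measurable [measurable (raw)]:
 assumes [measurable]: "g2 \<in> borel_measurable N" "g3 \<in> borel_measurable N"
 shows "(%w. prs (g2 w) (g3 w)) \<in> borel_measurable N"
proof -
 have "(%w. LINT r|lon {0<..}. pconv h k r (g2 w) (g3 w)) \<in> borel_measurable N" for h k
 proof -
  have "(%q. indicator {0<..} (snd q) *\<^sub>R pconv h k (snd q) (g2 (fst q)) (g3 (fst q))) \<in> borel_measurable (N \<Otimes>\<^sub>M lborel)"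
   by measurable
  then have "(%(w, r). indicator {0<..} r *\<^sub>R pconv h k r (g2 w) (g3 w)) \<in> borel_measurable (N \<Otimes>\<^sub>M lborel)"
   by (simp add: case_prod_beta')
  from lborel.borel_measurable_lebesgue_integral[OF this]
  show ?thesis unfolding lon_integral[OF borel_open[OF open_greaterThan]] set_lebesgue_integral_def .
 qed
 then show ?thesis unfolding prs_def by (intro borel_measurable_sum)
qed

lemma pconv_bound:
 obtains C where "C > 0" "!!h k r t x. r > 0 ==> t \<in> {0<..T} ==> \<bar>pconv h k r t x\<bar> \<le> C * t powr (- (1/4)) * time_profile r"
proof -
 from stress_holder obtain G where G: "G > 0"
  "!!h k t x y. t \<in> {0<..T} ==> \<bar>stress h k t y - stress h k t x\<bar> \<le> G * t powr (- (1/4)) * norm (y - x) powr (1/2)" by metis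
 define P where "P w C \<longleftrightarrow> (\<forall>r t x. r > 0 \<longrightarrow> t \<in> {0<..T} \<longrightarrow> \<bar>pconv (fst w) (snd w) r t x\<bar> \<le> C * t powr (- (1/4)) * time_profile r)" for w C
 have "\<exists>C>0. \<forall>w. P w C"
 proof (rule finite_uniform_bound)
  fix w :: "'n \<times> 'n"
  define h k where "h = fst w" and "k = snd w"
  let ?a = "axis h 1 :: real^'n" and ?b = "axis k 1 :: real^'n"
  from gkernel_moment[OF gkernel_gk2[of ?a ?b], of "1/2"] obtain A where A: "A > 0"
   "!!s. s > 0 ==> integrable lborel (%z. norm z powr (1/2) * \<bar>gk2 ?a ?b s z\<bar>)"
   "!!s. s > 0 ==> (LINT z|lborel. norm z powr (1/2) * \<bar>gk2 ?a ?b s z\<bar>) \<le> A * s powr ((1/2) / 2 - real 2 / 2)" by auto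
  have "DIM(real^'n) \<ge> 2" using d by simp
  from gkernel2_time_bound[OF this gkernel_gk2[of ?a ?b] zero_less_one] obtain D where D: "D > 0"
   "!!r z. 1 < r ==> \<bar>gk2 ?a ?b r z\<bar> \<le> D * r powr (- 2)" by metis
  define W where "W = M\<^sup>2 * weight_integral TYPE(real^'n) (p - 1)"
  have W: "W \<ge> 0" by (simp add: W_def weight_integral_nonneg)
  define C where "C = G * A + D * W * T powr (1/4)"
  have "C > 0" using G(1) A(1) D(1) W by (auto simp: C_def intro!: add_pos_nonneg)
  moreover have "\<bar>pconv h k r t x\<bar> \<le> C * t powr (- (1/4)) * time_profile r" if r: "r > 0" and t: "t \<in> {0<..T}" for r t x
  proof (cases "r \<le> 1")
   case True
   have "\<bar>pconv h k r t x\<bar> \<le> G * t powr (- (1/4)) * (A * r powr ((1/2) / 2 - real 2 / 2))"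
    unfolding pconv_def
    by (rule gk2_conv_holder[OF r _ stress_bound G(2)[OF t] _ _ A(2)[OF r] A(3)[OF r]]) (use G(1) in auto)
   also have "\<dots> = (G * A) * (t powr (- (1/4)) * time_profile r)" using True by (simp add: time_profile_def)
   also have "\<dots> \<le> C * (t powr (- (1/4)) * time_profile r)"
    using D(1) W by (intro mult_right_mono) (auto simp: C_def time_profile_nonneg)
   finally show ?thesis by (simp add: mult.assoc)
  next
   case False
   have "\<bar>pconv h k r t x\<bar> \<le> D * r powr (- 2) * (LINT y|lborel. \<bar>stress h k t y\<bar>)"
    unfolding pconv_def using False by (intro gkernel_conv_le D(2) stress_integrable) auto
   also have "\<dots> \<le> D * r powr (- 2) * W"
    using D(1) decays_integrable(3)[OF stress_decays] p by (intro mult_left_mono) (auto simp: W_def)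
   also have "\<dots> \<le> D * r powr (- 2) * W * (T powr (1/4) * t powr (- (1/4)))"
   proof -
    have "t powr (1/4) * t powr (- (1/4)) \<le> T powr (1/4) * t powr (- (1/4))"
     using t by (intro mult_right_mono powr_mono2) auto
    moreover have "t powr (1/4) * t powr (- (1/4)) = 1" unfolding powr_add[symmetric] using t by simp
    ultimately have "1 \<le> T powr (1/4) * t powr (- (1/4))" by simp
    then have "D * r powr (- 2) * W * 1 \<le> D * r powr (- 2) * W * (T powr (1/4) * t powr (- (1/4)))"
     using D(1) W by (intro mult_left_mono) auto
    then show ?thesis by simp
   qed
   also have "\<dots> = (D * W * T powr (1/4)) * (t powr (- (1/4)) * time_profile r)" using False by (simp add: time_profile_def)
   also have "\<dots> \<le> C * (t powr (- (1/4)) * time_profile r)"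
    using G(1) A(1) by (intro mult_right_mono) (auto simp: C_def time_profile_nonneg)
   finally show ?thesis by (simp add: mult.assoc)
  qed
  ultimately show "\<exists>C>0. P w C" unfolding P_def h_def[symmetric] k_def[symmetric] by blast
 next
  show "P w C'" if "P w C" "C \<le> C'" for w C C'
   unfolding P_def
  proof (intro allI impI)
   fix r t :: real and x assume "0 < r" "t \<in> {0<..T}"
   with that(1) have "\<bar>pconv (fst w) (snd w) r t x\<bar> \<le> C * (t powr (- (1/4)) * time_profile r)" unfolding P_def by (simp add: mult.assoc)
   also have "\<dots> \<le> C' * (t powr (- (1/4)) * time_profile r)" using that(2) by (intro mult_right_mono) (auto simp: time_profile_nonneg)
   finally show "\<bar>pconv (fst w) (snd w) r t x\<bar> \<le> C' * t powr (- (1/4)) * time_profile r" by (simp add: mult.assoc)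
  qed
 qed
 then obtain C where C: "C > 0" "!!w. P w C" by blast
 have "\<bar>pconv h k r t x\<bar> \<le> C * t powr (- (1/4)) * time_profile r" if "r > 0" "t \<in> {0<..T}" for h k r t x
  using C(2)[of "(h, k)"] that by (simp add: P_def)
 with C(1) that show ?thesis by blast
qed

lemma pconv_integrable:
 assumes t: "t \<in> {0<..T}"
 shows "integrable (lon {0<..}) (%r. pconv h k r t x)"
proof -
 from pconv_bound obtain C where C: "C > 0" "!!h k r t x. r > 0 ==> t \<in> {0<..T} ==> \<bar>pconv h k r t x\<bar> \<le> C * t powr (- (1/4)) * time_profile r" by metis
 show ?thesis
 proof (rule Bochner_Integration.integrable_bound[OF Bochner_Integration.integrable_mult_right[OF time_profile_integrable, of "C * t powr (- (1/4))"]])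
  show "(%r. pconv h k r t x) \<in> borel_measurable (lon {0<..})" by (rule lon_measurable) measurable
  show "AE r in lon {0<..}. norm (pconv h k r t x) \<le> norm (C * t powr (- (1/4)) * time_profile r)"
   by (intro AE_I2) (use t in \<open>auto intro!: order_trans[OF C(2) abs_ge_self]\<close>)
 qed
qed

lemma prs_bound:
 obtains C where "C > 0" "!!t x. t \<in> {0<..T} ==> \<bar>prs t x\<bar> \<le> C * t powr (- (1/4))"
proof -
 from pconv_bound obtain C where C: "C > 0" "!!h k r t x. r > 0 ==> t \<in> {0<..T} ==> \<bar>pconv h k r t x\<bar> \<le> C * t powr (- (1/4)) * time_profile r" by metis
 let ?I = "LINT r|lon {0<..}. time_profile r"
 have I: "?I \<ge> 0" by (rule integral_nonneg_AE) (auto simp: time_profile_nonneg)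
 have 1: "\<bar>LINT r|lon {0<..}. pconv h k r t x\<bar> \<le> C * t powr (- (1/4)) * ?I" if t: "t \<in> {0<..T}" for h k t x
 proof -
  have "\<bar>LINT r|lon {0<..}. pconv h k r t x\<bar> \<le> (LINT r|lon {0<..}. \<bar>pconv h k r t x\<bar>)"
   using integral_norm_bound[of "lon {0<..}" "%r. pconv h k r t x"] by simp
  also have "\<dots> \<le> (LINT r|lon {0<..}. C * t powr (- (1/4)) * time_profile r)"
   using C(2) t by (intro integral_mono integrable_abs pconv_integrable t Bochner_Integration.integrable_mult_right time_profile_integrable) auto
  finally show ?thesis by simp
 qed
 define D where "D = real CARD('n) * (real CARD('n) * (C * ?I)) + 1"
 have "\<bar>prs t x\<bar> \<le> D * t powr (- (1/4))" if t: "t \<in> {0<..T}" for t x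
 proof -
  have "\<bar>prs t x\<bar> \<le> (\<Sum>h::'n\<in>UNIV. \<Sum>k::'n\<in>UNIV. C * t powr (- (1/4)) * ?I)"
   unfolding prs_def by (intro order_trans[OF sum_abs] sum_mono 1 t)
  also have "\<dots> \<le> D * t powr (- (1/4))" by (simp add: D_def algebra_simps)
  finally show ?thesis .
 qed
 moreover have "D > 0" unfolding D_def using C(1) I by (intro add_nonneg_pos) auto
 ultimately show ?thesis using that by blast
qed

text \<open>By the semigroup law the first derivative at time \<open>\<tau>\<close> and the second
  derivatives at time r combine into third derivatives at time r + \<open>\<tau>\<close>. The
  integral over r > 0 thus becomes one over r > \<open>\<tau>\<close>: the nonlocal part of
  \<open>duh\<close> is the gradient of the heat-regularised pressure.\<close>

lemma gk1_conv_pressure: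
 assumes \<tau>: "\<tau> > 0" and s: "s \<in> {0<..T}"
 shows "conv (gk1 (axis j 1) \<tau>) (prs s) x
  = (\<Sum>h\<in>UNIV. \<Sum>k\<in>UNIV. LINT r|lon {\<tau><..}. conv (gk3 (axis h 1) (axis k 1) (axis j 1) r) (stress h k s) x)"
proof -
 let ?c = "axis j 1 :: real^'n"
 note fi = gkernel_integrable(1)[OF gkernel_gk1[of ?c] \<tau>]
 from pconv_bound obtain C where C: "C > 0" "!!h k r t x. r > 0 ==> t \<in> {0<..T} ==> \<bar>pconv h k r t x\<bar> \<le> C * t powr (- (1/4)) * time_profile r" by metis
 have fr: "integrable lborel (%y. gk1 ?c \<tau> (x - y))" using lborel_reflect(1)[of "gk1 ?c \<tau>" x] fi by simp
 let ?L = "LINT y|lborel. \<bar>gk1 ?c \<tau> (x - y)\<bar>"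
 have sw: "(LINT y|lborel. gk1 ?c \<tau> (x - y) * (LINT r|lon {0<..}. pconv h k r s y)) = (LINT r|lon {0<..}. conv (gk1 ?c \<tau>) (pconv h k r s) x) \<and>
  integrable lborel (%y. gk1 ?c \<tau> (x - y) * (LINT r|lon {0<..}. pconv h k r s y))" for h k
 proof -
  let ?f = "%r y. gk1 ?c \<tau> (x - y) * pconv h k r s y"
  have m: "(%(r, y). ?f r y) \<in> borel_measurable (lon {0<..} \<Otimes>\<^sub>M lborel)"
   by (rule lon_measurable_pair(1)) measurable
  have pb: "\<bar>pconv h k r s y\<bar> \<le> C * s powr (- (1/4)) * time_profile r" if "r \<in> space (lon {0<..})" for r y
   using C(2)[of r s h k y] that s by simp
  have i: "integrable lborel (?f r)" if "r \<in> space (lon {0<..})" for r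
   by (rule conv_integrable'[OF _ pb[OF that] fi]) measurable
  have b: "(LINT y|lborel. \<bar>?f r y\<bar>) \<le> ?L * (C * s powr (- (1/4))) * time_profile r" if r: "r \<in> space (lon {0<..})" for r
  proof -
   have "(LINT y|lborel. \<bar>?f r y\<bar>) \<le> (LINT y|lborel. \<bar>gk1 ?c \<tau> (x - y)\<bar> * (C * s powr (- (1/4)) * time_profile r))"
   proof (rule integral_mono[OF integrable_abs[OF i[OF r]]])
    show "\<bar>?f r y\<bar> \<le> \<bar>gk1 ?c \<tau> (x - y)\<bar> * (C * s powr (- (1/4)) * time_profile r)" for y
     unfolding abs_mult[of "gk1 _ _ _"] by (intro mult_left_mono pb[OF r]) auto
   qed (intro Bochner_Integration.integrable_mult_left integrable_abs fr)
   also have "\<dots> = ?L * (C * s powr (- (1/4)) * time_profile r)" by (rule Bochner_Integration.integral_mult_left_zero)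
   finally show ?thesis by (simp add: mult.assoc)
  qed
  note sw = integral_swap_bound[OF sigma_finite_lon sigma_finite_lborel m i b Bochner_Integration.integrable_mult_right[OF time_profile_integrable]]
  show ?thesis
   using sw(1,3) by (simp add: Bochner_Integration.integral_mult_right_zero)
 qed
 have as: "conv (gk1 ?c \<tau>) (pconv h k r s) x = conv (gk3 (axis h 1) (axis k 1) ?c (r + \<tau>)) (stress h k s) x" if r: "r > 0" for h k r
 proof -
  let ?g = "gk2 (axis h 1) (axis k 1 :: real^'n) r"
  obtain B where B: "!!z. \<bar>?g z\<bar> \<le> B" using gkernel_bounded[OF gkernel_gk2 r] by metis
  have "conv (gk1 ?c \<tau>) (conv ?g (stress h k s)) x = conv (conv (gk1 ?c \<tau>) ?g) (stress h k s) x"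
   by (rule conv_assoc[OF fi _ B stress_integrable(1)]) measurable
  then show ?thesis unfolding pconv_def gk1_conv_gk2[OF \<tau> r] by (simp add: add.commute)
 qed
 have "conv (gk1 ?c \<tau>) (prs s) x = (\<Sum>h\<in>UNIV. \<Sum>k\<in>UNIV. LINT r|lon {0<..}. conv (gk1 ?c \<tau>) (pconv h k r s) x)"
  unfolding prs_def sum_distrib_left using sw
  by (subst Bochner_Integration.integral_sum) (auto intro!: sum.cong Bochner_Integration.integrable_sum simp: Bochner_Integration.integral_sum)
 also have "\<dots> = (\<Sum>h\<in>UNIV. \<Sum>k\<in>UNIV. LINT r|lon {\<tau><..}. conv (gk3 (axis h 1) (axis k 1) ?c r) (stress h k s) x)"
 proof (intro sum.cong refl)
  fix h k
  have "(LINT r|lon {0<..}. conv (gk1 ?c \<tau>) (pconv h k r s) x) = (LINT r|lon {0<..}. conv (gk3 (axis h 1) (axis k 1) ?c (r + \<tau>)) (stress h k s) x)"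
   by (intro Bochner_Integration.integral_cong refl as) simp
  also have "\<dots> = (LINT r|lon {\<tau><..}. conv (gk3 (axis h 1) (axis k 1) ?c r) (stress h k s) x)"
  proof (rule lon_shift(2))
   show "(%r. conv (gk3 (axis h 1) (axis k 1) ?c r) (stress h k s) x) \<in> borel_measurable borel"
    using conv_stress_measurable[OF gkernel_pair_measurable(1)[OF gkernel_gk3], of "%r. r" borel "%_. s"] by simp
  qed
  finally show "(LINT r|lon {0<..}. conv (gk1 ?c \<tau>) (pconv h k r s) x) = (LINT r|lon {\<tau><..}. conv (gk3 (axis h 1) (axis k 1) ?c r) (stress h k s) x)" .
 qed
 finally show ?thesis .
qed

text \<open>The momentum flux u_k u_j + delta_kj p, with k the index to be contracted with a
  derivative.\<close>

definition momentum :: "'n \<Rightarrow> 'n \<Rightarrow> real \<Rightarrow> real^'n \<Rightarrow> real" where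
 "momentum j k s y = stress k j s y + (if k = j then prs s y else 0)"

lemma momentum_measurable [measurable (raw)]:
 assumes [measurable]: "g2 \<in> borel_measurable N" "g3 \<in> borel_measurable N"
 shows "(%w. momentum j k (g2 w) (g3 w)) \<in> borel_measurable N"
 unfolding momentum_def by measurable

lemma momentum_bound:
 obtains C where "C > 0" "!!j k t x. t \<in> {0<..T} ==> \<bar>momentum j k t x\<bar> \<le> C * t powr (- (1/4))"
proof -
 from prs_bound obtain C where C: "C > 0" "!!t x. t \<in> {0<..T} ==> \<bar>prs t x\<bar> \<le> C * t powr (- (1/4))" by metis
 have "\<bar>momentum j k t x\<bar> \<le> (M\<^sup>2 * T powr (1/4) + C) * t powr (- (1/4))" if t: "t \<in> {0<..T}" for j k t x
 proof -
  have "t powr (1/4) * t powr (- (1/4)) \<le> T powr (1/4) * t powr (- (1/4))"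
   using t by (intro mult_right_mono powr_mono2) auto
  moreover have "t powr (1/4) * t powr (- (1/4)) = 1" unfolding powr_add[symmetric] using t by simp
  ultimately have "1 \<le> T powr (1/4) * t powr (- (1/4))" by simp
  then have "M\<^sup>2 * 1 \<le> M\<^sup>2 * (T powr (1/4) * t powr (- (1/4)))" by (intro mult_left_mono) auto
  moreover have "\<bar>if k = j then prs t x else 0\<bar> \<le> C * t powr (- (1/4))" using C t by simp
  ultimately show ?thesis
   unfolding momentum_def using stress_bound[of k j t x] by (simp only: distrib_right mult.assoc mult_1_right)
 qed
 moreover have "M\<^sup>2 * T powr (1/4) + C > 0" using C(1) by (intro add_nonneg_pos) auto
 ultimately show ?thesis using that by blast
qed

text \<open>The projection has disappeared: the Duhamel integrand is an ordinary divergence of the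
  heat-regularised momentum flux, and this divergence can be moved to a test function.\<close>

lemma duh_momentum:
 assumes \<tau>: "\<tau> > 0" and s: "s \<in> {0<..T}"
 shows "duh j \<tau> s x = (\<Sum>k\<in>UNIV. conv (gk1 (axis k 1) \<tau>) (momentum j k s) x)"
proof -
 from prs_bound obtain C where C: "C > 0" "!!t x. t \<in> {0<..T} ==> \<bar>prs t x\<bar> \<le> C * t powr (- (1/4))" by metis
 have e: "conv (gk1 (axis k 1) \<tau>) (momentum j k s) x = conv (gk1 (axis k 1) \<tau>) (stress k j s) x + (if k = j then conv (gk1 (axis j 1) \<tau>) (prs s) x else 0)" for k
 proof -
  have 1: "integrable lborel (%y. gk1 (axis k 1) \<tau> (x - y) * stress k j s y)"
   by (rule conv_integrable'[OF _ stress_bound gkernel_integrable(1)[OF gkernel_gk1 \<tau>]]) measurable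
  have 2: "integrable lborel (%y. gk1 (axis j 1) \<tau> (x - y) * prs s y)"
   by (rule conv_integrable'[OF _ C(2)[OF s] gkernel_integrable(1)[OF gkernel_gk1 \<tau>]]) measurable
  show ?thesis using 1 2 by (cases "k = j") (simp_all add: momentum_def distrib_left)
 qed
 show ?thesis
  unfolding e duh_def gk1_conv_pressure[OF \<tau> s, symmetric] sum.distrib by (simp add: sum.delta)
qed

end

section \<open>Compactly supported test functions and the heat flow on them\<close>

text \<open>The functions of class C^m with compact support. Finite order admits the explicit
  polynomial bumps \<open>bump\<close>, and the recursion through partial derivatives fits repeated
  integration by parts.\<close>

primrec Cc :: "nat \<Rightarrow> (real^'n \<Rightarrow> real) \<Rightarrow> bool" where
 "Cc 0 \<phi> \<longleftrightarrow> continuous_on UNIV \<phi> \<and> (\<exists>R. \<forall>x. norm x > R \<longrightarrow> \<phi> x = 0)"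
| "Cc (Suc m) \<phi> \<longleftrightarrow> (\<exists>R. \<forall>x. norm x > R \<longrightarrow> \<phi> x = 0) \<and> (\<forall>x. \<phi> differentiable at x) \<and> (\<forall>i. Cc m (pderiv_at i \<phi>))"

lemma Cc_imp_0: "Cc m \<phi> ==> Cc 0 \<phi>"
 by (cases m) (auto simp: continuous_on_eq_continuous_within intro: differentiable_imp_continuous_within)

lemma Cc_Suc: "Cc (Suc m) \<phi> ==> Cc m \<phi>"
proof (induction m arbitrary: \<phi>)
 case 0
 then show ?case by (rule Cc_imp_0)
next
 case (Suc m)
 then show ?case by (simp del: Cc.simps add: Cc.simps(2)[of "Suc m"]) (simp only: Cc.simps(2), auto intro: Suc.IH)
qed

lemma Cc_support: "Cc m \<phi> ==> \<exists>R>0. \<forall>x. norm x > R \<longrightarrow> \<phi> x = 0"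
proof -
 assume "Cc m \<phi>"
 from Cc_imp_0[OF this] obtain R where "\<forall>x. norm x > R \<longrightarrow> \<phi> x = 0" by auto
 then show ?thesis by (intro exI[of _ "max R 1"]) auto
qed

lemma Cc_continuous: "Cc m \<phi> ==> continuous_on UNIV \<phi>"
 using Cc_imp_0 by auto

lemma Cc_measurable: "Cc m \<phi> ==> \<phi> \<in> borel_measurable borel"
 by (rule borel_measurable_continuous_onI[OF Cc_continuous])

lemma Cc_bounded:
 assumes "Cc m \<phi>"
 obtains B where "B > 0" "!!x. \<bar>\<phi> x\<bar> \<le> B"
proof -
 from Cc_support[OF assms] obtain R where R: "\<forall>x. norm x > R \<longrightarrow> \<phi> x = 0" by blast
 have "compact (\<phi> ` cball 0 R)"
  by (intro compact_continuous_image continuous_on_subset[OF Cc_continuous[OF assms]]) auto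
 then have "bounded (\<phi> ` cball 0 R)" by (rule compact_imp_bounded)
 then obtain B where B: "B > 0" "!!y. y \<in> \<phi> ` cball 0 R ==> norm y \<le> B"
  unfolding bounded_pos by auto
 have "\<bar>\<phi> x\<bar> \<le> B" for x
 proof (cases "norm x > R")
  case False
  then have "\<phi> x \<in> \<phi> ` cball 0 R" by auto
  from B(2)[OF this] show ?thesis by simp
 qed (use B R in simp)
 with B(1) that show ?thesis by blast
qed

lemma integrable_cball: "integrable lborel (%x::'a::euclidean_space. B * indicator (cball 0 R) x :: real)"
 by (intro Bochner_Integration.integrable_mult_right integrable_real_indicator emeasure_bounded_finite) auto

lemma Cc_integrable:
 assumes "Cc m \<phi>"
 shows "integrable lborel \<phi>"
proof -
 from Cc_support[OF assms] obtain R where R: "\<forall>x. norm x > R \<longrightarrow> \<phi> x = 0" by blast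
 from Cc_bounded[OF assms] obtain B where B: "B > 0" "!!x. \<bar>\<phi> x\<bar> \<le> B" by blast
 show ?thesis
 proof (rule Bochner_Integration.integrable_bound)
  show "integrable lborel (%x. B * indicator (cball 0 R) x)"
   by (rule integrable_cball)
  show "AE x in lborel. norm (\<phi> x) \<le> norm (B * indicator (cball 0 R) x)"
   using B R by (intro AE_I2) (auto split: split_indicator)
 qed (use Cc_measurable[OF assms] in simp)
qed

lemma Cc_mult_0: "continuous_on UNIV w ==> Cc m \<phi> ==> Cc 0 (%x. w x * \<phi> x)"
 using Cc_continuous[of m \<phi>] Cc_support[of m \<phi>] by (auto intro!: continuous_intros)

lemma Cc_add_0:
 assumes "Cc 0 f" "Cc 0 g"
 shows "Cc 0 (%x. f x + g x)"
proof -
 from Cc_support[OF assms(1)] Cc_support[OF assms(2)] obtain R1 R2 where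
  R: "\<forall>x. norm x > R1 \<longrightarrow> f x = 0" "\<forall>x. norm x > R2 \<longrightarrow> g x = 0" by blast
 have "\<forall>x. norm x > max R1 R2 \<longrightarrow> f x + g x = 0" using R by auto
 then have "\<exists>R. \<forall>x. norm x > R \<longrightarrow> f x + g x = 0" by blast
 moreover have "continuous_on UNIV (%x. f x + g x)"
  using Cc_continuous[OF assms(1)] Cc_continuous[OF assms(2)] by (rule continuous_on_add)
 ultimately show ?thesis by simp
qed

lemma Cc_sum_0: "(!!i. i \<in> A ==> Cc 0 (f i)) ==> finite A ==> Cc 0 (%x. \<Sum>i\<in>A. f i x)"
proof (induction A rule: infinite_finite_induct)
 case (insert i A)
 then have "Cc 0 (%x. f i x + (\<Sum>i\<in>A. f i x))" by (intro Cc_add_0) auto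
 then show ?case using insert.hyps by simp
qed auto

lemma linear_vec_expand:
 fixes f :: "real^'n \<Rightarrow> real"
 assumes "linear f"
 shows "f v = (\<Sum>i\<in>UNIV. f (axis i 1) * v $ i)"
proof -
 have "v = (\<Sum>i\<in>UNIV. v $ i *\<^sub>R axis i 1)"
  by (auto simp: vec_eq_iff axis_def if_distrib sum.delta cong: if_cong)
 then have "f v = f (\<Sum>i\<in>UNIV. v $ i *\<^sub>R axis i 1)" by simp
 also have "\<dots> = (\<Sum>i\<in>UNIV. v $ i *\<^sub>R f (axis i 1))"
  using assms by (simp add: linear_sum linear_scale)
 finally show ?thesis by (simp add: mult.commute)
qed

lemma pderiv_has_derivative:
 fixes \<phi> :: "real^'n \<Rightarrow> real"
 assumes "\<phi> differentiable at x"
 shows "(\<phi> has_derivative (%v. \<Sum>i\<in>UNIV. pderiv_at i \<phi> x * v $ i)) (at x)"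
proof -
 have 1: "(\<phi> has_derivative frechet_derivative \<phi> (at x)) (at x)" using assms frechet_derivative_works by blast
 then have "frechet_derivative \<phi> (at x) = (%v. \<Sum>i\<in>UNIV. pderiv_at i \<phi> x * v $ i)"
  unfolding pderiv_at_def by (intro ext linear_vec_expand) (rule has_derivative_linear)
 with 1 show ?thesis by simp
qed

lemma Cc_has_derivative: "Cc (Suc m) \<phi> ==> (\<phi> has_derivative (%v. \<Sum>i\<in>UNIV. pderiv_at i \<phi> x * v $ i)) (at x)"
 by (rule pderiv_has_derivative) simp

lemma Cc_pderiv: "Cc (Suc m) \<phi> ==> Cc m (pderiv_at i \<phi>)"
 by simp

text \<open>The derivative of the product w \<open>\<psi>\<close> has integral zero by
  \<open>integral_derivative_eq_0\<close>. Domination of its shifts comes from the compact support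
  of \<open>\<psi>\<close>: a constant on the ball enlarged by 1.\<close>

lemma integral_by_parts:
 fixes w \<psi> :: "real^'n \<Rightarrow> real"
 assumes w: "!!x. (w has_derivative w' x) (at x)" and c: "!!v. continuous_on UNIV (%x. w' x v)" and \<psi>: "Cc (Suc m) \<psi>"
 shows "(LINT x|lborel. w' x (axis i 1) * \<psi> x) = - (LINT x|lborel. w x * pderiv_at i \<psi> x)"
  "integrable lborel (%x. w' x (axis i 1) * \<psi> x)" "integrable lborel (%x. w x * pderiv_at i \<psi> x)"
proof -
 have wc: "continuous_on UNIV w"
  by (simp add: continuous_on_eq_continuous_within) (meson w has_derivative_continuous)
 note wl = has_derivative_linear[OF w]
 let ?D = "%x v. \<Sum>i\<in>UNIV. pderiv_at i \<psi> x * v $ i"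
 let ?K = "%x. \<Sum>i\<in>UNIV. \<bar>w x * pderiv_at i \<psi> x\<bar> + \<bar>w' x (axis i 1) * \<psi> x\<bar>"
 let ?G = "%x v. w x * ?D x v + w' x v * \<psi> x"
 have abs0: "Cc 0 f ==> Cc 0 (%x. \<bar>f x\<bar>)" for f :: "real^'n \<Rightarrow> real" by (auto intro: continuous_intros)
 have c1: "Cc 0 (%x. w x * pderiv_at i \<psi> x)" for i by (rule Cc_mult_0[OF wc Cc_pderiv[OF \<psi>]])
 have c2: "Cc 0 (%x. w' x (axis i 1) * \<psi> x)" for i by (rule Cc_mult_0[OF c \<psi>])
 note abs1 = abs0[OF c1] and abs2 = abs0[OF c2]
 have K: "Cc 0 ?K" by (rule Cc_sum_0[OF Cc_add_0[OF abs1 abs2]]) simp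
 from Cc_bounded[OF K] obtain B where B: "B > 0" "!!x. \<bar>?K x\<bar> \<le> B" by blast
 from Cc_support[OF K] obtain R where R: "R > 0" "!!x. norm x > R ==> ?K x = 0" by blast
 have Gb: "\<bar>?G x v\<bar> \<le> norm v * ?K x" for x v
 proof -
  have "?G x v = (\<Sum>i\<in>UNIV. (w x * pderiv_at i \<psi> x + w' x (axis i 1) * \<psi> x) * v $ i)"
   using linear_vec_expand[OF wl, of x v] by (simp add: sum_distrib_left sum_distrib_right sum.distrib algebra_simps)
  also have "\<bar>\<dots>\<bar> \<le> (\<Sum>i\<in>UNIV. (\<bar>w x * pderiv_at i \<psi> x\<bar> + \<bar>w' x (axis i 1) * \<psi> x\<bar>) * norm v)"
   by (intro order_trans[OF sum_abs] sum_mono) (auto simp: abs_mult[of _ "v $ _"] intro!: mult_mono component_le_norm_cart)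
  finally show ?thesis unfolding sum_distrib_right[symmetric] by (simp only: mult.commute)
 qed
 have "(LINT x|lborel. ?G x (axis i 1)) = 0"
 proof (rule integral_derivative_eq_0[where f = "%x. w x * \<psi> x" and \<delta> = 1 and g = "%x. B * indicator (cball 0 (R + 1)) x"])
  show "((%x. w x * \<psi> x) has_derivative ?G x) (at x)" for x
   by (rule has_derivative_mult[OF w Cc_has_derivative[OF \<psi>]])
  show "integrable lborel (%x. w x * \<psi> x)" by (rule Cc_integrable[OF Cc_mult_0[OF wc \<psi>]])
  show "(%x. ?G x v) \<in> borel_measurable borel" for v
   by (intro borel_measurable_continuous_onI continuous_intros wc c Cc_continuous[OF \<psi>] Cc_continuous[OF Cc_pderiv[OF \<psi>]])
  show "\<bar>?G (x + h) v\<bar> \<le> norm v * (B * indicator (cball 0 (R + 1)) x)" if h: "norm h < 1" for x h v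
  proof (cases "norm x \<le> R + 1")
   case True
   have "norm v * ?K (x + h) \<le> norm v * B" using B(2)[of "x + h"] by (intro mult_left_mono) auto
   then show ?thesis using order_trans[OF Gb] True by simp
  next
   case False
   then have "norm (x + h) > R" using h norm_triangle_ineq2[of x "- h"] by simp
   then show ?thesis using Gb[of "x + h" v] R(2) False by simp
  qed
  show "integrable lborel (%x::real^'n. B * indicator (cball 0 (R + 1)) x)"
   by (rule integrable_cball)
 qed simp
 moreover have "?G x (axis i 1) = w x * pderiv_at i \<psi> x + w' x (axis i 1) * \<psi> x" for x
  by (simp add: axis_def if_distrib sum.delta cong: if_cong)
 ultimately have "(LINT x|lborel. w x * pderiv_at i \<psi> x + w' x (axis i 1) * \<psi> x) = 0" by simp
 then show "(LINT x|lborel. w' x (axis i 1) * \<psi> x) = - (LINT x|lborel. w x * pderiv_at i \<psi> x)"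
  using Cc_integrable[OF c1] Cc_integrable[OF c2] by simp
 show "integrable lborel (%x. w' x (axis i 1) * \<psi> x)" "integrable lborel (%x. w x * pderiv_at i \<psi> x)"
  using Cc_integrable[OF c1] Cc_integrable[OF c2] by auto
qed

lemma gkernel_conv_pderiv:
 fixes f :: "real \<Rightarrow> real^'n \<Rightarrow> real"
 assumes k: "gkernel m f f'" and s: "s > 0" and \<psi>: "Cc (Suc n) \<psi>" and c: "!!v. continuous_on UNIV (%z. f' s z v)"
 shows "conv (f s) (pderiv_at i \<psi>) x = conv (%z. f' s z (axis i 1)) \<psi> x"
proof -
 have "((%y. f s (x - y)) has_derivative (%v. f' s (x - y) (- v))) (at y)" for y
 proof -
  have "((%y. x - y) has_derivative (%v. - v)) (at y)" by (auto intro!: derivative_eq_intros)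
  from has_derivative_compose[OF this gkernel_derivative[OF k s]] show ?thesis .
 qed
 moreover have "continuous_on UNIV (%y. f' s (x - y) (- v))" for v
  by (rule continuous_on_compose2[OF c]) (auto intro: continuous_intros)
 ultimately have "(LINT y|lborel. f' s (x - y) (- axis i 1) * \<psi> y) = - (LINT y|lborel. f s (x - y) * pderiv_at i \<psi> y)"
  by (rule integral_by_parts(1)[OF _ _ \<psi>])
 moreover have "f' s z (- v) = - f' s z v" for z v
  using linear_neg[OF has_derivative_linear[OF gkernel_derivative[OF k s]]] .
 ultimately show ?thesis by simp
qed

lemma gk_continuous:
 assumes "s > 0"
 shows "continuous_on UNIV (%z::'a::euclidean_space. gk1 a s z)" "continuous_on UNIV (%z::'a. gk2 a b s z)" "continuous_on UNIV (%z::'a. gk3 a b c s z)"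
 by (simp_all add: continuous_on_eq_continuous_within)
  (meson has_derivative_continuous gk1_has_derivative gk2_has_derivative gk3_has_derivative assms)+

definition lap :: "(real^'n \<Rightarrow> real) \<Rightarrow> real^'n \<Rightarrow> real" where
 "lap \<psi> x = (\<Sum>i\<in>UNIV. pderiv_at i (pderiv_at i \<psi>) x)"

lemma Cc_lap: "Cc (Suc (Suc 0)) \<psi> ==> Cc 0 (lap \<psi>)"
 unfolding lap_def[abs_def] by (rule Cc_sum_0) (auto simp del: Cc.simps intro: Cc_pderiv)

lemma conv_sum_right:
 assumes "!!i. integrable lborel (%y. f (x - y) * g i y)"
 shows "conv f (%y. \<Sum>i\<in>A. g i y) x = (\<Sum>i\<in>A. conv f (g i) x)"
 unfolding sum_distrib_left by (rule Bochner_Integration.integral_sum) (use assms in auto)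

lemma gkernel_conv_Cc_integrable:
 fixes f :: "real \<Rightarrow> real^'n \<Rightarrow> real"
 assumes k: "gkernel m f f'" and s: "s > 0" and \<psi>: "Cc n \<psi>"
 shows "integrable lborel (%y. f s (x - y) * \<psi> y)"
proof -
 obtain B where "!!z. \<bar>f s z\<bar> \<le> B" using gkernel_bounded[OF k s] by metis
 then show ?thesis by (intro conv_integrable[OF gkernel_measurable1[OF k] _ Cc_integrable[OF \<psi>]])
qed

lemma gk_conv_lap:
 fixes \<psi> :: "real^'n \<Rightarrow> real"
 assumes s: "s > 0" and \<psi>: "Cc (Suc (Suc 0)) \<psi>"
 shows "conv (gk s) (lap \<psi>) x = (\<Sum>i\<in>UNIV. conv (gk2 (axis i 1) (axis i 1) s) \<psi> x)"
  and "conv (gk1 (axis k 1) s) (lap \<psi>) x = (\<Sum>i\<in>UNIV. conv (gk3 (axis i 1) (axis i 1) (axis k 1) s) \<psi> x)"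
proof -
 have p1: "Cc (Suc 0) (pderiv_at i \<psi>)" "Cc 0 (pderiv_at i (pderiv_at i \<psi>))" for i
  using \<psi> by (auto simp del: Cc.simps intro: Cc_pderiv)
 have "conv (gk s) (lap \<psi>) x = (\<Sum>i\<in>UNIV. conv (gk s) (pderiv_at i (pderiv_at i \<psi>)) x)"
  unfolding lap_def by (rule conv_sum_right[OF gkernel_conv_Cc_integrable[OF gkernel_gk s p1(2)]])
 also have "\<dots> = (\<Sum>i\<in>UNIV. conv (gk2 (axis i 1) (axis i 1) s) \<psi> x)"
  unfolding gkernel_conv_pderiv[OF gkernel_gk s p1(1) gk_continuous(1)[OF s]]
   gkernel_conv_pderiv[OF gkernel_gk1 s \<psi> gk_continuous(2)[OF s]] ..
 finally show "conv (gk s) (lap \<psi>) x = (\<Sum>i\<in>UNIV. conv (gk2 (axis i 1) (axis i 1) s) \<psi> x)" .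
 have "conv (gk1 (axis k 1) s) (lap \<psi>) x = (\<Sum>i\<in>UNIV. conv (gk1 (axis k 1) s) (pderiv_at i (pderiv_at i \<psi>)) x)"
  unfolding lap_def by (rule conv_sum_right[OF gkernel_conv_Cc_integrable[OF gkernel_gk1 s p1(2)]])
 also have "\<dots> = (\<Sum>i\<in>UNIV. conv (gk3 (axis k 1) (axis i 1) (axis i 1) s) \<psi> x)"
  unfolding gkernel_conv_pderiv[OF gkernel_gk1 s p1(1) gk_continuous(2)[OF s]]
   gkernel_conv_pderiv[OF gkernel_gk2 s \<psi> gk_continuous(3)[OF s]] ..
 also have "\<dots> = (\<Sum>i\<in>UNIV. conv (gk3 (axis i 1) (axis i 1) (axis k 1) s) \<psi> x)"
  by (simp add: gk3_def inner_commute algebra_simps)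
 finally show "conv (gk1 (axis k 1) s) (lap \<psi>) x = (\<Sum>i\<in>UNIV. conv (gk3 (axis i 1) (axis i 1) (axis k 1) s) \<psi> x)" .
qed

text \<open>Both sides equal the sum of the third derivatives of the heat kernel convolved with
  \<open>\<psi>\<close>. Moving every derivative onto the kernel avoids having to interchange
  partial derivatives of \<open>\<psi>\<close>.\<close>

lemma gk1_conv_lap:
 fixes \<psi> :: "real^'n \<Rightarrow> real"
 assumes s: "s > 0" and \<psi>: "Cc (Suc (Suc (Suc 0))) \<psi>"
 shows "conv (gk s) (lap (pderiv_at k \<psi>)) x = conv (gk1 (axis k 1) s) (lap \<psi>) x"
proof -
 have "Cc (Suc (Suc 0)) (pderiv_at k \<psi>)" by (rule Cc_pderiv[OF \<psi>])
 from gk_conv_lap(1)[OF s this]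
 have "conv (gk s) (lap (pderiv_at k \<psi>)) x = (\<Sum>i\<in>UNIV. conv (gk2 (axis i 1) (axis i 1) s) (pderiv_at k \<psi>) x)" .
 also have "\<dots> = (\<Sum>i\<in>UNIV. conv (gk3 (axis i 1) (axis i 1) (axis k 1) s) \<psi> x)"
  unfolding gkernel_conv_pderiv[OF gkernel_gk2 s \<psi> gk_continuous(3)[OF s]] ..
 also have "\<dots> = conv (gk1 (axis k 1) s) (lap \<psi>) x"
  using gk_conv_lap(2)[OF s Cc_Suc[OF \<psi>]] by simp
 finally show ?thesis .
qed

lemma gk_heat_equation:
 fixes z :: "real^'n"
 assumes s: "s > 0"
 shows "((%s. gk s z) has_real_derivative (\<Sum>i\<in>UNIV. gk2 (axis i 1) (axis i 1) s z)) (at s)"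
proof -
 let ?d = "real CARD('n)"
 have "(\<Sum>i\<in>UNIV. gk2 (axis i 1) (axis i 1) s z) = ((\<Sum>i\<in>UNIV. (z $ i)\<^sup>2) / (4 * s^2) - ?d / (2 * s)) * gk s z"
  by (simp add: gk2_def inner_axis inner_axis_axis sum_distrib_right[symmetric] sum_subtractf sum_divide_distrib power2_eq_square)
 also have "(\<Sum>i\<in>UNIV. (z $ i)\<^sup>2) = (norm z)\<^sup>2"
  unfolding power2_norm_eq_inner inner_vec_def by (simp add: power2_eq_square)
 finally have eq: "(\<Sum>i\<in>UNIV. gk2 (axis i 1) (axis i 1) s z) = ((norm z)\<^sup>2 / (4 * s^2) - ?d / (2 * s)) * gk s z" .
 have 1: "((%s. (4 * pi * s) powr (- ?d / 2)) has_real_derivative - ?d / 2 * (4 * pi * s) powr (- ?d / 2) / s) (at s)"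
 proof -
  have "((%s. (4 * pi * s) powr (- ?d / 2)) has_real_derivative - ?d / 2 * (4 * pi * s) powr (- ?d / 2 - 1) * (4 * pi)) (at s)"
   using s by (auto intro!: derivative_eq_intros)
  moreover have "(4 * pi * s) powr (- ?d / 2 - 1) * (4 * pi) = (4 * pi * s) powr (- ?d / 2) / s"
  proof -
   define a e where "a = 4 * pi * s" and "e = - ?d / 2"
   have "a powr (e - 1) = a powr e / a" using powr_diff[of a e 1] s by (simp add: a_def)
   then have "a powr (e - 1) * (4 * pi) = a powr e / s" using s by (simp add: a_def field_simps)
   then show ?thesis by (simp only: a_def e_def)
  qed
  ultimately show ?thesis by (simp only: mult.assoc times_divide_eq_right)
 qed
 have 2: "((%s. exp (- (norm z)\<^sup>2 / (4 * s))) has_real_derivative exp (- (norm z)\<^sup>2 / (4 * s)) * ((norm z)\<^sup>2 / (4 * s^2))) (at s)"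
  using s by (auto intro!: derivative_eq_intros simp: power2_eq_square field_simps)
 from DERIV_mult[OF 1 2] show ?thesis
  unfolding eq gk_def using s by (simp add: algebra_simps)
qed

lemma gk_conv_time_derivative:
 fixes \<psi> :: "real^'n \<Rightarrow> real"
 assumes s: "s > 0" and \<psi>: "Cc (Suc (Suc 0)) \<psi>"
 shows "((%s. conv (gk s) \<psi> x) has_real_derivative conv (gk s) (lap \<psi>) x) (at s)"
proof -
 let ?L = "%s z. \<Sum>i\<in>UNIV. gk2 (axis i 1 :: real^'n) (axis i 1) s z"
 define P where "P i C \<longleftrightarrow> (\<forall>r z. s / 2 \<le> r \<longrightarrow> \<bar>gk2 (axis i 1 :: real^'n) (axis i 1) r z\<bar> \<le> C * r powr (- (real 2 / 2)))" for i C
 have "\<exists>C>0. \<forall>i. P i C"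
 proof (rule finite_uniform_bound)
  have "s / 2 > 0" using s by simp
  from gkernel_conv_bound[OF gkernel_gk2 this] show "\<exists>C>0. P i C" for i unfolding P_def by metis
  show "P i C'" if "P i C" "C \<le> C'" for i C C'
   using that unfolding P_def by (meson mult_right_mono order_trans powr_ge_zero)
 qed
 then obtain C where C: "C > 0" "!!i. P i C" by blast
 have L: "\<bar>?L r z\<bar> \<le> real CARD('n) * (C * (s / 2) powr (- 1))" if "s / 2 < r" for r z
 proof -
  have "\<bar>gk2 (axis i 1 :: real^'n) (axis i 1) r z\<bar> \<le> C * (s / 2) powr (- 1)" for i
  proof -
   have "\<bar>gk2 (axis i 1 :: real^'n) (axis i 1) r z\<bar> \<le> C * r powr (- 1)" using C(2)[of i] that unfolding P_def by force
   also have "\<dots> \<le> C * (s / 2) powr (- 1)" using C(1) s that by (intro mult_left_mono powr_mono2') auto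
   finally show ?thesis .
  qed
  then have "\<bar>?L r z\<bar> \<le> (\<Sum>i::'n\<in>UNIV. C * (s / 2) powr (- 1))" by (intro order_trans[OF sum_abs] sum_mono)
  then show ?thesis by simp
 qed
 let ?K = "real CARD('n) * (C * (s / 2) powr (- 1))"
 \<comment> \<open>Restricting to times beyond s/2 keeps the kernel bounds uniform; the set is open,
   so nothing is lost at s.\<close>
 have "((%s. LINT y|lborel. gk s (x - y) * \<psi> y) has_derivative (%v. LINT y|lborel. v * (?L s (x - y) * \<psi> y))) (at s within {s/2<..})"
 proof (rule has_derivative_lebesgue_integral[where g = "%y. ?K * \<bar>\<psi> y\<bar>"])
  show "s \<in> {s/2<..}" using s by simp
  fix r :: real and y assume "r \<in> {s/2<..}"
  then have r: "r > 0" "s / 2 < r" using s by auto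
  have "((%s. gk s (x - y) * \<psi> y) has_real_derivative ?L r (x - y) * \<psi> y) (at r)"
   by (rule DERIV_cmult_right[OF gk_heat_equation[OF r(1)]])
  moreover have "(*) (?L r (x - y) * \<psi> y) = (%v. v * (?L r (x - y) * \<psi> y))" by (intro ext mult.commute)
  ultimately show "((%s. gk s (x - y) * \<psi> y) has_derivative (%v. v * (?L r (x - y) * \<psi> y))) (at r within {s/2<..})"
   unfolding has_field_derivative_def by (simp only: has_derivative_at_withinI)
  show "\<bar>v * (?L r (x - y) * \<psi> y)\<bar> \<le> norm v * (?K * \<bar>\<psi> y\<bar>)" for v
   unfolding abs_mult real_norm_def using L[OF r(2), of "x - y"] by (intro mult_left_mono mult_right_mono) auto
  show "integrable lborel (%y. gk r (x - y) * \<psi> y)" by (rule gkernel_conv_Cc_integrable[OF gkernel_gk r(1) \<psi>])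
 next
  show "integrable lborel (%y. ?K * \<bar>\<psi> y\<bar>)" using Cc_integrable[OF \<psi>] by simp
  have [measurable]: "\<psi> \<in> borel_measurable borel" by (rule Cc_measurable[OF \<psi>])
  show "(%y. v * (?L s (x - y) * \<psi> y)) \<in> borel_measurable lborel" for v by measurable
 qed auto
 moreover have "(%v. LINT y|lborel. v * (?L s (x - y) * \<psi> y)) = (*) (conv (gk s) (lap \<psi>) x)"
 proof
  fix v :: real
  have "(LINT y|lborel. v * (?L s (x - y) * \<psi> y)) = v * (LINT y|lborel. (\<Sum>i\<in>UNIV. gk2 (axis i 1) (axis i 1) s (x - y) * \<psi> y))"
   by (simp add: sum_distrib_right)
  also have "(LINT y|lborel. (\<Sum>i\<in>UNIV. gk2 (axis i 1) (axis i 1) s (x - y) * \<psi> y)) = conv (gk s) (lap \<psi>) x"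
   unfolding gk_conv_lap(1)[OF s \<psi>]
   by (rule Bochner_Integration.integral_sum) (rule gkernel_conv_Cc_integrable[OF gkernel_gk2 s \<psi>])
  finally show "(LINT y|lborel. v * (?L s (x - y) * \<psi> y)) = conv (gk s) (lap \<psi>) x * v" by (simp only: mult.commute)
 qed
 ultimately have "((%s. conv (gk s) \<psi> x) has_derivative (*) (conv (gk s) (lap \<psi>) x)) (at s within {s/2<..})" by (simp only:)
 then show ?thesis
  unfolding has_field_derivative_def by (subst (asm) at_within_open) (use s in auto)
qed

lemma gk_conv_bound:
 fixes g :: "'a::euclidean_space \<Rightarrow> real"
 assumes s: "s > 0" and g: "!!y. \<bar>g y\<bar> \<le> B" "g \<in> borel_measurable borel"
 shows "\<bar>conv (gk s) g x\<bar> \<le> B"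
proof -
 have B: "B \<ge> 0" using g(1)[of 0] by linarith
 have gr: "integrable lborel (%y. gk s (x - y))" "(LINT y|lborel. gk s (x - y)) = 1"
  using lborel_reflect[of "gk s" x] gk_integral[OF s, where 'a='a] by auto
 have ci: "integrable lborel (%y. gk s (x - y) * g y)" by (rule conv_integrable'[OF g(2,1) gk_integral(1)[OF s]])
 have "\<bar>conv (gk s) g x\<bar> \<le> (LINT y|lborel. \<bar>gk s (x - y) * g y\<bar>)"
  using integral_norm_bound[of lborel "%y. gk s (x - y) * g y"] by simp
 also have "\<dots> \<le> (LINT y|lborel. gk s (x - y) * B)"
  by (rule integral_mono[OF integrable_abs[OF ci] Bochner_Integration.integrable_mult_left[OF gr(1)]])
   (auto simp: abs_mult intro!: mult_left_mono g)
 finally show ?thesis using gr by simp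
qed

lemma Cc_lipschitz:
 fixes \<psi> :: "real^'n \<Rightarrow> real"
 assumes "Cc (Suc m) \<psi>"
 obtains L where "L > 0" "!!x y. \<bar>\<psi> y - \<psi> x\<bar> \<le> L * norm (y - x)"
proof -
 define P where "P i C \<longleftrightarrow> (\<forall>x. \<bar>pderiv_at i \<psi> x\<bar> \<le> C)" for i C
 have "\<exists>C>0. \<forall>i. P i C"
 proof (rule finite_uniform_bound)
  show "\<exists>C>0. P i C" for i unfolding P_def by (rule Cc_bounded[OF Cc_pderiv[OF assms]]) blast
  show "P i C'" if "P i C" "C \<le> C'" for i C C' using that unfolding P_def by (meson order_trans)
 qed
 then obtain C where C: "C > 0" "!!i. P i C" by blast
 have "\<bar>\<psi> y - \<psi> x\<bar> \<le> (real CARD('n) * C) * norm (y - x)" for x y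
 proof -
  have "norm (\<psi> y - \<psi> x) \<le> (real CARD('n) * C) * norm (y - x)"
  proof (rule differentiable_bound[of UNIV])
   show "(\<psi> has_derivative (%v. \<Sum>i\<in>UNIV. pderiv_at i \<psi> z * v $ i)) (at z within UNIV)" for z
    using Cc_has_derivative[OF assms] by simp
   show "onorm (%v. \<Sum>i\<in>UNIV. pderiv_at i \<psi> z * v $ i) \<le> real CARD('n) * C" for z
   proof (rule onorm_le)
    fix v :: "real^'n"
    have "\<bar>\<Sum>i\<in>UNIV. pderiv_at i \<psi> z * v $ i\<bar> \<le> (\<Sum>i::'n\<in>UNIV. C * norm v)"
     using C by (intro order_trans[OF sum_abs] sum_mono) (auto simp: P_def abs_mult intro!: mult_mono component_le_norm_cart)
    then show "norm (\<Sum>i\<in>UNIV. pderiv_at i \<psi> z * v $ i) \<le> real CARD('n) * C * norm v" by simp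
   qed
  qed auto
  then show ?thesis by simp
 qed
 moreover have "real CARD('n) * C > 0" using C(1) by simp
 ultimately show ?thesis using that by blast
qed

text \<open>A test function is Lipschitz, and the first moment of the heat kernel is of order sqrt
  s.\<close>

lemma gk_conv_initial:
 fixes \<psi> :: "real^'n \<Rightarrow> real"
 assumes "Cc (Suc m) \<psi>"
 obtains C where "C > 0" "!!s x. s > 0 ==> \<bar>conv (gk s) \<psi> x - \<psi> x\<bar> \<le> C * sqrt s"
proof -
 obtain L where L: "L > 0" "!!x y. \<bar>\<psi> y - \<psi> x\<bar> \<le> L * norm (y - x)" using Cc_lipschitz[OF assms] by metis
 from gkernel_moment[OF gkernel_gk[where 'a="real^'n"], of 1] obtain A where A: "A > 0"
  "!!s. s > 0 ==> integrable lborel (%z::real^'n. norm z powr 1 * \<bar>gk s z\<bar>)"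
  "!!s. s > 0 ==> (LINT z|lborel. norm (z::real^'n) powr 1 * \<bar>gk s z\<bar>) \<le> A * s powr (1 / 2 - real 0 / 2)" by auto
 have "\<bar>conv (gk s) \<psi> x - \<psi> x\<bar> \<le> L * A * sqrt s" if s: "s > 0" for s x
 proof -
  let ?k = "%z::real^'n. norm z powr 1 * \<bar>gk s z\<bar>"
  have km: "?k \<in> borel_measurable borel" by measurable
  have gr: "integrable lborel (%y. gk s (x - y))" "(LINT y|lborel. gk s (x - y)) = 1"
   using lborel_reflect[of "gk s" x] gk_integral[OF s, where 'a="real^'n"] by auto
  note ci = gkernel_conv_Cc_integrable[OF gkernel_gk s assms, of x]
  have di: "integrable lborel (%y. gk s (x - y) * (\<psi> y - \<psi> x))" using ci gr by (simp add: right_diff_distrib)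
  have "conv (gk s) \<psi> x - \<psi> x = (LINT y|lborel. gk s (x - y) * (\<psi> y - \<psi> x))"
   using ci gr by (simp add: right_diff_distrib)
  also have "\<bar>\<dots>\<bar> \<le> (LINT y|lborel. \<bar>gk s (x - y) * (\<psi> y - \<psi> x)\<bar>)"
   using integral_norm_bound[of lborel "%y. gk s (x - y) * (\<psi> y - \<psi> x)"] by simp
  also have "\<dots> \<le> (LINT y|lborel. L * ?k (x - y))"
  proof (rule integral_mono[OF integrable_abs[OF di]])
   show "integrable lborel (%y. L * ?k (x - y))" using lborel_reflect(1)[OF km, of x] A(2)[OF s] by simp
   fix y
   have "gk s (x - y) * \<bar>\<psi> y - \<psi> x\<bar> \<le> gk s (x - y) * (L * norm (y - x))" by (intro mult_left_mono L) auto
   then show "\<bar>gk s (x - y) * (\<psi> y - \<psi> x)\<bar> \<le> L * ?k (x - y)" by (simp add: abs_mult norm_minus_commute mult_ac)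
  qed
  also have "\<dots> = L * (LINT z|lborel. ?k z)" using lborel_reflect(2)[OF km, of x] by simp
  also have "\<dots> \<le> L * (A * s powr (1 / 2 - real 0 / 2))" using L(1) A(3)[OF s] by (intro mult_left_mono) auto
  finally show ?thesis using s by (simp add: powr_half_sqrt mult.assoc)
 qed
 moreover have "L * A > 0" using L(1) A(1) by simp
 ultimately show ?thesis using that by blast
qed

lemma gk_conv_measurable:
 assumes [measurable]: "\<psi> \<in> borel_measurable borel" "g \<in> borel_measurable N" "h \<in> borel_measurable N"
 shows "(%w. conv (gk (g w)) \<psi> (h w :: 'a::euclidean_space)) \<in> borel_measurable N"
  "(%w. conv (gk1 c (g w)) \<psi> (h w)) \<in> borel_measurable N"
proof -
 have "(%(w, y). gk (g w) (h w - y) * \<psi> y) \<in> borel_measurable (N \<Otimes>\<^sub>M lborel)"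
  "(%(w, y). gk1 c (g w) (h w - y) * \<psi> y) \<in> borel_measurable (N \<Otimes>\<^sub>M lborel)"
  unfolding case_prod_beta' by measurable
 then show "(%w. conv (gk (g w)) \<psi> (h w :: 'a)) \<in> borel_measurable N" "(%w. conv (gk1 c (g w)) \<psi> (h w)) \<in> borel_measurable N"
  by (auto intro: lborel.borel_measurable_lebesgue_integral)
qed

lemma lon_const:
 fixes t c :: real
 assumes "t > 0"
 shows "integrable (lon {0<..<t}) (%_. c)" "(LINT s|lon {0<..<t}. c) = c * t"
 using assms by (simp_all add: lon_integrable set_integrable_def integrable_indicator_iff measure_restrict_space)

lemma lon_bounded_integrable:
 fixes f :: "real \<Rightarrow> real"
 assumes "t > 0" "f \<in> borel_measurable borel" "!!s. s \<in> {0<..<t} ==> \<bar>f s\<bar> \<le> B"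
 shows "integrable (lon {0<..<t}) f" "\<bar>LINT s|lon {0<..<t}. f s\<bar> \<le> B * t"
proof -
 show i: "integrable (lon {0<..<t}) f"
  by (rule Bochner_Integration.integrable_bound[OF lon_const(1)[OF assms(1), of B] lon_measurable[OF assms(2)]])
   (intro AE_I2, use assms(3) in \<open>auto intro!: order_trans[OF _ abs_ge_self]\<close>)
 have "\<bar>LINT s|lon {0<..<t}. f s\<bar> \<le> (LINT s|lon {0<..<t}. \<bar>f s\<bar>)"
  using integral_norm_bound[of "lon {0<..<t}" f] by simp
 also have "\<dots> \<le> (LINT s|lon {0<..<t}. B)"
  by (rule integral_mono[OF integrable_abs[OF i] lon_const(1)[OF assms(1)]]) (use assms(3) in auto)
 finally show "\<bar>LINT s|lon {0<..<t}. f s\<bar> \<le> B * t" by (simp only: lon_const(2)[OF assms(1)])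
qed

lemma gk_conv_duhamel:
 fixes \<psi> :: "real^'n \<Rightarrow> real"
 assumes t: "t > 0" and \<psi>: "Cc (Suc (Suc 0)) \<psi>"
 shows "conv (gk t) \<psi> x = \<psi> x + (LINT r|lon {0<..<t}. conv (gk r) (lap \<psi>) x)"
proof -
 let ?D = "%r. conv (gk r) (lap \<psi>) x"
 from Cc_bounded[OF Cc_lap[OF \<psi>]] obtain B where B: "B > 0" "!!x. \<bar>lap \<psi> x\<bar> \<le> B" by blast
 from gk_conv_initial[OF \<psi>] obtain C where C: "C > 0" "!!s x. s > 0 ==> \<bar>conv (gk s) \<psi> x - \<psi> x\<bar> \<le> C * sqrt s" by blast
 have lm: "lap \<psi> \<in> borel_measurable borel" by (rule Cc_measurable[OF Cc_lap[OF \<psi>]])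
 have Dm: "?D \<in> borel_measurable borel" by (rule gk_conv_measurable(1)[OF lm]) auto
 have Db: "\<bar>?D r\<bar> \<le> B" if "r > 0" for r by (rule gk_conv_bound[OF that B(2) lm])
 let ?X = "conv (gk t) \<psi> x - \<psi> x - (LINT r|lon {0<..<t}. ?D r)"
 \<comment> \<open>The heat kernel is singular at time 0, so the fundamental theorem of calculus is
   applied on [e, t]. The value at time e and the omitted interval cost C sqrt e and B e, which
   vanish with e.\<close>
 have key: "\<bar>?X\<bar> \<le> C * sqrt e + B * e" if e: "0 < e" "e < t" for e
 proof -
  have "(?D has_integral conv (gk t) \<psi> x - conv (gk e) \<psi> x) {e..t}"
  proof (rule fundamental_theorem_of_calculus)
   fix r assume "r \<in> {e..t}"
   then have "r > 0" using e by simp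
   then show "((%r. conv (gk r) \<psi> x) has_vector_derivative ?D r) (at r within {e..t})"
    unfolding has_real_derivative_iff_has_vector_derivative[symmetric]
    by (rule has_field_derivative_at_within[OF gk_conv_time_derivative[OF _ \<psi>]])
  qed (use e in simp)
  then have I1: "integral {e..t} ?D = conv (gk t) \<psi> x - conv (gk e) \<psi> x" by (rule integral_unique)
  have "{e..<t} \<subseteq> {0<..<t}" using e by auto
  note D0 = lon_bounded_integrable(1)[OF t Dm, of B]
  have i0: "integrable (lon {0<..<t}) ?D" by (rule D0) (use Db in auto)
  have i1: "integrable (lon {0<..<e}) ?D" "\<bar>LINT r|lon {0<..<e}. ?D r\<bar> \<le> B * e"
   by (rule lon_bounded_integrable[OF e(1) Dm]; use Db in auto)+
  have i2: "integrable (lon {e..<t}) ?D" by (rule lon_subset[OF i0]) (use e in auto)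
  have U: "{0<..<t} = {0<..<e} \<union> {e..<t}" using e by auto
  have s: "(LINT r|lon {0<..<t}. ?D r) = (LINT r|lon {0<..<e}. ?D r) + (LINT r|lon {e..<t}. ?D r)"
   unfolding U by (rule lon_Un(2)[OF _ _ _ i1(1) i2]) auto
  have "(LINT r|lon {e..<t}. ?D r) = integral {e..<t} ?D"
   using i2 by (simp add: lon_integrable lon_integral set_borel_integral_eq_integral(2))
  also have "\<dots> = integral {e..t} ?D"
   by (rule integral_spike_set) (auto intro: negligible_subset[of "{t}"])
  finally have "?X = (conv (gk e) \<psi> x - \<psi> x) - (LINT r|lon {0<..<e}. ?D r)" using s I1 by simp
  then show ?thesis using C(2)[OF e(1), of x] i1(2) by linarith
 qed
 have "((%e. C * sqrt e + B * e) \<longlongrightarrow> C * sqrt 0 + B * 0) (at_right 0)"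
  by (intro tendsto_intros)
 then have "((%e. C * sqrt e + B * e) \<longlongrightarrow> 0) (at_right 0)" by simp
 moreover have "\<forall>\<^sub>F e in at_right 0. \<bar>?X\<bar> \<le> C * sqrt e + B * e"
  unfolding eventually_at_right_field using t key by blast
 ultimately have "\<bar>?X\<bar> \<le> 0" by (rule tendsto_lowerbound) simp
 then show ?thesis by simp
qed

section \<open>The weak form of the momentum equation\<close>

abbreviation pairing :: "('a::euclidean_space \<Rightarrow> real) \<Rightarrow> ('a \<Rightarrow> real) \<Rightarrow> real" where
 "pairing f g \<equiv> LINT x|lborel. f x * g x"

lemma bounded_mult_integrable:
 fixes m g :: "'a \<Rightarrow> real"
 assumes "m \<in> borel_measurable N" "!!y. \<bar>m y\<bar> \<le> B" "integrable N g"
 shows "integrable N (%y. m y * g y)" "\<bar>LINT y|N. m y * g y\<bar> \<le> B * (LINT y|N. \<bar>g y\<bar>)"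
proof -
 have b: "\<bar>m y * g y\<bar> \<le> B * \<bar>g y\<bar>" for y unfolding abs_mult by (intro mult_right_mono assms) auto
 have gi: "integrable N (%y. B * \<bar>g y\<bar>)" using assms(3) by simp
 show i: "integrable N (%y. m y * g y)"
  by (rule Bochner_Integration.integrable_bound[OF gi])
   (use assms(1) borel_measurable_integrable[OF assms(3)] in \<open>auto intro!: order_trans[OF b abs_ge_self]\<close>)
 have "\<bar>LINT y|N. m y * g y\<bar> \<le> (LINT y|N. \<bar>m y * g y\<bar>)"
  using integral_norm_bound[of N "%y. m y * g y"] by simp
 also have "\<dots> \<le> (LINT y|N. B * \<bar>g y\<bar>)" by (rule integral_mono[OF integrable_abs[OF i] gi b])
 finally show "\<bar>LINT y|N. m y * g y\<bar> \<le> B * (LINT y|N. \<bar>g y\<bar>)" by simp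
qed

text \<open>The constant \<open>c\<close> is the parity of the kernel: 1 for the heat kernel, -1 for
  its first derivatives.\<close>

lemma conv_adjoint:
 fixes f m \<phi> :: "'a::euclidean_space \<Rightarrow> real"
 assumes f: "integrable lborel f" "!!z. f (- z) = c * f z" and m: "m \<in> borel_measurable borel" "!!y. \<bar>m y\<bar> \<le> B"
  and \<phi>: "integrable lborel \<phi>"
 shows "pairing (conv f m) \<phi> = c * pairing m (conv f \<phi>)"
  and "integrable lborel (conv f \<phi>)" "(LINT y|lborel. \<bar>conv f \<phi> y\<bar>) \<le> (LINT z|lborel. \<bar>f z\<bar>) * (LINT y|lborel. \<bar>\<phi> y\<bar>)"
proof -
 have [measurable]: "f \<in> borel_measurable borel" "\<phi> \<in> borel_measurable borel"
  using borel_measurable_integrable[OF f(1)] borel_measurable_integrable[OF \<phi>] by auto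
 note [measurable] = m(1)
 have fr: "integrable lborel (%y. f (x - y))" "(LINT y|lborel. \<bar>f (x - y)\<bar>) = (LINT z|lborel. \<bar>f z\<bar>)" for x
  using lborel_reflect(1)[of f x] f(1) lborel_reflect(2)[of "%y. \<bar>f y\<bar>" x] by auto
 have fs: "integrable lborel (%y. f (y - x))" "(LINT y|lborel. \<bar>f (y - x)\<bar>) = (LINT z|lborel. \<bar>f z\<bar>)" for x
  using lborel_shift(1)[of f "- x"] f(1) lborel_shift(2)[of "%y. \<bar>f y\<bar>" "- x"] by auto
 have "(LINT x|lborel. LINT y|lborel. \<phi> x * (m y * f (x - y))) = (LINT y|lborel. LINT x|lborel. \<phi> x * (m y * f (x - y)))"
 proof (rule integral_swap_bound(1)[OF sigma_finite_lborel sigma_finite_lborel])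
  show "(%(x, y). \<phi> x * (m y * f (x - y))) \<in> borel_measurable (lborel \<Otimes>\<^sub>M lborel)" by measurable
  have mi: "integrable lborel (%y. m y * f (x - y))" for x
   by (rule bounded_mult_integrable(1)[OF _ m(2) fr(1)]) simp
  show "integrable lborel (%y. \<phi> x * (m y * f (x - y)))" for x
   using mi by simp
  show "(LINT y|lborel. \<bar>\<phi> x * (m y * f (x - y))\<bar>) \<le> \<bar>\<phi> x\<bar> * (B * (LINT z|lborel. \<bar>f z\<bar>))" for x
  proof -
   have "(LINT y|lborel. \<bar>m y * f (x - y)\<bar>) \<le> (LINT y|lborel. B * \<bar>f (x - y)\<bar>)"
    using fr(1) mi[of x] by (intro integral_mono integrable_abs Bochner_Integration.integrable_mult_right)
     (auto simp: abs_mult intro!: mult_right_mono m(2))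
   then show ?thesis using fr(2)[of x] by (simp add: abs_mult[of "\<phi> x"] mult_left_mono)
  qed
  show "integrable lborel (%x. \<bar>\<phi> x\<bar> * (B * (LINT z|lborel. \<bar>f z\<bar>)))" using \<phi> by simp
 qed
 moreover have "(LINT x|lborel. \<phi> x * (m y * f (x - y))) = c * (m y * conv f \<phi> y)" for y
 proof -
  have "(LINT x|lborel. \<phi> x * (m y * f (x - y))) = (LINT x|lborel. (c * m y) * (f (y - x) * \<phi> x))"
   using f(2)[of "y - x" for x] by (intro Bochner_Integration.integral_cong refl) (simp add: mult_ac)
  then show ?thesis by (simp only: Bochner_Integration.integral_mult_right_zero mult.assoc)
 qed
 moreover have "(LINT y|lborel. \<phi> x * (m y * f (x - y))) = conv f m x * \<phi> x" for x
  unfolding Bochner_Integration.integral_mult_right_zero by (simp only: mult.commute)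
 ultimately show "pairing (conv f m) \<phi> = c * pairing m (conv f \<phi>)"
  by (simp only: Bochner_Integration.integral_mult_right_zero)
 have m1: "(%(x, y). f (y - x) * \<phi> x) \<in> borel_measurable (lborel \<Otimes>\<^sub>M lborel)" by measurable
 have i1: "integrable lborel (%y. f (y - x) * \<phi> x)" for x
  using fs(1) by simp
 have e1: "(LINT y|lborel. \<bar>f (y - x) * \<phi> x\<bar>) = (LINT z|lborel. \<bar>f z\<bar>) * \<bar>\<phi> x\<bar>" for x
  using fs(2)[of x] by (simp add: abs_mult)
 have gi: "integrable lborel (%x. (LINT z|lborel. \<bar>f z\<bar>) * \<bar>\<phi> x\<bar>)" using \<phi> by simp
 show i: "integrable lborel (conv f \<phi>)"
  by (rule integral_swap_bound(3)[OF sigma_finite_lborel sigma_finite_lborel m1 i1 _ gi]) (simp only: e1)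
 have m2: "(%(x, y). \<bar>f (y - x) * \<phi> x\<bar>) \<in> borel_measurable (lborel \<Otimes>\<^sub>M lborel)" by measurable
 have sw: "(LINT x|lborel. LINT y|lborel. \<bar>f (y - x) * \<phi> x\<bar>) = (LINT y|lborel. LINT x|lborel. \<bar>f (y - x) * \<phi> x\<bar>)"
  "integrable lborel (%y. LINT x|lborel. \<bar>f (y - x) * \<phi> x\<bar>)"
  by (rule integral_swap_bound[OF sigma_finite_lborel sigma_finite_lborel m2 integrable_abs[OF i1] _ gi], simp only: abs_abs e1)+
 have "(LINT y|lborel. \<bar>conv f \<phi> y\<bar>) \<le> (LINT y|lborel. LINT x|lborel. \<bar>f (y - x) * \<phi> x\<bar>)"
 proof (rule integral_mono[OF integrable_abs[OF i] sw(2)])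
  show "\<bar>conv f \<phi> y\<bar> \<le> (LINT x|lborel. \<bar>f (y - x) * \<phi> x\<bar>)" for y
   using integral_norm_bound[of lborel "%x. f (y - x) * \<phi> x"] by simp
 qed
 also have "\<dots> = (LINT z|lborel. \<bar>f z\<bar>) * (LINT y|lborel. \<bar>\<phi> y\<bar>)" unfolding sw(1)[symmetric] e1 by simp
 finally show "(LINT y|lborel. \<bar>conv f \<phi> y\<bar>) \<le> (LINT z|lborel. \<bar>f z\<bar>) * (LINT y|lborel. \<bar>\<phi> y\<bar>)" .
qed

lemma gk_conv_L1:
 fixes \<phi> :: "'a::euclidean_space \<Rightarrow> real"
 assumes s: "s > 0" and \<phi>: "integrable lborel \<phi>"
 shows "integrable lborel (conv (gk s) \<phi>)" "(LINT y|lborel. \<bar>conv (gk s) \<phi> y\<bar>) \<le> (LINT y|lborel. \<bar>\<phi> y\<bar>)"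
 using conv_adjoint(2,3)[OF gk_integral(1)[OF s], where c=1 and m="%_. 0" and B=0 and \<phi>=\<phi>] \<phi> gk_integral(2)[OF s, where 'a='a]
 by (auto simp: gk_minus gk_nonneg)

lemma pairing_duhamel:
 fixes m \<psi> :: "real^'n \<Rightarrow> real"
 assumes m: "m \<in> borel_measurable borel" "!!y. \<bar>m y\<bar> \<le> B" and \<psi>: "Cc (Suc (Suc 0)) \<psi>" and t: "t > 0"
 shows "pairing m (conv (gk t) \<psi>) = pairing m \<psi> + (LINT r|lon {0<..<t}. pairing m (conv (gk r) (lap \<psi>)))"
  and "integrable (lon {0<..<t}) (%r. pairing m (conv (gk r) (lap \<psi>)))"
proof -
 note [measurable] = m(1)
 note li = Cc_integrable[OF Cc_lap[OF \<psi>]]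
 have lm: "lap \<psi> \<in> borel_measurable borel" by (rule Cc_measurable[OF Cc_lap[OF \<psi>]])
 let ?f = "%r y. m y * conv (gk r) (lap \<psi>) y"
 have m1: "(%(r, y). ?f r y) \<in> borel_measurable (lon {0<..<t} \<Otimes>\<^sub>M lborel)"
  by (rule lon_measurable_pair(1)) (unfold case_prod_beta', intro borel_measurable_times gk_conv_measurable lm, measurable)
 have i1: "integrable lborel (?f r)" if "r \<in> space (lon {0<..<t})" for r
  by (rule bounded_mult_integrable(1)[OF _ m(2) gk_conv_L1(1)[OF _ li]]) (use that in auto)
 have b1: "(LINT y|lborel. \<bar>?f r y\<bar>) \<le> B * (LINT y|lborel. \<bar>lap \<psi> y\<bar>)" if "r \<in> space (lon {0<..<t})" for r
 proof -
  have r: "r > 0" using that by simp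
  have "\<bar>LINT y|lborel. \<bar>m y\<bar> * \<bar>conv (gk r) (lap \<psi>) y\<bar>\<bar> \<le> B * (LINT y|lborel. \<bar>\<bar>conv (gk r) (lap \<psi>) y\<bar>\<bar>)"
   by (rule bounded_mult_integrable(2)) (use m gk_conv_L1(1)[OF r li] in auto)
  also have "\<dots> \<le> B * (LINT y|lborel. \<bar>lap \<psi> y\<bar>)"
   using gk_conv_L1(2)[OF r li] order_trans[OF abs_ge_zero m(2)] by (intro mult_left_mono) auto
  finally show ?thesis by (simp add: abs_mult)
 qed
 note sw = integral_swap_bound[OF sigma_finite_lon sigma_finite_lborel m1 i1 b1 lon_const(1)[OF t]]
 show "integrable (lon {0<..<t}) (%r. pairing m (conv (gk r) (lap \<psi>)))" using sw(2) by simp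
 have e: "m y * conv (gk t) \<psi> y = m y * \<psi> y + (LINT r|lon {0<..<t}. ?f r y)" for y
  unfolding gk_conv_duhamel[OF t \<psi>] by (simp add: distrib_left)
 have "integrable lborel (%y. m y * \<psi> y)"
  by (rule bounded_mult_integrable(1)[OF _ m(2) Cc_integrable[OF \<psi>]]) simp
 then show "pairing m (conv (gk t) \<psi>) = pairing m \<psi> + (LINT r|lon {0<..<t}. pairing m (conv (gk r) (lap \<psi>)))"
  unfolding e using sw(1,3) by simp
qed

text \<open>The change of variables \<open>\<sigma> = s + r\<close> in a Duhamel integral.\<close>

lemma triangle_integral:
 fixes Y :: "real \<Rightarrow> real \<Rightarrow> real"
 assumes t: "t > 0" and Y: "(%(s, r). Y s r) \<in> borel_measurable (borel \<Otimes>\<^sub>M borel)"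
  and b: "!!s r. s \<in> {0<..<t} ==> r > 0 ==> \<bar>Y s r\<bar> \<le> g s" and g: "integrable (lon {0<..<t}) g"
 shows "(LINT s|lon {0<..<t}. LINT r|lon {0<..<t - s}. Y s r) = (LINT \<sigma>|lon {0<..<t}. LINT s|lon {0<..<\<sigma>}. Y s (\<sigma> - s))"
  and "integrable (lon {0<..<t}) (%s. LINT r|lon {0<..<t - s}. Y s r)"
  and "integrable (lon {0<..<t}) (%\<sigma>. LINT s|lon {0<..<\<sigma>}. Y s (\<sigma> - s))"
proof -
 \<comment> \<open>The triangle s < \<open>\<sigma>\<close> is encoded by an indicator, so that the
   interchange takes place on a square.\<close>
 let ?F = "%s \<sigma>. indicator {w. fst w < snd w} (s, \<sigma>) * Y s (\<sigma> - s)"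
 have Ym: "(%q. Y (f q) (h q)) \<in> borel_measurable N" if "f \<in> borel_measurable N" "h \<in> borel_measurable N" for f h :: "'c \<Rightarrow> real" and N
  using measurable_compose[OF _ Y, of "%q. (f q, h q)" N] that by auto
 have [measurable]: "(%q. Y (fst q) (snd q - fst q)) \<in> borel_measurable (borel \<Otimes>\<^sub>M borel)"
  by (rule Ym) auto
 have m0: "(%q. ?F (fst q) (snd q)) \<in> borel_measurable (borel \<Otimes>\<^sub>M borel)"
  unfolding prod.collapse
 proof (intro borel_measurable_times borel_measurable_indicator)
  show "{w. fst w < snd w} \<in> sets (borel \<Otimes>\<^sub>M (borel :: real measure))"
   unfolding borel_prod by (intro borel_open open_Collect_less continuous_intros)
 qed (intro Ym; measurable)
 have m: "(%(s, \<sigma>). ?F s \<sigma>) \<in> borel_measurable (lon {0<..<t} \<Otimes>\<^sub>M lon {0<..<t})"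
  by (rule lon_measurable_pair(3)) (use m0 in \<open>simp add: case_prod_beta'\<close>)
 have bF: "\<bar>?F s \<sigma>\<bar> \<le> g s" if "s \<in> {0<..<t}" for s \<sigma>
  using b[OF that, of "\<sigma> - s"] b[OF that, of 1] by (auto split: split_indicator)
 have mF: "?F s \<in> borel_measurable borel" for s
  using measurable_compose[OF _ m0, of "%\<sigma>. (s, \<sigma>)" borel] by simp
 note iF = lon_bounded_integrable[OF t mF bF]
 have bF': "(LINT \<sigma>|lon {0<..<t}. \<bar>?F s \<sigma>\<bar>) \<le> g s * t" if "s \<in> space (lon {0<..<t})" for s
 proof -
  have "\<bar>LINT \<sigma>|lon {0<..<t}. \<bar>?F s \<sigma>\<bar>\<bar> \<le> g s * t"
   using that by (intro lon_bounded_integrable(2)[OF t]) (auto intro!: borel_measurable_abs mF simp del: abs_mult simp: bF)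
  then show ?thesis by simp
 qed
 note sw = integral_swap_bound[OF sigma_finite_lon sigma_finite_lon m _ bF' Bochner_Integration.integrable_mult_left[OF g]]
 have 1: "(LINT \<sigma>|lon {0<..<t}. ?F s \<sigma>) = (LINT r|lon {0<..<t - s}. Y s r)" if s: "s \<in> {0<..<t}" for s
 proof -
  have "(LINT \<sigma>|lon {0<..<t}. ?F s \<sigma>) = (LINT \<sigma>|lborel. indicator {0<..<t - s} (\<sigma> + - s) *\<^sub>R Y s (\<sigma> + - s))"
   unfolding lon_integral[OF borel_open[OF open_greaterThanLessThan]] set_lebesgue_integral_def
   using s by (intro Bochner_Integration.integral_cong refl) (auto split: split_indicator)
  also have "\<dots> = (LINT \<sigma>|lborel. indicator {0<..<t - s} \<sigma> *\<^sub>R Y s \<sigma>)"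
   by (rule lborel_shift(2)) (intro borel_measurable_scaleR borel_measurable_indicator Ym, auto)
  finally show ?thesis unfolding lon_integral[OF borel_open[OF open_greaterThanLessThan]] set_lebesgue_integral_def .
 qed
 have 2: "(LINT s|lon {0<..<t}. ?F s \<sigma>) = (LINT s|lon {0<..<\<sigma>}. Y s (\<sigma> - s))" if s: "\<sigma> \<in> {0<..<t}" for \<sigma>
  unfolding lon_integral[OF borel_open[OF open_greaterThanLessThan]] set_lebesgue_integral_def
  using s by (intro Bochner_Integration.integral_cong refl) (auto split: split_indicator)
 have sw': "(LINT s|lon {0<..<t}. LINT \<sigma>|lon {0<..<t}. ?F s \<sigma>) = (LINT \<sigma>|lon {0<..<t}. LINT s|lon {0<..<t}. ?F s \<sigma>)"
  "integrable (lon {0<..<t}) (%s. LINT \<sigma>|lon {0<..<t}. ?F s \<sigma>)" "integrable (lon {0<..<t}) (%\<sigma>. LINT s|lon {0<..<t}. ?F s \<sigma>)"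
  by (rule sw; use iF(1) in auto)+
 show "(LINT s|lon {0<..<t}. LINT r|lon {0<..<t - s}. Y s r) = (LINT \<sigma>|lon {0<..<t}. LINT s|lon {0<..<\<sigma>}. Y s (\<sigma> - s))"
 proof -
  have "(LINT s|lon {0<..<t}. LINT r|lon {0<..<t - s}. Y s r) = (LINT s|lon {0<..<t}. LINT \<sigma>|lon {0<..<t}. ?F s \<sigma>)"
   by (rule Bochner_Integration.integral_cong[OF refl]) (simp add: 1)
  also have "\<dots> = (LINT \<sigma>|lon {0<..<t}. LINT s|lon {0<..<\<sigma>}. Y s (\<sigma> - s))"
   unfolding sw'(1) by (rule Bochner_Integration.integral_cong[OF refl]) (simp add: 2)
  finally show ?thesis .
 qed
 show "integrable (lon {0<..<t}) (%s. LINT r|lon {0<..<t - s}. Y s r)"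
  by (rule Bochner_Integration.integrable_cong[OF refl, THEN iffD1, OF _ sw'(2)]) (simp add: 1)
 show "integrable (lon {0<..<t}) (%\<sigma>. LINT s|lon {0<..<\<sigma>}. Y s (\<sigma> - s))"
  by (rule Bochner_Integration.integrable_cong[OF refl, THEN iffD1, OF _ sw'(3)]) (simp add: 2)
qed

context mild_ns
begin

text \<open>Minus the pairing of \<open>duh\<close> with \<open>\<phi>\<close>; the sign comes from
  the oddness of the first derivatives of the heat kernel.\<close>

definition duh_pairing :: "'n \<Rightarrow> (real^'n \<Rightarrow> real) \<Rightarrow> real \<Rightarrow> real \<Rightarrow> real" where
 "duh_pairing j \<phi> s \<tau> = (\<Sum>k\<in>UNIV. pairing (momentum j k s) (conv (gk1 (axis k 1) \<tau>) \<phi>))"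

lemma duh_pairing_eq:
 assumes \<tau>: "\<tau> > 0" and s: "s \<in> {0<..T}" and \<phi>: "Cc 0 \<phi>"
 shows "pairing (duh j \<tau> s) \<phi> = - duh_pairing j \<phi> s \<tau>"
proof -
 from momentum_bound obtain C where C: "!!j k t x. t \<in> {0<..T} ==> \<bar>momentum j k t x\<bar> \<le> C * t powr (- (1/4))" by metis
 note ki = gkernel_integrable(1)[OF gkernel_gk1 \<tau>]
 have o: "gk1 c \<tau> (- z) = - 1 * gk1 c \<tau> z" for c z :: "real^'n" by (simp add: gk1_def gk_minus)
 have mm: "momentum j k s \<in> borel_measurable borel" for k by measurable
 note adj = conv_adjoint(1)[OF ki o mm C[OF s] Cc_integrable[OF \<phi>]]
 have i: "integrable lborel (%x. conv (gk1 (axis k 1) \<tau>) (momentum j k s) x * \<phi> x)" for k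
 proof -
  from gkernelE[OF gkernel_gk1[of "axis k 1 :: real^'n"]] obtain A where
   "!!s z. s > 0 ==> \<bar>gk1 (axis k 1 :: real^'n) s z\<bar> \<le> A * s powr (- (real 1 / 2)) * gk (2 * s) z" by metis
  note bd = conv_L1_bound[OF gkernel_gk1 \<tau> C[OF s] mm this]
  show ?thesis
   by (rule bounded_mult_integrable(1)[OF _ bd Cc_integrable[OF \<phi>]])
    (use gk_conv_measurable(2)[of "momentum j k s" "%_. \<tau>" borel "%x. x" "axis k 1"] mm in simp)
 qed
 show ?thesis
  unfolding duh_momentum[OF \<tau> s] duh_pairing_def sum_distrib_right Bochner_Integration.integral_sum[OF i] adj
  by (simp add: sum_negf)
qed

text \<open>Here \<open>\<psi> k\<close> stands for a further k-th derivative of the test function.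
  Once the derivative is moved off the kernel, the singularity \<open>\<tau>\<close>^{-1/2} is gone
  and only s^{-1/4} from the bound on the momentum flux remains, which is integrable in s.\<close>

lemma duh_pairing_bound:
 assumes \<phi>: "integrable lborel \<phi>"
  and \<psi>: "!!k \<tau> x. \<tau> > 0 ==> conv (gk1 (axis k 1) \<tau>) \<phi> x = conv (gk \<tau>) (\<psi> k) x" "!!k. integrable lborel (\<psi> k)"
 obtains C where "C > 0" "!!j s \<tau>. s \<in> {0<..T} ==> \<tau> > 0 ==> \<bar>duh_pairing j \<phi> s \<tau>\<bar> \<le> C * s powr (- (1/4))"
proof -
 from momentum_bound obtain C where C: "C > 0" "!!j k t x. t \<in> {0<..T} ==> \<bar>momentum j k t x\<bar> \<le> C * t powr (- (1/4))" by metis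
 define D where "D = C * (\<Sum>k\<in>UNIV. LINT y|lborel. \<bar>\<psi> k y\<bar>) + 1"
 have "\<bar>duh_pairing j \<phi> s \<tau>\<bar> \<le> D * s powr (- (1/4))" if s: "s \<in> {0<..T}" and \<tau>: "\<tau> > 0" for j s \<tau>
 proof -
  have "\<bar>duh_pairing j \<phi> s \<tau>\<bar> \<le> (\<Sum>k\<in>UNIV. C * s powr (- (1/4)) * (LINT y|lborel. \<bar>\<psi> k y\<bar>))"
   unfolding duh_pairing_def
  proof (intro order_trans[OF sum_abs] sum_mono)
   fix k
   have "\<bar>pairing (momentum j k s) (conv (gk1 (axis k 1) \<tau>) \<phi>)\<bar> \<le> C * s powr (- (1/4)) * (LINT y|lborel. \<bar>conv (gk \<tau>) (\<psi> k) y\<bar>)"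
    unfolding \<psi>(1)[OF \<tau>] by (rule bounded_mult_integrable(2)[OF _ C(2)[OF s] gk_conv_L1(1)[OF \<tau> \<psi>(2)]]) measurable
   also have "\<dots> \<le> C * s powr (- (1/4)) * (LINT y|lborel. \<bar>\<psi> k y\<bar>)"
    using C(1) by (intro mult_left_mono gk_conv_L1(2)[OF \<tau> \<psi>(2)]) auto
   finally show "\<bar>pairing (momentum j k s) (conv (gk1 (axis k 1) \<tau>) \<phi>)\<bar> \<le> C * s powr (- (1/4)) * (LINT y|lborel. \<bar>\<psi> k y\<bar>)" .
  qed
  also have "\<dots> \<le> D * s powr (- (1/4))"
   unfolding D_def sum_distrib_left[symmetric] by (simp add: algebra_simps)
  finally show ?thesis .
 qed
 moreover have "D > 0" unfolding D_def using C(1) by (intro add_nonneg_pos mult_nonneg_nonneg sum_nonneg integral_nonneg_AE) auto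
 ultimately show ?thesis using that by blast
qed

lemma duh_pairing_measurable:
 assumes [measurable]: "\<phi> \<in> borel_measurable borel" "f \<in> borel_measurable N" "g \<in> borel_measurable N"
 shows "(%w. duh_pairing j \<phi> (f w) (g w)) \<in> borel_measurable N"
proof -
 have "(%(w, y). momentum j k (f w) y * conv (gk1 (axis k 1) (g w)) \<phi> y) \<in> borel_measurable (N \<Otimes>\<^sub>M lborel)" for k
  unfolding case_prod_beta' by (intro borel_measurable_times gk_conv_measurable momentum_measurable; measurable)
 then show ?thesis unfolding duh_pairing_def
  by (intro borel_measurable_sum lborel.borel_measurable_lebesgue_integral)
qed

text \<open>The weak Duhamel formula: tested against \<open>\<phi>\<close>, the mild solution satisfies the momentum
 equation integrated in time.\<close>

lemma weak_momentum:
 assumes t: "t \<in> {0<..T}" and b: "b \<in> borel_measurable borel" "!!y. \<bar>b y\<bar> \<le> M"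
  and hb: "!!t x. t > 0 ==> heat t a x $ j = conv (gk t) b x"
  and \<phi>: "Cc (Suc (Suc (Suc 0))) \<phi>"
 shows "pairing (%x. u t x $ j) \<phi> = pairing b \<phi>
  + (LINT \<sigma>|lon {0<..<t}. pairing (%x. u \<sigma> x $ j) (lap \<phi>))
  + (LINT s|lon {0<..<t}. (\<Sum>k\<in>UNIV. pairing (momentum j k s) (pderiv_at k \<phi>)))"
proof -
 have t0: "t > 0" using t by simp
 note [measurable] = b(1)
 \<comment> \<open>The mild formula tested with \<open>\<phi>\<close>. It is stated for continuous
   test functions because it is used twice: for the given function, and at the end for its
   Laplacian.\<close>
 have w1: "pairing (%x. u t x $ j) \<phi> = pairing b (conv (gk t) \<phi>) + (LINT s|lon {0<..<t}. duh_pairing j \<phi> s (t - s))"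
  if t: "t \<in> {0<..T}" and \<phi>: "Cc 0 \<phi>" for t \<phi>
 proof -
  have t0: "t > 0" using t by simp
  note pi = Cc_integrable[OF \<phi>] and [measurable] = Cc_measurable[OF \<phi>]
  have hi: "integrable lborel (%x. conv (gk t) b x * \<phi> x)"
   by (rule bounded_mult_integrable(1)[OF _ gk_conv_bound[OF t0 b(2,1)] pi])
    (use gk_conv_measurable(1)[OF b(1), of "%_. t" borel "%x. x"] in simp)
  from duh_bound obtain C where C: "C > 0" "!!j \<tau> s x. \<tau> > 0 ==> \<bar>duh j \<tau> s x\<bar> \<le> C * \<tau> powr (- (1/2))" by metis
  let ?d = "%s x. \<Sum>k\<in>UNIV. conv (gk1 (axis k 1) (t - s)) (momentum j k s) x"
  let ?f = "%s x. ?d s x * \<phi> x"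
  have dd: "?d s x = duh j (t - s) s x" if "s \<in> {0<..<t}" for s x
   using duh_momentum[of "t - s" s j x] that t by simp
  have dm: "(%q. ?d (fst q) (snd q)) \<in> borel_measurable (borel \<Otimes>\<^sub>M borel)"
  proof (intro borel_measurable_sum)
   fix k
   have "(%(q, y). gk1 (axis k 1) (t - fst q) (snd q - y) * momentum j k (fst q) y) \<in> borel_measurable ((borel \<Otimes>\<^sub>M borel) \<Otimes>\<^sub>M lborel)"
    unfolding case_prod_beta' by measurable
   then show "(%q. conv (gk1 (axis k 1) (t - fst q)) (momentum j k (fst q)) (snd q)) \<in> borel_measurable (borel \<Otimes>\<^sub>M borel)"
    by (rule lborel.borel_measurable_lebesgue_integral)
  qed
  have m: "(%(s, x). ?f s x) \<in> borel_measurable (lon {0<..<t} \<Otimes>\<^sub>M lborel)"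
   by (rule lon_measurable_pair(1)) (unfold case_prod_beta', intro borel_measurable_times dm, measurable)
  have mx: "?d s \<in> borel_measurable borel" for s
   using measurable_compose[OF measurable_Pair1'[of s borel borel] dm] by (simp only: fst_conv snd_conv space_borel UNIV_I simp_thms)
  have i: "integrable lborel (?f s)" "(LINT x|lborel. \<bar>?f s x\<bar>) \<le> C * (LINT y|lborel. \<bar>\<phi> y\<bar>) * (t - s) powr (- (1/2))"
   if "s \<in> space (lon {0<..<t})" for s
  proof -
   have "t - s > 0" using that by simp
   then have B: "\<bar>?d s x\<bar> \<le> C * (t - s) powr (- (1/2))" for x using C(2) that dd[of s x] by simp
   show "integrable lborel (?f s)" by (rule bounded_mult_integrable(1)[OF _ B pi]) (use mx in simp)
   have "\<bar>LINT x|lborel. \<bar>?d s x\<bar> * \<bar>\<phi> x\<bar>\<bar> \<le> C * (t - s) powr (- (1/2)) * (LINT x|lborel. \<bar>\<bar>\<phi> x\<bar>\<bar>)"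
    by (rule bounded_mult_integrable(2)) (use B mx pi in auto)
   then show "(LINT x|lborel. \<bar>?f s x\<bar>) \<le> C * (LINT y|lborel. \<bar>\<phi> y\<bar>) * (t - s) powr (- (1/2))"
    by (simp add: abs_mult mult_ac)
  qed
  have g: "integrable (lon {0<..<t}) (%s. C * (LINT y|lborel. \<bar>\<phi> y\<bar>) * (t - s) powr (- (1/2)))"
   using powr_integral_open(3)[of "1/2" t] t0 by simp
  note sw = integral_swap_bound[OF sigma_finite_lon sigma_finite_lborel m i g]
  have ux: "u t x $ j * \<phi> x = conv (gk t) b x * \<phi> x - (LINT s|lon {0<..<t}. ?f s x)" for x
  proof -
   have "(LINT s|lon {0<..<t}. duh j (t - s) s x) = (LINT s|lon {0<..<t}. ?d s x)"
    by (intro Bochner_Integration.integral_cong refl dd[symmetric]) simp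
   then show ?thesis
    unfolding mild_component[OF t] hb[OF t0] by (simp add: left_diff_distrib)
  qed
  have "pairing (%x. u t x $ j) \<phi> = pairing (conv (gk t) b) \<phi> - (LINT s|lon {0<..<t}. LINT x|lborel. ?f s x)"
   unfolding ux using hi sw(1,3) by simp
  also have "(LINT s|lon {0<..<t}. LINT x|lborel. ?f s x) = (LINT s|lon {0<..<t}. - duh_pairing j \<phi> s (t - s))"
  proof (intro Bochner_Integration.integral_cong refl)
   fix s assume "s \<in> space (lon {0<..<t})"
   then have s: "s \<in> {0<..<t}" "t - s > 0" "s \<in> {0<..T}" using t by auto
   show "(LINT x|lborel. ?f s x) = - duh_pairing j \<phi> s (t - s)"
    unfolding dd[OF s(1)] by (rule duh_pairing_eq[OF s(2,3) \<phi>])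
  qed
  also have "pairing (conv (gk t) b) \<phi> = pairing b (conv (gk t) \<phi>)"
   using conv_adjoint(1)[OF gk_integral(1)[OF t0], where c=1 and m=b and B=M and \<phi>=\<phi>] b pi by (simp add: gk_minus)
  finally show ?thesis by simp
 qed
 note p3 = Cc_pderiv[OF \<phi>]
 have lp: "conv (gk \<tau>) (lap (pderiv_at k \<phi>)) x = conv (gk1 (axis k 1) \<tau>) (lap \<phi>) x" if "\<tau> > 0" for k \<tau> x
  by (rule gk1_conv_lap[OF that \<phi>])
 have gp: "conv (gk \<tau>) (pderiv_at k \<phi>) x = conv (gk1 (axis k 1) \<tau>) \<phi> x" if "\<tau> > 0" for k \<tau> x
  by (rule gkernel_conv_pderiv[OF gkernel_gk that \<phi> gk_continuous(1)[OF that]])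
 from momentum_bound obtain C where C: "!!j k t x. t \<in> {0<..T} ==> \<bar>momentum j k t x\<bar> \<le> C * t powr (- (1/4))" by metis
 let ?Y0 = "%s. \<Sum>k\<in>UNIV. pairing (momentum j k s) (pderiv_at k \<phi>)"
 note \<phi>2 = Cc_Suc[OF \<phi>]
 note \<phi>l = Cc_lap[OF \<phi>2]
 \<comment> \<open>Duhamel's formula for the heat flow of the test function: to zeroth order the
   flux is paired with the gradient of \<open>\<phi>\<close>, and the correction has the same
   structure with \<open>lap \<phi>\<close> in place of \<open>\<phi>\<close>.\<close>
 have Yd: "duh_pairing j \<phi> s \<tau> = ?Y0 s + (LINT r|lon {0<..<\<tau>}. duh_pairing j (lap \<phi>) s r)" if s: "s \<in> {0<..T}" and \<tau>: "\<tau> > 0" for s \<tau>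
 proof -
  note pd = pairing_duhamel[OF _ C[OF s] p3 \<tau>]
  have mm: "momentum j k s \<in> borel_measurable borel" for k by measurable
  have "duh_pairing j \<phi> s \<tau> = (\<Sum>k\<in>UNIV. pairing (momentum j k s) (pderiv_at k \<phi>)
    + (LINT r|lon {0<..<\<tau>}. pairing (momentum j k s) (conv (gk r) (lap (pderiv_at k \<phi>)))))"
   unfolding duh_pairing_def gp[OF \<tau>, symmetric] by (intro sum.cong refl pd(1) mm)
  also have "\<dots> = ?Y0 s + (LINT r|lon {0<..<\<tau>}. (\<Sum>k\<in>UNIV. pairing (momentum j k s) (conv (gk r) (lap (pderiv_at k \<phi>)))))"
   unfolding sum.distrib by (subst Bochner_Integration.integral_sum) (auto intro: pd(2) mm)
  also have "(LINT r|lon {0<..<\<tau>}. (\<Sum>k\<in>UNIV. pairing (momentum j k s) (conv (gk r) (lap (pderiv_at k \<phi>))))) = (LINT r|lon {0<..<\<tau>}. duh_pairing j (lap \<phi>) s r)"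
   unfolding duh_pairing_def by (intro Bochner_Integration.integral_cong refl sum.cong) (simp add: lp)
  finally show ?thesis .
 qed
 from duh_pairing_bound[OF Cc_integrable[OF \<phi>l] lp[symmetric] Cc_integrable[OF Cc_lap[OF p3]]] obtain D where
  D: "D > 0" "!!j s \<tau>. s \<in> {0<..T} ==> \<tau> > 0 ==> \<bar>duh_pairing j (lap \<phi>) s \<tau>\<bar> \<le> D * s powr (- (1/4))" by metis
 have si: "integrable (lon {0<..<t}) (%s. K * s powr (- (1/4)))" for K
  using powr_integral_open(1)[of "1/4" t] t0 by simp
 \<comment> \<open>In the variable \<open>\<sigma>\<close> = s + r the inner integral becomes the
   Duhamel term at time \<open>\<sigma>\<close>, tested with \<open>lap \<phi>\<close>.\<close>
 have tri: "(LINT s|lon {0<..<t}. LINT r|lon {0<..<t - s}. duh_pairing j (lap \<phi>) s r) = (LINT \<sigma>|lon {0<..<t}. LINT s|lon {0<..<\<sigma>}. duh_pairing j (lap \<phi>) s (\<sigma> - s))"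
  "integrable (lon {0<..<t}) (%s. LINT r|lon {0<..<t - s}. duh_pairing j (lap \<phi>) s r)"
  "integrable (lon {0<..<t}) (%\<sigma>. LINT s|lon {0<..<\<sigma>}. duh_pairing j (lap \<phi>) s (\<sigma> - s))"
  by (rule triangle_integral[OF t0 _ _ si, of _ D];
    use t D(2) in \<open>auto simp: case_prod_beta' intro!: duh_pairing_measurable Cc_measurable[OF \<phi>l]\<close>)+
 from duh_pairing_bound[OF Cc_integrable[OF \<phi>] gp[symmetric] Cc_integrable[OF p3]] obtain E where
  E: "E > 0" "!!j s \<tau>. s \<in> {0<..T} ==> \<tau> > 0 ==> \<bar>duh_pairing j \<phi> s \<tau>\<bar> \<le> E * s powr (- (1/4))" by metis
 have Yi: "integrable (lon {0<..<t}) (%s. duh_pairing j \<phi> s (t - s))"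
  by (rule Bochner_Integration.integrable_bound[OF si[of E]])
   (use t in \<open>auto intro!: AE_I2 lon_measurable duh_pairing_measurable Cc_measurable[OF \<phi>] order_trans[OF E(2) abs_ge_self]\<close>)
 have Y0i: "integrable (lon {0<..<t}) ?Y0"
  by (rule Bochner_Integration.integrable_cong[OF refl, THEN iffD1, OF _ Bochner_Integration.integrable_diff[OF Yi tri(2)]])
   (use t in \<open>auto simp: Yd\<close>)
 have Ys: "(LINT s|lon {0<..<t}. duh_pairing j \<phi> s (t - s)) = (LINT s|lon {0<..<t}. ?Y0 s + (LINT r|lon {0<..<t - s}. duh_pairing j (lap \<phi>) s r))"
  by (intro Bochner_Integration.integral_cong refl Yd) (use t in auto)
 note pb = pairing_duhamel[OF b \<phi>2 t0]
 have "pairing (%x. u t x $ j) \<phi> = pairing b \<phi> + ((LINT r|lon {0<..<t}. pairing b (conv (gk r) (lap \<phi>)))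
   + (LINT \<sigma>|lon {0<..<t}. LINT s|lon {0<..<\<sigma>}. duh_pairing j (lap \<phi>) s (\<sigma> - s))) + (LINT s|lon {0<..<t}. ?Y0 s)"
  unfolding w1[OF t Cc_imp_0[OF \<phi>]] pb(1) Ys using Y0i tri(1,2) by simp
 \<comment> \<open>Together with the heat extension of the datum, \<open>w1\<close> at time
   \<open>\<sigma>\<close> for the test function \<open>lap \<phi>\<close> reassembles the
   velocity.\<close>
 also have "(LINT r|lon {0<..<t}. pairing b (conv (gk r) (lap \<phi>)))
   + (LINT \<sigma>|lon {0<..<t}. LINT s|lon {0<..<\<sigma>}. duh_pairing j (lap \<phi>) s (\<sigma> - s))
  = (LINT \<sigma>|lon {0<..<t}. pairing (%x. u \<sigma> x $ j) (lap \<phi>))"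
  unfolding Bochner_Integration.integral_add[OF pb(2) tri(3), symmetric]
  by (intro Bochner_Integration.integral_cong refl w1[OF _ \<phi>l, symmetric]) (use t in auto)
 finally show ?thesis .
qed

end

section \<open>Differentiating the tested equation in time\<close>

lemma Ck_on_slice:
 assumes "t \<in> S" "Ck_on k (S \<times> UNIV) (%(t, x). f t x)"
 shows "Ck_on k UNIV (f t)"
proof -
 have "Ck_on k (S \<times> UNIV) g ==> Ck_on k UNIV (%x. g (t, x))" for g :: "_ \<times> _ \<Rightarrow> 'c::real_normed_vector"
 proof (induction k arbitrary: g)
  case 0
  then have c: "continuous_on (S \<times> UNIV) g" by simp
  show ?case unfolding Ck_on.simps
   by (rule continuous_on_compose2[OF c]) (use assms(1) in \<open>auto intro!: continuous_on_Pair continuous_on_const continuous_on_id\<close>)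
 next
  case (Suc k)
  then obtain g' where g: "!!z. z \<in> S \<times> UNIV ==> (g has_derivative g' z) (at z within S \<times> UNIV)"
   "!!v. Ck_on k (S \<times> UNIV) (%z. g' z v)" by auto
  have "((%x. g (t, x)) has_derivative (%v. g' (t, x) (0, v))) (at x)" for x
  proof -
   have 1: "((%x. (t, x)) has_derivative (%v. (0, v))) (at x)" by (auto intro!: derivative_eq_intros)
   have "(g has_derivative g' (t, x)) (at (t, x) within range (%x. (t, x)))"
    by (rule has_derivative_subset[OF g(1)]) (use assms(1) in auto)
   from has_derivative_in_compose[OF 1 this] show ?thesis .
  qed
  then show ?case using Suc.IH[OF g(2)] by (auto intro!: exI[of _ "%x v. g' (t, x) (0, v)"])
 qed
 from this[OF assms(2)] show ?thesis by simp
qed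

lemma Ck_on_component: "Ck_on k S (f :: 'a::real_normed_vector \<Rightarrow> real^'n) ==> Ck_on k S (%x. f x $ j)"
proof (induction k arbitrary: f)
 case 0
 then show ?case by (auto intro: continuous_intros)
next
 case (Suc k)
 then obtain f' where f: "!!x. x \<in> S ==> (f has_derivative f' x) (at x within S)" "!!v. Ck_on k S (%x. f' x v)" by auto
 show ?case using bounded_linear.has_derivative[OF bounded_linear_vec_nth f(1)] Suc.IH[OF f(2)]
  by (auto intro!: exI[of _ "%x v. f' x v $ j"])
qed

lemma Ck_on_pderiv:
 assumes "Ck_on (Suc k) UNIV f"
 shows "f differentiable at x" "Ck_on k UNIV (pderiv_at i f)"
proof -
 from assms obtain f' where f: "!!x. (f has_derivative f' x) (at x)" "!!v. Ck_on k UNIV (%x. f' x v)" by auto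
 show "f differentiable at x" using f(1) by (rule differentiableI)
 have "pderiv_at i f = (%x. f' x (axis i 1))" using pderiv_at_eq[OF f(1)] by auto
 then show "Ck_on k UNIV (pderiv_at i f)" using f(2) by simp
qed

lemma pderiv_at_component:
 fixes f :: "real^'n \<Rightarrow> real^'m"
 assumes "f differentiable at x"
 shows "pderiv_at i f x $ j = pderiv_at i (%y. f y $ j) x"
 using pderiv_at_eq[OF bounded_linear.has_derivative[OF bounded_linear_vec_nth assms[unfolded frechet_derivative_works]]]
 by (simp add: pderiv_at_def)

lemma Ck_on_mult:
 fixes f g :: "real^'n \<Rightarrow> real"
 assumes "Ck_on (Suc 0) UNIV f" "Ck_on (Suc 0) UNIV g"
 shows "Ck_on (Suc 0) UNIV (%x. f x * g x)"
proof -
 from assms obtain f' g' where f: "!!x. (f has_derivative f' x) (at x)" "!!v. continuous_on UNIV (%x. f' x v)"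
  and g: "!!x. (g has_derivative g' x) (at x)" "!!v. continuous_on UNIV (%x. g' x v)" by auto
 have "continuous_on UNIV f" "continuous_on UNIV g"
  using f(1) g(1) by (auto simp: continuous_on_eq_continuous_within intro: has_derivative_continuous)
 then show ?thesis using f g
  by (auto intro!: exI[of _ "%x v. f x * g' x v + f' x v * g x"] has_derivative_mult continuous_intros)
qed

lemma Ck_on_by_parts:
 assumes "Ck_on (Suc 0) UNIV w" "Cc (Suc m) \<psi>"
 shows "pairing (pderiv_at i w) \<psi> = - pairing w (pderiv_at i \<psi>)"
  "integrable lborel (%x. pderiv_at i w x * \<psi> x)" "integrable lborel (%x. w x * pderiv_at i \<psi> x)"
proof -
 have c: "continuous_on UNIV (%x. \<Sum>i\<in>UNIV. pderiv_at i w x * v $ i)" for v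
  using Ck_on_pderiv(2)[OF assms(1)] by (auto intro!: continuous_intros)
 note ip = integral_by_parts[OF pderiv_has_derivative[OF Ck_on_pderiv(1)[OF assms(1)]] c assms(2), of i]
 have "(\<Sum>l\<in>UNIV. pderiv_at l w x * axis i 1 $ l) = pderiv_at i w x" for x
  by (simp add: axis_def if_distrib sum.delta cong: if_cong)
 with ip show "pairing (pderiv_at i w) \<psi> = - pairing w (pderiv_at i \<psi>)"
  "integrable lborel (%x. pderiv_at i w x * \<psi> x)" "integrable lborel (%x. w x * pderiv_at i \<psi> x)"
  by simp_all
qed

lemma pairing_lap:
 assumes w: "Ck_on (Suc (Suc 0)) UNIV w" and \<psi>: "Cc (Suc (Suc 0)) \<psi>"
 shows "pairing (lap w) \<psi> = pairing w (lap \<psi>)" "integrable lborel (%x. lap w x * \<psi> x)"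
proof -
 have w1: "Ck_on (Suc 0) UNIV w"
  using w Ck_on_pderiv[OF w] by (auto simp: continuous_on_eq_continuous_within differentiable_imp_continuous_within)
   (metis has_derivative_continuous)
 note i1 = Ck_on_by_parts[OF Ck_on_pderiv(2)[OF w] \<psi>]
 note i2 = Ck_on_by_parts[OF w1 Cc_pderiv[OF \<psi>]]
 show "pairing (lap w) \<psi> = pairing w (lap \<psi>)"
  unfolding lap_def sum_distrib_right sum_distrib_left Bochner_Integration.integral_sum[OF i1(2)] Bochner_Integration.integral_sum[OF i2(3)]
  using i1(1) i2(1) by simp
 show "integrable lborel (%x. lap w x * \<psi> x)" unfolding lap_def sum_distrib_right using i1(2) by auto
qed

lemma laplacian_component:
 fixes v :: "real^'n \<Rightarrow> real^'n"
 assumes "Ck_on (Suc (Suc 0)) UNIV v"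
 shows "laplacian v x $ j = lap (%y. v y $ j) x"
proof -
 have "(%y. pderiv_at i v y $ j) = pderiv_at i (%y. v y $ j)" for i
  using pderiv_at_component[OF Ck_on_pderiv(1)[OF assms]] by auto
 then show ?thesis
  using pderiv_at_component[OF Ck_on_pderiv(1)[OF Ck_on_pderiv(2)[OF assms]]] by (simp add: laplacian_def lap_def)
qed

lemma lon_indefinite_integral:
 fixes F :: "real \<Rightarrow> real"
 assumes i: "integrable (lon {0<..<T}) F" and t: "t \<in> {0<..T}" and c: "continuous_on {0<..T} F"
 shows "((%t. LINT s|lon {0<..<t}. F s) has_vector_derivative F t) (at t within {0<..T})"
proof -
 have s: "set_integrable lborel {0<..<T} F" using i by (simp add: lon_integrable)
 have 0: "F integrable_on {0..T}"
  using set_borel_integral_eq_integral(1)[OF s] by (simp add: integrable_on_Icc_iff_Ioo)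
 have S: "{0..T} - {0} = {0<..T}" by auto
 have "((%t. integral {0..t} F) has_vector_derivative F t) (at t within {0..T} - {0})"
  by (rule integral_has_vector_derivative_continuous_at[OF 0])
   (use t c in \<open>auto simp: S continuous_on_eq_continuous_within\<close>)
 then have 1: "((%t. integral {0..t} F) has_vector_derivative F t) (at t within {0<..T})" unfolding S .
 have "integral {0..t} F = (LINT s|lon {0<..<t}. F s)" if "t \<in> {0<..T}" for t
 proof -
  have "set_integrable lborel {0<..<t} F" by (rule set_integrable_subset[OF s]) (use that in auto)
  from set_borel_integral_eq_integral(2)[OF this] show ?thesis
   by (simp add: lon_integral integral_open_interval_real)
 qed
 with t 1 show ?thesis by (intro has_vector_derivative_transform[OF _ _ 1]) auto
qed

lemma lon_continuous_integrable:
 fixes F :: "real \<Rightarrow> real"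
 assumes c: "continuous_on {0<..T} F" and b: "!!t. t \<in> {0<..T} ==> \<bar>F t\<bar> \<le> C * t powr (- a)" and a: "a < 1" and T: "T > 0"
 shows "integrable (lon {0<..<T}) F"
proof (rule Bochner_Integration.integrable_bound)
 show "integrable (lon {0<..<T}) (%t. C * t powr (- a))" using powr_integral_open(1)[OF a, of T] T by simp
 have "F \<in> borel_measurable (restrict_space borel {0<..<T})"
  by (rule borel_measurable_continuous_on_restrict[OF continuous_on_subset[OF c]]) auto
 then show "F \<in> borel_measurable (lon {0<..<T})"
  by (simp cong: measurable_cong_sets add: sets_restrict_space)
qed (auto intro!: AE_I2 order_trans[OF b abs_ge_self])

context mild_ns
begin

lemma u_component_continuous: "continuous_on {0<..T} (%t. u t x $ j)"
 by (intro continuous_intros continuous_on_compose2[OF cont, of "{0<..T}" "%t. (t, x)", simplified]) auto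

lemma u_slice_continuous: "t \<in> {0<..T} ==> continuous_on UNIV (u t)"
 using continuous_on_compose2[OF cont continuous_on_Pair[OF continuous_on_const continuous_on_id], of t UNIV] by (auto simp: image_subset_iff)

lemma stress_continuous_time: "continuous_on {0<..T} (%t. stress h k t x)"
 by (rule continuous_on_eq[of _ "%t. u t x $ h * u t x $ k"]) (auto simp: stress_def intro!: continuous_intros u_component_continuous)

text \<open>The interval stays away from 0 because the dominating function has the constant
  t1^{-1/4}, which degenerates there.\<close>

lemma prs_continuous_time:
 assumes "t1 > 0"
 shows "continuous_on {t1..T} (%t. prs t x)"
proof -
 from pconv_bound obtain C where C: "C > 0" "!!h k r t x. r > 0 ==> t \<in> {0<..T} ==> \<bar>pconv h k r t x\<bar> \<le> C * t powr (- (1/4)) * time_profile r" by metis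
 show ?thesis unfolding prs_def
 proof (intro continuous_on_sum continuous_on_lebesgue_integral)
  show "integrable (lon {0<..}) (%r. C * t1 powr (- (1/4)) * time_profile r)" using time_profile_integrable by simp
  show "(%r. pconv h k r t x) \<in> borel_measurable (lon {0<..})" for h k t by (rule lon_measurable) measurable
  fix h k r assume r: "r \<in> space (lon {0::real<..})"
  show "\<bar>pconv h k r t x\<bar> \<le> C * t1 powr (- (1/4)) * time_profile r" if "t \<in> {t1..T}" for t
  proof -
   have "\<bar>pconv h k r t x\<bar> \<le> C * t powr (- (1/4)) * time_profile r" using C(2) r that assms by auto
   also have "\<dots> \<le> C * t1 powr (- (1/4)) * time_profile r"
    using that assms C(1) by (intro mult_right_mono mult_left_mono powr_mono2') (auto simp: time_profile_nonneg)
   finally show ?thesis .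
  qed
  have r: "r > 0" using r by simp
  have "integrable lborel (%y. gk2 (axis h 1) (axis k 1) r (x - y))"
   using lborel_reflect(1)[of "gk2 (axis h 1) (axis k 1) r" x] gkernel_integrable(1)[OF gkernel_gk2 r] by simp
  then have i: "integrable lborel (%y. \<bar>gk2 (axis h 1) (axis k 1) r (x - y)\<bar> * M\<^sup>2)" by simp
  show "continuous_on {t1..T} (%t. pconv h k r t x)"
   unfolding pconv_def
   by (rule continuous_on_lebesgue_integral[OF _ _ _ i])
    (use assms in \<open>auto simp: abs_mult intro!: continuous_intros continuous_on_subset[OF stress_continuous_time] mult_left_mono stress_bound\<close>)
 qed
qed

lemma prs_continuous:
 assumes t: "t \<in> {0<..T}"
 shows "continuous_on UNIV (prs t)"
proof -
 from pconv_bound obtain C where C: "C > 0" "!!h k r t x. r > 0 ==> t \<in> {0<..T} ==> \<bar>pconv h k r t x\<bar> \<le> C * t powr (- (1/4)) * time_profile r" by metis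
 have "continuous_on UNIV (%x. prs t x)" unfolding prs_def
 proof (intro continuous_on_sum continuous_on_lebesgue_integral)
  show "integrable (lon {0<..}) (%r. C * t powr (- (1/4)) * time_profile r)" using time_profile_integrable by simp
  show "(%r. pconv h k r t x) \<in> borel_measurable (lon {0<..})" for h k x by (rule lon_measurable) measurable
  fix h k r assume "r \<in> space (lon {0::real<..})"
  then have r: "r > 0" by simp
  show "\<bar>pconv h k r t x\<bar> \<le> C * t powr (- (1/4)) * time_profile r" for x using C(2) r t by auto
  show "continuous_on UNIV (%x. pconv h k r t x)"
   unfolding pconv_def continuous_on_eq_continuous_within
   using gkernel_conv_has_derivative[OF gkernel_gk2 r stress_integrable(1)] has_derivative_continuous by blast
 qed
 then show ?thesis by simp
qed

lemma momentum_pairing_continuous: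
 assumes g: "integrable lborel g"
 shows "continuous_on {0<..T} (%t. pairing (momentum j k t) g)"
proof -
 from momentum_bound obtain C where C: "C > 0" "!!j k t x. t \<in> {0<..T} ==> \<bar>momentum j k t x\<bar> \<le> C * t powr (- (1/4))" by metis
 note [measurable] = borel_measurable_integrable[OF g, unfolded measurable_lborel1]
 have *: "continuous_on {t1..T} (%t. pairing (momentum j k t) g)" if t1: "t1 > 0" for t1
 proof (rule continuous_on_lebesgue_integral)
  show "integrable lborel (%y. C * t1 powr (- (1/4)) * \<bar>g y\<bar>)" using g by simp
  show "continuous_on {t1..T} (%t. momentum j k t y * g y)" for y
   unfolding momentum_def using t1 prs_continuous_time[OF t1]
   by (cases "k = j") (auto intro!: continuous_intros continuous_on_subset[OF stress_continuous_time])
  show "\<bar>momentum j k t y * g y\<bar> \<le> C * t1 powr (- (1/4)) * \<bar>g y\<bar>" if t: "t \<in> {t1..T}" for t y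
  proof -
   have "\<bar>momentum j k t y\<bar> \<le> C * t powr (- (1/4))" using C(2) t t1 by auto
   also have "\<dots> \<le> C * t1 powr (- (1/4))" using t t1 C(1) by (intro mult_left_mono powr_mono2') auto
   finally show ?thesis by (simp add: abs_mult mult_right_mono)
  qed
 qed measurable
 show ?thesis
  unfolding continuous_on_eq_continuous_within
 proof
  fix t assume t: "t \<in> {0<..T}"
  have "continuous (at t within {t/2..T}) (%t. pairing (momentum j k t) g)"
   using *[of "t/2"] t by (auto simp: continuous_on_eq_continuous_within)
  moreover have "at t within {t/2..T} = at t within {0<..T}"
   by (rule at_within_nhd[of _ "{t/2<..}"]) (use t in auto)
  ultimately show "continuous (at t within {0<..T}) (%t. pairing (momentum j k t) g)" by simp
 qed
qed

lemma u_component_le: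
 assumes "t \<in> {0<..T}"
 shows "\<bar>u t y $ j\<bar> \<le> M"
proof -
 have "(1 + norm y) powr (- (p / 2)) \<le> 1" using powr_mono2'[of "- (p / 2)" 1 "1 + norm y"] p by simp
 then have "norm (u t y) \<le> M" using bound[OF assms, of y] M_nonneg mult_left_mono[of _ 1 M] by fastforce
 then show ?thesis using component_le_norm_cart[of "u t y" j] by linarith
qed

lemma velocity_pairing_continuous:
 assumes g: "integrable lborel g"
 shows "continuous_on {0<..T} (%t. pairing (%x. u t x $ j) g)"
proof (rule continuous_on_lebesgue_integral)
 note [measurable] = borel_measurable_integrable[OF g, unfolded measurable_lborel1]
 show "integrable lborel (%y. M * \<bar>g y\<bar>)" using g by simp
 show "continuous_on {0<..T} (%t. u t y $ j * g y)" for y by (intro continuous_intros u_component_continuous)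
 show "(%y. u t y $ j * g y) \<in> borel_measurable lborel" if "t \<in> {0<..T}" for t
  using borel_measurable_continuous_onI[OF continuous_on_component[OF u_slice_continuous[OF that]], of j] by simp
 show "\<bar>u t y $ j * g y\<bar> \<le> M * \<bar>g y\<bar>" if "t \<in> {0<..T}" for t y
  using u_component_le[OF that, of y j] by (simp add: abs_mult mult_right_mono)
qed

text \<open>The classical time derivative, taken under the pairing. On the compact set formed by
  [t/2, T] and the support of \<open>\<phi>\<close> the time derivative of u is bounded, which is
  the domination; at t = T the derivative is one-sided.\<close>

lemma velocity_pairing_derivative:
 assumes t: "t \<in> {0<..T}" and \<phi>: "Cc m \<phi>"
  and U: "!!z. z \<in> {0<..T} \<times> UNIV ==> ((%(t, x). u t x) has_derivative U z) (at z within {0<..T} \<times> UNIV)"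
   "!!v. continuous_on ({0<..T} \<times> UNIV) (%z. U z v)"
 shows "vector_derivative (%s. u s x) (at t within {0<..T}) = U (t, x) (1, 0)"
  and "((%t. pairing (%x. u t x $ j) \<phi>) has_vector_derivative pairing (%x. U (t, x) (1, 0) $ j) \<phi>) (at t within {t/2..T})"
proof -
 have D: "((%s. u s x) has_derivative (%h. U (s, x) (h, 0))) (at s within {0<..T})" if s: "s \<in> {0<..T}" for s x
 proof -
  have 1: "((%s. (s, x)) has_derivative (%h. (h, 0))) (at s within {0<..T})" by (auto intro!: derivative_eq_intros)
  have "((%(t, x). u t x) has_derivative U (s, x)) (at (s, x) within (%s. (s, x)) ` {0<..T})"
   by (rule has_derivative_subset[OF U(1)]) (use s in auto)
  from has_derivative_in_compose[OF 1 this] show ?thesis by simp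
 qed
 have l: "U (s, x) (h, 0) = h *\<^sub>R U (s, x) (1, 0)" if "s \<in> {0<..T}" for s x h
  using linear_scale[OF has_derivative_linear[OF U(1)[of "(s, x)"]], of h "(1, 0)"] that by simp
 have D': "((%s. u s x) has_vector_derivative U (s, x) (1, 0)) (at s within {0<..T})" if s: "s \<in> {0<..T}" for s x
  unfolding has_vector_derivative_def by (rule has_derivative_eq_rhs[OF D[OF s]]) (rule ext, rule l[OF s])
 have nb: "at t within {0<..T} \<noteq> bot"
  using t islimpt_closure_open[of "{0<..<T}" "{0..T}" t] islimpt_subset[of t "{0<..<T}" "{0<..T}"]
  by (auto simp: trivial_limit_within)
 show "vector_derivative (%s. u s x) (at t within {0<..T}) = U (t, x) (1, 0)"
  by (rule vector_derivative_within[OF nb D'[OF t]])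
 from Cc_support[OF \<phi>] obtain R where R: "R > 0" "!!x. norm x > R ==> \<phi> x = 0" by blast
 have c: "continuous_on ({t/2..T} \<times> cball 0 R) (%z. U z (1, 0) $ j)"
  by (intro continuous_on_component continuous_on_subset[OF U(2)]) (use t in auto)
 have "compact ((%z. U z (1, 0) $ j) ` ({t/2..T} \<times> cball 0 R))"
  by (intro compact_continuous_image[OF c] compact_Times) auto
 then obtain B where B: "B > 0" "!!z. z \<in> {t/2..T} \<times> cball 0 R ==> \<bar>U z (1, 0) $ j\<bar> \<le> B"
  unfolding bounded_pos[THEN iffD1[OF _ compact_imp_bounded]] by (auto dest!: compact_imp_bounded simp: bounded_pos)
 have sub: "s \<in> {0<..T}" if "s \<in> {t/2..T}" for s using that t by auto
 have um: "(%x. u s x $ j * \<phi> x) \<in> borel_measurable borel" "integrable lborel (%x. u s x $ j * \<phi> x)" if "s \<in> {0<..T}" for s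
  using Cc_mult_0[OF continuous_on_component[OF u_slice_continuous[OF that]] \<phi>, of j] Cc_measurable Cc_integrable by blast+
 have "((%s. LINT x|lborel. u s x $ j * \<phi> x) has_derivative (%h. LINT x|lborel. h * U (t, x) (1, 0) $ j * \<phi> x)) (at t within {t/2..T})"
 proof (rule has_derivative_lebesgue_integral[where f' = "%s x h. h * U (s, x) (1, 0) $ j * \<phi> x" and g = "%x. B * \<bar>\<phi> x\<bar>"])
  show "t \<in> {t/2..T}" using t by auto
  show "integrable lborel (%x. B * \<bar>\<phi> x\<bar>)" using Cc_integrable[OF \<phi>] by simp
  show "(%x. h * U (t, x) (1, 0) $ j * \<phi> x) \<in> borel_measurable lborel" for h
  proof -
   have "continuous_on UNIV (%x. U (t, x) (1, 0) $ j)"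
    using continuous_on_compose2[OF U(2) continuous_on_Pair[OF continuous_on_const continuous_on_id], of t UNIV "(1, 0)"] t
    by (intro continuous_on_component) (auto simp: image_subset_iff)
   from borel_measurable_continuous_onI[OF this] Cc_measurable[OF \<phi>] show ?thesis by simp
  qed
  fix s x assume s: "s \<in> {t/2..T}"
  have "((%s. u s x $ j * \<phi> x) has_derivative (%h. (h *\<^sub>R U (s, x) (1, 0)) $ j * \<phi> x)) (at s within {t/2..T})"
   by (intro has_derivative_mult_left bounded_linear.has_derivative[OF bounded_linear_vec_nth]
     has_derivative_subset[OF D'[OF sub[OF s], unfolded has_vector_derivative_def]]) (use t in auto)
  then show "((%s. u s x $ j * \<phi> x) has_derivative (%h. h * U (s, x) (1, 0) $ j * \<phi> x)) (at s within {t/2..T})"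
   by simp
  show "\<bar>h * U (s, x) (1, 0) $ j * \<phi> x\<bar> \<le> norm h * (B * \<bar>\<phi> x\<bar>)" for h
   using B(2)[of "(s, x)"] R(2)[of x] s by (cases "norm x > R") (auto simp: abs_mult mult.assoc intro!: mult_left_mono mult_right_mono)
 qed (use um sub in auto)
 then show "((%t. pairing (%x. u t x $ j) \<phi>) has_vector_derivative pairing (%x. U (t, x) (1, 0) $ j) \<phi>) (at t within {t/2..T})"
  unfolding has_vector_derivative_def by (simp add: mult.assoc)
qed

text \<open>The same derivative computed from \<open>weak_momentum\<close>, whose right-hand side is
  an indefinite time integral. Its integrands are continuous on (0, T] and at most of order
  t^{-1/4}, hence integrable.\<close>

lemma velocity_pairing_derivative':
 assumes t: "t \<in> {0<..T}" and \<phi>: "Cc (Suc (Suc (Suc 0))) \<phi>"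
 shows "((%t. pairing (%x. u t x $ j) \<phi>) has_vector_derivative
  pairing (%x. u t x $ j) (lap \<phi>) + (\<Sum>k\<in>UNIV. pairing (momentum j k t) (pderiv_at k \<phi>))) (at t within {0<..T})"
proof -
 from initial_borel obtain b where b: "b \<in> borel_measurable borel" "!!y. \<bar>b y\<bar> \<le> M" "!!t x. t > 0 ==> heat t a x $ j = conv (gk t) b x"
  by metis
 let ?F1 = "%t. pairing (%x. u t x $ j) (lap \<phi>)" and ?F2 = "%t. \<Sum>k\<in>UNIV. pairing (momentum j k t) (pderiv_at k \<phi>)"
 note li = Cc_integrable[OF Cc_lap[OF Cc_Suc[OF \<phi>]]] and pi = Cc_integrable[OF Cc_pderiv[OF \<phi>]]
 have c: "continuous_on {0<..T} ?F1" "continuous_on {0<..T} ?F2"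
  by (intro velocity_pairing_continuous li continuous_on_sum momentum_pairing_continuous pi)+
 from momentum_bound obtain C where C: "!!j k t x. t \<in> {0<..T} ==> \<bar>momentum j k t x\<bar> \<le> C * t powr (- (1/4))" by metis
 let ?K = "C * (\<Sum>k\<in>UNIV. LINT y|lborel. \<bar>pderiv_at k \<phi> y\<bar>)"
 have "\<bar>?F2 t\<bar> \<le> ?K * t powr (- (1/4))" if t: "t \<in> {0<..T}" for t
 proof -
  have "\<bar>?F2 t\<bar> \<le> (\<Sum>k\<in>UNIV. C * t powr (- (1/4)) * (LINT y|lborel. \<bar>pderiv_at k \<phi> y\<bar>))"
   by (intro order_trans[OF sum_abs] sum_mono bounded_mult_integrable(2)[OF _ C[OF t] pi]) measurable
  then show ?thesis unfolding sum_distrib_left[symmetric] by (simp add: mult_ac)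
 qed
 from lon_continuous_integrable[OF c(2) this _ T] have i2: "integrable (lon {0<..<T}) ?F2" by simp
 have "\<bar>?F1 t\<bar> \<le> M * (LINT y|lborel. \<bar>lap \<phi> y\<bar>) * t powr (- 0)" if t: "t \<in> {0<..T}" for t
  using bounded_mult_integrable(2)[OF _ u_component_le[OF t] li] t borel_measurable_continuous_onI[OF continuous_on_component[OF u_slice_continuous[OF t]]]
  by simp
 from lon_continuous_integrable[OF c(1) this _ T] have i1: "integrable (lon {0<..<T}) ?F1" by simp
 have "((%t. pairing b \<phi> + (LINT s|lon {0<..<t}. ?F1 s) + (LINT s|lon {0<..<t}. ?F2 s)) has_vector_derivative 0 + ?F1 t + ?F2 t) (at t within {0<..T})"
  by (intro has_vector_derivative_add has_vector_derivative_const lon_indefinite_integral i1 i2 c t)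
 from has_vector_derivative_transform[OF t weak_momentum[OF _ b \<phi>] this] show ?thesis by simp
qed

end

section \<open>Bump functions, and functions with vanishing weak gradient\<close>

lemma Cc_Suc_I:
 assumes "!!x. (f has_derivative (%v. \<Sum>i\<in>UNIV. g i x * v $ i)) (at x)" "!!i. Cc m (g i)" "\<exists>R. \<forall>x. norm x > R \<longrightarrow> f x = 0"
 shows "Cc (Suc m) f" "pderiv_at i f = g i"
proof -
 have "pderiv_at i f = g i" for i
  using pderiv_at_eq[OF assms(1)] by (auto simp: fun_eq_iff axis_def if_distrib sum.delta cong: if_cong)
 then show "Cc (Suc m) f" "pderiv_at i f = g i" using assms by (auto intro: differentiableI)
qed

lemma Cc_lincomb: "Cc m f ==> Cc m g ==> Cc m (%x. \<alpha> * f x + \<beta> * g x)"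
proof (induction m arbitrary: f g)
 case 0
 then show ?case using Cc_mult_0[of "%_. \<alpha>" 0 f] Cc_mult_0[of "%_. \<beta>" 0 g] by (intro Cc_add_0) (auto intro: continuous_intros)
next
 case (Suc m)
 show ?case
 proof (rule Cc_Suc_I(1))
  show "((%x. \<alpha> * f x + \<beta> * g x) has_derivative (%v. \<Sum>i\<in>UNIV. (\<alpha> * pderiv_at i f x + \<beta> * pderiv_at i g x) * v $ i)) (at x)" for x
   by (rule has_derivative_eq_rhs[OF has_derivative_add[OF has_derivative_mult_right[OF Cc_has_derivative[OF Suc.prems(1)]]
     has_derivative_mult_right[OF Cc_has_derivative[OF Suc.prems(2)]]]])
    (simp add: fun_eq_iff sum.distrib sum_distrib_left algebra_simps)
  show "Cc m (%x. \<alpha> * pderiv_at i f x + \<beta> * pderiv_at i g x)" for i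
   by (intro Suc.IH Cc_pderiv Suc.prems)
  from Cc_support[OF Suc.prems(1)] Cc_support[OF Suc.prems(2)] obtain R1 R2 where
   "\<forall>x. norm x > R1 \<longrightarrow> f x = 0" "\<forall>x. norm x > R2 \<longrightarrow> g x = 0" by blast
  then show "\<exists>R. \<forall>x. norm x > R \<longrightarrow> \<alpha> * f x + \<beta> * g x = 0" by (intro exI[of _ "max R1 R2"]) auto
 qed
qed

lemma Cc_coordinate: "Cc m f ==> Cc m (%x. x $ i * f x)"
proof (induction m arbitrary: f)
 case 0
 then show ?case by (rule Cc_mult_0[rotated]) (intro continuous_intros)
next
 case (Suc m)
 show ?case
 proof (rule Cc_Suc_I(1))
  have delta: "(\<Sum>k\<in>UNIV. (if k = i then c else 0) * v $ k) = v $ i * c" for c and v :: "real^'a"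
   by (subst sum.remove[of _ i]) (auto intro!: sum.neutral)
  show "((%x. x $ i * f x) has_derivative (%v. \<Sum>k\<in>UNIV. ((if k = i then 1 else 0) * f x + 1 * (x $ i * pderiv_at k f x)) * v $ k)) (at x)" for x
   by (rule has_derivative_eq_rhs, rule has_derivative_mult[OF bounded_linear.has_derivative[OF bounded_linear_vec_nth has_derivative_ident] Cc_has_derivative[OF Suc.prems]],
     rule ext, unfold distrib_right sum.distrib mult_if_delta delta)
    (simp only: sum_distrib_left mult.assoc mult_1_left add.commute)
  show "Cc m (%x. (if k = i then 1 else 0) * f x + 1 * (x $ i * pderiv_at k f x))" for k
   by (rule Cc_lincomb[OF Cc_Suc[OF Suc.prems] Suc.IH[OF Cc_pderiv[OF Suc.prems]]])
  from Cc_support[OF Suc.prems] show "\<exists>R. \<forall>x. norm x > R \<longrightarrow> x $ i * f x = 0" by auto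
 qed
qed

text \<open>A power of a truncated paraboloid: for r > 0 and positive m it is nonnegative, supported
  in the ball of radius r about x, of class C^{m-1}, and has closed-form derivatives both in y and
  in the centre x.\<close>

definition bump :: "real \<Rightarrow> nat \<Rightarrow> real^'n \<Rightarrow> real^'n \<Rightarrow> real" where
 "bump r m x y = max 0 (r\<^sup>2 - (y - x) \<bullet> (y - x)) ^ m"

lemma positive_part_power_derivative:
 fixes s :: real
 shows "((%s. max 0 s ^ Suc (Suc m)) has_real_derivative real (Suc (Suc m)) * max 0 s ^ Suc m) (at s)"
proof -
 consider "s > 0" | "s < 0" | "s = 0" by linarith
 then show ?thesis
 proof cases
  case 1
  have "((%s. s ^ Suc (Suc m)) has_real_derivative real (Suc (Suc m)) * max 0 s ^ Suc m) (at s)"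
   using 1 DERIV_pow[of "Suc (Suc m)" s] by simp
  then show ?thesis by (rule has_field_derivative_transform_within_open[of _ _ _ "{0<..}"]) (use 1 in auto)
 next
  case 2
  have "((%s. 0) has_real_derivative real (Suc (Suc m)) * max 0 s ^ Suc m) (at s)" using 2 by simp
  then show ?thesis by (rule has_field_derivative_transform_within_open[of _ _ _ "{..<0}"]) (use 2 in auto)
 next
  case 3
  \<comment> \<open>At the kink the difference quotient equals one power less of the positive part,
    which tends to 0.\<close>
  have "((%h. max 0 h ^ Suc m) \<longlongrightarrow> max 0 (0::real) ^ Suc m) (at 0)" by (intro tendsto_intros)
  then have "((%h. max 0 h ^ Suc (Suc m) / h) \<longlongrightarrow> max 0 (0::real) ^ Suc m) (at 0)"
   by (rule Lim_transform_eventually) (auto simp: eventually_at max_def intro!: exI[of _ 1])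
  then show ?thesis using 3 by (simp add: DERIV_def)
 qed
qed

lemma bump_has_derivative:
 "((%y. bump r (Suc (Suc m)) x y) has_derivative (%v. - 2 * real (Suc (Suc m)) * bump r (Suc m) x y * ((y - x) \<bullet> v))) (at y)"
 "((%x. bump r (Suc (Suc m)) x y) has_derivative (%v. 2 * real (Suc (Suc m)) * bump r (Suc m) x y * ((y - x) \<bullet> v))) (at x)"
proof -
 note d = has_derivative_compose[OF _ positive_part_power_derivative[unfolded has_field_derivative_def]]
 have 1: "((%y. r\<^sup>2 - (y - x) \<bullet> (y - x)) has_derivative (%v. - 2 * ((y - x) \<bullet> v))) (at y)"
  by (auto intro!: derivative_eq_intros simp: inner_commute)
 have 2: "((%x. r\<^sup>2 - (y - x) \<bullet> (y - x)) has_derivative (%v. 2 * ((y - x) \<bullet> v))) (at x)"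
  by (auto intro!: derivative_eq_intros simp: inner_commute)
 show "((%y. bump r (Suc (Suc m)) x y) has_derivative (%v. - 2 * real (Suc (Suc m)) * bump r (Suc m) x y * ((y - x) \<bullet> v))) (at y)"
  unfolding bump_def by (rule has_derivative_eq_rhs[OF d[OF 1]]) (simp add: fun_eq_iff algebra_simps)
 show "((%x. bump r (Suc (Suc m)) x y) has_derivative (%v. 2 * real (Suc (Suc m)) * bump r (Suc m) x y * ((y - x) \<bullet> v))) (at x)"
  unfolding bump_def by (rule has_derivative_eq_rhs[OF d[OF 2]]) (simp add: fun_eq_iff algebra_simps)
qed

lemma bump_0: "r > 0 ==> norm (y - x) \<ge> r ==> bump r (Suc m) x y = 0"
 using power_mono[of r "norm (y - x)" 2] by (simp add: bump_def power2_norm_eq_inner max_def)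

lemma bump_Cc:
 fixes x :: "real^'n"
 assumes r: "r > 0"
 shows "Cc m (bump r (Suc m) x)"
  "pderiv_at i (bump r (Suc (Suc m)) x) y = - 2 * real (Suc (Suc m)) * (y - x) $ i * bump r (Suc m) x y"
proof -
 have supp: "\<exists>R. \<forall>y. norm y > R \<longrightarrow> bump r (Suc m) x y = 0" for m
 proof (intro exI allI impI)
  fix y :: "real^'n" assume "norm y > r + norm x"
  then show "bump r (Suc m) x y = 0" using norm_triangle_ineq2[of y x] by (intro bump_0[OF r]) linarith
 qed
 have S: "((%y. bump r (Suc (Suc m)) x y) has_derivative (%v. \<Sum>i\<in>UNIV. (- 2 * real (Suc (Suc m)) * (y $ i * bump r (Suc m) x y)
   + 2 * real (Suc (Suc m)) * x $ i * bump r (Suc m) x y) * v $ i)) (at y)" for m y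
  by (rule has_derivative_eq_rhs[OF bump_has_derivative(1)], rule ext, unfold inner_vec_def sum_distrib_left, rule sum.cong[OF refl])
   (simp add: algebra_simps)
 show Cc: "Cc m (bump r (Suc m) x)" for m
 proof (induction m)
  case 0
  have "continuous_on UNIV (bump r (Suc 0) x)" unfolding bump_def by (intro continuous_intros)
  then show ?case using supp[of 0] by simp
 next
  case (Suc m)
  show ?case by (rule Cc_Suc_I(1)[OF S _ supp]) (intro Cc_lincomb Cc_coordinate Suc)
 qed
 have "pderiv_at i (bump r (Suc (Suc m)) x) = (%y. - 2 * real (Suc (Suc m)) * (y $ i * bump r (Suc m) x y)
   + 2 * real (Suc (Suc m)) * x $ i * bump r (Suc m) x y)"
  by (rule Cc_Suc_I(2)[OF S _ supp, where m = m]) (intro Cc_lincomb Cc_coordinate Cc)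
 then show "pderiv_at i (bump r (Suc (Suc m)) x) y = - 2 * real (Suc (Suc m)) * (y - x) $ i * bump r (Suc m) x y"
  by (simp add: algebra_simps)
qed

lemma bump_le: "0 \<le> bump r m x y" "bump r m x y \<le> (r\<^sup>2) ^ m"
 unfolding bump_def by (auto intro!: power_mono)

text \<open>A continuous function with vanishing distributional gradient is constant.\<close>

lemma weak_gradient_0:
 fixes g :: "real^'n \<Rightarrow> real"
 assumes g: "continuous_on UNIV g" and z: "!!j \<phi>. Cc (Suc (Suc (Suc 0))) \<phi> ==> pairing g (pderiv_at j \<phi>) = 0"
 shows "g x = g y"
proof -
 let ?m = "Suc (Suc (Suc 0))"
 \<comment> \<open>The derivative of a bump with respect to its centre is minus its derivative in y,
   so by assumption the pairing with g is stationary under moving the centre.\<close>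
 have const: "pairing g (bump r (Suc ?m) x1) = pairing g (bump r (Suc ?m) x2)" if r: "r > 0" for r x1 x2
 proof -
  have "\<exists>c. \<forall>x\<in>UNIV. pairing g (bump r (Suc ?m) x) = c"
  proof (rule has_derivative_zero_constant)
   fix x0 :: "real^'n"
   let ?D = "%x y v. g y * (2 * real (Suc ?m) * bump r ?m x y * ((y - x) \<bullet> v))"
   let ?K = "cball x0 (r + 1)"
   have "((%x. pairing g (bump r (Suc ?m) x)) has_derivative (%v. LINT y|lborel. ?D x0 y v)) (at x0 within cball x0 1)"
   proof (rule has_derivative_lebesgue_integral[where g = "%y. 8 * (r\<^sup>2) ^ ?m * r * (indicator ?K y * \<bar>g y\<bar>)"])
    show "((%x. g y * bump r (Suc ?m) x y) has_derivative ?D x y) (at x within cball x0 1)" for x y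
     by (rule has_derivative_mult_right[OF has_derivative_at_withinI[OF bump_has_derivative(2)]])
    show "\<bar>?D x y v\<bar> \<le> norm v * (8 * (r\<^sup>2) ^ ?m * r * (indicator ?K y * \<bar>g y\<bar>))" if "x \<in> cball x0 1" for x y v
    proof (cases "norm (y - x) \<ge> r")
     case False
     have "y \<in> ?K" using False that dist_triangle[of x0 y x] by (simp add: dist_norm norm_minus_commute)
     moreover have "bump r ?m x y * \<bar>(y - x) \<bullet> v\<bar> \<le> (r\<^sup>2) ^ ?m * (r * norm v)"
      using False by (intro mult_mono bump_le order_trans[OF Cauchy_Schwarz_ineq2] mult_right_mono) auto
     then have "\<bar>g y\<bar> * (8 * (bump r ?m x y * \<bar>(y - x) \<bullet> v\<bar>)) \<le> \<bar>g y\<bar> * (8 * ((r\<^sup>2) ^ ?m * (r * norm v)))"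
      by (intro mult_left_mono) auto
     ultimately show ?thesis using bump_le(1)[of r ?m x y] by (simp add: abs_mult mult_ac)
    qed (use bump_0[OF r, of y x] r in simp)
    have "integrable lborel (%y. indicator ?K y *\<^sub>R \<bar>g y\<bar>)"
     by (intro borel_integrable_compact continuous_intros continuous_on_subset[OF g]) auto
    then show "integrable lborel (%y. 8 * (r\<^sup>2) ^ ?m * r * (indicator ?K y * \<bar>g y\<bar>))" by simp
    show "integrable lborel (%y. g y * bump r (Suc ?m) x y)" for x
     by (rule Cc_integrable[OF Cc_mult_0[OF g bump_Cc(1)[OF r]]])
    show "(%y. ?D x0 y v) \<in> borel_measurable lborel" for v
     using borel_measurable_continuous_onI[OF g] Cc_measurable[OF bump_Cc(1)[OF r, of "Suc (Suc 0)" x0]] by simp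
   qed auto
   moreover have "(LINT y|lborel. ?D x0 y v) = 0" for v
   proof -
    have "?D x0 y v = (\<Sum>i\<in>UNIV. - v $ i * (g y * pderiv_at i (bump r (Suc ?m) x0) y))" for y
     unfolding bump_Cc(2)[OF r] inner_vec_def sum_distrib_left by (rule sum.cong[OF refl]) (simp add: algebra_simps)
    moreover have "integrable lborel (%y. g y * pderiv_at i (bump r (Suc ?m) x0) y)" for i
     by (rule Cc_integrable[OF Cc_mult_0[OF g Cc_pderiv[OF bump_Cc(1)[OF r]]]])
    ultimately show ?thesis using z[OF bump_Cc(1)[OF r]] by (simp add: Bochner_Integration.integral_sum)
   qed
   ultimately show "((%x. pairing g (bump r (Suc ?m) x)) has_derivative (%v. 0)) (at x0 within UNIV)"
    using at_within_interior[of x0 "cball x0 1"] by simp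
  qed simp
  then show ?thesis by auto
 qed
 \<comment> \<open>If g were larger at x1 than at x2, continuity would preserve this under equal
   displacements in a small ball, and the equality of the two bump averages would force a
   nonnegative continuous function that is positive at 0 to vanish almost everywhere.\<close>
 have le: "g x1 \<le> g x2" for x1 x2
 proof (rule ccontr)
  assume "\<not> g x1 \<le> g x2"
  then have pos: "g x1 - g x2 > 0" by simp
  have c: "continuous_on UNIV (%z. g (x1 + z) - g (x2 + z))"
   by (intro continuous_intros continuous_on_compose2[OF g]) auto
  have "open ((%z. g (x1 + z) - g (x2 + z)) -` {0<..})"
   using c by (simp add: continuous_on_open_vimage)
  moreover have "0 \<in> (%z. g (x1 + z) - g (x2 + z)) -` {0<..}" using pos by simp
  ultimately obtain r where r: "r > 0" "ball 0 r \<subseteq> (%z. g (x1 + z) - g (x2 + z)) -` {0<..}"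
   by (rule openE)
  have r2: "g (x1 + z) - g (x2 + z) > 0" if "norm z < r" for z
   using that subsetD[OF r(2), of z] by simp
  let ?E = "%z. (g (x1 + z) - g (x2 + z)) * bump r (Suc ?m) 0 z"
  have sh: "(LINT z|lborel. g (w + z) * bump r (Suc ?m) 0 z) = pairing g (bump r (Suc ?m) w)"
   "integrable lborel (%z. g (w + z) * bump r (Suc ?m) 0 z)" for w
  proof -
   have m: "(%y. g y * bump r (Suc ?m) w y) \<in> borel_measurable borel"
    and i: "integrable lborel (%y. g y * bump r (Suc ?m) w y)"
    using Cc_mult_0[OF g bump_Cc(1)[OF r(1)]] Cc_measurable Cc_integrable by blast+
   show "(LINT z|lborel. g (w + z) * bump r (Suc ?m) 0 z) = pairing g (bump r (Suc ?m) w)"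
    "integrable lborel (%z. g (w + z) * bump r (Suc ?m) 0 z)"
    using lborel_shift[OF m, of w] i by (auto simp: bump_def add.commute)
  qed
  have i: "integrable lborel ?E" unfolding left_diff_distrib using sh(2) by auto
  have "(LINT z|lborel. ?E z) = 0"
   using const[OF r(1)] sh unfolding left_diff_distrib by simp
  moreover have nn: "?E z \<ge> 0" for z
   using r2[of z] bump_0[OF r(1), where x=0 and y=z] bump_le(1)[of r "Suc ?m" 0 z] by (cases "norm z < r") auto
  ultimately have "AE z in lborel. ?E z = 0"
   using integral_nonneg_eq_0_iff_AE[OF i] by auto
  then have "AE z in lebesgue. z \<in> {z. ?E z = 0}" by (intro AE_completion) simp
  then have "0 \<in> {z. ?E z = 0}"
   by (rule mem_closed_if_AE_lebesgue[rotated])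
    (intro closed_Collect_eq continuous_on_mult c Cc_continuous[OF bump_Cc(1)[OF r(1)]] continuous_on_const)
  then show False using pos r(1) by (simp add: bump_def)
 qed
 show ?thesis using le[of x y] le[of y x] by simp
qed

section \<open>Identification of the pressure up to a function of time\<close>

context mild_ns
begin

text \<open>The time derivative of the tested velocity is computed twice: classically, where the
  equation brings in the gradient of q, and through \<open>velocity_pairing_derivative'\<close>,
  where the flux brings in \<open>prs\<close>. After integration by parts the diffusion and the
  convection terms coincide, and only the difference of the two pressures is left.\<close>

lemma pressure_weak_gradient:
 assumes sm: "Ck_on (Suc (Suc 0)) ({0<..T} \<times> UNIV) (%(t, x). u t x)" and q: "is_pressure T u q" and t: "t \<in> {0<..T}"
  and \<phi>: "Cc (Suc (Suc (Suc 0))) \<phi>"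
 shows "pairing (%x. q t x - prs t x) (pderiv_at j \<phi>) = 0" "continuous_on UNIV (q t)"
proof -
 from sm obtain U where U: "!!z. z \<in> {0<..T} \<times> UNIV ==> ((%(t, x). u t x) has_derivative U z) (at z within {0<..T} \<times> UNIV)"
  "!!v. Ck_on (Suc 0) ({0<..T} \<times> UNIV) (%z. U z v)" unfolding Ck_on.simps(2)[of "Suc 0"] by blast
 have Uc: "continuous_on ({0<..T} \<times> UNIV) (%z. U z v)" for v
  using U(2)[of v] by (auto simp: continuous_on_eq_continuous_within intro: has_derivative_continuous)
 let ?W = "%x. U (t, x) (1, 0)"
 have Wc: "continuous_on UNIV (%x. ?W x $ i)" for i
  using continuous_on_compose2[OF Uc continuous_on_Pair[OF continuous_on_const continuous_on_id], of t UNIV "(1, 0)"] t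
  by (intro continuous_on_component) (auto simp: image_subset_iff)
 note v2 = Ck_on_slice[OF t sm]
 note vi2 = Ck_on_component[OF v2]
 have vi1: "Ck_on (Suc 0) UNIV (%x. u t x $ i)" for i
  using vi2[of i] unfolding Ck_on.simps
  by (auto simp: continuous_on_eq_continuous_within; metis has_derivative_continuous)
 have vv: "Ck_on (Suc 0) UNIV (%x. u t x $ k * u t x $ i)" for k i by (rule Ck_on_mult[OF vi1 vi1])
 let ?N = "%i x. \<Sum>k\<in>UNIV. pderiv_at k (%y. u t y $ k * u t y $ i) x"
 let ?G = "%x. \<chi> i. - (?W x $ i - lap (%y. u t y $ i) x + ?N i x)"
 have lc: "continuous_on UNIV (lap (%y. u t y $ i))" for i
  using Ck_on_pderiv(2)[OF Ck_on_pderiv(2)[OF vi2]] unfolding lap_def[abs_def] by (auto intro!: continuous_intros)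
 have Nc: "continuous_on UNIV (?N i)" for i
  using Ck_on_pderiv(2)[OF vv] by (auto intro!: continuous_intros)
 have "GDERIV (q t) x :> ?G x" for x
 proof -
  have "?G x = - (vector_derivative (%s. u s x) (at t within {0<..T}) - laplacian (u t) x + div_tensor (tensor (u t)) x)"
   by (simp add: velocity_pairing_derivative(1)[OF t \<phi> U(1) Uc] vec_eq_iff laplacian_component[OF v2] div_tensor_def tensor_def)
  with q t show ?thesis unfolding is_pressure_def by metis
 qed
 then have qd: "(q t has_derivative (%h. h \<bullet> ?G x)) (at x)" for x by (simp add: gderiv_def)
 have qc: "continuous_on UNIV (%x. h \<bullet> ?G x)" for h
  unfolding inner_vec_def vec_lambda_beta inner_real_def
  by (intro continuous_on_mult continuous_on_const continuous_on_minus continuous_on_add[OF continuous_on_diff[OF Wc lc] Nc] continuous_on_sum)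
 show "continuous_on UNIV (q t)"
  unfolding continuous_on_eq_continuous_within using qd has_derivative_continuous by blast
 note ibp = integral_by_parts[OF qd qc \<phi>, of j]
 have tT: "t / 2 < T" "t \<in> cbox (t/2) T" using t by auto
 \<comment> \<open>Both derivatives are taken within [t/2, T], an interval on which derivatives are
   unique even at the endpoint T.\<close>
 have Wp: "pairing (%x. ?W x $ j) \<phi> = pairing (%x. u t x $ j) (lap \<phi>) + (\<Sum>k\<in>UNIV. pairing (momentum j k t) (pderiv_at k \<phi>))"
 proof (rule vector_derivative_unique_within_closed_interval[OF tT, of "%t. pairing (%x. u t x $ j) \<phi>"]; unfold box_real)
  show "((%t. pairing (%x. u t x $ j) \<phi>) has_vector_derivative pairing (%x. ?W x $ j) \<phi>) (at t within {t/2..T})"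
   by (rule velocity_pairing_derivative(2)[OF t \<phi> U(1) Uc])
  show "((%t. pairing (%x. u t x $ j) \<phi>) has_vector_derivative
   pairing (%x. u t x $ j) (lap \<phi>) + (\<Sum>k\<in>UNIV. pairing (momentum j k t) (pderiv_at k \<phi>))) (at t within {t/2..T})"
   by (rule has_vector_derivative_within_subset[OF velocity_pairing_derivative'[OF t \<phi>]]) (use t in auto)
 qed
 have i: "integrable lborel (%x. ?W x $ j * \<phi> x)"
  by (rule Cc_integrable[OF Cc_mult_0[OF Wc \<phi>]])
 note pl = pairing_lap[OF vi2 Cc_Suc[OF \<phi>], of j] and nb = Ck_on_by_parts[OF vv \<phi>]
 have iN: "integrable lborel (%x. ?N j x * \<phi> x)" unfolding sum_distrib_right using nb(2) by auto
 have "(LINT x|lborel. (axis j 1 \<bullet> ?G x) * \<phi> x) = (LINT x|lborel. - (?W x $ j * \<phi> x) + lap (%y. u t y $ j) x * \<phi> x - ?N j x * \<phi> x)"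
  by (simp add: inner_axis' algebra_simps)
 also have "\<dots> = - pairing (%x. ?W x $ j) \<phi> + pairing (%x. u t x $ j) (lap \<phi>) - (LINT x|lborel. ?N j x * \<phi> x)"
  using i pl iN by simp
 also have "(LINT x|lborel. ?N j x * \<phi> x) = - (\<Sum>k\<in>UNIV. pairing (%x. u t x $ k * u t x $ j) (pderiv_at k \<phi>))"
  unfolding sum_distrib_right by (subst Bochner_Integration.integral_sum) (auto simp: nb sum_negf)
 finally have "pairing (q t) (pderiv_at j \<phi>) = (\<Sum>k\<in>UNIV. pairing (momentum j k t) (pderiv_at k \<phi>) - pairing (%x. u t x $ k * u t x $ j) (pderiv_at k \<phi>))"
  unfolding ibp(1) Wp by (simp add: sum_subtractf)
 also have "\<dots> = (\<Sum>k\<in>UNIV. if k = j then pairing (prs t) (pderiv_at j \<phi>) else 0)"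
 proof (rule sum.cong[OF refl])
  fix k
  have pi: "integrable lborel (%x. prs t x * pderiv_at k \<phi> x)"
   by (rule Cc_integrable[OF Cc_mult_0[OF prs_continuous[OF t] Cc_pderiv[OF \<phi>]]])
  have "momentum j k t x = u t x $ k * u t x $ j + (if k = j then prs t x else 0)" for x
   using t by (simp add: momentum_def stress_def)
  then show "pairing (momentum j k t) (pderiv_at k \<phi>) - pairing (%x. u t x $ k * u t x $ j) (pderiv_at k \<phi>)
   = (if k = j then pairing (prs t) (pderiv_at j \<phi>) else 0)"
   using nb(3)[of k j k] pi by (auto simp: distrib_right)
 qed
 also have "\<dots> = pairing (prs t) (pderiv_at j \<phi>)" by (simp add: sum.delta)
 finally show "pairing (%x. q t x - prs t x) (pderiv_at j \<phi>) = 0"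
  unfolding left_diff_distrib using ibp(3) Cc_integrable[OF Cc_mult_0[OF prs_continuous[OF t] Cc_pderiv[OF \<phi>]], of j] by simp
qed

lemma pressure_eq:
 assumes sm: "Ck_on (Suc (Suc 0)) ({0<..T} \<times> UNIV) (%(t, x). u t x)" and q: "is_pressure T u q" and t: "t \<in> {0<..T}"
 shows "q t x = (q t 0 - prs t 0) + prs t x"
proof -
 \<comment> \<open>The continuity of \<open>q t\<close> comes from the second part of
   \<open>pressure_weak_gradient\<close>, which is stated relative to a test function; the zero
   function, a null combination of bumps, serves as one.\<close>
 have z: "Cc (Suc (Suc (Suc 0))) (%x::real^'n. 0)"
  using bump_Cc(1)[of 1 "Suc (Suc (Suc 0))" 0] Cc_lincomb[of _ _ _ 0 0] by (simp del: Cc.simps)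
 have "q t x - prs t x = q t 0 - prs t 0"
  by (rule weak_gradient_0[of "%x. q t x - prs t x"])
   (intro continuous_intros prs_continuous[OF t] pressure_weak_gradient(2)[OF sm q t z], rule pressure_weak_gradient(1)[OF sm q t])
 then show ?thesis by simp
qed

end

section \<open>The spatial expansion of the pressure\<close>

lemma powr_piecewise_integral:
 fixes a b c1 c2 A :: real
 assumes a: "a < 1" and b: "b > 1" and A: "A > 0"
 shows "integrable (lon {0<..}) (%r. if r \<le> A then c1 * r powr (- a) else c2 * r powr (- b))"
  "(LINT r|lon {0<..}. (if r \<le> A then c1 * r powr (- a) else c2 * r powr (- b)))
   = c1 * (A powr (1 - a) / (1 - a)) + c2 * (A powr (1 - b) / (b - 1))"
proof -
 let ?f = "%r. if r \<le> A then c1 * r powr (- a) else c2 * r powr (- b)"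
 have U: "{0::real<..} = {0<..A} \<union> {A<..}" using A by auto
 have 1: "integrable (lon {0<..A}) ?f" "(LINT r|lon {0<..A}. ?f r) = c1 * (A powr (1 - a) / (1 - a))"
  using powr_integral_0[OF a, of A] A Bochner_Integration.integrable_cong[of "lon {0<..A}" "lon {0<..A}" ?f "%r. c1 * r powr (- a)"]
   Bochner_Integration.integral_cong[of "lon {0<..A}" "lon {0<..A}" ?f "%r. c1 * r powr (- a)"] by auto
 have 2: "integrable (lon {A<..}) ?f" "(LINT r|lon {A<..}. ?f r) = c2 * (A powr (1 - b) / (b - 1))"
  using powr_integral_inf[OF b A] Bochner_Integration.integrable_cong[of "lon {A<..}" "lon {A<..}" ?f "%r. c2 * r powr (- b)"]
   Bochner_Integration.integral_cong[of "lon {A<..}" "lon {A<..}" ?f "%r. c2 * r powr (- b)"] by auto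
 show "integrable (lon {0<..}) ?f" unfolding U by (rule lon_Un(1)[OF _ _ _ 1(1) 2(1)]) auto
 show "(LINT r|lon {0<..}. ?f r) = c1 * (A powr (1 - a) / (1 - a)) + c2 * (A powr (1 - b) / (b - 1))"
  unfolding U 1(2)[symmetric] 2(2)[symmetric] by (rule lon_Un(2)[OF _ _ _ 1(1) 2(1)]) auto
qed

lemma gk2_conv_modulus:
 fixes F :: "'a::euclidean_space \<Rightarrow> real"
 assumes s: "s > 0" and F: "F \<in> borel_measurable borel" "!!y. \<bar>F y\<bar> \<le> B"
  and H: "!!y. \<bar>F y - F x\<bar> \<le> h (x - y)" and i: "integrable lborel (%z. h z * \<bar>gk2 a b s z\<bar>)"
 shows "\<bar>conv (gk2 a b s) F x\<bar> \<le> (LINT z|lborel. h z * \<bar>gk2 a b s z\<bar>)"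
proof -
 note cc = gk2_conv_cancel[OF s F, where a=a and b=b and x=x]
 let ?k = "%z. h z * \<bar>gk2 a b s z\<bar>"
 have km: "?k \<in> borel_measurable borel" using borel_measurable_integrable[OF i] by simp
 have "\<bar>conv (gk2 a b s) F x\<bar> \<le> (LINT y|lborel. \<bar>gk2 a b s (x - y) * (F y - F x)\<bar>)"
  unfolding cc(1) using integral_norm_bound[of lborel "%y. gk2 a b s (x - y) * (F y - F x)"] by simp
 also have "\<dots> \<le> (LINT y|lborel. ?k (x - y))"
 proof (rule integral_mono[OF integrable_abs[OF cc(2)]])
  show "integrable lborel (%y. ?k (x - y))" using lborel_reflect(1)[OF km, of x] i by simp
  show "\<bar>gk2 a b s (x - y) * (F y - F x)\<bar> \<le> ?k (x - y)" for y
   using mult_left_mono[OF H[of y], of "\<bar>gk2 a b s (x - y)\<bar>"] by (simp add: abs_mult mult.commute)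
 qed
 also have "\<dots> = (LINT z|lborel. ?k z)" using lborel_reflect(2)[OF km, of x] by simp
 finally show ?thesis .
qed

text \<open>Meant for times beyond |x|^2, when the kernel varies slowly everywhere: the mean value
  theorem is used for all y, with the Gaussian replaced by its maximum, and the first moment of g
  pays for it.\<close>

lemma conv_far:
 fixes f :: "real \<Rightarrow> 'a::euclidean_space \<Rightarrow> real"
 assumes k: "gkernel m f f'" and s: "s > 0" and g: "decays p M g" and p: "p > real DIM('a) + 1"
  and C: "C > 0" "!!s z v. s > 0 ==> \<bar>f' s z v\<bar> \<le> C * norm v * s powr (- ((real m + 1) / 2)) * gk (2 * s) z"
 shows "\<bar>conv (f s) g x - f s x * (LINT y|lborel. g y)\<bar>
  \<le> C * s powr (- ((real m + 1) / 2)) * gk (2 * s) (0::'a) * (M * weight_integral TYPE('a) (p - 1))"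
proof -
 note gi = decays_integrable[OF g p]
 from gkernel_bounded[OF k s] obtain B where B: "!!z. \<bar>f s z\<bar> \<le> B" by metis
 have ci: "integrable lborel (%y. f s (x - y) * g y)"
  by (rule conv_integrable[OF gkernel_measurable1[OF k] B gi(1)])
 let ?a = "C * s powr (- ((real m + 1) / 2)) * gk (2 * s) (0::'a)"
 have a: "?a \<ge> 0" using C(1) by (simp add: gk_nonneg)
 have le: "\<bar>f s (x - y) - f s x\<bar> \<le> ?a * norm y" for y
 proof -
  have "\<bar>f' s z v\<bar> \<le> ?a * norm v" for z v
  proof -
   have "C * norm v * s powr (- ((real m + 1) / 2)) * gk (2 * s) z \<le> C * norm v * s powr (- ((real m + 1) / 2)) * gk (2 * s) (0::'a)"
    using C(1) s by (intro mult_left_mono gk_le_at_0) auto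
   with C(2)[OF s, of z v] show ?thesis by (simp add: mult_ac)
  qed
  from gkernel_mean_value[OF k s this, of x "x - y"] show ?thesis by simp
 qed
 have g2: "integrable lborel (%y. norm y * \<bar>g y\<bar>)" using integrable_abs[OF gi(2)] by (simp add: abs_mult)
 have "conv (f s) g x - f s x * (LINT y|lborel. g y) = (LINT y|lborel. f s (x - y) * g y - f s x * g y)"
  using ci gi(1) by simp
 also have "\<bar>\<dots>\<bar> \<le> (LINT y|lborel. \<bar>f s (x - y) * g y - f s x * g y\<bar>)"
  using integral_norm_bound[of lborel "%y. f s (x - y) * g y - f s x * g y"] by simp
 also have "\<dots> \<le> (LINT y|lborel. ?a * (norm y * \<bar>g y\<bar>))"
 proof (rule integral_mono)
  show "\<bar>f s (x - y) * g y - f s x * g y\<bar> \<le> ?a * (norm y * \<bar>g y\<bar>)" for y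
   using mult_right_mono[OF le[of y], of "\<bar>g y\<bar>"] by (simp add: left_diff_distrib[symmetric] abs_mult mult.assoc)
 qed (use ci gi(1) g2 in auto)
 also have "\<dots> = ?a * (LINT y|lborel. norm y * \<bar>g y\<bar>)" by simp
 also have "\<dots> \<le> ?a * (M * weight_integral TYPE('a) (p - 1))" using gi(4) a by (rule mult_left_mono)
 finally show ?thesis .
qed

context mild_ns
begin

text \<open>Three ranges of r are treated differently. For r <= 1 there is no smallness from a
  Taylor expansion, and the cancellation of second derivatives is combined with
  \<open>stress_holder_decay\<close>; the subtracted leading term is small by
  \<open>gk_decay\<close>. For 1 < r <= |x|^2 the comparison of \<open>conv_near_far\<close>
  applies. For r > |x|^2 \<open>conv_far\<close> gives r^{-(d+3)/2}, which integrates to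
  |x|^{-(d+1)}. The factor t^{-\<open>\<beta>\<close>/4} stems from the first range alone.\<close>

lemma pressure_component_asymptotics:
 assumes p2: "p \<le> 2 * (real CARD('n) + 1)" and \<kappa>: "\<kappa> \<le> p - 1" "\<kappa> \<le> real CARD('n) + 1"
 defines "\<beta> \<equiv> 1 / (real CARD('n) + 1)"
 shows "\<exists>K>0. \<forall>t\<in>{0<..T}. \<forall>x. norm x \<ge> 1 \<longrightarrow>
  \<bar>(LINT r|lon {0<..}. pconv h k r t x) - (LINT r|lon {0<..}. gk2 (axis h 1) (axis k 1) r x) * (LINT y|lborel. stress h k t y)\<bar>
   \<le> K * (1 + t powr (- (\<beta>/4))) * norm x powr (- \<kappa>)"
proof -
 let ?d = "real CARD('n)" and ?g = "gk2 (axis h 1) (axis k 1 :: real^'n)"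
 note gk = gkernel_gk2[of "axis h 1" "axis k 1 :: real^'n"]
 from gk obtain C where C: "C > 0" "!!s z. s > 0 ==> \<bar>?g s z\<bar> \<le> C * s powr (- (real 2 / 2)) * gk (2 * s) z"
  "!!s z v. s > 0 ==> \<bar>gk3 (axis h 1) (axis k 1 :: real^'n) v s z\<bar> \<le> C * norm v * s powr (- ((real 2 + 1) / 2)) * gk (2 * s) z"
  by (rule gkernelE) auto
 obtain C2 where C2: "C2 > 0"
  "!!z::real^'n. z \<noteq> 0 ==> (LINT s|lon {0<..}. s powr (- (real 2 / 2)) * gk (2 * s) z) = C2 * norm z powr (2 - ?d - real 2)"
  using gk_double_time_integral[of 2, where 'a="real^'n"] by auto
 obtain C3 where C3: "C3 > 0"
  "!!z::real^'n. z \<noteq> 0 ==> (LINT s|lon {0<..}. s powr (- (real 3 / 2)) * gk (2 * s) z) = C3 * norm z powr (2 - ?d - real 3)"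
  using gk_double_time_integral[of 3, where 'a="real^'n"] by auto
 note C23 = C2(1) C3(1) C2(2) C3(2)
 from gkernel_moment[OF gk, of "\<beta>/2"] obtain A1 where A1: "A1 > 0"
  "!!s. s > 0 ==> integrable lborel (%z. norm z powr (\<beta>/2) * \<bar>?g s z\<bar>)"
  "!!s. s > 0 ==> (LINT z|lborel. norm z powr (\<beta>/2) * \<bar>?g s z\<bar>) \<le> A1 * s powr ((\<beta>/2) / 2 - real 2 / 2)"
  unfolding \<beta>_def by auto
 from gkernel_moment[OF gk, of "?d + 1"] obtain A2 where A2: "A2 > 0"
  "!!s. s > 0 ==> integrable lborel (%z. norm z powr (?d + 1) * \<bar>?g s z\<bar>)"
  "!!s. s > 0 ==> (LINT z|lborel. norm z powr (?d + 1) * \<bar>?g s z\<bar>) \<le> A2 * s powr ((?d + 1) / 2 - real 2 / 2)"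
  by auto
 obtain D where D: "D > 0" "!!s z. s > 0 ==> z \<noteq> 0 ==> gk (2 * s) (z::real^'n) \<le> D * s powr 1 * norm z powr (- (?d + 2 * 1))"
  using gk_decay[of 1, where 'a="real^'n"] by auto
 from stress_holder_decay[OF p2, folded \<beta>_def] obtain G where G: "G > 0" "!!h k t x y. t \<in> {0<..T} ==> norm y \<ge> norm x / 2 ==>
  \<bar>stress h k t y - stress h k t x\<bar> \<le> G * t powr (- (\<beta>/4)) * (1 + norm x) powr (- (p - 1)) * norm (y - x) powr (\<beta>/2)" by metis
 define w where "w = weight_integral TYPE(real^'n) (p - 1)"
 have w: "w \<ge> 0" by (simp add: w_def weight_integral_nonneg)
 define L1 where "L1 = C * M\<^sup>2 * (w + 2 powr p + 2 * w) + C * (8 * pi) powr (- ?d / 2) * (M\<^sup>2 * w)"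
 define L0 where "L0 = G * A1 + 2 * M\<^sup>2 * 2 powr (?d + 1) * A2 + C * D * M\<^sup>2 * w"
 have L: "L1 \<ge> 0" "L0 \<ge> 0" using w C(1) G(1) A1(1) A2(1) D(1) by (auto simp: L1_def L0_def)
 define K where "K = L1 * (C3 * 2 powr (?d + 1) + C2 + 2 + 2) + L0 * (4 / \<beta>) + 1"
 have \<beta>: "\<beta> > 0" by (simp add: \<beta>_def)
 have "K > 0" unfolding K_def using L C23 \<beta> by (intro add_nonneg_pos add_nonneg_nonneg mult_nonneg_nonneg) auto
 moreover have "\<bar>(LINT r|lon {0<..}. pconv h k r t x) - (LINT r|lon {0<..}. ?g r x) * (LINT y|lborel. stress h k t y)\<bar>
   \<le> K * (1 + t powr (- (\<beta>/4))) * norm x powr (- \<kappa>)" if t: "t \<in> {0<..T}" and x: "norm x \<ge> 1" for t x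
 proof -
  define N where "N = norm x"
  have N: "N \<ge> 1" "N > 0" "x \<noteq> 0" using x by (auto simp: N_def)
  define Th where "Th = 1 + t powr (- (\<beta>/4))"
  have Th: "Th \<ge> 1" by (simp add: Th_def)
  let ?E = "LINT y|lborel. stress h k t y"
  let ?I = "%r. pconv h k r t x - ?g r x * ?E"
  let ?Ha = "%r. r powr (- (real 3 / 2)) * gk (2 * r) (x /\<^sub>R 2)"
  let ?Hb = "%r. N powr (- 1) * (r powr (- (real 2 / 2)) * gk (2 * r) x)"
  \<comment> \<open>For r <= N^2 the far contribution N^{-p} r^{-1} of \<open>conv_near_far\<close>
    is weakened to N^{-p} r^{-1/2}: its integral up to N^2 is 2 N^{-(p-1)}, just what is needed, and
    no logarithm appears. Beyond N^2 the exponent is that of \<open>conv_far\<close>.\<close>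
  let ?Hc = "%r. if r \<le> N\<^sup>2 then N powr (- p) * r powr (- (1/2)) else 1 * r powr (- ((?d + 3) / 2))"
  let ?Hz = "%r. if r \<le> 1 then Th * N powr (- \<kappa>) * r powr (- (1 - \<beta>/4)) else 0 * r powr (- 2)"
  let ?H = "%r. L1 * (?Ha r + ?Hb r + ?Hc r) + L0 * ?Hz r"
  have nn: "?Ha r \<ge> 0" "?Hb r \<ge> 0" "?Hc r \<ge> 0" "?Hz r \<ge> 0" for r using Th by (auto simp: gk_nonneg)
  have E: "\<bar>?E\<bar> \<le> M\<^sup>2 * w"
   using order_trans[OF integral_abs_bound decays_integrable(3)[OF stress_decays[of h k t]]] p by (simp add: w_def)
  have small: "\<bar>?I r\<bar> \<le> L0 * ?Hz r" if r: "0 < r" "r \<le> 1" for r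
  proof -
   let ?c1 = "G * t powr (- (\<beta>/4)) * (1 + N) powr (- (p - 1))" and ?c2 = "2 * M\<^sup>2 * (2 powr (?d + 1) * N powr (- (?d + 1)))"
   let ?R = "N powr (- \<kappa>) * r powr (- (1 - \<beta>/4))"
   have r1: "1 \<le> r powr (- (1 - \<beta>/4))" using powr_mono2'[of "- (1 - \<beta>/4)" r 1] r d by (simp add: \<beta>_def)
   have le: "N powr (- (?d + 1)) \<le> N powr (- \<kappa>)" "(1 + N) powr (- (p - 1)) \<le> N powr (- \<kappa>)" "N powr (- (?d + 2 * 1)) \<le> N powr (- \<kappa>)"
    using N \<kappa> p powr_mono2'[of "- (p - 1)" N "1 + N"] powr_mono[of "- (p - 1)" "- \<kappa>" N] by (auto intro!: powr_mono)
   \<comment> \<open>A modulus for the increment depending on x - y only. Where |y| >= |x|/2 it is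
     the decaying Hoelder bound. Elsewhere |x - y| >= N/2, so the trivial bound 2 M^2 may be
     multiplied by (2 |x - y| / N)^{d+1}, and the moment of order d + 1 turns this into
     N^{-(d+1)}.\<close>
   have H: "\<bar>stress h k t y - stress h k t x\<bar> \<le> ?c1 * norm (x - y) powr (\<beta>/2) + ?c2 * norm (x - y) powr (?d + 1)" for y
   proof (cases "norm y \<ge> norm x / 2")
    case True
    have "0 \<le> ?c2 * norm (x - y) powr (?d + 1)" by simp
    then show ?thesis using G(2)[OF t True, of h k] by (simp only: norm_minus_commute[of y x] N_def)
   next
    case False
    have xy: "norm (x - y) \<ge> N / 2" using False norm_triangle_ineq2[of x y] by (simp add: N_def)
    have "1 = 2 powr (?d + 1) * N powr (- (?d + 1)) * (N / 2) powr (?d + 1)"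
     using N powr_add[of N "- (?d + 1)" "?d + 1"] by (simp add: powr_divide)
    also have "\<dots> \<le> 2 powr (?d + 1) * N powr (- (?d + 1)) * norm (x - y) powr (?d + 1)"
     using xy N by (intro mult_left_mono powr_mono2) auto
    finally have "2 * M\<^sup>2 * 1 \<le> 2 * M\<^sup>2 * (2 powr (?d + 1) * N powr (- (?d + 1)) * norm (x - y) powr (?d + 1))"
     by (intro mult_left_mono) auto
    moreover have "0 \<le> ?c1 * norm (x - y) powr (\<beta>/2)" using G(1) by simp
    moreover have "\<bar>stress h k t y - stress h k t x\<bar> \<le> 2 * M\<^sup>2"
     using stress_bound[of h k t y] stress_bound[of h k t x] by linarith
    ultimately show ?thesis by (simp add: mult.assoc)
   qed
   have "\<bar>pconv h k r t x\<bar> \<le> (LINT z|lborel. (?c1 * norm z powr (\<beta>/2) + ?c2 * norm z powr (?d + 1)) * \<bar>?g r z\<bar>)"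
    unfolding pconv_def
    by (rule gk2_conv_modulus[OF r(1) _ stress_bound, where h = "%z. ?c1 * norm z powr (\<beta>/2) + ?c2 * norm z powr (?d + 1)", OF _ H])
     (use A1(2)[OF r(1)] A2(2)[OF r(1)] in \<open>simp_all add: distrib_right mult.assoc\<close>)
   also have "\<dots> = ?c1 * (LINT z|lborel. norm z powr (\<beta>/2) * \<bar>?g r z\<bar>) + ?c2 * (LINT z|lborel. norm z powr (?d + 1) * \<bar>?g r z\<bar>)"
    using A1(2)[OF r(1)] A2(2)[OF r(1)] by (simp add: distrib_right mult.assoc)
   also have "\<dots> \<le> ?c1 * (A1 * r powr ((\<beta>/2) / 2 - real 2 / 2)) + ?c2 * (A2 * r powr ((?d + 1) / 2 - real 2 / 2))"
    using G(1) by (intro add_mono mult_left_mono A1(3) A2(3) r) auto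
   also have "\<dots> \<le> G * A1 * Th * ?R + 2 * M\<^sup>2 * 2 powr (?d + 1) * A2 * Th * ?R"
   proof (rule add_mono)
    have "t powr (- (\<beta>/4)) * (1 + N) powr (- (p - 1)) \<le> Th * N powr (- \<kappa>)"
     using le(2) by (intro mult_mono) (auto simp: Th_def)
    then have "G * A1 * r powr (- (1 - \<beta>/4)) * (t powr (- (\<beta>/4)) * (1 + N) powr (- (p - 1))) \<le> G * A1 * r powr (- (1 - \<beta>/4)) * (Th * N powr (- \<kappa>))"
     using G(1) A1(1) by (intro mult_left_mono) auto
    then show "?c1 * (A1 * r powr ((\<beta>/2) / 2 - real 2 / 2)) \<le> G * A1 * Th * ?R" by (simp add: mult_ac)
    have "r powr ((?d + 1) / 2 - real 2 / 2) \<le> 1" using r d by (intro powr_le1) auto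
    then have "N powr (- (?d + 1)) * r powr ((?d + 1) / 2 - real 2 / 2) \<le> (Th * N powr (- \<kappa>)) * r powr (- (1 - \<beta>/4))"
     using le(1) Th r1 mult_mono[of 1 Th "N powr (- (?d + 1))" "N powr (- \<kappa>)"] by (intro mult_mono) auto
    then have "2 * M\<^sup>2 * 2 powr (?d + 1) * A2 * (N powr (- (?d + 1)) * r powr ((?d + 1) / 2 - real 2 / 2)) \<le> 2 * M\<^sup>2 * 2 powr (?d + 1) * A2 * ((Th * N powr (- \<kappa>)) * r powr (- (1 - \<beta>/4)))"
     using A2(1) by (intro mult_left_mono) auto
    then show "?c2 * (A2 * r powr ((?d + 1) / 2 - real 2 / 2)) \<le> 2 * M\<^sup>2 * 2 powr (?d + 1) * A2 * Th * ?R" by (simp add: mult_ac)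
   qed
   finally have 1: "\<bar>pconv h k r t x\<bar> \<le> G * A1 * Th * ?R + 2 * M\<^sup>2 * 2 powr (?d + 1) * A2 * Th * ?R" .
   have "\<bar>?g r x\<bar> \<le> C * r powr (- (real 2 / 2)) * (D * r powr 1 * N powr (- (?d + 2 * 1)))"
    unfolding N_def using C(1) by (intro order_trans[OF C(2)[OF r(1)]] mult_left_mono D(2) r N) auto
   also have "\<dots> = C * D * (N powr (- (?d + 2 * 1)) * 1)" using r(1) by (simp add: powr_minus)
   also have "\<dots> \<le> C * D * ((Th * N powr (- \<kappa>)) * r powr (- (1 - \<beta>/4)))"
    using le(3) Th r1 C(1) D(1) mult_mono[of 1 Th "N powr (- (?d + 2 * 1))" "N powr (- \<kappa>)"] by (intro mult_left_mono mult_mono) auto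
   finally have "\<bar>?g r x\<bar> * \<bar>?E\<bar> \<le> C * D * ((Th * N powr (- \<kappa>)) * r powr (- (1 - \<beta>/4))) * (M\<^sup>2 * w)"
    using E C(1) D(1) Th by (intro mult_mono) auto
   then have "\<bar>?I r\<bar> \<le> G * A1 * Th * ?R + 2 * M\<^sup>2 * 2 powr (?d + 1) * A2 * Th * ?R + C * D * M\<^sup>2 * w * Th * ?R"
    using 1 abs_triangle_ineq4[of "pconv h k r t x" "?g r x * ?E"] by (simp only: abs_mult mult_ac)
   also have "\<dots> = L0 * ?Hz r" using r by (simp add: L0_def algebra_simps)
   finally show ?thesis .
  qed
  have large: "\<bar>?I r\<bar> \<le> L1 * (?Ha r + ?Hb r + ?Hc r)" if r: "r > 1" for r
  proof (cases "r \<le> N\<^sup>2")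
   case True
   have r0: "r > 0" using r by simp
   have "\<bar>?I r\<bar> \<le> C * M\<^sup>2 * (w * ?Ha r + 2 powr p * N powr (- p) * r powr (- (real 2 / 2)) + 2 * w * ?Hb r)"
   proof -
    have e: "(real 2 + 1) / 2 = real 3 / 2" "2 / N * w * X = 2 * w * (N powr (- 1) * X)" for X
     using N by (auto simp: powr_minus_divide)
    show ?thesis
     using conv_near_far(1)[OF gk r0 N(3) stress_decays _ C, of h k t] p
     unfolding pconv_def w_def[symmetric] N_def[symmetric] DIM_cart DIM_real mult_1_right e by simp
   qed
   also have "\<dots> \<le> C * M\<^sup>2 * (w * ?Ha r + 2 powr p * ?Hc r + 2 * w * ?Hb r)"
   proof -
    have "r powr (- (real 2 / 2)) \<le> r powr (- (1/2))" using r by (intro powr_mono) auto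
    then have "2 powr p * N powr (- p) * r powr (- (real 2 / 2)) \<le> 2 powr p * N powr (- p) * r powr (- (1/2))"
     by (intro mult_left_mono) auto
    then show ?thesis using True C(1) w by (intro mult_left_mono add_mono) (auto simp: mult.assoc)
   qed
   also have "\<dots> \<le> C * M\<^sup>2 * (w + 2 powr p + 2 * w) * (?Ha r + ?Hb r + ?Hc r)"
   proof -
    have "w * ?Ha r \<le> (w + 2 powr p + 2 * w) * ?Ha r" "2 powr p * ?Hc r \<le> (w + 2 powr p + 2 * w) * ?Hc r"
     "2 * w * ?Hb r \<le> (w + 2 powr p + 2 * w) * ?Hb r"
     using nn[of r] w by (intro mult_right_mono; simp)+
    then have "w * ?Ha r + 2 powr p * ?Hc r + 2 * w * ?Hb r \<le> (w + 2 powr p + 2 * w) * (?Ha r + ?Hb r + ?Hc r)"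
     unfolding distrib_left by linarith
    then show ?thesis using C(1) unfolding mult.assoc by (intro mult_left_mono) auto
   qed
   also have "\<dots> \<le> L1 * (?Ha r + ?Hb r + ?Hc r)"
    using nn[of r] w C(1) unfolding L1_def by (intro mult_right_mono) auto
   finally show ?thesis .
  next
   case False
   have r0: "r > 0" using r by simp
   have "\<bar>?I r\<bar> \<le> C * r powr (- ((real 2 + 1) / 2)) * gk (2 * r) (0::real^'n) * (M\<^sup>2 * w)"
    using conv_far[OF gk r0 stress_decays _ C(1,3)] p unfolding pconv_def w_def by simp
   also have "\<dots> = C * (8 * pi) powr (- ?d / 2) * (M\<^sup>2 * w) * (r powr (- ((real 2 + 1) / 2)) * r powr (- ?d / 2))"
    unfolding gk_double_at_0[OF r0] by simp
   also have "r powr (- ((real 2 + 1) / 2)) * r powr (- ?d / 2) = ?Hc r"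
    unfolding powr_add[symmetric] using False by (auto intro!: arg_cong[where f = "(powr) r"] simp: field_simps)
   also have "C * (8 * pi) powr (- ?d / 2) * (M\<^sup>2 * w) * ?Hc r \<le> L1 * (?Ha r + ?Hb r + ?Hc r)"
    using nn[of r] w C(1) unfolding L1_def by (intro mult_mono) auto
   finally show ?thesis .
  qed
  have bd: "\<bar>?I r\<bar> \<le> ?H r" if "r > 0" for r
  proof (cases "r \<le> 1")
   case True
   then show ?thesis using small[OF that] nn[of r] L by (smt (verit) mult_nonneg_nonneg)
  next
   case False
   then have "?Hz r = 0" by simp
   with False large[of r] show ?thesis by (simp only: mult_zero_right add_0_right not_le)
  qed
  have i1: "integrable (lon {0<..}) ?Ha" by (rule gk_double_time_integrable) (use N in auto)
  have i2: "integrable (lon {0<..}) ?Hb"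
   by (rule Bochner_Integration.integrable_mult_right, rule gk_double_time_integrable) (use N in auto)
  have b: "(?d + 3) / 2 > 1" "1 - \<beta> / 4 < 1" using d \<beta> by auto
  have A: "N\<^sup>2 > 0" "1 / 2 < (1::real)" "2 > (1::real)" using N by auto
  note i3 = powr_piecewise_integral[OF A(2) b(1) A(1), of "N powr (- p)" 1]
  note i0 = powr_piecewise_integral[OF b(2) A(3) zero_less_one, of "Th * N powr (- \<kappa>)" 0]
  have iH: "integrable (lon {0<..}) ?H" using i1 i2 i3(1) i0(1) by auto
  have iI: "integrable (lon {0<..}) ?I"
   using pconv_integrable[OF t, of h k x] gk2_time_integral(1)[OF N(3), of "axis h 1" "axis k 1"] by simp
  have eq: "(LINT r|lon {0<..}. pconv h k r t x) - (LINT r|lon {0<..}. ?g r x) * ?E = (LINT r|lon {0<..}. ?I r)"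
   using pconv_integrable[OF t, of h k x] gk2_time_integral(1)[OF N(3), of "axis h 1" "axis k 1"] by simp
  have "\<bar>LINT r|lon {0<..}. ?I r\<bar> \<le> (LINT r|lon {0<..}. ?H r)"
   by (rule order_trans[OF integral_abs_bound integral_mono[OF integrable_abs[OF iI] iH]]) (use bd in simp)
  also have "\<dots> = L1 * ((LINT r|lon {0<..}. ?Ha r) + (LINT r|lon {0<..}. ?Hb r) + (LINT r|lon {0<..}. ?Hc r)) + L0 * (LINT r|lon {0<..}. ?Hz r)"
   using i1 i2 i3(1) i0(1) by simp
  also have "\<dots> \<le> L1 * (C3 * 2 powr (?d + 1) * N powr (- \<kappa>) + C2 * N powr (- \<kappa>) + (2 * N powr (- \<kappa>) + 2 * N powr (- \<kappa>))) + L0 * ((4 / \<beta>) * (Th * N powr (- \<kappa>)))"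
  proof (intro add_mono mult_left_mono L)
   have le: "N powr (- (?d + 1)) \<le> N powr (- \<kappa>)" "N powr (- (p - 1)) \<le> N powr (- \<kappa>)"
    using N \<kappa> by (auto intro!: powr_mono)
   have "(LINT r|lon {0<..}. ?Ha r) = C3 * norm (x /\<^sub>R 2) powr (- (?d + 1))"
    using C23(4)[of "x /\<^sub>R 2"] N by (simp add: algebra_simps)
   also have "\<dots> \<le> C3 * 2 powr (?d + 1) * N powr (- \<kappa>)"
    unfolding norm_half_powr N_def[symmetric] using le C23 by simp
   finally show "(LINT r|lon {0<..}. ?Ha r) \<le> C3 * 2 powr (?d + 1) * N powr (- \<kappa>)" .
   have "(LINT r|lon {0<..}. ?Hb r) = N powr (- 1) * (C2 * N powr (2 - ?d - real 2))"
    unfolding N_def Bochner_Integration.integral_mult_right_zero C23(3)[OF N(3)] ..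
   also have "\<dots> = C2 * N powr (- (?d + 1))" using powr_add[of N "- ?d" "- 1"] by simp
   also have "\<dots> \<le> C2 * N powr (- \<kappa>)" using le C23 by simp
   finally show "(LINT r|lon {0<..}. ?Hb r) \<le> C2 * N powr (- \<kappa>)" .
   have sq: "(N\<^sup>2) powr e = N powr (2 * e)" for e using N by (simp add: powr_powr[symmetric])
   have "N powr (- p) * ((N\<^sup>2) powr (1 - 1/2) / (1 - 1/2)) = 2 * N powr (- (p - 1))"
    unfolding sq using N powr_add[of N 1 "- p"] by simp
   moreover have "1 * ((N\<^sup>2) powr (1 - (?d + 3) / 2) / ((?d + 3) / 2 - 1)) \<le> 2 * N powr (- (?d + 1))"
   proof -
    have "(N\<^sup>2) powr (1 - (?d + 3) / 2) = N powr (- (?d + 1))" unfolding sq by (rule arg_cong[where f = "(powr) N"]) (simp add: field_simps)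
    moreover have "(?d + 3) / 2 - 1 \<ge> 1 / 2" by simp
    ultimately show ?thesis
     using divide_left_mono[of "1/2" "(?d + 3) / 2 - 1" "N powr (- (?d + 1))"] by simp
   qed
   ultimately show "(LINT r|lon {0<..}. ?Hc r) \<le> 2 * N powr (- \<kappa>) + 2 * N powr (- \<kappa>)"
    unfolding i3(2) using le by simp
   show "(LINT r|lon {0<..}. ?Hz r) \<le> (4 / \<beta>) * (Th * N powr (- \<kappa>))" unfolding i0(2) by (simp add: mult_ac)
  qed
  also have "\<dots> = (L1 * (C3 * 2 powr (?d + 1) + C2 + 2 + 2) + L0 * (4 / \<beta>) * Th) * N powr (- \<kappa>)"
   by (simp add: algebra_simps)
  also have "\<dots> \<le> (K * Th) * N powr (- \<kappa>)"
  proof (rule mult_right_mono)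
   have "L1 * (C3 * 2 powr (?d + 1) + C2 + 2 + 2) * 1 \<le> L1 * (C3 * 2 powr (?d + 1) + C2 + 2 + 2) * Th"
    using L C23 Th by (intro mult_left_mono mult_nonneg_nonneg) auto
   then show "L1 * (C3 * 2 powr (?d + 1) + C2 + 2 + 2) + L0 * (4 / \<beta>) * Th \<le> K * Th"
    unfolding K_def distrib_right using Th by linarith
  qed simp
  finally show ?thesis unfolding eq by (simp add: Th_def N_def)
 qed
 ultimately show ?thesis by blast
qed

lemma pressure_asymptotics:
 assumes p2: "p \<le> 2 * (real CARD('n) + 1)" and \<kappa>: "\<kappa> \<le> p - 1" "\<kappa> \<le> real CARD('n) + 1"
 obtains K where "K > 0" "!!t x. t \<in> {0<..T} ==> norm x \<ge> 1 ==>
  \<bar>prs t x + profile (energy_matrix u t) x\<bar> \<le> K * (1 + t powr (- (1 / (real CARD('n) + 1) / 4))) * norm x powr (- \<kappa>)"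
proof -
 let ?W = "%t x. (1 + t powr (- (1 / (real CARD('n) + 1) / 4))) * norm (x::real^'n) powr (- \<kappa>)"
 let ?D = "%h k t x. (LINT r|lon {0<..}. pconv h k r t x) - (LINT r|lon {0<..}. gk2 (axis h 1) (axis k 1) r x) * (LINT y|lborel. stress h k t y)"
 define P where "P w K \<longleftrightarrow> (\<forall>t\<in>{0<..T}. \<forall>x. norm x \<ge> 1 \<longrightarrow> \<bar>?D (fst w) (snd w) t x\<bar> \<le> K * ?W t x)" for w K
 have W: "?W t x \<ge> 0" for t x by simp
 have "\<exists>K>0. \<forall>w. P w K"
 proof (rule finite_uniform_bound)
  show "\<exists>K>0. P w K" for w
   using pressure_component_asymptotics[OF p2 \<kappa>] unfolding P_def by (simp only: mult.assoc)
  show "P w K'" if "P w K" "K \<le> K'" for w K K'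
   using that(1) mult_right_mono[OF that(2) W] unfolding P_def by (meson order_trans)
 qed
 then obtain K where K: "K > 0" "!!w. P w K" by blast
 let ?K = "real CARD('n) * (real CARD('n) * K)"
 have "\<bar>prs t x + profile (energy_matrix u t) x\<bar> \<le> ?K * ?W t x" if t: "t \<in> {0<..T}" and x: "norm x \<ge> 1" for t x
 proof -
  have "x \<noteq> 0" using x by auto
  then have eq: "prs t x + profile (energy_matrix u t) x = (\<Sum>h\<in>UNIV. \<Sum>k\<in>UNIV. ?D h k t x)"
   unfolding prs_def by (simp add: profile_eq energy_matrix_eq[OF t] sum_subtractf)
  have "\<bar>\<Sum>h\<in>UNIV. \<Sum>k\<in>UNIV. ?D h k t x\<bar> \<le> (\<Sum>h::'n\<in>UNIV. \<Sum>k::'n\<in>UNIV. K * ?W t x)"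
  proof (intro order_trans[OF sum_abs] sum_mono)
   show "\<bar>?D h k t x\<bar> \<le> K * ?W t x" for h k using K(2)[of "(h, k)"] t x by (simp add: P_def)
  qed
  then show ?thesis unfolding eq by (simp add: mult.assoc)
 qed
 moreover have "?K > 0" using K(1) by simp
 ultimately show ?thesis using that[of ?K] by (simp only: mult.assoc)
qed

end

section \<open>From weighted spaces to pointwise bounds, and the two expansions\<close>

lemma Linf_AE_bound:
 assumes "Linf_norm \<theta> f \<le> ereal M"
 shows "AE x in lebesgue. norm (f x) \<le> M * (1 + norm x) powr (- \<theta>)"
proof -
 have "AE x in lebesgue. ereal ((1 + norm x) powr \<theta> * norm (f x)) \<le> Linf_norm \<theta> f"
  unfolding Linf_norm_def by (rule esssup_AE)
 then show ?thesis
 proof (rule AE_mp, intro AE_I2 impI)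
  fix x assume "ereal ((1 + norm x) powr \<theta> * norm (f x)) \<le> Linf_norm \<theta> f"
  then have "(1 + norm x) powr \<theta> * norm (f x) \<le> M" using assms by (metis ereal_less_eq(3) order_trans)
  then have "(1 + norm x) powr (- \<theta>) * ((1 + norm x) powr \<theta> * norm (f x)) \<le> (1 + norm x) powr (- \<theta>) * M"
   by (rule mult_left_mono) simp
  moreover have "(1 + norm x) powr (- \<theta>) * (1 + norm x) powr \<theta> = 1"
   unfolding powr_add[symmetric] by simp (smt (verit) norm_ge_zero)
  ultimately show "norm (f x) \<le> M * (1 + norm x) powr (- \<theta>)" by (simp add: mult.assoc[symmetric] mult.commute[of M])
 qed
qed

text \<open>For continuous f the set where the bound holds is closed, and a closed set of full
  measure is the whole space.\<close>

lemma Linf_pointwise_bound: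
 fixes f :: "real^'n \<Rightarrow> real^'n"
 assumes "Linf_norm \<theta> f \<le> ereal M" "continuous_on UNIV f"
 shows "norm (f x) \<le> M * (1 + norm x) powr (- \<theta>)"
proof -
 have *: "\<forall>x::real^'n\<in>UNIV. 1 + norm x \<noteq> 0" by (metis add_pos_nonneg less_irrefl norm_ge_zero zero_less_one)
 have "closed {x. norm (f x) \<le> M * (1 + norm x) powr (- \<theta>)}"
  by (intro closed_Collect_le continuous_intros assms(2) *)
 from mem_closed_if_AE_lebesgue[OF this, of x] Linf_AE_bound[OF assms(1)] show ?thesis by simp
qed

text \<open>The exponent of the locale is twice the decay exponent of the velocity, which exceeds d
  + 1 by the hypothesis on \<open>\<theta>\<close>. The single constant is large enough for the
  velocity and for the datum, and nonnegative.\<close>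

lemma mild_ns_instance:
 fixes a :: "real^'n \<Rightarrow> real^'n" and u :: "real \<Rightarrow> real^'n \<Rightarrow> real^'n"
 assumes d: "CARD('n) \<ge> 2" and \<theta>: "\<theta> > (real CARD('n) + 1) / 2" and a: "a \<in> Linf \<theta>" and T: "T > 0"
  and u: "u \<in> Cw T (min \<theta> (real CARD('n) + 1))" and mild: "mild_solution T a u"
  and smooth: "smooth_on ({0<..T} \<times> UNIV) (%(t, x). u t x)"
 obtains M where "mild_ns a u T (2 * min \<theta> (real CARD('n) + 1)) M"
proof -
 let ?\<eta> = "min \<theta> (real CARD('n) + 1)"
 have c: "continuous_on ({0<..T} \<times> UNIV) (%(t, x). u t x)"
  using smooth unfolding smooth_on_def by (metis Ck_on.simps(1))
 have sl: "continuous_on UNIV (u t)" if "t \<in> {0<..T}" for t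
  using Ck_on_slice[OF that, of 0 u] c by simp
 from u obtain M1 where M1: "!!t. t \<in> {0..T} ==> Linf_norm ?\<eta> (u t) \<le> ereal M1" unfolding Cw_def by blast
 from a obtain M2 where M2: "Linf_norm \<theta> a \<le> ereal M2" unfolding Linf_def
  by (cases "Linf_norm \<theta> a") (auto intro: that)
 let ?M = "max M1 (max M2 0)"
 have "mild_ns a u T (2 * ?\<eta>) ?M"
 proof
  show "AE y in lebesgue. norm (a y) \<le> ?M"
   using Linf_AE_bound[OF M2]
  proof (rule AE_mp, intro AE_I2 impI)
   fix y :: "real^'n" assume le: "norm (a y) \<le> M2 * (1 + norm y) powr (- \<theta>)"
   have "(1 + norm y) powr (- \<theta>) \<le> 1" using powr_mono2'[of "- \<theta>" 1 "1 + norm y"] \<theta> by simp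
   then have "M2 * (1 + norm y) powr (- \<theta>) \<le> max M2 0 * 1"
    by (intro mult_mono) auto
   with le show "norm (a y) \<le> ?M" by simp
  qed
  show "norm (u t x) \<le> ?M * (1 + norm x) powr (- (2 * ?\<eta> / 2))" if "t \<in> {0<..T}" for t x
  proof -
   have "norm (u t x) \<le> M1 * (1 + norm x) powr (- ?\<eta>)"
    using Linf_pointwise_bound[OF M1 sl[OF that]] that by simp
   also have "\<dots> \<le> ?M * (1 + norm x) powr (- ?\<eta>)" by (rule mult_right_mono) auto
   finally show ?thesis by simp
  qed
  show "a \<in> borel_measurable lebesgue" using a by (simp add: Linf_def)
 qed (use d \<theta> T c mild in \<open>auto simp: min_def\<close>)
 then show ?thesis by (rule that)
qed

lemma locally_bounded_negative_powr:
 assumes "b \<ge> 0" "K \<ge> 0"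
 shows "locally_bounded_on {0<..T} (%t. K * (1 + t powr (- b)))"
 unfolding locally_bounded_on_def
proof (intro ballI exI conjI impI)
 fix t :: real assume t: "t \<in> {0<..T}"
 then show "t / 2 > 0" by simp
 fix s assume s: "s \<in> {0<..T}" "\<bar>s - t\<bar> < t / 2"
 then have "t / 2 \<le> s" by linarith
 then have "s powr (- b) \<le> (t / 2) powr (- b)" using t assms by (intro powr_mono2') auto
 then show "\<bar>K * (1 + s powr (- b))\<bar> \<le> K * (1 + (t / 2) powr (- b))"
  using assms by (simp add: mult_left_mono abs_of_nonneg)
qed

lemma set_integral_degenerate:
 fixes f :: "real \<Rightarrow> 'b::{banach, second_countable_topology}"
 shows "(LINT s:{c..c}|lebesgue. f s) = 0"
proof -
 have "AE s in lebesgue. indicator {c..c} s *\<^sub>R f s = 0"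
  using AE_completion[OF AE_lborel_singleton[of c]] by eventually_elim simp
 then show ?thesis unfolding set_lebesgue_integral_def by (rule integral_eq_zero_AE)
qed

theorem theorem1p2:
  fixes a :: "real^'n::finite \<Rightarrow> real^'n"
    and u :: "real \<Rightarrow> real^'n \<Rightarrow> real^'n"
    and T \<theta> :: real
  assumes "CARD('n) \<ge> 2"
    and "\<theta> > (real CARD('n) + 1) / 2"
    and "a \<in> Linf \<theta>"
    and "weak_div_free a"
    and "T > 0"
    and "u \<in> Cw T (min \<theta> (real CARD('n) + 1))"
    and "mild_solution T a u"
    and "smooth_on ({0<..T} \<times> UNIV) (\<lambda>(t, x). u t x)"
  shows "big_Ot {0..T} (\<lambda>x. norm x powr min (2 * \<theta>) (real CARD('n) + 2))
           (\<lambda>t x. u t x - (heat t a x + grad (profile (K_matrix u t)) x))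
       \<and> (weak_derivs_Linf \<theta> a \<longrightarrow>
           (\<forall>p. is_pressure T u p \<longrightarrow>
             (\<exists>p0 :: real \<Rightarrow> real.
               big_Ot {0<..T} (\<lambda>x. norm x powr min (2 * \<theta> - 1) (real CARD('n) + 1))
                 (\<lambda>t x. p t x - (p0 t - profile (energy_matrix u t) x)))))"
proof -
 let ?d = "real CARD('n)"
 let ?q = "2 * min \<theta> (?d + 1)"
 from mild_ns_instance[OF assms(1-3,5-8)] obtain M where "mild_ns a u T ?q M" .
 then interpret mild_ns a u T ?q M .
 have scale: "norm x powr e * (C * norm x powr (- e)) = C" if "norm x \<ge> 1" for x :: "real^'n" and e C
 proof -
  have "norm x powr e * norm x powr (- e) = 1" unfolding powr_add[symmetric] using that by auto
  then show ?thesis by (simp add: mult.left_commute)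
 qed
 have velocity: "big_Ot {0..T} (\<lambda>x. norm x powr min (2 * \<theta>) (?d + 2)) (\<lambda>t x. u t x - (heat t a x + grad (profile (K_matrix u t)) x))"
 proof -
  let ?\<kappa> = "min (2 * \<theta>) (?d + 2)"
  \<comment> \<open>The truncation of the decay at d + 1 is harmless because d + 2 <= 2 (d +
    1).\<close>
  have "?\<kappa> \<le> ?q" "?\<kappa> \<le> ?d + 2" by (auto simp: min_def)
  from velocity_asymptotics[OF this] obtain C where C:
   "\<And>t x. t \<in> {0<..T} \<Longrightarrow> norm x \<ge> 1 \<Longrightarrow> norm (u t x - (heat t a x + grad (profile (K_matrix u t)) x)) \<le> C * norm x powr (- ?\<kappa>)" by metis
  show ?thesis
   unfolding big_Ot_def
  proof (intro exI[of _ "\<lambda>_. max C 0"] exI[of _ 1] conjI ballI allI impI)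
   show "locally_bounded_on {0..T} (\<lambda>_. max C 0)"
    unfolding locally_bounded_on_def by (metis order_refl zero_less_one)
   fix t and x :: "real^'n" assume t: "t \<in> {0..T}" and x: "1 \<le> norm x"
   show "norm (norm x powr ?\<kappa> *\<^sub>R (u t x - (heat t a x + grad (profile (K_matrix u t)) x))) \<le> max C 0"
   \<comment> \<open>The uniform estimate concerns t > 0. At t = 0 the integrals over {0..0} vanish,
     hence so do K and the profile, and \<open>heat 0 a\<close> is a itself, so the remainder is
     zero.\<close>
   proof (cases "t = 0")
    case True
    have K: "K_matrix u 0 = (\<lambda>h k. 0)"
     by (intro ext) (simp only: K_matrix_def set_integral_degenerate)
    have "u 0 x = heat 0 a x"
     using assms(7)[unfolded mild_solution_def, THEN bspec, THEN spec, of 0 x, unfolded set_integral_degenerate] assms(5) by simp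
    moreover have "profile (\<lambda>h k. 0) = (\<lambda>x::real^'n. 0)" by (simp add: profile_def fun_eq_iff)
    then have "grad (profile (\<lambda>h k. 0)) x = 0" by (simp add: grad_def pderiv_at_def vec_eq_iff)
    ultimately show ?thesis unfolding True K by simp
   next
    case False
    then have "norm (u t x - (heat t a x + grad (profile (K_matrix u t)) x)) \<le> C * norm x powr (- ?\<kappa>)"
     using C t x by simp
    then have "norm x powr ?\<kappa> * norm (u t x - (heat t a x + grad (profile (K_matrix u t)) x)) \<le> norm x powr ?\<kappa> * (C * norm x powr (- ?\<kappa>))"
     by (rule mult_left_mono) simp
    then show ?thesis unfolding scale[OF x] by simp
   qed
  qed
 qed
 have pressure: "\<exists>p0. big_Ot {0<..T} (\<lambda>x. norm x powr min (2 * \<theta> - 1) (?d + 1)) (\<lambda>t x. p t x - (p0 t - profile (energy_matrix u t) x))"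
  if p: "is_pressure T u p" for p
 proof -
  let ?\<kappa> = "min (2 * \<theta> - 1) (?d + 1)"
  let ?b = "1 / (?d + 1) / 4"
  have "?q \<le> 2 * (?d + 1)" "?\<kappa> \<le> ?q - 1" "?\<kappa> \<le> ?d + 1" by (auto simp: min_def)
  from pressure_asymptotics[OF this] obtain K where K: "K > 0" "\<And>t x. t \<in> {0<..T} \<Longrightarrow> norm x \<ge> 1 \<Longrightarrow>
   \<bar>prs t x + profile (energy_matrix u t) x\<bar> \<le> K * (1 + t powr (- ?b)) * norm x powr (- ?\<kappa>)" by metis
  have sm: "Ck_on (Suc (Suc 0)) ({0<..T} \<times> UNIV) (\<lambda>(t, x). u t x)" using assms(8) unfolding smooth_on_def by blast
  show ?thesis
   unfolding big_Ot_def
  \<comment> \<open>The additive function of t is the constant value of p t - \<open>prs\<close> t,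
    read off at the origin; after subtracting it the remainder is that of
    \<open>prs\<close>.\<close>
  proof (rule exI[of _ "\<lambda>t. p t 0 - prs t 0"], rule exI[of _ "\<lambda>t. K * (1 + t powr (- ?b))"], rule exI[of _ 1], intro conjI ballI allI impI)
   show "locally_bounded_on {0<..T} (\<lambda>t. K * (1 + t powr (- ?b)))"
    by (rule locally_bounded_negative_powr) (use K(1) in auto)
   fix t and x :: "real^'n" assume t: "t \<in> {0<..T}" and x: "1 \<le> norm x"
   have eq: "p t x - (p t 0 - prs t 0 - profile (energy_matrix u t) x) = prs t x + profile (energy_matrix u t) x"
    using pressure_eq[OF sm p t, of x] by simp
   have "norm x powr ?\<kappa> * \<bar>prs t x + profile (energy_matrix u t) x\<bar> \<le> K * (1 + t powr (- ?b))"
    using mult_left_mono[OF K(2)[OF t x], of "norm x powr ?\<kappa>"] by (simp only: scale[OF x] powr_ge_zero)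
   then show "norm (norm x powr ?\<kappa> *\<^sub>R (p t x - (p t 0 - prs t 0 - profile (energy_matrix u t) x))) \<le> K * (1 + t powr (- ?b))"
    unfolding eq by (simp add: abs_mult)
  qed
 qed
 from velocity pressure show ?thesis by blast
qed

end
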